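(* Let $(\mathcal V,\otimes,\Psi)$ be a braided monoidal category as in the context. (i) Let $(\mathfrak g,\sigma,[\,,],\delta)$ be a good quantum Lie algebra in $\mathcal V$. Then $(\mathfrak g,\sigma,[\,,])$ is a (left) quantum Lie algebra in $\mathcal V$, and $\tilde\sigma:\tilde{\mathfrak g}\,\underline\otimes\,\tilde{\mathfrak g}\to\tilde{\mathfrak g}\,\underline\otimes\,\tilde{\mathfrak g}$ is a morphism of coalgebras. In particular, $U(\mathfrak g)$ is a bialgebra in $\mathcal V$ with coalgebra structure given by $\Delta(x)=x\otimes1+1\otimes x+\delta(x)$, $\varepsilon(x)=0$ for $x\in\mathfrak g$. (ii) Conversely, let $(\mathfrak g,\sigma,[\,,])$ be a quantum Lie algebra in $\mathcal V$ equipped with a coassociative morphism $\delta:\mathfrak g\to\mathfrak g\otimes\mathfrak g$. If $\tilde\sigma:\tilde{\mathfrak g}\,\underline\otimes\,\tilde{\mathfrak g}\to\tilde{\mathfrak g}\,\underline\otimes\,\tilde{\mathfrak g}$ is a morphism of coalgebras, then $(\mathfrak g,\sigma,[\,,],\delta)$ is a good quantum Lie algebra.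
   Context: $k$ is a field. $(\mathcal V,\otimes,\Psi)$ is a braided monoidal category (invertible braiding $\Psi$) which is a category of modules, comodules or crossed modules (left or right) over a bialgebra or Hopf algebra; its objects are $k$-vector spaces with extra structure, the unit object has underlying space $k$. All structure maps are morphisms in $\mathcal V$; $\underline\otimes$ denotes the braided tensor product of algebras or coalgebras, e.g. $\Delta_{C\underline\otimes C}=(\mathrm{id}\otimes\Psi\otimes\mathrm{id})(\Delta\otimes\Delta)$; a bialgebra in $\mathcal V$ has $\Delta:B\to B\,\underline\otimes\,B$ and $\varepsilon$ algebra morphisms. Left quantum Lie algebra in $\mathcal V$: object $\mathfrak g$ with morphisms $\sigma:\mathfrak g^{\otimes2}\to\mathfrak g^{\otimes2}$, $C=[\,,]:\mathfrak g^{\otimes2}\to\mathfrak g$ such that (1) $\sigma$ satisfies the braid relation; (2) $[x,[y,z]]=[[x,y],z]+\sum_i[y_i,[x_i,z]]$, where $\sum_iy_i\otimes x_i=\sigma(x\otimes y)$; (3) $\sigma(\mathrm{id}\otimes C)=(C\otimes\mathrm{id})\sigma_{23}\sigma_{12}$ and $\sigma(C\otimes\mathrm{id})-(\mathrm{id}\otimes C)\sigma_{12}\sigma_{23}=(C\otimes\mathrm{id})(\mathrm{id}\otimes\sigma)-\sigma(\mathrm{id}\otimes C)(\sigma\otimes\mathrm{id})$; (4) $\ker(\mathrm{id}-\sigma)\subset\ker[\,,]$. $U(\mathfrak g)=T(\mathfrak g)/\langle x\otimes y-\sigma(x\otimes y)-[x,y]\rangle$. Good quantum Lie algebra in $\mathcal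 V$: $(\mathfrak g,\sigma,[\,,],\delta)$ with $\mathfrak g$ an object, $\sigma:\mathfrak g^{\otimes2}\to\mathfrak g^{\otimes2}$, $[\,,]:\mathfrak g^{\otimes2}\to\mathfrak g$, $\delta:\mathfrak g\to\mathfrak g^{\otimes2}$ morphisms, $\delta$ coassociative, and (with $\Psi=\Psi_{\mathfrak g,\mathfrak g}$) (L1') $[\,,](\mathrm{id}\otimes[\,,])=[\,,]([\,,]\otimes\mathrm{id})+[\,,](\mathrm{id}\otimes[\,,])(\sigma\otimes\mathrm{id})$; (L2'-a) $\sigma=\Psi+([\,,]\otimes\mathrm{id})(\mathrm{id}\otimes\Psi)(\delta\otimes\mathrm{id})$; (L2'-b) $\sigma=\Psi^{-1}+\Psi^{-1}(\mathrm{id}\otimes[\,,])(\delta\otimes\mathrm{id})$; (L3') $\delta\circ[\,,]=([\,,]\otimes\mathrm{id})(\mathrm{id}\otimes\delta)+(\mathrm{id}\otimes[\,,])(\Psi\otimes\mathrm{id})(\mathrm{id}\otimes\delta)+([\,,]\otimes[\,,])(\mathrm{id}\otimes\Psi\otimes\mathrm{id})(\delta\otimes\delta)$; and $\ker(\mathrm{id}^{\otimes2}-\sigma)\subset\ker[\,,]$. Extension: $\tilde{\mathfrak g}=k\gamma\oplus\mathfrak g$ ($k\gamma$ the unit object) with $\tilde\sigma(\gamma\otimes z)=z\otimes\gamma$, $\tilde\sigma(z\otimes\gamma)=\gamma\otimes z$ ($z\in\tilde{\mathfrak g}$), $\tilde\sigma(x\otimes y)=\sigma(x\otimes y)+[x,y]\otimes\gamma$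 ($x,y\in\mathfrak g$), and coalgebra structure $\tilde\delta(\gamma)=\gamma\otimes\gamma$, $\tilde\delta(x)=x\otimes\gamma+\gamma\otimes x+\delta(x)$, $\tilde\varepsilon(\gamma)=1$, $\tilde\varepsilon(x)=0$ ($x\in\mathfrak g$). *)

theory Defs
  imports Complex_Main
begin

text \<open>
  Size convention.  The vectors of all spaces under consideration live in one infinite-dimensional
  k-vector space (the type 'v), so a vector space is a subspace of it, and a
  linear map between spaces is (the restriction of) a linear endomorphism of 'v; every
  linear map between subspaces extends to such an endomorphism, and equality of maps is only ever
  asserted on the relevant subspace.  As 'v is an arbitrary type, this bounds only the
  dimension of the spaces.

  The tensor product is given by a universal bilinear map tensor on 'v; its restriction
  to subspaces X and Y is a tensor product of X and Y with underlying space the span of the x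
  tensor y.  This tensor product is not strict, hence the associators below.  The unit object is
  the line spanned by a vector unity, which plays the role of the element 1 of k.
\<close>

datatype kind = Modules | Comodules | Crossed_modules

datatype side = Left | Right

text \<open>
  The field coact is irrelevant for modules, and act is irrelevant for comodules.
  The action is always written with the element of H as first argument, also for right actions.
\<close>

record 'v obj =
  space :: "'v set"
  act :: "'v \<Rightarrow> 'v \<Rightarrow> 'v"
  coact :: "'v \<Rightarrow> 'v"

text \<open>
  Products are linear maps on the tensor square; a unit is given as a map \<open>\<eta>\<close> from the
  unit object, so that \<open>\<eta>\<close> applied to unity is the unit element.
\<close>

record ('k, 'v) category_data =
  scale :: "'k \<Rightarrow> 'v \<Rightarrow> 'v"
  tensor :: "'v \<Rightarrow> 'v \<Rightarrow> 'v" (infixr "\<otimes>\<index>" 70)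
  unity :: "'v"
  kind :: kind
  side :: side
  hspace :: "'v set"
  hmult :: "'v \<Rightarrow> 'v"
  hunit :: "'v \<Rightarrow> 'v"
  hcomult :: "'v \<Rightarrow> 'v"
  hcounit :: "'v \<Rightarrow> 'k"
  braid :: "'v obj \<Rightarrow> 'v obj \<Rightarrow> 'v \<Rightarrow> 'v" ("\<Psi>\<index>")


section \<open>Vector spaces and tensor products\<close>

locale tensor_universe = vector_space "scale V"
  for V :: "('k::field, 'v::ab_group_add) category_data" (structure)
begin

abbreviation lin :: "('v \<Rightarrow> 'v) \<Rightarrow> bool" where
  "lin f \<equiv> Vector_Spaces.linear (scale V) (scale V) f"

abbreviation functional :: "('v \<Rightarrow> 'k) \<Rightarrow> bool" where
  "functional f \<equiv> Vector_Spaces.linear (scale V) (*) f"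

definition bilin :: "('v \<Rightarrow> 'v \<Rightarrow> 'v) \<Rightarrow> bool" where
  "bilin \<phi> \<longleftrightarrow> (\<forall>x. lin (\<phi> x)) \<and> (\<forall>y. lin (\<lambda>x. \<phi> x y))"

definition universal_tensor :: bool where
  "universal_tensor \<longleftrightarrow>
     bilin (tensor V) \<and>
     (\<forall>\<phi>. bilin \<phi> \<longrightarrow> (\<exists>!h. lin h \<and> (\<forall>x y. h (x \<otimes> y) = \<phi> x y))) \<and>
     unity V \<noteq> 0 \<and>
     (\<nexists>B. finite B \<and> span B = UNIV)"

definition lift :: "('v \<Rightarrow> 'v \<Rightarrow> 'v) \<Rightarrow> 'v \<Rightarrow> 'v" where
  "lift \<phi> = (THE h. lin h \<and> (\<forall>x y. h (x \<otimes> y) = \<phi> x y))"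

definition ten :: "('v \<Rightarrow> 'v) \<Rightarrow> ('v \<Rightarrow> 'v) \<Rightarrow> 'v \<Rightarrow> 'v" (infixr "\<otimes>\<^sub>m" 70) where
  "f \<otimes>\<^sub>m g = lift (\<lambda>x y. f x \<otimes> g y)"

definition ten_functional :: "('v \<Rightarrow> 'k) \<Rightarrow> ('v \<Rightarrow> 'k) \<Rightarrow> 'v \<Rightarrow> 'k" where
  "ten_functional f g = (THE h. functional h \<and> (\<forall>x y. h (x \<otimes> y) = f x * g y))"

definition ten_space :: "'v set \<Rightarrow> 'v set \<Rightarrow> 'v set" (infixr "\<otimes>\<^sub>s" 70) where
  "X \<otimes>\<^sub>s Y = span {x \<otimes> y | x y. x \<in> X \<and> y \<in> Y}"

definition flip :: "'v \<Rightarrow> 'v" where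
  "flip = lift (\<lambda>x y. y \<otimes> x)"

text \<open>\<open>\<alpha>\<close> maps (x tensor y) tensor z to x tensor (y tensor z), and \<open>\<alpha>'\<close> is its inverse.\<close>

definition assoc :: "'v \<Rightarrow> 'v" ("\<alpha>") where
  "\<alpha> = lift (\<lambda>u z. lift (\<lambda>x y. x \<otimes> (y \<otimes> z)) u)"

definition assoc_inv :: "'v \<Rightarrow> 'v" ("\<alpha>''") where
  "\<alpha>' = lift (\<lambda>x u. lift (\<lambda>y z. (x \<otimes> y) \<otimes> z) u)"

text \<open>Triple tensor powers are bracketed to the left: the map f acting in positions 1,2 and 2,3.\<close>

definition pos12 :: "('v \<Rightarrow> 'v) \<Rightarrow> 'v \<Rightarrow> 'v" where
  "pos12 f = f \<otimes>\<^sub>m id"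

definition pos23 :: "('v \<Rightarrow> 'v) \<Rightarrow> 'v \<Rightarrow> 'v" where
  "pos23 f = \<alpha>' \<circ> (id \<otimes>\<^sub>m f) \<circ> \<alpha>"

text \<open>The map \<open>id \<otimes> \<psi> \<otimes> id\<close> from \<open>(X \<otimes> Y) \<otimes> (Z \<otimes> W)\<close> to \<open>(X \<otimes> Z) \<otimes> (Y \<otimes> W)\<close>,
  for \<open>\<psi>\<close> from \<open>Y \<otimes> Z\<close> to \<open>Z \<otimes> Y\<close>.\<close>

definition mid :: "('v \<Rightarrow> 'v) \<Rightarrow> 'v \<Rightarrow> 'v" where
  "mid \<psi> = \<alpha>' \<circ> (id \<otimes>\<^sub>m (\<alpha> \<circ> (\<psi> \<otimes>\<^sub>m id) \<circ> \<alpha>')) \<circ> \<alpha>"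

definition is_algebra :: "'v set \<Rightarrow> ('v \<Rightarrow> 'v) \<Rightarrow> ('v \<Rightarrow> 'v) \<Rightarrow> bool" where
  "is_algebra A m \<eta> \<longleftrightarrow>
     subspace A \<and> lin m \<and> m ` (A \<otimes>\<^sub>s A) \<subseteq> A \<and> lin \<eta> \<and> \<eta> (unity V) \<in> A \<and>
     (\<forall>x\<in>A. \<forall>y\<in>A. \<forall>z\<in>A. m (m (x \<otimes> y) \<otimes> z) = m (x \<otimes> m (y \<otimes> z))) \<and>
     (\<forall>x\<in>A. m (\<eta> (unity V) \<otimes> x) = x \<and> m (x \<otimes> \<eta> (unity V)) = x)"

definition coassociative :: "'v set \<Rightarrow> ('v \<Rightarrow> 'v) \<Rightarrow> bool" where
  "coassociative C \<Delta> \<longleftrightarrow> (\<forall>x\<in>C. \<alpha> ((\<Delta> \<otimes>\<^sub>m id) (\<Delta> x)) = (id \<otimes>\<^sub>m \<Delta>) (\<Delta> x))"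

definition is_coalgebra :: "'v set \<Rightarrow> ('v \<Rightarrow> 'v) \<Rightarrow> ('v \<Rightarrow> 'k) \<Rightarrow> bool" where
  "is_coalgebra C \<Delta> \<epsilon> \<longleftrightarrow>
     subspace C \<and> lin \<Delta> \<and> \<Delta> ` C \<subseteq> C \<otimes>\<^sub>s C \<and> functional \<epsilon> \<and>
     coassociative C \<Delta> \<and>
     (\<forall>x\<in>C. lift (\<lambda>a b. scale V (\<epsilon> a) b) (\<Delta> x) = x \<and>
            lift (\<lambda>a b. scale V (\<epsilon> b) a) (\<Delta> x) = x)"

text \<open>Bialgebra with respect to a braiding \<open>\<psi>\<close> of \<open>B \<otimes> B\<close>, which enters through the product
  of the braided tensor product algebra; an ordinary bialgebra if \<open>\<psi>\<close> is the flip.\<close>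

definition is_bialgebra ::
    "('v \<Rightarrow> 'v) \<Rightarrow> 'v set \<Rightarrow> ('v \<Rightarrow> 'v) \<Rightarrow> ('v \<Rightarrow> 'v) \<Rightarrow> ('v \<Rightarrow> 'v) \<Rightarrow> ('v \<Rightarrow> 'k) \<Rightarrow> bool" where
  "is_bialgebra \<psi> B m \<eta> \<Delta> \<epsilon> \<longleftrightarrow>
     is_algebra B m \<eta> \<and> is_coalgebra B \<Delta> \<epsilon> \<and>
     (\<forall>z \<in> B \<otimes>\<^sub>s B. \<Delta> (m z) = (m \<otimes>\<^sub>m m) (mid \<psi> ((\<Delta> \<otimes>\<^sub>m \<Delta>) z))) \<and>
     \<Delta> (\<eta> (unity V)) = \<eta> (unity V) \<otimes> \<eta> (unity V) \<and>
     (\<forall>x\<in>B. \<forall>y\<in>B. \<epsilon> (m (x \<otimes> y)) = \<epsilon> x * \<epsilon> y) \<and>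
     \<epsilon> (\<eta> (unity V)) = 1"


section \<open>Modules, comodules and crossed modules over H\<close>

abbreviation h_mul :: "'v \<Rightarrow> 'v \<Rightarrow> 'v" (infixl "\<cdot>" 75) where
  "a \<cdot> b \<equiv> hmult V (a \<otimes> b)"

abbreviation h_one :: "'v" where
  "h_one \<equiv> hunit V (unity V)"

definition is_module :: "'v obj \<Rightarrow> bool" where
  "is_module X \<longleftrightarrow>
     bilin (act X) \<and>
     (\<forall>h \<in> hspace V. \<forall>x \<in> space X. act X h x \<in> space X) \<and>
     (\<forall>x \<in> space X. act X h_one x = x) \<and>
     (\<forall>g \<in> hspace V. \<forall>h \<in> hspace V. \<forall>x \<in> space X.
        act X g (act X h x) = act X (case side V of Left \<Rightarrow> g \<cdot> h | Right \<Rightarrow> h \<cdot> g) x)"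

definition is_comodule :: "'v obj \<Rightarrow> bool" where
  "is_comodule X \<longleftrightarrow>
     lin (coact X) \<and>
     (case side V of
       Left \<Rightarrow>
         coact X ` space X \<subseteq> hspace V \<otimes>\<^sub>s space X \<and>
         (\<forall>x \<in> space X.
            \<alpha> ((hcomult V \<otimes>\<^sub>m id) (coact X x)) = (id \<otimes>\<^sub>m coact X) (coact X x) \<and>
            lift (\<lambda>h y. scale V (hcounit V h) y) (coact X x) = x)
     | Right \<Rightarrow>
         coact X ` space X \<subseteq> space X \<otimes>\<^sub>s hspace V \<and>
         (\<forall>x \<in> space X.
            \<alpha> ((coact X \<otimes>\<^sub>m id) (coact X x)) = (id \<otimes>\<^sub>m hcomult V) (coact X x) \<and>
            lift (\<lambda>y h. scale V (hcounit V h) y) (coact X x) = x))"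

text \<open>
  In Sweedler notation, the condition for left crossed modules is
  \<open>h1 x(-1) \<otimes> h2.x(0) = (h1.x)(-1) h2 \<otimes> (h1.x)(0)\<close>, and that for right crossed modules is
  \<open>x(0).h1 \<otimes> x(1) h2 = (x.h2)(0) \<otimes> h1 (x.h2)(1)\<close>.
\<close>

definition crossed_compatible :: "'v obj \<Rightarrow> bool" where
  "crossed_compatible X \<longleftrightarrow>
     (\<forall>h \<in> hspace V. \<forall>x \<in> space X.
        case side V of
          Left \<Rightarrow>
            lift (\<lambda>a b. ((\<lambda>c. a \<cdot> c) \<otimes>\<^sub>m act X b) (coact X x)) (hcomult V h) =
            lift (\<lambda>a b. ((\<lambda>c. c \<cdot> b) \<otimes>\<^sub>m id) (coact X (act X a x))) (hcomult V h)
        | Right \<Rightarrow>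
            lift (\<lambda>a b. (act X a \<otimes>\<^sub>m (\<lambda>c. c \<cdot> b)) (coact X x)) (hcomult V h) =
            lift (\<lambda>a b. (id \<otimes>\<^sub>m (\<lambda>c. a \<cdot> c)) (coact X (act X b x))) (hcomult V h))"

definition is_obj :: "'v obj \<Rightarrow> bool" where
  "is_obj X \<longleftrightarrow>
     subspace (space X) \<and>
     (case kind V of
       Modules \<Rightarrow> is_module X
     | Comodules \<Rightarrow> is_comodule X
     | Crossed_modules \<Rightarrow> is_module X \<and> is_comodule X \<and> crossed_compatible X)"

definition module_map :: "'v obj \<Rightarrow> 'v obj \<Rightarrow> ('v \<Rightarrow> 'v) \<Rightarrow> bool" where
  "module_map X Y f \<longleftrightarrow>
     (\<forall>h \<in> hspace V. \<forall>x \<in> space X. f (act X h x) = act Y h (f x))"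

definition comodule_map :: "'v obj \<Rightarrow> 'v obj \<Rightarrow> ('v \<Rightarrow> 'v) \<Rightarrow> bool" where
  "comodule_map X Y f \<longleftrightarrow>
     (\<forall>x \<in> space X. coact Y (f x) =
        (case side V of Left \<Rightarrow> (id \<otimes>\<^sub>m f) (coact X x) | Right \<Rightarrow> (f \<otimes>\<^sub>m id) (coact X x)))"

definition mor :: "'v obj \<Rightarrow> 'v obj \<Rightarrow> ('v \<Rightarrow> 'v) \<Rightarrow> bool" where
  "mor X Y f \<longleftrightarrow>
     lin f \<and> f ` space X \<subseteq> space Y \<and>
     (case kind V of
       Modules \<Rightarrow> module_map X Y f
     | Comodules \<Rightarrow> comodule_map X Y f
     | Crossed_modules \<Rightarrow> module_map X Y f \<and> comodule_map X Y f)"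

definition unit_obj :: "'v obj" where
  "unit_obj =
     \<lparr> space = span {unity V},
       act = (\<lambda>h x. scale V (hcounit V h) x),
       coact = (\<lambda>x. case side V of Left \<Rightarrow> h_one \<otimes> x | Right \<Rightarrow> x \<otimes> h_one) \<rparr>"

text \<open>Diagonal action \<open>h1.x \<otimes> h2.y\<close>, and diagonal coaction \<open>x(-1) y(-1) \<otimes> (x(0) \<otimes> y(0))\<close>
  or \<open>(x(0) \<otimes> y(0)) \<otimes> x(1) y(1)\<close>.\<close>

definition ten_obj :: "'v obj \<Rightarrow> 'v obj \<Rightarrow> 'v obj" (infixr "\<otimes>\<^sub>o" 70) where
  "X \<otimes>\<^sub>o Y =
     \<lparr> space = space X \<otimes>\<^sub>s space Y,
       act = (\<lambda>h z. lift (\<lambda>a b. (act X a \<otimes>\<^sub>m act Y b) z) (hcomult V h)),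
       coact = (\<lambda>z. case side V of
           Left \<Rightarrow> (hmult V \<otimes>\<^sub>m id) (mid flip ((coact X \<otimes>\<^sub>m coact Y) z))
         | Right \<Rightarrow> (id \<otimes>\<^sub>m hmult V) (mid flip ((coact X \<otimes>\<^sub>m coact Y) z))) \<rparr>"


section \<open>Braidings\<close>

definition natural_iso_braid :: bool where
  "natural_iso_braid \<longleftrightarrow>
     (\<forall>X Y. is_obj X \<and> is_obj Y \<longrightarrow>
        mor (X \<otimes>\<^sub>o Y) (Y \<otimes>\<^sub>o X) (\<Psi> X Y) \<and>
        (\<exists>g. mor (Y \<otimes>\<^sub>o X) (X \<otimes>\<^sub>o Y) g \<and>
             (\<forall>z \<in> space (X \<otimes>\<^sub>o Y). g (\<Psi> X Y z) = z) \<and>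
             (\<forall>z \<in> space (Y \<otimes>\<^sub>o X). \<Psi> X Y (g z) = z))) \<and>
     (\<forall>X X' Y Y' f g. is_obj X \<and> is_obj X' \<and> is_obj Y \<and> is_obj Y' \<and> mor X X' f \<and> mor Y Y' g \<longrightarrow>
        (\<forall>z \<in> space (X \<otimes>\<^sub>o Y). \<Psi> X' Y' ((f \<otimes>\<^sub>m g) z) = (g \<otimes>\<^sub>m f) (\<Psi> X Y z)))"

definition hexagons :: bool where
  "hexagons \<longleftrightarrow>
     (\<forall>X Y Z. is_obj X \<and> is_obj Y \<and> is_obj Z \<longrightarrow>
        (\<forall>w \<in> space ((X \<otimes>\<^sub>o Y) \<otimes>\<^sub>o Z).
           \<alpha> (\<Psi> X (Y \<otimes>\<^sub>o Z) (\<alpha> w)) = (id \<otimes>\<^sub>m \<Psi> X Z) (\<alpha> ((\<Psi> X Y \<otimes>\<^sub>m id) w))) \<and>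
        (\<forall>w \<in> space (X \<otimes>\<^sub>o (Y \<otimes>\<^sub>o Z)).
           \<alpha>' (\<Psi> (X \<otimes>\<^sub>o Y) Z (\<alpha>' w)) = (\<Psi> X Z \<otimes>\<^sub>m id) (\<alpha>' ((id \<otimes>\<^sub>m \<Psi> Y Z) w))))"

end

locale braided_category = tensor_universe V
  for V :: "('k::field, 'v::ab_group_add) category_data" (structure) +
  assumes universal_tensor: "universal_tensor"
    and H_bialgebra: "is_bialgebra flip (hspace V) (hmult V) (hunit V) (hcomult V) (hcounit V)"
    and natural_iso_braid: "natural_iso_braid"
    and hexagons: "hexagons"
begin

section \<open>Algebras, coalgebras and bialgebras in V\<close>

definition algebra_in :: "'v obj \<Rightarrow> ('v \<Rightarrow> 'v) \<Rightarrow> ('v \<Rightarrow> 'v) \<Rightarrow> bool" where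
  "algebra_in A m \<eta> \<longleftrightarrow>
     is_obj A \<and> is_algebra (space A) m \<eta> \<and> mor (A \<otimes>\<^sub>o A) A m \<and> mor unit_obj A \<eta>"

definition bialgebra_in ::
    "'v obj \<Rightarrow> ('v \<Rightarrow> 'v) \<Rightarrow> ('v \<Rightarrow> 'v) \<Rightarrow> ('v \<Rightarrow> 'v) \<Rightarrow> ('v \<Rightarrow> 'k) \<Rightarrow> bool" where
  "bialgebra_in B m \<eta> \<Delta> \<epsilon> \<longleftrightarrow>
     algebra_in B m \<eta> \<and> is_bialgebra (\<Psi> B B) (space B) m \<eta> \<Delta> \<epsilon> \<and>
     mor B (B \<otimes>\<^sub>o B) \<Delta> \<and> mor B unit_obj (\<lambda>x. scale V (\<epsilon> x) (unity V))"

text \<open>The coalgebra structure of the braided tensor square of an object with maps \<open>\<Delta>\<close>, \<open>\<epsilon>\<close>.\<close>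

definition braided_square_comult :: "'v obj \<Rightarrow> ('v \<Rightarrow> 'v) \<Rightarrow> 'v \<Rightarrow> 'v" where
  "braided_square_comult C \<Delta> = mid (\<Psi> C C) \<circ> (\<Delta> \<otimes>\<^sub>m \<Delta>)"

definition braided_square_counit :: "('v \<Rightarrow> 'k) \<Rightarrow> 'v \<Rightarrow> 'k" where
  "braided_square_counit \<epsilon> = ten_functional \<epsilon> \<epsilon>"

definition coalgebra_morphism ::
    "'v obj \<Rightarrow> ('v \<Rightarrow> 'v) \<Rightarrow> ('v \<Rightarrow> 'k) \<Rightarrow> 'v obj \<Rightarrow> ('v \<Rightarrow> 'v) \<Rightarrow> ('v \<Rightarrow> 'k) \<Rightarrow> ('v \<Rightarrow> 'v) \<Rightarrow> bool"
  where
  "coalgebra_morphism C \<Delta> \<epsilon> D \<Delta>' \<epsilon>' f \<longleftrightarrow>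
     mor C D f \<and> (\<forall>x \<in> space C. \<Delta>' (f x) = (f \<otimes>\<^sub>m f) (\<Delta> x) \<and> \<epsilon>' (f x) = \<epsilon> x)"


section \<open>Quantum Lie algebras\<close>

text \<open>The bracket is a linear map \<open>C\<close> on the tensor square, so \<open>[x,y] = C (x \<otimes> y)\<close>.\<close>

definition quantum_jacobi :: "'v set \<Rightarrow> ('v \<Rightarrow> 'v) \<Rightarrow> ('v \<Rightarrow> 'v) \<Rightarrow> bool" where
  "quantum_jacobi S \<sigma> C \<longleftrightarrow>
     (\<forall>x\<in>S. \<forall>y\<in>S. \<forall>z\<in>S.
        C (x \<otimes> C (y \<otimes> z)) =
        C (C (x \<otimes> y) \<otimes> z) + lift (\<lambda>y' x'. C (y' \<otimes> C (x' \<otimes> z))) (\<sigma> (x \<otimes> y)))"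

definition quantum_Lie_algebra :: "'v obj \<Rightarrow> ('v \<Rightarrow> 'v) \<Rightarrow> ('v \<Rightarrow> 'v) \<Rightarrow> bool" where
  "quantum_Lie_algebra g \<sigma> C \<longleftrightarrow>
     is_obj g \<and> mor (g \<otimes>\<^sub>o g) (g \<otimes>\<^sub>o g) \<sigma> \<and> mor (g \<otimes>\<^sub>o g) g C \<and>
     (\<forall>w \<in> space ((g \<otimes>\<^sub>o g) \<otimes>\<^sub>o g).
        pos12 \<sigma> (pos23 \<sigma> (pos12 \<sigma> w)) = pos23 \<sigma> (pos12 \<sigma> (pos23 \<sigma> w))) \<and>
     quantum_jacobi (space g) \<sigma> C \<and>
     (\<forall>w \<in> space ((g \<otimes>\<^sub>o g) \<otimes>\<^sub>o g).
        \<sigma> ((id \<otimes>\<^sub>m C) (\<alpha> w)) = (C \<otimes>\<^sub>m id) (pos23 \<sigma> (pos12 \<sigma> w)) \<and>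
        \<sigma> ((C \<otimes>\<^sub>m id) w) - (id \<otimes>\<^sub>m C) (\<alpha> (pos12 \<sigma> (pos23 \<sigma> w))) =
        (C \<otimes>\<^sub>m id) (pos23 \<sigma> w) - \<sigma> ((id \<otimes>\<^sub>m C) (\<alpha> (pos12 \<sigma> w)))) \<and>
     (\<forall>z \<in> space (g \<otimes>\<^sub>o g). z - \<sigma> z = 0 \<longrightarrow> C z = 0)"

definition good_quantum_Lie_algebra ::
    "'v obj \<Rightarrow> ('v \<Rightarrow> 'v) \<Rightarrow> ('v \<Rightarrow> 'v) \<Rightarrow> ('v \<Rightarrow> 'v) \<Rightarrow> bool" where
  "good_quantum_Lie_algebra g \<sigma> C \<delta> \<longleftrightarrow>
     is_obj g \<and> mor (g \<otimes>\<^sub>o g) (g \<otimes>\<^sub>o g) \<sigma> \<and> mor (g \<otimes>\<^sub>o g) g C \<and> mor g (g \<otimes>\<^sub>o g) \<delta> \<and>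
     coassociative (space g) \<delta> \<and>
     (\<forall>w \<in> space ((g \<otimes>\<^sub>o g) \<otimes>\<^sub>o g).
        C ((id \<otimes>\<^sub>m C) (\<alpha> w)) = C ((C \<otimes>\<^sub>m id) w) + C ((id \<otimes>\<^sub>m C) (\<alpha> ((\<sigma> \<otimes>\<^sub>m id) w)))) \<and>
     (\<forall>z \<in> space (g \<otimes>\<^sub>o g).
        \<sigma> z = \<Psi> g g z + (C \<otimes>\<^sub>m id) (\<alpha>' ((id \<otimes>\<^sub>m \<Psi> g g) (\<alpha> ((\<delta> \<otimes>\<^sub>m id) z))))) \<and>
     (\<forall>z \<in> space (g \<otimes>\<^sub>o g).
        \<sigma> z = inv_into (space (g \<otimes>\<^sub>o g)) (\<Psi> g g) z +
              inv_into (space (g \<otimes>\<^sub>o g)) (\<Psi> g g) ((id \<otimes>\<^sub>m C) (\<alpha> ((\<delta> \<otimes>\<^sub>m id) z)))) \<and>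
     (\<forall>z \<in> space (g \<otimes>\<^sub>o g).
        \<delta> (C z) =
          (C \<otimes>\<^sub>m id) (\<alpha>' ((id \<otimes>\<^sub>m \<delta>) z)) +
          (id \<otimes>\<^sub>m C) (\<alpha> ((\<Psi> g g \<otimes>\<^sub>m id) (\<alpha>' ((id \<otimes>\<^sub>m \<delta>) z)))) +
          (C \<otimes>\<^sub>m C) (mid (\<Psi> g g) ((\<delta> \<otimes>\<^sub>m \<delta>) z))) \<and>
     (\<forall>z \<in> space (g \<otimes>\<^sub>o g). z - \<sigma> z = 0 \<longrightarrow> C z = 0)"

text \<open>\<open>G\<close> is a direct sum in V of the unit object and \<open>g\<close>, with injections \<open>i\<close> and \<open>j\<close>.\<close>

definition unit_direct_sum :: "'v obj \<Rightarrow> 'v obj \<Rightarrow> ('v \<Rightarrow> 'v) \<Rightarrow> ('v \<Rightarrow> 'v) \<Rightarrow> bool" where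
  "unit_direct_sum g G i j \<longleftrightarrow>
     is_obj G \<and> mor unit_obj G i \<and> mor g G j \<and>
     inj_on i (space unit_obj) \<and> inj_on j (space g) \<and>
     i ` space unit_obj \<inter> j ` space g = {0} \<and>
     space G = {a + b | a b. a \<in> i ` space unit_obj \<and> b \<in> j ` space g}"

text \<open>
  \<open>G\<close>, with \<open>\<gamma>\<close> the image of 1, is a realisation of the extension of \<open>g\<close> by the unit object,
  and \<open>s\<close>, \<open>d\<close>, \<open>e\<close> are the extended braiding, coproduct and counit on it.  The conditions
  determine these maps uniquely on \<open>G\<close>.
\<close>

definition unit_extension ::
    "'v obj \<Rightarrow> ('v \<Rightarrow> 'v) \<Rightarrow> ('v \<Rightarrow> 'v) \<Rightarrow> ('v \<Rightarrow> 'v) \<Rightarrow>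
     'v obj \<Rightarrow> ('v \<Rightarrow> 'v) \<Rightarrow> ('v \<Rightarrow> 'v) \<Rightarrow> ('v \<Rightarrow> 'v) \<Rightarrow> ('v \<Rightarrow> 'v) \<Rightarrow> ('v \<Rightarrow> 'k) \<Rightarrow> bool" where
  "unit_extension g \<sigma> C \<delta> G i j s d e \<longleftrightarrow>
     unit_direct_sum g G i j \<and> lin s \<and> lin d \<and> functional e \<and>
     (let \<gamma> = i (unity V) in
        (\<forall>z \<in> space G. s (\<gamma> \<otimes> z) = z \<otimes> \<gamma> \<and> s (z \<otimes> \<gamma>) = \<gamma> \<otimes> z) \<and>
        (\<forall>x \<in> space g. \<forall>y \<in> space g.
           s (j x \<otimes> j y) = (j \<otimes>\<^sub>m j) (\<sigma> (x \<otimes> y)) + j (C (x \<otimes> y)) \<otimes> \<gamma>) \<and>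
        d \<gamma> = \<gamma> \<otimes> \<gamma> \<and>
        (\<forall>x \<in> space g. d (j x) = j x \<otimes> \<gamma> + \<gamma> \<otimes> j x + (j \<otimes>\<^sub>m j) (\<delta> x)) \<and>
        e \<gamma> = 1 \<and>
        (\<forall>x \<in> space g. e (j x) = 0))"

definition coalgebra_endomorphism_of_square ::
    "'v obj \<Rightarrow> ('v \<Rightarrow> 'v) \<Rightarrow> ('v \<Rightarrow> 'k) \<Rightarrow> ('v \<Rightarrow> 'v) \<Rightarrow> bool" where
  "coalgebra_endomorphism_of_square G d e s \<longleftrightarrow>
     coalgebra_morphism
       (G \<otimes>\<^sub>o G) (braided_square_comult G d) (braided_square_counit e)
       (G \<otimes>\<^sub>o G) (braided_square_comult G d) (braided_square_counit e) s"


section \<open>The tensor algebra and the enveloping algebra\<close>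

primrec tensor_power :: "'v obj \<Rightarrow> nat \<Rightarrow> 'v obj" where
  "tensor_power g 0 = unit_obj"
| "tensor_power g (Suc n) = tensor_power g n \<otimes>\<^sub>o g"

text \<open>The map sending \<open>x1 \<otimes> ... \<otimes> xn\<close> to the product of the \<open>\<iota> xi\<close>.\<close>

primrec product_map :: "('v \<Rightarrow> 'v) \<Rightarrow> ('v \<Rightarrow> 'v) \<Rightarrow> ('v \<Rightarrow> 'v) \<Rightarrow> nat \<Rightarrow> 'v \<Rightarrow> 'v" where
  "product_map m \<eta> \<iota> 0 = \<eta>"
| "product_map m \<eta> \<iota> (Suc n) = m \<circ> (product_map m \<eta> \<iota> n \<otimes>\<^sub>m \<iota>)"

text \<open>\<open>T\<close> is the direct sum of all tensor powers of \<open>g\<close>, multiplied by concatenation.\<close>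

definition tensor_algebra ::
    "'v obj \<Rightarrow> 'v obj \<Rightarrow> ('v \<Rightarrow> 'v) \<Rightarrow> ('v \<Rightarrow> 'v) \<Rightarrow> ('v \<Rightarrow> 'v) \<Rightarrow> bool" where
  "tensor_algebra g T m \<eta> \<iota> \<longleftrightarrow>
     algebra_in T m \<eta> \<and> mor g T \<iota> \<and>
     (\<forall>t \<in> space T. \<exists>!x :: nat \<Rightarrow> 'v.
        (\<forall>n. x n \<in> space (tensor_power g n)) \<and> finite {n. x n \<noteq> 0} \<and>
        t = (\<Sum>n | x n \<noteq> 0. product_map m \<eta> \<iota> n (x n)))"

definition two_sided_ideal :: "'v set \<Rightarrow> ('v \<Rightarrow> 'v) \<Rightarrow> 'v set \<Rightarrow> bool" where
  "two_sided_ideal A m I \<longleftrightarrow>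
     subspace I \<and> I \<subseteq> A \<and> (\<forall>a\<in>A. \<forall>b\<in>I. m (a \<otimes> b) \<in> I \<and> m (b \<otimes> a) \<in> I)"

definition generated_ideal :: "'v set \<Rightarrow> ('v \<Rightarrow> 'v) \<Rightarrow> 'v set \<Rightarrow> 'v set" where
  "generated_ideal A m R = \<Inter> {I. two_sided_ideal A m I \<and> R \<subseteq> I}"

text \<open>\<open>U\<close> is a quotient in V of the tensor algebra of \<open>g\<close> by the ideal of the defining relations
  of the enveloping algebra, and \<open>\<iota>\<close> is the canonical map from \<open>g\<close> to it.\<close>

definition enveloping_algebra ::
    "'v obj \<Rightarrow> ('v \<Rightarrow> 'v) \<Rightarrow> ('v \<Rightarrow> 'v) \<Rightarrow>
     'v obj \<Rightarrow> ('v \<Rightarrow> 'v) \<Rightarrow> ('v \<Rightarrow> 'v) \<Rightarrow> ('v \<Rightarrow> 'v) \<Rightarrow> bool" where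
  "enveloping_algebra g \<sigma> C U m \<eta> \<iota> \<longleftrightarrow>
     algebra_in U m \<eta> \<and> mor g U \<iota> \<and>
     (\<exists>T m\<^sub>T \<eta>\<^sub>T \<iota>\<^sub>T \<pi>.
        tensor_algebra g T m\<^sub>T \<eta>\<^sub>T \<iota>\<^sub>T \<and>
        mor T U \<pi> \<and> \<pi> ` space T = space U \<and>
        (\<forall>a \<in> space T. \<forall>b \<in> space T. \<pi> (m\<^sub>T (a \<otimes> b)) = m (\<pi> a \<otimes> \<pi> b)) \<and>
        \<pi> (\<eta>\<^sub>T (unity V)) = \<eta> (unity V) \<and>
        {t \<in> space T. \<pi> t = 0} =
          generated_ideal (space T) m\<^sub>T
            {m\<^sub>T (\<iota>\<^sub>T x \<otimes> \<iota>\<^sub>T y) - m\<^sub>T ((\<iota>\<^sub>T \<otimes>\<^sub>m \<iota>\<^sub>T) (\<sigma> (x \<otimes> y))) - \<iota>\<^sub>T (C (x \<otimes> y)) | x y.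
               x \<in> space g \<and> y \<in> space g} \<and>
        (\<forall>x \<in> space g. \<iota> x = \<pi> (\<iota>\<^sub>T x)))"

end

end

theory Submission
  imports Defs
begin

text \<open>
  The bracket of \<open>g\<close> extends to an operation \<open>A\<close> of \<open>G = k\<gamma> \<oplus> g\<close> on itself, with \<open>A(\<gamma> \<otimes> z) = z\<close> and
  \<open>A(z \<otimes> \<gamma>) = e(z)\<gamma>\<close>.  In terms of \<open>A\<close> and the coproduct \<open>d\<close> of \<open>G\<close>, the axioms of a good quantum Lie
  algebra become homogeneous: (L2'-a) says \<open>s = (A \<otimes> id)(id \<otimes> \<Psi>)(d \<otimes> id)\<close>, (L2'-b) says
  \<open>\<Psi> s = (id \<otimes> A)(d \<otimes> id)\<close>, (L3') says that \<open>A\<close> is a morphism of coalgebras, and (L1') says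
  \<open>A(id \<otimes> A) = A(id \<otimes> A)(s \<otimes> id)\<close>.  String diagram calculations then show that \<open>s\<close> is a morphism of
  coalgebras and satisfies the braid relation; the components of the latter with respect to
  \<open>G = k\<gamma> \<oplus> g\<close> are the axioms of a quantum Lie algebra.  Conversely, composing the coalgebra morphism
  \<open>s\<close> with counits gives back (L2'-a), (L2'-b) and (L3').

  In \<open>U\<close> the defining relations read \<open>\<nu> s = \<nu>\<close>, where \<open>\<nu>\<close> is the product of \<open>U\<close> restricted to
  \<open>G \<otimes> G\<close> with \<open>\<gamma>\<close> sent to 1.  As \<open>s\<close> is a morphism of coalgebras, \<open>(\<nu> \<otimes> \<nu>) d\<^bsub>G\<otimes>G\<^esub>\<close> is also invariant under
  \<open>s\<close>, which is what is needed for \<open>\<Delta>\<close> to respect the relations.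
\<close>

section \<open>Linear maps and tensor products\<close>

text \<open>The point of adjoining \<gamma> is that \<open>A\<close> and \<open>d\<close> then
  behave like the adjoint action of a braided Hopf algebra that is cocommutative relative to this
  action, although \<open>G\<close> itself carries no product. Cocommutativity is (L2'-b) with
  (L2'-a) substituted, and invariance under \<open>s\<close> stands in for associativity of an
  action. From this the braid relation is formal; its crucial ingredient is that the diagonal action
  on a tensor square commutes with the braiding.

  Two obstacles shape the rest. The tensor product is not strict, so diagrams are evaluated on words
  with a free tail, where associators disappear. And objects are spaces with explicit actions and
  coactions on either side, all inside one type \<open>'v\<close>: the monoidal structure has to be
  established by hand, after turning right structures into left ones, and \<open>G\<close>, the
  tensor algebra and \<open>U\<close> have to be realised there, sums by tensoring with an
  independent sequence and quotients as complements.\<close>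

named_theorems lin_intros

context tensor_universe
begin

lemma lin_iff:
  "lin f \<longleftrightarrow> (\<forall>x y. f (x + y) = f x + f y) \<and> (\<forall>c x. f (scale V c x) = scale V c (f x))"
  by (simp add: Vector_Spaces.linear_iff vector_space_axioms)

lemma functional_iff:
  "functional f \<longleftrightarrow> (\<forall>x y. f (x + y) = f x + f y) \<and> (\<forall>c x. f (scale V c x) = c * f x)"
proof -
  have "vector_space ((*) :: 'k \<Rightarrow> 'k \<Rightarrow> 'k)"
    by unfold_locales (auto simp: algebra_simps)
  then show ?thesis
    by (simp add: Vector_Spaces.linear_iff vector_space_axioms)
qed

lemma lin_add: "lin f \<Longrightarrow> f (x + y) = f x + f y"
  and lin_scale: "lin f \<Longrightarrow> f (scale V c x) = scale V c (f x)"
  by (simp_all add: lin_iff)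

lemma lin_0: "lin f \<Longrightarrow> f 0 = 0"
  using lin_scale[of f 0 0] by simp

lemma lin_neg: "lin f \<Longrightarrow> f (- x) = - f x"
  using lin_add[of f x "- x"] lin_0[of f] by (simp add: eq_neg_iff_add_eq_0 add.commute)

lemma lin_diff: "lin f \<Longrightarrow> f (x - y) = f x - f y"
  using lin_add[of f x "- y"] lin_neg[of f y] by simp

lemma lin_sum: "lin f \<Longrightarrow> f (sum g A) = (\<Sum>a\<in>A. f (g a))"
  by (induction A rule: infinite_finite_induct) (simp_all add: lin_0[of f] lin_add[of f])

lemmas lin_simps = lin_add lin_scale lin_0 lin_neg lin_diff

lemma functional_add: "functional f \<Longrightarrow> f (x + y) = f x + f y"
  and functional_scale: "functional f \<Longrightarrow> f (scale V c x) = c * f x"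
  by (simp_all add: functional_iff)

lemma functional_0: "functional f \<Longrightarrow> f 0 = 0"
  using functional_scale[of f 0 0] by simp

lemma lin_id [lin_intros]: "lin id" "lin (\<lambda>x. x)"
  by (simp_all add: lin_iff)

lemma lin_zero [lin_intros]: "lin (\<lambda>x. 0)"
  by (simp add: lin_iff)

lemma lin_compose: "lin f \<Longrightarrow> lin g \<Longrightarrow> lin (\<lambda>x. f (g x))"
  by (simp add: lin_iff)

lemma lin_o [lin_intros]: "lin f \<Longrightarrow> lin g \<Longrightarrow> lin (f \<circ> g)"
  by (simp add: lin_iff)

lemma lin_plus [lin_intros]: "lin f \<Longrightarrow> lin g \<Longrightarrow> lin (\<lambda>x. f x + g x)"
  by (simp add: lin_iff algebra_simps)

lemma lin_minus [lin_intros]: "lin f \<Longrightarrow> lin g \<Longrightarrow> lin (\<lambda>x. f x - g x)"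
  by (simp add: lin_iff algebra_simps)

lemma lin_scaled [lin_intros]: "lin f \<Longrightarrow> lin (\<lambda>x. scale V c (f x))"
  by (simp add: lin_iff algebra_simps)

lemma lin_functional [lin_intros]: "functional e \<Longrightarrow> lin g \<Longrightarrow> lin (\<lambda>x. scale V (e (g x)) c)"
  by (simp add: lin_iff functional_iff algebra_simps)

lemma span_lin_eq:
  assumes "z \<in> span B" "lin f" "lin g" "\<And>b. b \<in> B \<Longrightarrow> f b = g b"
  shows "f z = g z"
  using assms(1) by (induction rule: span_induct_alt) (simp_all add: assms(4) lin_simps[OF assms(2)] lin_simps[OF assms(3)])

lemma projection_exists:
  assumes "subspace S"
  shows "\<exists>P. lin P \<and> (\<forall>x. P x \<in> S) \<and> (\<forall>x\<in>S. P x = x)"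
  using vector_space_pair.linear_exists_left_inverse_on[OF _ lin_id(1) assms]
  by (auto simp: vector_space_pair_def vector_space_axioms)

definition pr :: "'v set \<Rightarrow> 'v \<Rightarrow> 'v" where
  "pr S = (SOME P. lin P \<and> (\<forall>x. P x \<in> S) \<and> (\<forall>x\<in>S. P x = x))"

lemma
  assumes "subspace S"
  shows lin_pr: "lin (pr S)" and pr_in: "pr S x \<in> S" and pr_eq: "x \<in> S \<Longrightarrow> pr S x = x"
  using someI_ex[OF projection_exists[OF assms]] unfolding pr_def by auto

text \<open>Realises the quotient by \<open>S\<close> inside \<open>'v\<close>: the complementary
  projection of a projection onto \<open>S\<close> has kernel \<open>S\<close>, and its values are
  canonical representatives of the classes.\<close>

lemma kernel_projection:
  assumes "subspace S"
  obtains P where "lin P" "\<And>x. P x = 0 \<longleftrightarrow> x \<in> S" "\<And>x. P (P x) = P x" "\<And>x. x - P x \<in> S"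
proof
  show "lin (\<lambda>x. x - pr S x)" by (intro lin_intros lin_pr assms)
  show "x - pr S x = 0 \<longleftrightarrow> x \<in> S" for x
    using pr_in[OF assms, of x] pr_eq[OF assms, of x] by auto
  show "x - pr S x - pr S (x - pr S x) = x - pr S x" for x
    by (simp add: lin_diff[OF lin_pr[OF assms]] pr_eq[OF assms pr_in[OF assms]])
  show "x - (x - pr S x) \<in> S" for x using pr_in[OF assms, of x] by simp
qed

lemma lin_factor:
  assumes "lin p" "lin f" "subspace S" "\<And>x. x \<in> S \<Longrightarrow> p x = 0 \<Longrightarrow> f x = 0"
  obtains h where "lin h" "\<And>x. x \<in> S \<Longrightarrow> h (p x) = f x"
proof -
  obtain r where r: "lin r" "r ` UNIV \<subseteq> S" "\<And>x. x \<in> p ` S \<Longrightarrow> p (r x) = x"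
    using vector_space_pair.linear_exists_right_inverse_on[OF _ assms(1,3)]
    by (auto simp: vector_space_pair_def vector_space_axioms)
  have "f (r (p x)) = f x" if "x \<in> S" for x
  proof -
    have "x - r (p x) \<in> S" using that r(2) by (intro subspace_diff assms(3)) auto
    moreover have "p (x - r (p x)) = 0" using that r(3) by (simp add: lin_diff[OF assms(1)])
    ultimately have "f (x - r (p x)) = 0" by (rule assms(4))
    then show ?thesis by (simp add: lin_diff[OF assms(2)])
  qed
  with that[of "\<lambda>x. f (r x)"] show ?thesis using lin_compose[OF assms(2) r(1)] by simp
qed

lemma subspace_image_lin: "lin f \<Longrightarrow> subspace S \<Longrightarrow> subspace (f ` S)"
  unfolding subspace_def
  by (auto simp: lin_0[of f] lin_add[of f, symmetric] lin_scale[of f, symmetric] intro: image_eqI[where x=0])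

lemma functional_exists:
  assumes "independent B" obtains f where "functional f" "\<And>b. b \<in> B \<Longrightarrow> f b = g b"
proof -
  have "vector_space ((*) :: 'k \<Rightarrow> 'k \<Rightarrow> 'k)"
    by unfold_locales (auto simp: algebra_simps)
  then show ?thesis
    using vector_space_pair.linear_independent_extend[of "scale V" "(*)" B g] assms that
    by (auto simp: vector_space_pair_def vector_space_axioms)
qed

end

section \<open>Tensor products of maps and subspaces, from the universal property\<close>

locale tensor_universal = tensor_universe V
  for V :: "('k::field, 'v::ab_group_add) category_data" (structure) +
  assumes universal: "universal_tensor"
begin

lemma bilin_tensor: "bilin (tensor V)"
  and unity_nonzero: "unity V \<noteq> 0"
  using universal by (auto simp: universal_tensor_def)

lemma lin_left: "lin (\<lambda>x. x \<otimes> y)" and lin_right: "lin (\<lambda>y. x \<otimes> y)"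
  using bilin_tensor by (auto simp: bilin_def)

lemma lin_tensor_left [lin_intros]: "lin f \<Longrightarrow> lin (\<lambda>x. f x \<otimes> y)"
  and lin_tensor_right [lin_intros]: "lin f \<Longrightarrow> lin (\<lambda>x. y \<otimes> f x)"
  by (rule lin_compose[OF lin_left] lin_compose[OF lin_right]; simp)+

lemmas tensor_left_simps = lin_simps[OF lin_left]
lemmas tensor_right_simps = lin_simps[OF lin_right]
lemmas tensor_simps [simp] = tensor_left_simps tensor_right_simps

lemma bilinI: "(\<And>x. lin (\<phi> x)) \<Longrightarrow> (\<And>y. lin (\<lambda>x. \<phi> x y)) \<Longrightarrow> bilin \<phi>"
  by (simp add: bilin_def)

lemma bilinD: "bilin \<phi> \<Longrightarrow> lin (\<phi> x)" "bilin \<phi> \<Longrightarrow> lin (\<lambda>x. \<phi> x y)"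
  by (auto simp: bilin_def)

lemma lift_spec:
  assumes "bilin \<phi>" shows "lin (lift \<phi>) \<and> (\<forall>x y. lift \<phi> (x \<otimes> y) = \<phi> x y)"
proof -
  have "\<exists>!h. lin h \<and> (\<forall>x y. h (x \<otimes> y) = \<phi> x y)"
    using universal assms by (simp add: universal_tensor_def)
  from theI'[OF this] show ?thesis unfolding lift_def .
qed

lemma lin_lift [lin_intros]: "bilin \<phi> \<Longrightarrow> lin (lift \<phi>)"
  and lift_tensor: "bilin \<phi> \<Longrightarrow> lift \<phi> (x \<otimes> y) = \<phi> x y"
  using lift_spec by auto

text \<open>Universality refers to the whole type, so the uniqueness half gives equality at every
  vector, with no membership condition. \<open>ten_eq\<close> below is the version for maps that are
  only known to agree on subspaces.\<close>

lemma tensor_ext: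
  assumes "lin f" "lin g" "\<And>x y. f (x \<otimes> y) = g (x \<otimes> y)" shows "f z = g z"
proof -
  have "bilin (\<lambda>x y. g (x \<otimes> y))"
    by (intro bilinI lin_compose[OF assms(2)] lin_left lin_right)
  then have "\<exists>!h. lin h \<and> (\<forall>x y. h (x \<otimes> y) = g (x \<otimes> y))"
    using universal by (simp add: universal_tensor_def)
  with assms show ?thesis by metis
qed

lemma ten_bilin: "lin f \<Longrightarrow> lin g \<Longrightarrow> bilin (\<lambda>x y. f x \<otimes> g y)"
  by (intro bilinI lin_intros)

lemma lin_ten [lin_intros]: "lin f \<Longrightarrow> lin g \<Longrightarrow> lin (f \<otimes>\<^sub>m g)"
  unfolding ten_def by (intro lin_lift ten_bilin)

lemma ten_tensor: "lin f \<Longrightarrow> lin g \<Longrightarrow> (f \<otimes>\<^sub>m g) (x \<otimes> y) = f x \<otimes> g y"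
  unfolding ten_def by (intro lift_tensor ten_bilin)

lemma lin_ten_apply [lin_intros]:
  "lin f \<Longrightarrow> lin g \<Longrightarrow> lin h \<Longrightarrow> lin (\<lambda>x. (f \<otimes>\<^sub>m g) (h x))"
  by (intro lin_compose[OF lin_ten])

lemma ten_comp:
  assumes "lin f" "lin g" "lin f'" "lin g'"
  shows "(f \<otimes>\<^sub>m g) ((f' \<otimes>\<^sub>m g') z) = ((\<lambda>x. f (f' x)) \<otimes>\<^sub>m (\<lambda>x. g (g' x))) z"
  by (rule tensor_ext[where z=z])
    (use assms in \<open>auto intro!: lin_intros lin_compose[OF assms(1)] lin_compose[OF assms(2)]
      simp: ten_tensor lin_compose[OF assms(1)] lin_compose[OF assms(2)]\<close>)

lemma ten_id [simp]: "(id \<otimes>\<^sub>m id) z = z" "((\<lambda>x. x) \<otimes>\<^sub>m (\<lambda>x. x)) z = z"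
  by (rule tensor_ext[where z=z], auto intro!: lin_intros simp: ten_tensor lin_intros)+

text \<open>The outer \<open>lift\<close> in \<alpha> needs the inner lift to be linear in its
  parameter \<open>z\<close>. That is an equality of two linear maps in \<open>u\<close>, so it can
  be tested on pure tensors.\<close>

lemma assoc_bilin: "bilin (\<lambda>x y. x \<otimes> y \<otimes> z)" "bilin (\<lambda>u z. lift (\<lambda>x y. x \<otimes> y \<otimes> z) u)"
proof -
  show *: "bilin (\<lambda>x y. x \<otimes> y \<otimes> z)" for z by (intro bilinI lin_intros)
  have "lift (\<lambda>x y. x \<otimes> y \<otimes> (a + b)) u = lift (\<lambda>x y. x \<otimes> y \<otimes> a) u + lift (\<lambda>x y. x \<otimes> y \<otimes> b) u"
    "lift (\<lambda>x y. x \<otimes> y \<otimes> scale V c a) u = scale V c (lift (\<lambda>x y. x \<otimes> y \<otimes> a) u)" for a b c u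
    by (rule tensor_ext[where z=u], (intro lin_plus lin_scaled lin_lift *)+, simp only: lift_tensor[OF *], simp)+
  then show "bilin (\<lambda>u z. lift (\<lambda>x y. x \<otimes> y \<otimes> z) u)"
    by (intro bilinI) (simp_all add: lin_iff lin_simps[OF lin_lift[OF *]])
qed

lemma assoc_inv_bilin: "bilin (\<lambda>y z. (x \<otimes> y) \<otimes> z)" "bilin (\<lambda>x u. lift (\<lambda>y z. (x \<otimes> y) \<otimes> z) u)"
proof -
  show *: "bilin (\<lambda>y z. (x \<otimes> y) \<otimes> z)" for x by (intro bilinI lin_intros)
  have **: "lift (\<lambda>y z. ((a + b) \<otimes> y) \<otimes> z) u = lift (\<lambda>y z. (a \<otimes> y) \<otimes> z) u + lift (\<lambda>y z. (b \<otimes> y) \<otimes> z) u"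
    "lift (\<lambda>y z. (scale V c a \<otimes> y) \<otimes> z) u = scale V c (lift (\<lambda>y z. (a \<otimes> y) \<otimes> z) u)" for a b c u
    by (rule tensor_ext[where z=u], (intro lin_plus lin_scaled lin_lift *)+, simp only: lift_tensor[OF *], simp)+
  show "bilin (\<lambda>x u. lift (\<lambda>y z. (x \<otimes> y) \<otimes> z) u)"
    by (intro bilinI lin_lift *) (use ** in \<open>unfold lin_iff, blast\<close>)
qed

lemma lin_assoc [lin_intros]: "lin \<alpha>" and assoc_tensor [simp]: "\<alpha> ((x \<otimes> y) \<otimes> z) = x \<otimes> (y \<otimes> z)"
  by (simp_all add: assoc_def lin_lift lift_tensor assoc_bilin)

lemma lin_assoc_inv [lin_intros]: "lin \<alpha>'"
  and assoc_inv_tensor [simp]: "\<alpha>' (x \<otimes> (y \<otimes> z)) = (x \<otimes> y) \<otimes> z"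
  by (simp_all add: assoc_inv_def lin_lift lift_tensor assoc_inv_bilin)

lemmas lin_assoc_apply [lin_intros] = lin_compose[OF lin_assoc]
lemmas lin_assoc_inv_apply [lin_intros] = lin_compose[OF lin_assoc_inv]
lemmas assoc_simps [simp] = lin_simps[OF lin_assoc] lin_simps[OF lin_assoc_inv]

lemma tensor_ext3:
  assumes "lin f" "lin g" "\<And>x y z. f ((x \<otimes> y) \<otimes> z) = g ((x \<otimes> y) \<otimes> z)" shows "f w = g w"
proof (rule tensor_ext[OF assms(1,2)])
  show "f (u \<otimes> z) = g (u \<otimes> z)" for u z
    by (rule tensor_ext[where z=u]) (auto intro!: lin_compose[OF assms(1)] lin_compose[OF assms(2)] lin_left assms(3))
qed

lemma tensor_ext3':
  assumes "lin f" "lin g" "\<And>x y z. f (x \<otimes> (y \<otimes> z)) = g (x \<otimes> (y \<otimes> z))" shows "f w = g w"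
proof (rule tensor_ext[OF assms(1,2)])
  show "f (x \<otimes> u) = g (x \<otimes> u)" for u x
    by (rule tensor_ext[where z=u]) (auto intro!: lin_compose[OF assms(1)] lin_compose[OF assms(2)] lin_right assms(3))
qed

lemma assoc_inverse [simp]: "\<alpha>' (\<alpha> z) = z" "\<alpha> (\<alpha>' z) = z"
  by (rule tensor_ext3[where w=z], auto intro!: lin_intros)
    (rule tensor_ext3'[where w=z], auto intro!: lin_intros)

lemma lin_flip [lin_intros]: "lin flip" and flip_tensor [simp]: "flip (x \<otimes> y) = y \<otimes> x"
proof -
  have "bilin (\<lambda>x y. y \<otimes> x)" by (intro bilinI lin_intros)
  then show "lin flip" "flip (x \<otimes> y) = y \<otimes> x" by (simp_all add: flip_def lin_lift lift_tensor)
qed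

lemmas lin_flip_apply [lin_intros] = lin_compose[OF lin_flip]
lemmas flip_simps [simp] = lin_simps[OF lin_flip]

lemma flip_flip [simp]: "flip (flip z) = z"
  by (rule tensor_ext[where z=z]) (auto intro!: lin_intros)

lemma flip_ten: "lin f \<Longrightarrow> lin g \<Longrightarrow> flip ((f \<otimes>\<^sub>m g) z) = (g \<otimes>\<^sub>m f) (flip z)"
  by (rule tensor_ext[where z=z]) (auto intro!: lin_intros simp: ten_tensor)

lemma lin_mid [lin_intros]: "lin \<psi> \<Longrightarrow> lin (mid \<psi>)"
  unfolding mid_def by (intro lin_intros)

lemmas lin_mid_apply [lin_intros] = lin_compose[OF lin_mid]

lemma mid_tensor: "lin \<psi> \<Longrightarrow> mid \<psi> ((x \<otimes> y) \<otimes> (z \<otimes> w)) = \<alpha>' (x \<otimes> \<alpha> (\<psi> (y \<otimes> z) \<otimes> w))"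
  unfolding mid_def by (simp add: ten_tensor lin_intros)

lemma mid_flip [simp]: "mid flip ((x \<otimes> y) \<otimes> (z \<otimes> w)) = (x \<otimes> z) \<otimes> (y \<otimes> w)"
  by (simp add: mid_tensor lin_intros)

lemma ten_space_mem: "x \<in> X \<Longrightarrow> y \<in> Y \<Longrightarrow> x \<otimes> y \<in> X \<otimes>\<^sub>s Y"
  unfolding ten_space_def by (intro span_base) auto

lemma subspace_ten_space [simp]: "subspace (X \<otimes>\<^sub>s Y)"
  unfolding ten_space_def by simp

lemma ten_eq:
  assumes "z \<in> X \<otimes>\<^sub>s Y" "lin f" "lin g" "\<And>x y. x \<in> X \<Longrightarrow> y \<in> Y \<Longrightarrow> f (x \<otimes> y) = g (x \<otimes> y)"
  shows "f z = g z"
  using assms(1) unfolding ten_space_def by (rule span_lin_eq) (auto simp: assms)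

lemma ten_mem:
  assumes "z \<in> X \<otimes>\<^sub>s Y" "lin f" "subspace S" "\<And>x y. x \<in> X \<Longrightarrow> y \<in> Y \<Longrightarrow> f (x \<otimes> y) \<in> S"
  shows "f z \<in> S"
  using assms(1) unfolding ten_space_def
  by (induction rule: span_induct_alt)
    (auto simp: assms lin_simps[OF assms(2)] subspace_0 subspace_add subspace_scale)

lemma ten_eq3:
  assumes "w \<in> (X \<otimes>\<^sub>s Y) \<otimes>\<^sub>s Z" "lin f" "lin g"
    "\<And>x y z. x \<in> X \<Longrightarrow> y \<in> Y \<Longrightarrow> z \<in> Z \<Longrightarrow> f ((x \<otimes> y) \<otimes> z) = g ((x \<otimes> y) \<otimes> z)"
  shows "f w = g w"
  using assms(1-3)
proof (rule ten_eq)
  show "f (u \<otimes> z) = g (u \<otimes> z)" if "u \<in> X \<otimes>\<^sub>s Y" "z \<in> Z" for u z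
    using that(1) by (rule ten_eq)
      (auto intro!: lin_compose[OF assms(2)] lin_compose[OF assms(3)] lin_left assms(4) that(2))
qed

lemma ten_eq4:
  assumes "w \<in> (X \<otimes>\<^sub>s Y) \<otimes>\<^sub>s (Z \<otimes>\<^sub>s W)" "lin f" "lin g"
    "\<And>x y z v. x \<in> X \<Longrightarrow> y \<in> Y \<Longrightarrow> z \<in> Z \<Longrightarrow> v \<in> W \<Longrightarrow>
      f ((x \<otimes> y) \<otimes> (z \<otimes> v)) = g ((x \<otimes> y) \<otimes> (z \<otimes> v))"
  shows "f w = g w"
  using assms(1-3)
proof (rule ten_eq3)
  show "f ((x \<otimes> y) \<otimes> z) = g ((x \<otimes> y) \<otimes> z)" if "x \<in> X" "y \<in> Y" "z \<in> Z \<otimes>\<^sub>s W" for x y z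
    using that(3) by (rule ten_eq)
      (auto intro!: lin_compose[OF assms(2)] lin_compose[OF assms(3)] lin_right assms(4) that(1,2))
qed

lemma ten_map:
  assumes "z \<in> X \<otimes>\<^sub>s Y" "lin f" "lin g" "f ` X \<subseteq> X'" "g ` Y \<subseteq> Y'"
  shows "(f \<otimes>\<^sub>m g) z \<in> X' \<otimes>\<^sub>s Y'"
  by (rule ten_mem[OF assms(1)]) (use assms in \<open>auto intro!: lin_intros ten_space_mem simp: ten_tensor\<close>)

lemma ten_cong:
  assumes "z \<in> X \<otimes>\<^sub>s Y" "lin f" "lin g" "lin f'" "lin g'"
    "\<And>x. x \<in> X \<Longrightarrow> f x = f' x" "\<And>x. x \<in> Y \<Longrightarrow> g x = g' x"
  shows "(f \<otimes>\<^sub>m g) z = (f' \<otimes>\<^sub>m g') z"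
  by (rule ten_eq[OF assms(1)]) (use assms in \<open>auto intro!: lin_intros simp: ten_tensor\<close>)

lemma assoc_mem: "w \<in> (X \<otimes>\<^sub>s Y) \<otimes>\<^sub>s Z \<Longrightarrow> \<alpha> w \<in> X \<otimes>\<^sub>s (Y \<otimes>\<^sub>s Z)"
proof (rule ten_mem[of w "X \<otimes>\<^sub>s Y" Z])
  show "\<alpha> (u \<otimes> z) \<in> X \<otimes>\<^sub>s (Y \<otimes>\<^sub>s Z)" if "u \<in> X \<otimes>\<^sub>s Y" "z \<in> Z" for u z
    using that(1) by (rule ten_mem) (auto intro!: lin_intros ten_space_mem that)
qed (auto intro: lin_intros)

lemma assoc_inv_mem: "w \<in> X \<otimes>\<^sub>s (Y \<otimes>\<^sub>s Z) \<Longrightarrow> \<alpha>' w \<in> (X \<otimes>\<^sub>s Y) \<otimes>\<^sub>s Z"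
proof (rule ten_mem[of w X "Y \<otimes>\<^sub>s Z"])
  show "\<alpha>' (x \<otimes> u) \<in> (X \<otimes>\<^sub>s Y) \<otimes>\<^sub>s Z" if "x \<in> X" "u \<in> Y \<otimes>\<^sub>s Z" for u x
    using that(2) by (rule ten_mem) (auto intro!: lin_intros ten_space_mem that)
qed (auto intro: lin_intros)

lemma flip_mem: "z \<in> X \<otimes>\<^sub>s Y \<Longrightarrow> flip z \<in> Y \<otimes>\<^sub>s X"
  by (rule ten_mem[of z X Y]) (auto intro!: lin_intros ten_space_mem)

lemma mid_mem:
  assumes "w \<in> (X \<otimes>\<^sub>s Y) \<otimes>\<^sub>s (Z \<otimes>\<^sub>s W)" "lin \<psi>" "\<psi> ` (Y \<otimes>\<^sub>s Z) \<subseteq> Z' \<otimes>\<^sub>s Y'"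
  shows "mid \<psi> w \<in> (X \<otimes>\<^sub>s Z') \<otimes>\<^sub>s (Y' \<otimes>\<^sub>s W)"
proof -
  have "(\<alpha> \<circ> (\<psi> \<otimes>\<^sub>m id) \<circ> \<alpha>') u \<in> Z' \<otimes>\<^sub>s (Y' \<otimes>\<^sub>s W)" if "u \<in> Y \<otimes>\<^sub>s (Z \<otimes>\<^sub>s W)" for u
    using that assms(2,3) by (auto intro!: assoc_mem ten_map[where f=\<psi>] assoc_inv_mem lin_intros)
  then show ?thesis
    unfolding mid_def comp_apply
    by (intro assoc_inv_mem ten_map[OF assoc_mem[OF assms(1)]] lin_intros assms(2)) auto
qed

text \<open>On the unit object this is its identification with k; the extension to the rest of
  \<open>'v\<close> is an arbitrary choice.\<close>

definition coord :: "'v \<Rightarrow> 'k" where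
  "coord = (SOME f. functional f \<and> f (unity V) = 1)"

lemma functional_coord: "functional coord" and coord_unity [simp]: "coord (unity V) = 1"
proof -
  obtain f :: "'v \<Rightarrow> 'k" where "functional f" "f (unity V) = 1"
    by (rule functional_exists[of "{unity V}" "\<lambda>_. 1"]) (auto simp: unity_nonzero)
  then have "functional coord \<and> coord (unity V) = 1"
    unfolding coord_def by (metis (mono_tags, lifting) someI)
  then show "functional coord" "coord (unity V) = 1" by auto
qed

lemma unit_space: "x \<in> span {unity V} \<longleftrightarrow> (\<exists>c. x = scale V c (unity V))"
  by (auto simp: span_singleton)

text \<open>This is id \<otimes> e followed by the identification of X \<otimes> k with X;
  \<open>contract_left\<close> is the mirror image.\<close>

definition contract_right :: "('v \<Rightarrow> 'k) \<Rightarrow> 'v \<Rightarrow> 'v" where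
  "contract_right e = lift (\<lambda>x y. scale V (e y) x)"

definition contract_left :: "('v \<Rightarrow> 'k) \<Rightarrow> 'v \<Rightarrow> 'v" where
  "contract_left e = lift (\<lambda>x y. scale V (e x) y)"

lemma lin_contract_right [lin_intros]: "functional e \<Longrightarrow> lin (contract_right e)"
  and contract_right_tensor: "functional e \<Longrightarrow> contract_right e (x \<otimes> y) = scale V (e y) x"
proof -
  assume "functional e"
  then have "bilin (\<lambda>x y. scale V (e y) x)" by (intro bilinI lin_intros)
  then show "lin (contract_right e)" "contract_right e (x \<otimes> y) = scale V (e y) x"
    by (simp_all add: contract_right_def lin_lift lift_tensor)
qed

lemma lin_contract_left [lin_intros]: "functional e \<Longrightarrow> lin (contract_left e)"
  and contract_left_tensor: "functional e \<Longrightarrow> contract_left e (x \<otimes> y) = scale V (e x) y"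
proof -
  assume "functional e"
  then have "bilin (\<lambda>x y. scale V (e x) y)" by (intro bilinI lin_intros)
  then show "lin (contract_left e)" "contract_left e (x \<otimes> y) = scale V (e x) y"
    by (simp_all add: contract_left_def lin_lift lift_tensor)
qed

lemma tensor_unity_inject: "x \<otimes> unity V = y \<otimes> unity V \<longleftrightarrow> x = y"
  using contract_right_tensor[OF functional_coord, of _ "unity V"] by (metis coord_unity scale_one)

lemma ten_functional_spec:
  assumes "functional f" "functional g"
  shows "functional (ten_functional f g) \<and> (\<forall>x y. ten_functional f g (x \<otimes> y) = f x * g y)"
proof -
  \<comment> \<open>The universal property concerns maps with values in \<open>'v\<close>, so the
    scalar f(x) g(y) is moved to the line of \<open>unity V\<close> and recovered with
    \<open>coord\<close>.\<close>
  define B where "B = (\<lambda>x y. scale V (f x * g y) (unity V))"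
  have B: "bilin B" using assms unfolding B_def bilin_def lin_iff functional_iff
    by (simp add: algebra_simps)
  have 1: "functional (\<lambda>z. coord (lift B z))"
    using lin_lift[OF B] functional_coord by (simp add: functional_iff lin_iff)
  have 2: "coord (lift B (x \<otimes> y)) = f x * g y" for x y
    using functional_scale[OF functional_coord] by (simp add: lift_tensor[OF B]) (simp add: B_def)
  have 3: "h = (\<lambda>z. coord (lift B z))" if "functional h" "\<And>x y. h (x \<otimes> y) = f x * g y" for h
  proof
    fix z
    have "scale V (h z) (unity V) = scale V (coord (lift B z)) (unity V)"
      by (rule tensor_ext[where z=z])
        (auto intro!: lin_functional[OF that(1) lin_id(2)] lin_functional[OF 1 lin_id(2)] simp: that 2)
    then show "h z = coord (lift B z)" using unity_nonzero by simp
  qed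
  have "\<exists>!h. functional h \<and> (\<forall>x y. h (x \<otimes> y) = f x * g y)"
  proof (rule ex1I[of _ "\<lambda>z. coord (lift B z)"])
    show "functional (\<lambda>z. coord (lift B z)) \<and> (\<forall>x y. coord (lift B (x \<otimes> y)) = f x * g y)"
      using 1 2 by blast
  qed (rule 3; blast)
  from theI'[OF this] show ?thesis unfolding ten_functional_def .
qed

end

sublocale braided_category \<subseteq> tensor_universal
  by unfold_locales (rule universal_tensor)

section \<open>String diagrams\<close>

text \<open>Strands are numbered from 0.  \<open>A k\<close> merges the strands \<open>k\<close> and \<open>k + 1\<close>, \<open>p k\<close> crosses them, and
  \<open>d k\<close> splits strand \<open>k\<close>.\<close>

locale merge_strands =
  fixes A p :: "nat \<Rightarrow> 'a \<Rightarrow> 'a"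
  assumes AA: "k + 1 \<le> l \<Longrightarrow> A k (A (l + 1) w) = A l (A k w)"
    and Ap: "k + 1 \<le> l \<Longrightarrow> A k (p (l + 1) w) = p l (A k w)"
    and pA: "k + 2 \<le> l \<Longrightarrow> p k (A l w) = A l (p k w)"
    and pp: "k + 2 \<le> l \<Longrightarrow> p k (p l w) = p l (p k w)"
    and pA_left: "p k (A k w) = A (k + 1) (p k (p (k + 1) w))"
    and pA_right: "p k (A (k + 1) w) = A k (p (k + 1) (p k w))"
begin

context notes One_nat_def [simp del] add_2_eq_Suc [simp del] add_2_eq_Suc' [simp del] begin

text \<open>\<open>A 0 (A 2 (p 1 w))\<close> is the product of the braided tensor square on four
  strands. Naturality moves all crossings in front of the merges; what remains are threefold
  products in both outputs and two crossing patterns that differ by commuting distant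
  crossings.\<close>

lemma product_assoc:
  assumes "\<And>k w. A k (A k w) = A k (A (k + 1) w)"
  shows "A 0 (A 2 (p 1 (A 0 (A 2 (p 1 w))))) = A 0 (A 2 (p 1 (A 2 (A 4 (p 3 w)))))"
proof -
  have "A 0 (A 2 (p 1 (A 0 (A 2 (p 1 w))))) = A 0 (A 0 (A 3 (p 2 (A 2 (p 1 w)))))"
    by (simp add: AA[of 0 2, symmetric] Ap[of 0 1, symmetric])
  also have "\<dots> = A 0 (A 0 (A 3 (A 3 (p 2 (p 3 (p 1 w))))))"
    using pA_left[of 2] by simp
  also have "\<dots> = A 0 (A 1 (A 3 (A 4 (p 2 (p 3 (p 1 w))))))"
    using assms[of 0] assms[of 3] by simp
  finally have L: "A 0 (A 2 (p 1 (A 0 (A 2 (p 1 w))))) = \<dots>" .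
  have "A 0 (A 2 (p 1 (A 2 (A 4 (p 3 w))))) = A 0 (A 2 (A 1 (p 2 (p 1 (A 4 (p 3 w))))))"
    using pA_right[of 1] by simp
  also have "\<dots> = A 0 (A 2 (A 1 (p 2 (A 4 (p 1 (p 3 w))))))"
    by (simp add: pA[of 1 4])
  also have "\<dots> = A 0 (A 2 (A 1 (A 4 (p 2 (p 1 (p 3 w))))))"
    by (simp add: pA[of 2 4])
  also have "\<dots> = A 0 (A 1 (A 3 (A 4 (p 2 (p 1 (p 3 w))))))"
    by (simp add: AA[of 1 2, symmetric])
  also have "p 1 (p 3 w) = p 3 (p 1 w)" by (simp add: pp[of 1 3])
  finally show ?thesis using L by simp
qed

end

end

text \<open>The laws with a side condition say that operations on disjoint strands commute, the
  index being corrected by the strands gained or lost to the left. \<open>dp_left\<close> and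
  \<open>dp_right\<close> combine naturality of the braiding along the coproduct with a
  hexagon.\<close>

locale strands = merge_strands A p for A p :: "nat \<Rightarrow> 'a \<Rightarrow> 'a" +
  fixes d :: "nat \<Rightarrow> 'a \<Rightarrow> 'a"
  assumes Ad: "k + 1 \<le> l \<Longrightarrow> A k (d (l + 1) w) = d l (A k w)"
    and pd: "k + 2 \<le> l \<Longrightarrow> p k (d l w) = d l (p k w)"
    and dA: "k + 1 \<le> l \<Longrightarrow> d k (A l w) = A (l + 1) (d k w)"
    and dp: "k + 1 \<le> l \<Longrightarrow> d k (p l w) = p (l + 1) (d k w)"
    and dd: "k + 1 \<le> l \<Longrightarrow> d k (d l w) = d (l + 1) (d k w)"
    and dp_left: "d k (p k w) = p (k + 1) (p k (d (k + 1) w))"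
    and dp_right: "d (k + 1) (p k w) = p k (p (k + 1) (d k w))"
begin

context notes One_nat_def [simp del] add_2_eq_Suc [simp del] add_2_eq_Suc' [simp del] begin

text \<open>Coassociativity is assumed only for the two factors contained in \<open>w\<close>, not
  as a law for \<open>d\<close>: the lemma serves an induction over products in which nothing more
  is known.\<close>

lemma coassoc_product:
  assumes mult: "\<And>k w. d k (A k w) = A k (A (k + 2) (p (k + 1) (d k (d (k + 1) w))))"
    and "d 1 (d 1 w) = d 2 (d 1 w)"
    and "d 0 (d 0 (d 1 (d 1 w))) = d 1 (d 0 (d 1 (d 1 w)))"
  shows "d 0 (d 0 (A 0 w)) = d 1 (d 0 (A 0 w))"
proof -
  have "d 0 (d 0 (A 0 w)) = d 0 (A 0 (A 2 (p 1 (d 0 (d 1 w)))))"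
    using mult[of 0] by simp
  also have "\<dots> = A 0 (A 2 (p 1 (d 0 (d 1 (A 2 (p 1 (d 0 (d 1 w))))))))"
    using mult[of 0] by simp
  also have "\<dots> = A 0 (A 2 (p 1 (A 4 (d 0 (d 1 (p 1 (d 0 (d 1 w))))))))"
    by (simp add: dA[of 1 2] dA[of 0 3])
  also have "\<dots> = A 0 (A 2 (A 4 (p 1 (d 0 (d 1 (p 1 (d 0 (d 1 w))))))))"
    by (simp add: pA[of 1 4])
  also have "\<dots> = A 0 (A 2 (A 4 (p 1 (d 0 (p 2 (p 1 (d 2 (d 0 (d 1 w)))))))))"
    using dp_left[of 1] by simp
  also have "\<dots> = A 0 (A 2 (A 4 (p 1 (p 3 (p 2 (d 0 (d 2 (d 0 (d 1 w)))))))))"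
    by (simp add: dp[of 0])
  also have "d 0 (d 2 (d 0 (d 1 w))) = d 0 (d 0 (d 1 (d 1 w)))"
    by (simp add: dd[of 0 1])
  finally have L: "d 0 (d 0 (A 0 w)) = A 0 (A 2 (A 4 (p 1 (p 3 (p 2 (d 0 (d 0 (d 1 (d 1 w)))))))))" .
  have "d 1 (d 0 (A 0 w)) = d 1 (A 0 (A 2 (p 1 (d 0 (d 1 w)))))"
    using mult[of 0] by simp
  also have "\<dots> = A 0 (d 2 (A 2 (p 1 (d 0 (d 1 w)))))"
    by (simp add: Ad[of 0 1, symmetric])
  also have "\<dots> = A 0 (A 2 (A 4 (p 3 (d 2 (d 3 (p 1 (d 0 (d 1 w))))))))"
    using mult[of 2] by simp
  also have "\<dots> = A 0 (A 2 (A 4 (p 3 (d 2 (p 1 (d 3 (d 0 (d 1 w))))))))"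
    by (simp add: pd[of 1 3])
  also have "\<dots> = A 0 (A 2 (A 4 (p 3 (p 1 (p 2 (d 1 (d 3 (d 0 (d 1 w)))))))))"
    using dp_right[of 1] by simp
  also have "d 1 (d 3 (d 0 (d 1 w))) = d 1 (d 0 (d 2 (d 1 w)))"
    by (simp add: dd[of 0 2])
  also have "d 2 (d 1 w) = d 1 (d 1 w)" using assms(2) by simp
  also have "d 1 (d 0 (d 1 (d 1 w))) = d 0 (d 0 (d 1 (d 1 w)))" using assms(3) by simp
  also have "p 3 (p 1 (p 2 (d 0 (d 0 (d 1 (d 1 w)))))) = p 1 (p 3 (p 2 (d 0 (d 0 (d 1 (d 1 w))))))"
    by (simp add: pp[of 1 3])
  finally show ?thesis using L by simp
qed

end

end

text \<open>The axioms on \<open>G\<close> with \<open>s\<close> eliminated by (L2'-a):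
  \<open>cocomm\<close> is (L2'-b), \<open>act_comult\<close> is (L3') and \<open>act_twist\<close>
  is (L1').\<close>

locale action_strands = strands +
  assumes coassoc: "d k (d k w) = d (k + 1) (d k w)"
    and yang_baxter: "p k (p (k + 1) (p k w)) = p (k + 1) (p k (p (k + 1) w))"
    and cocomm: "p k (A k (p (k + 1) (d k w))) = A (k + 1) (d k w)"
    and act_comult: "d k (A k w) = A k (A (k + 2) (p (k + 1) (d k (d (k + 1) w))))"
    and act_twist: "A k (A (k + 1) w) = A k (A (k + 1) (A k (p (k + 1) (d k w))))"
begin

context notes One_nat_def [simp del] add_2_eq_Suc [simp del] add_2_eq_Suc' [simp del] begin

definition s :: "nat \<Rightarrow> 'a \<Rightarrow> 'a" where "s k w = A k (p (k + 1) (d k w))"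

lemma As: "k + 1 \<le> l \<Longrightarrow> A k (s (l + 1) w) = s l (A k w)"
  unfolding s_def using Ap[of k "l + 1"] by (simp add: AA Ap Ad)

lemma ps: "k + 2 \<le> l \<Longrightarrow> p k (s l w) = s l (p k w)"
  unfolding s_def by (simp add: pA pp[of k "l + 1"] pp[of k l] pd)

lemma ds: "k + 1 \<le> l \<Longrightarrow> d k (s l w) = s (l + 1) (d k w)"
  unfolding s_def by (simp add: dA dp dd)

text \<open>\<open>act_comult\<close> splits the action inside \<open>s\<close>: one copy of the
  first argument acts on the first part of the second argument, and coassociativity lets the
  remaining copies reassemble to \<open>s\<close> on the second part.\<close>

lemma comult_left: "d 0 (s 0 w) = A 0 (s 2 (p 1 (d 0 (d 1 w))))"
proof -
  have "d 0 (s 0 w) = A 0 (A 2 (p 1 (d 0 (d 1 (p 1 (d 0 w))))))"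
    using act_comult[of 0] by (simp add: s_def)
  also have "d 1 (p 1 (d 0 w)) = p 2 (p 1 (d 2 (d 0 w)))"
    using dp_left[of 1] by simp
  also have "d 0 (p 2 (p 1 (d 2 (d 0 w)))) = p 3 (p 2 (d 0 (d 0 (d 1 w))))"
    by (simp add: dp[of 0] dd[of 0 1])
  also have "d 0 (d 0 (d 1 w)) = d 1 (d 0 (d 1 w))"
    using coassoc[of 0] by simp
  also have "p 1 (p 3 (p 2 (d 1 (d 0 (d 1 w))))) = p 3 (p 1 (p 2 (d 1 (d 0 (d 1 w)))))"
    by (simp add: pp[of 1 3])
  also have "p 1 (p 2 (d 1 (d 0 (d 1 w)))) = d 2 (p 1 (d 0 (d 1 w)))"
    using dp_right[of 1] by simp
  finally show ?thesis by (simp add: s_def)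
qed

text \<open>The second output of \<open>s\<close> is an untouched copy of the first argument, so
  naturality and coassociativity suffice.\<close>

lemma comult_right: "d 1 (s 0 w) = s 0 (p 1 (d 0 w))"
proof -
  have "d 1 (s 0 w) = A 0 (d 2 (p 1 (d 0 w)))" by (simp add: s_def Ad[of 0 1, symmetric])
  also have "d 2 (p 1 (d 0 w)) = p 1 (p 2 (d 1 (d 0 w)))"
    using dp_right[of 1] by simp
  also have "d 1 (d 0 w) = d 0 (d 0 w)" using coassoc[of 0] by simp
  also have "p 2 (d 0 (d 0 w)) = d 0 (p 1 (d 0 w))" by (simp add: dp[of 0 1])
  finally show ?thesis by (simp add: s_def)
qed

text \<open>Both sides are brought to the form splits, then crossings, then the two merges
  \<open>A 0\<close> and \<open>A 3\<close>. Cocommutativity enters on the left, where the crossing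
  on top of \<open>s 2\<close> is removed.\<close>

lemma s_comult: "p 1 (d 0 (d 1 (s 0 w))) = s 0 (s 2 (p 1 (d 0 (d 1 w))))"
proof -
  have "p 1 (d 0 (d 1 (s 0 w))) = p 1 (A 0 (s 2 (p 1 (d 0 (d 1 (p 1 (d 0 w)))))))"
    by (simp add: comult_right comult_left)
  also have "\<dots> = A 0 (p 2 (s 2 (p 1 (d 0 (d 1 (p 1 (d 0 w)))))))"
    by (simp add: Ap[of 0 1, symmetric])
  also have "\<dots> = A 0 (A 3 (d 2 (p 1 (d 0 (d 1 (p 1 (d 0 w)))))))"
    using cocomm[of 2] by (simp add: s_def)
  also have "d 1 (p 1 (d 0 w)) = p 2 (p 1 (d 2 (d 0 w)))"
    using dp_left[of 1] by simp
  also have "d 0 (p 2 (p 1 (d 2 (d 0 w)))) = p 3 (p 2 (d 0 (d 2 (d 0 w))))"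
    by (simp add: dp[of 0])
  also have "d 2 (p 1 (p 3 (p 2 (d 0 (d 2 (d 0 w)))))) = p 1 (p 2 (d 1 (p 3 (p 2 (d 0 (d 2 (d 0 w)))))))"
    using dp_right[of 1] by simp
  also have "\<dots> = p 1 (p 2 (p 4 (p 3 (d 1 (d 0 (d 0 (d 1 w)))))))"
    by (simp add: dp[of 1] dd[of 0 1])
  also have "d 1 (d 0 (d 0 (d 1 w))) = d 0 (d 0 (d 0 (d 1 w)))"
    using coassoc[of 0 "d 0 (d 1 w)"] by simp
  finally have L: "p 1 (d 0 (d 1 (s 0 w))) =
    A 0 (A 3 (p 1 (p 2 (p 4 (p 3 (d 0 (d 0 (d 0 (d 1 w)))))))))" .
  have "s 0 (s 2 (p 1 (d 0 (d 1 w)))) = A 0 (p 1 (s 3 (d 0 (p 1 (d 0 (d 1 w))))))"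
    unfolding s_def[of 0] by (simp add: ds[of 0 2])
  also have "\<dots> = A 0 (p 1 (s 3 (p 2 (d 0 (d 0 (d 1 w))))))" by (simp add: dp[of 0])
  also have "\<dots> = A 0 (A 3 (p 1 (p 4 (d 3 (p 2 (d 0 (d 0 (d 1 w))))))))"
    by (simp add: s_def[of 3] pA[of 1 3])
  also have "d 3 (p 2 (d 0 (d 0 (d 1 w)))) = p 2 (p 3 (d 2 (d 0 (d 0 (d 1 w)))))"
    using dp_right[of 2] by simp
  also have "d 2 (d 0 (d 0 (d 1 w))) = d 0 (d 0 (d 0 (d 1 w)))"
    using dd[of 0 1 "d 0 (d 1 w)"] coassoc[of 0 "d 1 w", symmetric] by simp
  also have "p 4 (p 2 (p 3 (d 0 (d 0 (d 0 (d 1 w)))))) = p 2 (p 4 (p 3 (d 0 (d 0 (d 0 (d 1 w))))))"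
    by (simp add: pp[of 2 4])
  finally show ?thesis using L by simp
qed

text \<open>Cocommutativity in disguise: the diagonal action on a tensor square commutes with \<open>p\<close>.\<close>

lemma p_s_s: "p 0 (s 1 (s 0 w)) = s 1 (s 0 (p 1 w))"
proof -
  have s_s: "s 1 (s 0 w) = A 0 (A 2 (p 3 (p 1 (p 2 (d 0 (d 0 w))))))" for w
  proof -
    have "s 1 (s 0 w) = s 1 (A 0 (p 1 (d 0 w)))" by (simp add: s_def[of 0])
    also have "\<dots> = A 0 (s 2 (p 1 (d 0 w)))" by (simp add: As[of 0 1, symmetric])
    also have "\<dots> = A 0 (A 2 (p 3 (d 2 (p 1 (d 0 w)))))" by (simp add: s_def[of 2])
    also have "d 2 (p 1 (d 0 w)) = p 1 (p 2 (d 1 (d 0 w)))"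
      using dp_right[of 1] by simp
    also have "d 1 (d 0 w) = d 0 (d 0 w)" using coassoc[of 0] by simp
    finally show ?thesis .
  qed
  \<comment> \<open>Naturality turns \<open>cocomm\<close> into a statement with the merge last:
    under an action on a copy of the acting strand, the extra crossings become invisible, although
    the braiding need not be an involution.\<close>
  have cc: "A 1 (p 0 (p 1 (p 1 (d 0 v)))) = A 1 (d 0 v)" for v
    using cocomm[of 0] pA_left[of 0 "p 1 (d 0 v)"] by simp
  have "p 0 (s 1 (s 0 w)) = p 0 (s 1 (A 0 (p 1 (d 0 w))))" by (simp add: s_def[of 0])
  also have "\<dots> = p 0 (A 0 (s 2 (p 1 (d 0 w))))" by (simp add: As[of 0 1, symmetric])
  also have "\<dots> = A 1 (p 0 (p 1 (A 2 (p 3 (d 2 (p 1 (d 0 w)))))))"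
    using pA_left[of 0] by (simp add: s_def[of 2])
  also have "\<dots> = A 1 (p 0 (A 1 (p 2 (p 1 (p 3 (d 2 (p 1 (d 0 w))))))))"
    using pA_right[of 1] by simp
  also have "\<dots> = A 1 (A 0 (p 1 (p 0 (p 2 (p 1 (p 3 (d 2 (p 1 (d 0 w)))))))))"
    using pA_right[of 0] by simp
  also have "d 2 (p 1 (d 0 w)) = p 1 (p 2 (d 1 (d 0 w)))"
    using dp_right[of 1] by simp
  also have "d 1 (d 0 w) = d 0 (d 0 w)" using coassoc[of 0] by simp
  also have "p 1 (p 3 (p 1 (p 2 (d 0 (d 0 w))))) = p 3 (p 1 (p 1 (p 2 (d 0 (d 0 w)))))"
    by (simp add: pp[of 1 3])
  finally have *: "p 0 (s 1 (s 0 w)) = A 0 (A 2 (p 1 (p 0 (p 2 (p 3 (p 1 (p 1 (p 2 (d 0 (d 0 w))))))))))"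
    by (simp add: AA[of 0 1, symmetric])
  have "\<dots> = A 0 (A 2 (p 1 (p 2 (p 3 (p 0 (p 1 (p 1 (d 0 (p 1 (d 0 w))))))))))"
    by (simp add: pp[of 0] dp[of 0])
  also have "\<dots> = A 0 (p 1 (A 1 (p 3 (p 0 (p 1 (p 1 (d 0 (p 1 (d 0 w)))))))))"
    using pA_left[of 1] by simp
  also have "\<dots> = A 0 (p 1 (p 2 (A 1 (d 0 (p 1 (d 0 w))))))"
    using Ap[of 1 2] by (simp add: cc)
  also have "\<dots> = A 0 (p 1 (A 1 (d 0 (p 2 (p 1 (d 0 w))))))"
    using Ap[of 1 2] by (simp add: dp[of 0])
  also have "\<dots> = A 0 (A 2 (p 1 (p 2 (p 3 (p 2 (d 0 (d 0 w)))))))"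
    using pA_left[of 1] by (simp add: dp[of 0])
  \<comment> \<open>The Yang-Baxter equation moves the crossing of the two strands acted upon below
    the splits, where it becomes the crossing on the other side of the claim.\<close>
  also have "p 2 (p 3 (p 2 (d 0 (d 0 w)))) = p 3 (p 2 (d 0 (d 0 (p 1 w))))"
    using yang_baxter[of 2] by (simp add: dp[of 0])
  also have "p 1 (p 3 (p 2 (d 0 (d 0 (p 1 w))))) = p 3 (p 1 (p 2 (d 0 (d 0 (p 1 w)))))"
    by (simp add: pp[of 1 3])
  finally show ?thesis using * s_s by simp
qed

text \<open>The axioms are invariant under shifting all strands, so the law two places further right
  is the previous lemma in a shifted instance of the locale.\<close>

lemma p_s_s_2: "p 2 (s 3 (s 2 w)) = s 3 (s 2 (p 3 w))"
proof -
  interpret shifted: action_strands "\<lambda>k. A (k + 2)" "\<lambda>k. p (k + 2)" "\<lambda>k. d (k + 2)"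
    using AA[of "k + 2" "l + 2" for k l] Ap[of "k + 2" "l + 2" for k l] pA[of "k + 2" "l + 2" for k l]
      pp[of "k + 2" "l + 2" for k l] pA_left[of "k + 2" for k] pA_right[of "k + 2" for k]
      Ad[of "k + 2" "l + 2" for k l] pd[of "k + 2" "l + 2" for k l] dA[of "k + 2" "l + 2" for k l]
      dp[of "k + 2" "l + 2" for k l] dd[of "k + 2" "l + 2" for k l]
      dp_left[of "k + 2" for k] dp_right[of "k + 2" for k] coassoc[of "k + 2" for k]
      yang_baxter[of "k + 2" for k] cocomm[of "k + 2" for k] act_comult[of "k + 2" for k]
      act_twist[of "k + 2" for k]
    by unfold_locales (simp_all add: numeral_2_eq_2 One_nat_def)
  show ?thesis
    using shifted.p_s_s[of w] by (simp add: s_def shifted.s_def)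
qed

text \<open>Both sides are rewritten as nested actions on one word. On the left this takes the
  coproduct of an output of \<open>s\<close> and then \<open>p_s_s_2\<close>, that is
  cocommutativity; on the right it takes \<open>act_twist\<close>, that is (L1').\<close>

theorem s_braid: "s 0 (s 1 (s 0 w)) = s 1 (s 0 (s 1 w))"
proof -
  have "s 0 (s 1 (s 0 w)) = A 0 (p 1 (s 2 (d 0 (s 0 w))))"
    unfolding s_def[of 0] by (simp add: ds[of 0 1])
  also have "\<dots> = A 0 (p 1 (A 0 (s 3 (s 2 (p 1 (d 0 (d 1 w)))))))"
    by (simp add: comult_left As[of 0 2, symmetric])
  also have "\<dots> = A 0 (A 0 (p 2 (s 3 (s 2 (p 1 (d 0 (d 1 w)))))))"
    by (simp add: Ap[of 0 1, symmetric])
  finally have L: "s 0 (s 1 (s 0 w)) = \<dots>" .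
  have "s 1 (s 0 (s 1 w)) = s 1 (A 0 (p 1 (d 0 (A 1 (p 2 (d 1 w))))))"
    by (simp add: s_def[of 0] s_def[of 1 w])
  also have "\<dots> = s 1 (A 0 (p 1 (A 2 (p 3 (d 0 (d 1 w))))))"
    by (simp add: dA[of 0] dp[of 0])
  also have "\<dots> = s 1 (A 0 (A 1 (p 2 (p 1 (p 3 (d 0 (d 1 w)))))))"
    using pA_right[of 1] by simp
  also have "\<dots> = A 0 (A 1 (s 3 (p 2 (p 1 (p 3 (d 0 (d 1 w)))))))"
    by (simp add: As[of 0 1, symmetric] As[of 1 2, symmetric])
  \<comment> \<open>The left side has one merge more, produced by \<open>comult_left\<close>;
    \<open>act_twist\<close> creates its counterpart.\<close>
  also have "\<dots> = A 0 (A 1 (A 0 (p 1 (d 0 (s 3 (p 2 (p 1 (p 3 (d 0 (d 1 w))))))))))"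
    using act_twist[of 0] by simp
  also have "\<dots> = A 0 (A 0 (A 2 (p 1 (d 0 (s 3 (p 2 (p 1 (p 3 (d 0 (d 1 w))))))))))"
    by (simp add: AA[of 0 1, symmetric])
  also have "\<dots> = A 0 (A 0 (A 2 (p 1 (s 4 (p 3 (p 2 (p 4 (d 0 (d 0 (d 1 w))))))))))"
    by (simp add: ds[of 0] dp[of 0])
  also have "\<dots> = A 0 (A 0 (s 3 (A 2 (p 1 (p 3 (p 2 (p 4 (d 0 (d 0 (d 1 w))))))))))"
    using As[of 2 3] by (simp add: ps[of 1 4])
  also have "d 0 (d 0 (d 1 w)) = d 1 (d 0 (d 1 w))"
    using coassoc[of 0] by simp
  finally have R: "s 1 (s 0 (s 1 w)) = A 0 (A 0 (s 3 (A 2 (p 1 (p 3 (p 2 (p 4 (d 1 (d 0 (d 1 w))))))))))" .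
  have "p 2 (s 3 (s 2 (p 1 (d 0 (d 1 w))))) = s 3 (s 2 (p 3 (p 1 (d 0 (d 1 w)))))"
    by (rule p_s_s_2)
  also have "\<dots> = s 3 (A 2 (p 3 (d 2 (p 3 (p 1 (d 0 (d 1 w)))))))"
    by (simp add: s_def[of 2])
  also have "\<dots> = s 3 (A 2 (p 3 (p 4 (d 2 (p 1 (d 0 (d 1 w)))))))"
    by (simp add: dp[of 2 3])
  also have "d 2 (p 1 (d 0 (d 1 w))) = p 1 (p 2 (d 1 (d 0 (d 1 w))))"
    using dp_right[of 1] by simp
  also have "p 3 (p 4 (p 1 (p 2 (d 1 (d 0 (d 1 w)))))) = p 1 (p 3 (p 2 (p 4 (d 1 (d 0 (d 1 w))))))"
    by (simp add: pp[of 1] pp[of 2 4])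
  finally show ?thesis using L R by simp
qed

end

end

section \<open>Operations on words\<close>

text \<open>A word \<open>x1 \<otimes> (x2 \<otimes> \<dots> (xn \<otimes> r))\<close> is bracketed to the right and carries an arbitrary tail \<open>r\<close>, so
  that no associators occur: \<open>pos k f\<close> applies \<open>f\<close> to what follows the first \<open>k\<close> letters.\<close>

context tensor_universal
begin

primrec pos :: "nat \<Rightarrow> ('v \<Rightarrow> 'v) \<Rightarrow> 'v \<Rightarrow> 'v" where
  "pos 0 f = f"
| "pos (Suc k) f = id \<otimes>\<^sub>m pos k f"

lemma lin_pos [lin_intros]: "lin f \<Longrightarrow> lin (pos k f)"
  by (induction k) (auto intro: lin_intros)

lemmas lin_pos_apply [lin_intros] = lin_compose[OF lin_pos]

lemma pos_pos: "pos k (pos l f) = pos (k + l) f"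
  by (induction k) auto

lemma pos_comp: "lin f \<Longrightarrow> lin g \<Longrightarrow> pos k (f \<circ> g) = pos k f \<circ> pos k g"
proof (induction k)
  case (Suc k)
  have "(id \<otimes>\<^sub>m (pos k f \<circ> pos k g)) w = (id \<otimes>\<^sub>m pos k f) ((id \<otimes>\<^sub>m pos k g) w)" for w
    using Suc.prems by (subst ten_comp) (auto intro: lin_intros simp: comp_def id_def)
  moreover have "pos k (f \<circ> g) = pos k f \<circ> pos k g" using Suc by blast
  ultimately show ?case by (metis (no_types) ext pos.simps(2) o_apply)
qed simp

lemma pos_2_tensor: "lin f \<Longrightarrow> pos 2 f (x \<otimes> (y \<otimes> r)) = x \<otimes> (y \<otimes> f r)"
  by (simp add: numeral_2_eq_2 ten_tensor lin_intros)

lemma pos_2_assoc: "lin f \<Longrightarrow> pos 2 f (\<alpha> (u \<otimes> r)) = \<alpha> (u \<otimes> f r)"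
  by (rule tensor_ext[where z=u]) (auto intro!: lin_intros simp: pos_2_tensor)

text \<open>Naturality in the tail expresses that \<open>F\<close> turns the first \<open>a\<close>
  letters into \<open>b\<close> letters, without a decomposition of the tail.\<close>

definition natural_op :: "nat \<Rightarrow> nat \<Rightarrow> ('v \<Rightarrow> 'v) \<Rightarrow> bool" where
  "natural_op a b F \<longleftrightarrow> lin F \<and> (\<forall>K. lin K \<longrightarrow> F \<circ> pos a K = pos b K \<circ> F)"

text \<open>The common source of all interchange laws: an operation behind the letters that
  \<open>F\<close> consumes is a map of its tail.\<close>

lemma pos_comm:
  assumes "natural_op a b F" "lin K"
  shows "pos k F (pos (k + (a + m)) K w) = pos (k + (b + m)) K (pos k F w)"
proof -
  have F: "lin F" and "F \<circ> pos a (pos m K) = pos b (pos m K) \<circ> F"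
    using assms by (auto simp: natural_op_def lin_pos)
  then have "pos k (F \<circ> pos a (pos m K)) w = pos k (pos b (pos m K) \<circ> F) w" by simp
  then show ?thesis by (simp add: pos_comp pos_pos F assms(2) lin_pos)
qed

lemma pos_comm_le:
  assumes "natural_op a b F" "lin K" "k + a \<le> l" "l' = l - a + b"
  shows "pos k F (pos l K w) = pos l' K (pos k F w)"
  using pos_comm[OF assms(1,2), of k "l - (k + a)" w] assms(3,4) by (simp add: algebra_simps)

text \<open>The projection \<open>pr S\<close> makes the naturality conditions hold on all of the underlying vector space, and
  does not change the operations on words with letters in \<open>S\<close>.\<close>

definition merge :: "'v set \<Rightarrow> ('v \<Rightarrow> 'v) \<Rightarrow> 'v \<Rightarrow> 'v" where
  "merge S f w = ((\<lambda>z. f ((pr S \<otimes>\<^sub>m pr S) z)) \<otimes>\<^sub>m id) (\<alpha>' w)"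

definition cross :: "'v set \<Rightarrow> ('v \<Rightarrow> 'v) \<Rightarrow> 'v \<Rightarrow> 'v" where
  "cross S f w = \<alpha> (((\<lambda>z. f ((pr S \<otimes>\<^sub>m pr S) z)) \<otimes>\<^sub>m id) (\<alpha>' w))"

definition split :: "'v set \<Rightarrow> ('v \<Rightarrow> 'v) \<Rightarrow> 'v \<Rightarrow> 'v" where
  "split S f w = \<alpha> (((\<lambda>z. f (pr S z)) \<otimes>\<^sub>m id) w)"

text \<open>These pass from the left-bracketed tensors of the definitions to words, by appending a
  tail \<open>r\<close> and rebracketing.\<close>

definition word2 :: "'v \<Rightarrow> 'v \<Rightarrow> 'v" where "word2 z r = \<alpha> (z \<otimes> r)"
definition word3 :: "'v \<Rightarrow> 'v \<Rightarrow> 'v" where "word3 w r = \<alpha> (\<alpha> (w \<otimes> r))"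
definition word4 :: "'v \<Rightarrow> 'v \<Rightarrow> 'v" where "word4 q r = \<alpha> ((id \<otimes>\<^sub>m \<alpha>) (\<alpha> (q \<otimes> r)))"

lemma word_tensor [simp]:
  "word2 (x \<otimes> y) r = x \<otimes> (y \<otimes> r)"
  "word3 ((x \<otimes> y) \<otimes> z) r = x \<otimes> (y \<otimes> (z \<otimes> r))"
  "word4 (u \<otimes> v) r = \<alpha> (u \<otimes> \<alpha> (v \<otimes> r))"
  by (simp_all add: word2_def word3_def word4_def ten_tensor lin_intros)

lemma lin_word [lin_intros]:
  "lin f \<Longrightarrow> lin (\<lambda>x. word2 (f x) r)" "lin f \<Longrightarrow> lin (\<lambda>x. word3 (f x) r)" "lin f \<Longrightarrow> lin (\<lambda>x. word4 (f x) r)"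
  by (simp_all add: word2_def word3_def word4_def lin_intros)

text \<open>Reads identities of words back as identities of tensors: associators are bijective and
  tensoring with \<open>unity V\<close> is injective.\<close>

lemma word_inject:
  "word2 z (unity V) = word2 z' (unity V) \<longleftrightarrow> z = z'"
  "word3 w (unity V) = word3 w' (unity V) \<longleftrightarrow> w = w'"
  "word4 q (unity V) = word4 q' (unity V) \<longleftrightarrow> q = q'"
proof -
  have a: "\<alpha> x = \<alpha> y \<longleftrightarrow> x = y" for x y by (metis assoc_inverse(1))
  have "(id \<otimes>\<^sub>m \<alpha>') ((id \<otimes>\<^sub>m \<alpha>) x) = x" for x
    by (subst ten_comp) (auto intro: lin_intros simp: id_def)
  then have b: "(id \<otimes>\<^sub>m \<alpha>) x = (id \<otimes>\<^sub>m \<alpha>) y \<longleftrightarrow> x = y" for x y by metis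
  show "word2 z (unity V) = word2 z' (unity V) \<longleftrightarrow> z = z'"
    "word3 w (unity V) = word3 w' (unity V) \<longleftrightarrow> w = w'"
    "word4 q (unity V) = word4 q' (unity V) \<longleftrightarrow> q = q'"
    by (simp_all add: word2_def word3_def word4_def a b tensor_unity_inject)
qed

end

section \<open>Operations on words with letters in a subspace\<close>

locale subspace_words = tensor_universal V
  for V :: "('k::field, 'v::ab_group_add) category_data" (structure) +
  fixes S :: "'v set"
  assumes S: "subspace S"
begin

abbreviation P where "P \<equiv> pr S"

lemma P_mem [simp]: "P x \<in> S" and P_id [simp]: "x \<in> S \<Longrightarrow> P x = x"
  by (simp_all add: pr_in[OF S] pr_eq[OF S])

lemma lin_P [lin_intros]: "lin P" by (rule lin_pr[OF S])
lemma PP_id: "z \<in> S \<otimes>\<^sub>s S \<Longrightarrow> (P \<otimes>\<^sub>m P) z = z"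
  by (rule ten_eq[of z S S]) (simp_all add: ten_tensor lin_intros)

context
  fixes f assumes f: "lin f"
begin

lemmas lin_f_PP = lin_compose[OF f lin_ten[OF lin_P lin_P]] lin_compose[OF f lin_P]

lemma lin_merge [lin_intros]: "lin (merge S f)"
  and lin_cross [lin_intros]: "lin (cross S f)"
  and lin_split [lin_intros]: "lin (split S f)"
  by (simp_all add: merge_def[abs_def] cross_def[abs_def] split_def[abs_def] lin_intros lin_f_PP)

lemmas lin_merge_apply [lin_intros] = lin_compose[OF lin_merge]
lemmas lin_cross_apply [lin_intros] = lin_compose[OF lin_cross]
lemmas lin_split_apply [lin_intros] = lin_compose[OF lin_split]

lemma merge_tensor: "merge S f (x \<otimes> (y \<otimes> r)) = f (P x \<otimes> P y) \<otimes> r"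
  and cross_tensor: "cross S f (x \<otimes> (y \<otimes> r)) = \<alpha> (f (P x \<otimes> P y) \<otimes> r)"
  and split_tensor: "split S f (x \<otimes> r) = \<alpha> (f (P x) \<otimes> r)"
  by (simp_all add: merge_def cross_def split_def ten_tensor lin_intros lin_f_PP)

lemma natural_merge: "natural_op 2 1 (merge S f)"
  and natural_cross: "natural_op 2 2 (cross S f)"
  and natural_split: "natural_op 1 2 (split S f)"
proof -
  have "merge S f (pos 2 K w) = pos 1 K (merge S f w)"
    "cross S f (pos 2 K w) = pos 2 K (cross S f w)" if "lin K" for K w
    by (rule tensor_ext3'[where w=w]; simp add: that pos_2_tensor merge_tensor cross_tensor pos_2_assoc ten_tensor
        lin_intros lin_compose[OF lin_merge] lin_compose[OF lin_cross])+
  moreover have "split S f (pos 1 K w) = pos 2 K (split S f w)" if "lin K" for K w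
    by (rule tensor_ext[where z=w]; simp add: that pos_2_assoc ten_tensor split_tensor lin_intros
        lin_compose[OF lin_split])
  ultimately show "natural_op 2 1 (merge S f)" "natural_op 2 2 (cross S f)" "natural_op 1 2 (split S f)"
    by (simp_all add: natural_op_def lin_intros fun_eq_iff del: pos.simps One_nat_def)
qed

text \<open>This and the following lemmas are the dictionary between the operations on words and the
  maps with associators in the definitions.\<close>

lemma merge_word2: "z \<in> S \<otimes>\<^sub>s S \<Longrightarrow> merge S f (word2 z r) = f z \<otimes> r"
  and cross_word2: "z \<in> S \<otimes>\<^sub>s S \<Longrightarrow> cross S f (word2 z r) = word2 (f z) r"
  by (simp_all add: merge_def cross_def word2_def ten_tensor lin_intros lin_f_PP PP_id)

lemma split_word: "x \<in> S \<Longrightarrow> split S f (x \<otimes> r) = word2 (f x) r"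
  by (simp add: split_tensor word2_def)

lemma
  assumes "w \<in> (S \<otimes>\<^sub>s S) \<otimes>\<^sub>s S"
  shows merge_word3: "merge S f (word3 w r) = word2 ((f \<otimes>\<^sub>m id) w) r"
    and pos_merge_word3: "pos 1 (merge S f) (word3 w r) = word2 ((id \<otimes>\<^sub>m f) (\<alpha> w)) r"
    and cross_word3: "cross S f (word3 w r) = word3 ((f \<otimes>\<^sub>m id) w) r"
    and pos_cross_word3: "pos 1 (cross S f) (word3 w r) = word3 (\<alpha>' ((id \<otimes>\<^sub>m f) (\<alpha> w))) r"
proof -
  have a: "\<alpha> (u \<otimes> (z \<otimes> r)) = word3 (u \<otimes> z) r" for u z r
    by (simp add: word3_def)
  have b: "x \<otimes> \<alpha> (u \<otimes> r) = word3 (\<alpha>' (x \<otimes> u)) r" for x u r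
    by (rule tensor_ext[where z=u]) (auto intro!: lin_intros)
  show "merge S f (word3 w r) = word2 ((f \<otimes>\<^sub>m id) w) r"
    "pos 1 (merge S f) (word3 w r) = word2 ((id \<otimes>\<^sub>m f) (\<alpha> w)) r"
    "cross S f (word3 w r) = word3 ((f \<otimes>\<^sub>m id) w) r"
    "pos 1 (cross S f) (word3 w r) = word3 (\<alpha>' ((id \<otimes>\<^sub>m f) (\<alpha> w))) r"
    by (rule ten_eq3[OF assms]; simp add: f merge_tensor cross_tensor ten_tensor a b
        lin_intros lin_compose[OF lin_merge] lin_compose[OF lin_cross])+
qed

lemma
  assumes "z \<in> S \<otimes>\<^sub>s S"
  shows split_word2: "split S f (word2 z r) = word3 ((f \<otimes>\<^sub>m id) z) r"
    and pos_split_word2: "pos 1 (split S f) (word2 z r) = word3 (\<alpha>' ((id \<otimes>\<^sub>m f) z)) r"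
    and split_split_word2: "split S f (pos 1 (split S f) (word2 z r)) = word4 ((f \<otimes>\<^sub>m f) z) r"
proof -
  have a: "\<alpha> (u \<otimes> (z \<otimes> r)) = word3 (u \<otimes> z) r" for u z r
    by (simp add: word3_def)
  have b: "x \<otimes> \<alpha> (u \<otimes> r) = word3 (\<alpha>' (x \<otimes> u)) r" for x u r
    by (rule tensor_ext[where z=u]; simp add: lin_intros)
  show "split S f (word2 z r) = word3 ((f \<otimes>\<^sub>m id) z) r"
    "pos 1 (split S f) (word2 z r) = word3 (\<alpha>' ((id \<otimes>\<^sub>m f) z)) r"
    by (rule ten_eq[OF assms]; simp add: f split_tensor ten_tensor a b lin_intros)+
  show "split S f (pos 1 (split S f) (word2 z r)) = word4 ((f \<otimes>\<^sub>m f) z) r"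
    by (rule ten_eq[OF assms]; simp add: f split_tensor ten_tensor lin_intros)
qed

lemma
  assumes "q \<in> (S \<otimes>\<^sub>s S) \<otimes>\<^sub>s (S \<otimes>\<^sub>s S)"
  shows merge_merge_word4: "merge S f (pos 2 (merge S f) (word4 q r)) = word2 ((f \<otimes>\<^sub>m f) q) r"
    and cross_cross_word4: "cross S f (pos 2 (cross S f) (word4 q r)) = word4 ((f \<otimes>\<^sub>m f) q) r"
    and pos_cross_word4: "pos 1 (cross S f) (word4 q r) = word4 (mid f q) r"
proof -
  have a: "x \<otimes> \<alpha> (u \<otimes> (v \<otimes> r)) = word4 (\<alpha>' (x \<otimes> \<alpha> (u \<otimes> v))) r" for x u v r
    by (rule tensor_ext[where z=u]; simp add: lin_intros)
  show "merge S f (pos 2 (merge S f) (word4 q r)) = word2 ((f \<otimes>\<^sub>m f) q) r"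
    "cross S f (pos 2 (cross S f) (word4 q r)) = word4 ((f \<otimes>\<^sub>m f) q) r"
    by (rule ten_eq4[OF assms]; simp add: f merge_tensor cross_tensor ten_tensor pos_2_tensor pos_2_assoc lin_intros)+
  show "pos 1 (cross S f) (word4 q r) = word4 (mid f q) r"
    by (rule ten_eq4[OF assms]; simp add: f cross_tensor ten_tensor lin_intros mid_tensor a)
qed

end

text \<open>The axioms hold for letters in \<open>S\<close>, while the strand laws must hold for all
  vectors. An operation does not notice when a letter it consumes is first projected to
  \<open>S\<close>; inserting \<open>Q\<close> at these letters therefore reduces a law to words in
  \<open>S\<close>, which is the content of \<open>word_ext2\<close> and its variants.\<close>

definition Q :: "'v \<Rightarrow> 'v" where "Q = P \<otimes>\<^sub>m id"

lemma lin_Q [lin_intros]: "lin Q" by (simp add: Q_def lin_intros)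
lemma Q_tensor [simp]: "Q (x \<otimes> r) = P x \<otimes> r" by (simp add: Q_def ten_tensor lin_intros)
lemma P_P [simp]: "P (P x) = P x" by simp
lemmas lin_Q_apply [lin_intros] = lin_compose[OF lin_Q]

lemma natural_Q: "natural_op 1 1 Q"
proof -
  have "Q (pos 1 K w) = pos 1 K (Q w)" if "lin K" for K w
    by (rule tensor_ext[where z=w]; simp add: that ten_tensor lin_intros)
  then show ?thesis by (simp add: natural_op_def lin_intros fun_eq_iff del: pos.simps One_nat_def)
qed

text \<open>Because tails are free, an identity between operations also holds behind
  \<open>k\<close> further letters. Composites are encoded as lists so that one lemma covers every
  identity.\<close>

lemma pos_shift:
  assumes "\<And>w. foldr (\<lambda>(i, F). pos i F) xs w = foldr (\<lambda>(i, F). pos i F) ys w"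
    and "\<forall>(i, F) \<in> set xs \<union> set ys. lin F"
  shows "foldr (\<lambda>(i, F). pos (k + i) F) xs w = foldr (\<lambda>(i, F). pos (k + i) F) ys w"
proof -
  have *: "lin (foldr (\<lambda>(i, F). pos i F) xs) \<and>
    pos k (foldr (\<lambda>(i, F). pos i F) xs) w = foldr (\<lambda>(i, F). pos (k + i) F) xs w"
    if "\<forall>(i, F) \<in> set xs. lin F" for xs :: "(nat \<times> ('v \<Rightarrow> 'v)) list" and w
    using that
  proof (induction xs arbitrary: w)
    case Nil
    have "id \<otimes>\<^sub>m id = (id :: 'v \<Rightarrow> 'v)" by (rule ext) simp
    then have "pos k id = id"
      by (induction k) simp_all
    then show ?case by (simp add: lin_intros id_def)
  next
    case (Cons a xs)
    obtain i F where a: "a = (i, F)" by fastforce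
    let ?G = "foldr (\<lambda>(i, F). pos i F) xs"
    have "lin F" "lin ?G" "pos k ?G w = foldr (\<lambda>(i, F). pos (k + i) F) xs w" for w
      using Cons by (auto simp: a)
    then show ?case
      using fun_cong[OF pos_comp[of "pos i F" ?G k], of w] by (simp add: a lin_intros pos_pos comp_def)
  qed
  have "foldr (\<lambda>(i, F). pos i F) xs = foldr (\<lambda>(i, F). pos i F) ys"
    using assms(1) by blast
  then show ?thesis using *[of xs w] *[of ys w] assms(2) by auto
qed

lemma word_ext2:
  assumes "lin F" "lin G" "\<And>w. F (Q (pos 1 Q w)) = F w" "\<And>w. G (Q (pos 1 Q w)) = G w"
    "\<And>z r. z \<in> S \<otimes>\<^sub>s S \<Longrightarrow> F (word2 z r) = G (word2 z r)"
  shows "F w = G w"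
proof (rule tensor_ext3'[OF assms(1,2)])
  fix x y r
  have "Q (pos 1 Q (x \<otimes> (y \<otimes> r))) = word2 (P x \<otimes> P y) r" by (simp add: ten_tensor lin_intros)
  then show "F (x \<otimes> (y \<otimes> r)) = G (x \<otimes> (y \<otimes> r))"
    using assms(3,4)[of "x \<otimes> (y \<otimes> r)"] assms(5)[of "P x \<otimes> P y" r] by (simp add: ten_space_mem)
qed

lemma word_ext1:
  assumes "lin F" "lin G" "\<And>w. F (Q w) = F w" "\<And>w. G (Q w) = G w"
    "\<And>x r. x \<in> S \<Longrightarrow> F (x \<otimes> r) = G (x \<otimes> r)"
  shows "F w = G w"
  by (rule tensor_ext[OF assms(1,2)]) (metis assms(3-5) Q_tensor P_mem)

lemma word_ext3:
  assumes "lin F" "lin G" "\<And>w. F (Q (pos 1 Q (pos 2 Q w))) = F w" "\<And>w. G (Q (pos 1 Q (pos 2 Q w))) = G w"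
    "\<And>z r. z \<in> (S \<otimes>\<^sub>s S) \<otimes>\<^sub>s S \<Longrightarrow> F (word3 z r) = G (word3 z r)"
  shows "F w = G w"
proof (rule tensor_ext3'[OF assms(1,2)])
  fix x y u
  show "F (x \<otimes> (y \<otimes> u)) = G (x \<otimes> (y \<otimes> u))"
  proof (rule tensor_ext[where z=u])
    fix z r
    have "Q (pos 1 Q (pos 2 Q (x \<otimes> (y \<otimes> (z \<otimes> r))))) = word3 ((P x \<otimes> P y) \<otimes> P z) r"
      by (simp add: ten_tensor lin_intros pos_2_tensor)
    then show "F (x \<otimes> (y \<otimes> (z \<otimes> r))) = G (x \<otimes> (y \<otimes> (z \<otimes> r)))"
      using assms(3,4)[of "x \<otimes> (y \<otimes> (z \<otimes> r))"] assms(5)[of "(P x \<otimes> P y) \<otimes> P z" r]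
      by (simp add: ten_space_mem)
  qed (intro lin_compose[OF assms(1)] lin_compose[OF assms(2)] lin_right lin_id lin_tensor_right)+
qed

context
  fixes f assumes f: "lin f"
begin

lemma absorb:
  "merge S f (Q w) = merge S f w" "merge S f (pos 1 Q w) = merge S f w"
  "cross S f (Q w) = cross S f w" "cross S f (pos 1 Q w) = cross S f w"
  "split S f (Q w) = split S f w"
proof -
  show "merge S f (Q w) = merge S f w" "merge S f (pos 1 Q w) = merge S f w"
    "cross S f (Q w) = cross S f w" "cross S f (pos 1 Q w) = cross S f w"
    by (rule tensor_ext3'[where w=w]; simp add: f merge_tensor cross_tensor lin_intros ten_tensor)+
  show "split S f (Q w) = split S f w"
    by (rule tensor_ext[where z=w]; simp add: f split_tensor lin_intros)
qed

lemma absorb_1: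
  "pos 1 (merge S f) (pos 1 Q w) = pos 1 (merge S f) w" "pos 1 (merge S f) (pos 2 Q w) = pos 1 (merge S f) w"
  "pos 1 (cross S f) (pos 1 Q w) = pos 1 (cross S f) w" "pos 1 (cross S f) (pos 2 Q w) = pos 1 (cross S f) w"
  "pos 1 (split S f) (pos 1 Q w) = pos 1 (split S f) w"
  using pos_shift[where k=1 and xs="[(0, merge S f), (0, Q)]" and ys="[(0, merge S f)]"]
    pos_shift[where k=1 and xs="[(0, merge S f), (1, Q)]" and ys="[(0, merge S f)]"]
    pos_shift[where k=1 and xs="[(0, cross S f), (0, Q)]" and ys="[(0, cross S f)]"]
    pos_shift[where k=1 and xs="[(0, cross S f), (1, Q)]" and ys="[(0, cross S f)]"]
    pos_shift[where k=1 and xs="[(0, split S f), (0, Q)]" and ys="[(0, split S f)]"]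
  by (simp_all add: absorb lin_intros f numeral_2_eq_2 del: pos.simps(2) One_nat_def)

text \<open>A projection passes operations that do not touch its letter until one absorbs it. As
  rewrite rules these discharge the invariance hypotheses of the \<open>word_ext\<close>
  lemmas.\<close>

lemma Q_out:
  "pos 1 (merge S f) (Q w) = Q (pos 1 (merge S f) w)" "pos 2 (merge S f) (Q w) = Q (pos 2 (merge S f) w)"
  "pos 1 (cross S f) (Q w) = Q (pos 1 (cross S f) w)" "pos 1 (split S f) (Q w) = Q (pos 1 (split S f) w)"
  "merge S f (pos 2 Q w) = pos 1 Q (merge S f w)" "merge S f (pos 3 Q w) = pos 2 Q (merge S f w)"
  "cross S f (pos 2 Q w) = pos 2 Q (cross S f w)" "pos 1 (cross S f) (pos 3 Q w) = pos 3 Q (pos 1 (cross S f) w)"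
  "split S f (pos 1 Q w) = pos 2 Q (split S f w)" "split S f (pos 2 Q w) = pos 3 Q (split S f w)"
  "pos 1 (split S f) (pos 2 Q w) = pos 3 Q (pos 1 (split S f) w)"
  using pos_comm_le[OF natural_Q lin_merge[OF f], of 0 1 1 w] pos_comm_le[OF natural_Q lin_merge[OF f], of 0 2 2 w]
    pos_comm_le[OF natural_Q lin_cross[OF f], of 0 1 1 w] pos_comm_le[OF natural_Q lin_split[OF f], of 0 1 1 w]
    pos_comm_le[OF natural_merge[OF f] lin_Q, of 0 2 1 w] pos_comm_le[OF natural_merge[OF f] lin_Q, of 0 3 2 w]
    pos_comm_le[OF natural_cross[OF f] lin_Q, of 0 2 2 w] pos_comm_le[OF natural_cross[OF f] lin_Q, of 1 3 3 w]
    pos_comm_le[OF natural_split[OF f] lin_Q, of 0 1 2 w] pos_comm_le[OF natural_split[OF f] lin_Q, of 0 2 3 w]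
    pos_comm_le[OF natural_split[OF f] lin_Q, of 1 2 3 w]
  by (simp_all del: pos.simps(2) One_nat_def)

end

end

text \<open>\<open>a_left\<close> and \<open>a_right\<close> are naturality of the braiding along
  the product, with the braiding past a tensor square already expanded by a hexagon, so that a
  single map \<open>c\<close> occurs.\<close>

locale product_words = subspace_words V S
  for V :: "('k::field, 'v::ab_group_add) category_data" (structure) and S +
  fixes a c :: "'v \<Rightarrow> 'v"
  assumes a: "lin a" and c: "lin c"
    and a_mem: "z \<in> S \<otimes>\<^sub>s S \<Longrightarrow> a z \<in> S"
    and c_mem: "z \<in> S \<otimes>\<^sub>s S \<Longrightarrow> c z \<in> S \<otimes>\<^sub>s S"
    and a_left: "w \<in> (S \<otimes>\<^sub>s S) \<otimes>\<^sub>s S \<Longrightarrow>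
      c ((a \<otimes>\<^sub>m id) w) = (id \<otimes>\<^sub>m a) (\<alpha> ((c \<otimes>\<^sub>m id) (\<alpha>' ((id \<otimes>\<^sub>m c) (\<alpha> w)))))"
    and a_right: "w \<in> (S \<otimes>\<^sub>s S) \<otimes>\<^sub>s S \<Longrightarrow>
      c ((id \<otimes>\<^sub>m a) (\<alpha> w)) = (a \<otimes>\<^sub>m id) (\<alpha>' ((id \<otimes>\<^sub>m c) (\<alpha> ((c \<otimes>\<^sub>m id) w))))"
begin

lemma mem_left: "w \<in> (S \<otimes>\<^sub>s S) \<otimes>\<^sub>s S \<Longrightarrow> (c \<otimes>\<^sub>m id) w \<in> (S \<otimes>\<^sub>s S) \<otimes>\<^sub>s S"
  and mem_right: "w \<in> (S \<otimes>\<^sub>s S) \<otimes>\<^sub>s S \<Longrightarrow> \<alpha>' ((id \<otimes>\<^sub>m c) (\<alpha> w)) \<in> (S \<otimes>\<^sub>s S) \<otimes>\<^sub>s S"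
  and mem_merge_left: "w \<in> (S \<otimes>\<^sub>s S) \<otimes>\<^sub>s S \<Longrightarrow> (a \<otimes>\<^sub>m id) w \<in> S \<otimes>\<^sub>s S"
  and mem_merge_right: "w \<in> (S \<otimes>\<^sub>s S) \<otimes>\<^sub>s S \<Longrightarrow> (id \<otimes>\<^sub>m a) (\<alpha> w) \<in> S \<otimes>\<^sub>s S"
  by (auto intro!: ten_map[OF _ c lin_id(1)] ten_map[OF _ lin_id(1) c] ten_map[OF _ a lin_id(1)]
      ten_map[OF _ lin_id(1) a] assoc_mem assoc_inv_mem simp: a_mem c_mem)

abbreviation A where "A k \<equiv> pos k (merge S a)"
abbreviation p where "p k \<equiv> pos k (cross S c)"

lemmas lin_ac [lin_intros] = lin_merge[OF a] lin_cross[OF c]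
lemmas lin_ac_apply [lin_intros] = lin_merge_apply[OF a] lin_cross_apply[OF c]
lemmas words_ac = merge_word2[OF a] merge_word3[OF a] pos_merge_word3[OF a]
  cross_word2[OF c] cross_word3[OF c] pos_cross_word3[OF c] mem_left mem_right mem_merge_left mem_merge_right
lemmas Q_ac = absorb[OF a] absorb[OF c] absorb_1[OF a] absorb_1[OF c] Q_out[OF a] Q_out[OF c]

context notes pos.simps(2) [simp del] One_nat_def [simp del]
begin

lemma merge_strands: "merge_strands A p"
proof
  show "A k (A (l + 1) w) = A l (A k w)" "A k (p (l + 1) w) = p l (A k w)" if "k + 1 \<le> l" for k l w
    using that by (auto intro!: pos_comm_le[OF natural_merge[OF a]] lin_intros)
  show "p k (A l w) = A l (p k w)" "p k (p l w) = p l (p k w)" if "k + 2 \<le> l" for k l w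
    using that by (auto intro!: pos_comm_le[OF natural_cross[OF c]] lin_intros)
  have 1: "p 0 (A 0 w) = A 1 (p 0 (p 1 w))" for w
    by (rule word_ext3[where w=w]; simp add: lin_intros Q_ac words_ac a_left)
  have 2: "p 0 (A 1 w) = A 0 (p 1 (p 0 w))" for w
    by (rule word_ext3[where w=w]; simp add: lin_intros Q_ac words_ac a_right)
  show "p k (A k w) = A (k + 1) (p k (p (k + 1) w))" for k w
    using pos_shift[where k=k and xs="[(0, cross S c), (0, merge S a)]" and w=w
        and ys="[(1, merge S a), (0, cross S c), (1, cross S c)]"] 1 by (simp add: lin_intros)
  show "p k (A (k + 1) w) = A k (p (k + 1) (p k w))" for k w
    using pos_shift[where k=k and xs="[(0, cross S c), (1, merge S a)]" and w=w
        and ys="[(0, merge S a), (1, cross S c), (0, cross S c)]"] 2 by (simp add: lin_intros)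
qed

end

end

sublocale product_words \<subseteq> merge_strands A p
  by (rule merge_strands)

text \<open>Only naturality along \<open>e\<close> is assumed. Associativity, coassociativity and
  multiplicativity are hypotheses of individual lemmas, because the locale is used both for the
  action on \<open>G\<close> and for the product of \<open>U\<close>.\<close>

locale bialgebra_words = product_words V S a c
  for V :: "('k::field, 'v::ab_group_add) category_data" (structure) and S a c +
  fixes e :: "'v \<Rightarrow> 'v"
  assumes e: "lin e"
    and e_mem: "x \<in> S \<Longrightarrow> e x \<in> S \<otimes>\<^sub>s S"
    and e_left: "z \<in> S \<otimes>\<^sub>s S \<Longrightarrow>
      (e \<otimes>\<^sub>m id) (c z) = \<alpha>' ((id \<otimes>\<^sub>m c) (\<alpha> ((c \<otimes>\<^sub>m id) (\<alpha>' ((id \<otimes>\<^sub>m e) z)))))"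
    and e_right: "z \<in> S \<otimes>\<^sub>s S \<Longrightarrow>
      (id \<otimes>\<^sub>m e) (c z) = \<alpha> ((c \<otimes>\<^sub>m id) (\<alpha>' ((id \<otimes>\<^sub>m c) (\<alpha> ((e \<otimes>\<^sub>m id) z)))))"
begin

abbreviation d where "d k \<equiv> pos k (split S e)"

lemma mem_split_left: "z \<in> S \<otimes>\<^sub>s S \<Longrightarrow> (e \<otimes>\<^sub>m id) z \<in> (S \<otimes>\<^sub>s S) \<otimes>\<^sub>s S"
  and mem_split_right: "z \<in> S \<otimes>\<^sub>s S \<Longrightarrow> \<alpha>' ((id \<otimes>\<^sub>m e) z) \<in> (S \<otimes>\<^sub>s S) \<otimes>\<^sub>s S"
  and mem_split_split: "z \<in> S \<otimes>\<^sub>s S \<Longrightarrow> (e \<otimes>\<^sub>m e) z \<in> (S \<otimes>\<^sub>s S) \<otimes>\<^sub>s (S \<otimes>\<^sub>s S)"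
  by (auto intro!: ten_map[OF _ e lin_id(1)] ten_map[OF _ lin_id(1) e] ten_map[OF _ e e]
      assoc_inv_mem simp: e_mem)

lemma mem_mid: "q \<in> (S \<otimes>\<^sub>s S) \<otimes>\<^sub>s (S \<otimes>\<^sub>s S) \<Longrightarrow> mid c q \<in> (S \<otimes>\<^sub>s S) \<otimes>\<^sub>s (S \<otimes>\<^sub>s S)"
  by (rule mid_mem[OF _ c]) (auto simp: c_mem)

lemmas lin_e [lin_intros] = lin_split[OF e]
lemmas lin_e_apply [lin_intros] = lin_split_apply[OF e]
lemmas words_e = split_word[OF e] split_word2[OF e] pos_split_word2[OF e] mem_split_left mem_split_right
lemmas words_4 = split_word[OF e] split_split_word2[OF e] mem_split_split mem_mid pos_cross_word4[OF c]
  merge_merge_word4[OF a]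
lemmas Q_e = absorb[OF e] absorb_1[OF e] Q_out[OF e]

context notes pos.simps(2) [simp del] One_nat_def [simp del]
begin

lemma strands: "strands A p d"
proof
  show "A k (d (l + 1) w) = d l (A k w)" if "k + 1 \<le> l" for k l w
    using that by (auto intro!: pos_comm_le[OF natural_merge[OF a]] lin_intros)
  show "p k (d l w) = d l (p k w)" if "k + 2 \<le> l" for k l w
    using that by (auto intro!: pos_comm_le[OF natural_cross[OF c]] lin_intros)
  show "d k (A l w) = A (l + 1) (d k w)" "d k (p l w) = p (l + 1) (d k w)"
    "d k (d l w) = d (l + 1) (d k w)" if "k + 1 \<le> l" for k l w
    using that by (auto intro!: pos_comm_le[OF natural_split[OF e]] lin_intros)
  have 1: "d 0 (p 0 w) = p 1 (p 0 (d 1 w))" for w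
    by (rule word_ext2[where w=w]; simp add: lin_intros Q_ac Q_e words_ac words_e e_left c_mem)
  have 2: "d 1 (p 0 w) = p 0 (p 1 (d 0 w))" for w
  proof (rule word_ext2[where w=w])
    fix z r assume z: "z \<in> S \<otimes>\<^sub>s S"
    have "d 1 (p 0 (word2 z r)) = word3 (\<alpha>' ((id \<otimes>\<^sub>m e) (c z))) r"
      using z by (simp add: words_ac words_e c_mem)
    also have "\<dots> = p 0 (p 1 (d 0 (word2 z r)))"
      using z by (simp add: e_right words_ac words_e)
    finally show "d 1 (p 0 (word2 z r)) = p 0 (p 1 (d 0 (word2 z r)))" .
  qed (simp_all add: lin_intros Q_ac Q_e)
  show "d k (p k w) = p (k + 1) (p k (d (k + 1) w))" for k w
    using pos_shift[where k=k and xs="[(0, split S e), (0, cross S c)]" and w=w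
        and ys="[(1, cross S c), (0, cross S c), (1, split S e)]"] 1 by (simp add: lin_intros)
  show "d (k + 1) (p k w) = p k (p (k + 1) (d k w))" for k w
    using pos_shift[where k=k and xs="[(1, split S e), (0, cross S c)]" and w=w
        and ys="[(0, cross S c), (1, cross S c), (0, split S e)]"] 2 by (simp add: lin_intros)
qed

end

end

sublocale bialgebra_words \<subseteq> strands A p d
  by (rule strands)

context bialgebra_words
begin

context notes pos.simps(2) [simp del] One_nat_def [simp del]
begin

lemma multiplicative_words:
  assumes "\<And>z. z \<in> S \<otimes>\<^sub>s S \<Longrightarrow> e (a z) = (a \<otimes>\<^sub>m a) (mid c ((e \<otimes>\<^sub>m e) z))"
  shows "d k (A k w) = A k (A (k + 2) (p (k + 1) (d k (d (k + 1) w))))"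
proof -
  have "d 0 (A 0 w) = A 0 (A 2 (p 1 (d 0 (d 1 w))))" for w
    by (rule word_ext2[where w=w])
      (simp_all add: lin_intros Q_ac Q_e words_ac words_4 a_mem assms)
  then show ?thesis
    using pos_shift[where k=k and xs="[(0, split S e), (0, merge S a)]" and w=w
        and ys="[(0, merge S a), (2, merge S a), (1, cross S c), (0, split S e), (1, split S e)]"]
    by (simp add: lin_intros)
qed

lemma coassoc_words:
  assumes "coassociative S e"
  shows "d k (d k w) = d (k + 1) (d k w)"
proof -
  have 1: "\<alpha>' ((id \<otimes>\<^sub>m e) (e x)) = (e \<otimes>\<^sub>m id) (e x)" if "x \<in> S" for x
    using assms that by (metis coassociative_def assoc_inverse(1))
  have "d 0 (d 0 w) = d 1 (d 0 w)" for w
    by (rule word_ext1[where w=w]) (simp_all add: lin_intros Q_e words_e e_mem 1)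
  then show ?thesis
    using pos_shift[where k=k and xs="[(0, split S e), (0, split S e)]" and w=w
        and ys="[(1, split S e), (0, split S e)]"]
    by (simp add: lin_intros)
qed

lemma action_strands:
  assumes co: "coassociative S e"
    and yb: "\<And>w. w \<in> (S \<otimes>\<^sub>s S) \<otimes>\<^sub>s S \<Longrightarrow> pos12 c (pos23 c (pos12 c w)) = pos23 c (pos12 c (pos23 c w))"
    and cocomm: "\<And>z. z \<in> S \<otimes>\<^sub>s S \<Longrightarrow>
      c ((a \<otimes>\<^sub>m id) (\<alpha>' ((id \<otimes>\<^sub>m c) (\<alpha> ((e \<otimes>\<^sub>m id) z))))) = (id \<otimes>\<^sub>m a) (\<alpha> ((e \<otimes>\<^sub>m id) z))"
    and mult: "\<And>z. z \<in> S \<otimes>\<^sub>s S \<Longrightarrow> e (a z) = (a \<otimes>\<^sub>m a) (mid c ((e \<otimes>\<^sub>m e) z))"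
    and twist: "\<And>w. w \<in> (S \<otimes>\<^sub>s S) \<otimes>\<^sub>s S \<Longrightarrow> a ((id \<otimes>\<^sub>m a) (\<alpha> w)) =
      a ((id \<otimes>\<^sub>m a) (\<alpha> (((\<lambda>z. (a \<otimes>\<^sub>m id) (\<alpha>' ((id \<otimes>\<^sub>m c) (\<alpha> ((e \<otimes>\<^sub>m id) z))))) \<otimes>\<^sub>m id) w)))"
  shows "action_strands A p d"
proof
  fix k w
  show "d k (d k w) = d (k + 1) (d k w)" using co by (rule coassoc_words)
  have "p 0 (p 1 (p 0 w)) = p 1 (p 0 (p 1 w))" for w
    by (rule word_ext3[where w=w])
      (use yb in \<open>simp_all add: lin_intros Q_ac words_ac pos12_def pos23_def\<close>)
  then show "p k (p (k + 1) (p k w)) = p (k + 1) (p k (p (k + 1) w))"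
    using pos_shift[where k=k and xs="[(0, cross S c), (1, cross S c), (0, cross S c)]" and w=w
        and ys="[(1, cross S c), (0, cross S c), (1, cross S c)]"]
    by (simp add: lin_intros)
  have "p 0 (A 0 (p 1 (d 0 w))) = A 1 (d 0 w)" for w
    by (rule word_ext2[where w=w])
      (use cocomm in \<open>simp_all add: lin_intros Q_ac Q_e words_ac words_e\<close>)
  then show "p k (A k (p (k + 1) (d k w))) = A (k + 1) (d k w)"
    using pos_shift[where k=k and xs="[(0, cross S c), (0, merge S a), (1, cross S c), (0, split S e)]"
        and w=w and ys="[(1, merge S a), (0, split S e)]"]
    by (simp add: lin_intros)
  show "d k (A k w) = A k (A (k + 2) (p (k + 1) (d k (d (k + 1) w))))"
    using mult by (rule multiplicative_words)
  have lin_s: "lin (\<lambda>z. (a \<otimes>\<^sub>m id) (\<alpha>' ((id \<otimes>\<^sub>m c) (\<alpha> ((e \<otimes>\<^sub>m id) z)))))"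
    by (intro lin_intros a c e)
  have s_word: "A 0 (p 1 (d 0 (word2 z r))) =
      word2 ((a \<otimes>\<^sub>m id) (\<alpha>' ((id \<otimes>\<^sub>m c) (\<alpha> ((e \<otimes>\<^sub>m id) z))))) r" if "z \<in> S \<otimes>\<^sub>s S" for z r
    using that by (simp add: words_ac words_e)
  have s_mem: "(a \<otimes>\<^sub>m id) (\<alpha>' ((id \<otimes>\<^sub>m c) (\<alpha> ((e \<otimes>\<^sub>m id) z)))) \<in> S \<otimes>\<^sub>s S" if "z \<in> S \<otimes>\<^sub>s S" for z
    using that by (simp add: words_ac words_e)
  have "A 0 (A 1 w) = A 0 (A 1 (A 0 (p 1 (d 0 w))))" for w
  proof (rule word_ext3[where w=w])
    fix w r assume w: "w \<in> (S \<otimes>\<^sub>s S) \<otimes>\<^sub>s S"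
    let ?s = "\<lambda>z. (a \<otimes>\<^sub>m id) (\<alpha>' ((id \<otimes>\<^sub>m c) (\<alpha> ((e \<otimes>\<^sub>m id) z))))"
    have "A 0 (p 1 (d 0 (word3 w r))) = word3 ((?s \<otimes>\<^sub>m id) w) r"
    proof -
      \<comment> \<open>A word of three letters is a word of two with a longer tail, so
        \<open>s_word\<close> applies to it.\<close>
      have *: "word3 (u \<otimes> z) r = word2 u (z \<otimes> r)" for u z by (simp add: word3_def word2_def)
      show ?thesis
      proof (rule ten_eq[OF w])
        show "A 0 (p 1 (d 0 (word3 (u \<otimes> z) r))) = word3 ((?s \<otimes>\<^sub>m id) (u \<otimes> z)) r"
          if "u \<in> S \<otimes>\<^sub>s S" "z \<in> S" for u z
          using s_word[OF that(1)] by (simp add: * ten_tensor[OF lin_s lin_id(1)])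
      qed (intro lin_intros a c e)+
    qed
    moreover have "(?s \<otimes>\<^sub>m id) w \<in> (S \<otimes>\<^sub>s S) \<otimes>\<^sub>s S"
      by (rule ten_map[OF w lin_s lin_id(1)]) (auto simp: s_mem)
    ultimately show "A 0 (A 1 (word3 w r)) = A 0 (A 1 (A 0 (p 1 (d 0 (word3 w r)))))"
      using w twist by (simp add: words_ac)
  qed (simp_all add: lin_intros Q_ac Q_e)
  then show "A k (A (k + 1) w) = A k (A (k + 1) (A k (p (k + 1) (d k w))))"
    using pos_shift[where k=k and xs="[(0, merge S a), (1, merge S a)]" and w=w
        and ys="[(0, merge S a), (1, merge S a), (0, merge S a), (1, cross S c), (0, split S e)]"]
    by (simp add: lin_intros)
qed

theorem action_braiding:
  fixes s
  assumes "action_strands A p d"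
    and s: "lin s" "\<And>z. z \<in> S \<otimes>\<^sub>s S \<Longrightarrow> s z = (a \<otimes>\<^sub>m id) (\<alpha>' ((id \<otimes>\<^sub>m c) (\<alpha> ((e \<otimes>\<^sub>m id) z))))"
  shows "w \<in> (S \<otimes>\<^sub>s S) \<otimes>\<^sub>s S \<Longrightarrow> pos12 s (pos23 s (pos12 s w)) = pos23 s (pos12 s (pos23 s w))"
    and "z \<in> S \<otimes>\<^sub>s S \<Longrightarrow> mid c ((e \<otimes>\<^sub>m e) (s z)) = (s \<otimes>\<^sub>m s) (mid c ((e \<otimes>\<^sub>m e) z))"
proof -
  interpret S: action_strands A p d by fact
  have s_mem: "s z \<in> S \<otimes>\<^sub>s S" if "z \<in> S \<otimes>\<^sub>s S" for z
    using that by (simp add: words_ac words_e s)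
  \<comment> \<open>\<open>s\<close> agrees with the composite on \<open>S\<close> tensor
    \<open>S\<close> only; the projections built into \<open>cross\<close> make this an identity on
    all words.\<close>
  have "cross S s w = A 0 (p 1 (d 0 w))" for w
    by (rule word_ext2[where w=w])
      (simp_all add: lin_intros Q_ac Q_e absorb[OF s(1)] s(1) words_ac words_e cross_word2[OF s(1)] s)
  then have "pos k (cross S s) w = A k (p (k + 1) (d k w))" for k w
    using pos_shift[where k=k and xs="[(0, cross S s)]" and w=w
        and ys="[(0, merge S a), (1, cross S c), (0, split S e)]"] by (simp add: lin_intros s)
  then have S_s: "S.s k w = pos k (cross S s) w" for k w by (simp add: S.s_def)
  show "pos12 s (pos23 s (pos12 s w)) = pos23 s (pos12 s (pos23 s w))" if w: "w \<in> (S \<otimes>\<^sub>s S) \<otimes>\<^sub>s S"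
  proof -
    have m: "(s \<otimes>\<^sub>m id) w \<in> (S \<otimes>\<^sub>s S) \<otimes>\<^sub>s S" "\<alpha>' ((id \<otimes>\<^sub>m s) (\<alpha> w)) \<in> (S \<otimes>\<^sub>s S) \<otimes>\<^sub>s S"
      if "w \<in> (S \<otimes>\<^sub>s S) \<otimes>\<^sub>s S" for w
      using that by (auto intro!: ten_map[OF _ s(1) lin_id(1)] ten_map[OF _ lin_id(1) s(1)] assoc_mem assoc_inv_mem simp: s_mem)
    show ?thesis
      using S.s_braid[of "word3 w (unity V)"] w
      by (simp add: S_s cross_word3[OF s(1)] pos_cross_word3[OF s(1)] m word_inject pos12_def pos23_def)
  qed
  show "mid c ((e \<otimes>\<^sub>m e) (s z)) = (s \<otimes>\<^sub>m s) (mid c ((e \<otimes>\<^sub>m e) z))" if z: "z \<in> S \<otimes>\<^sub>s S"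
    using S.s_comult[of "word2 z (unity V)"] z
    by (simp add: S_s cross_word2[OF s(1)] s_mem words_4 cross_cross_word4[OF s(1)] word_inject)
qed

end

end

context bialgebra_words
begin

context notes pos.simps(2) [simp del] One_nat_def [simp del]
begin

text \<open>\<open>coassoc_product\<close> on the word of \<open>x\<close> and \<open>y\<close>:
  peeling off \<open>x\<close> reduces its two hypotheses to coassociativity at \<open>y\<close> and
  at \<open>x\<close>.\<close>

lemma coassoc_product_words:
  assumes mult: "\<And>z. z \<in> S \<otimes>\<^sub>s S \<Longrightarrow> e (a z) = (a \<otimes>\<^sub>m a) (mid c ((e \<otimes>\<^sub>m e) z))"
    and x: "x \<in> S" "\<alpha> ((e \<otimes>\<^sub>m id) (e x)) = (id \<otimes>\<^sub>m e) (e x)"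
    and y: "y \<in> S" "\<alpha> ((e \<otimes>\<^sub>m id) (e y)) = (id \<otimes>\<^sub>m e) (e y)"
  shows "\<alpha> ((e \<otimes>\<^sub>m id) (e (a (x \<otimes> y)))) = (id \<otimes>\<^sub>m e) (e (a (x \<otimes> y)))"
proof -
  have split2: "d 0 (d 0 (z \<otimes> r)) = word3 ((e \<otimes>\<^sub>m id) (e z)) r" "d 1 (d 0 (z \<otimes> r)) = word3 (\<alpha>' ((id \<otimes>\<^sub>m e) (e z))) r"
    if "z \<in> S" for z r
    using that by (simp_all add: words_e e_mem)
  have co: "d 0 (d 0 (z \<otimes> r)) = d 1 (d 0 (z \<otimes> r))"
    if "z \<in> S" "\<alpha> ((e \<otimes>\<^sub>m id) (e z)) = (id \<otimes>\<^sub>m e) (e z)" for z r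
    unfolding split2[OF that(1)] by (simp add: that(2)[symmetric])
  have step: "pos (k + 1) F (z \<otimes> r) = z \<otimes> pos k F r" if "lin F" for F k z r
    using that unfolding Suc_eq_plus1[symmetric] pos.simps(2) by (simp add: ten_tensor lin_intros)
  let ?w = "x \<otimes> (y \<otimes> unity V)"
  have "d 0 (d 0 (A 0 ?w)) = d 1 (d 0 (A 0 ?w))"
  proof (rule coassoc_product[OF multiplicative_words[OF mult]])
    have 1: "d 1 (x \<otimes> r) = x \<otimes> d 0 r" "d 2 (x \<otimes> r) = x \<otimes> d 1 r" for r
      using step[of "split S e" 0 x r] step[of "split S e" 1 x r] by (simp_all add: lin_intros)
    show "d 1 (d 1 ?w) = d 2 (d 1 ?w)" unfolding 1 co[OF y] ..
    show "d 0 (d 0 (d 1 (d 1 ?w))) = d 1 (d 0 (d 1 (d 1 ?w)))" unfolding 1 by (rule co[OF x])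
  qed
  moreover have "A 0 ?w = a (x \<otimes> y) \<otimes> unity V"
    using words_ac(1)[OF ten_space_mem[OF x(1) y(1)]] by simp
  ultimately have "(e \<otimes>\<^sub>m id) (e (a (x \<otimes> y))) = \<alpha>' ((id \<otimes>\<^sub>m e) (e (a (x \<otimes> y))))"
    using x(1) y(1) by (simp add: split2[simplified] a_mem ten_space_mem word_inject)
  then show ?thesis by simp
qed

end

end

context product_words
begin

context notes pos.simps(2) [simp del] One_nat_def [simp del]
begin

text \<open>The elements of the tensor square occupy two letters each, so the claim is
  \<open>product_assoc\<close> on six strands.\<close>

lemma square_assoc:
  assumes assoc: "\<And>x y z. x \<in> S \<Longrightarrow> y \<in> S \<Longrightarrow> z \<in> S \<Longrightarrow> a (a (x \<otimes> y) \<otimes> z) = a (x \<otimes> a (y \<otimes> z))"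
    and xyz: "x \<in> S \<otimes>\<^sub>s S" "y \<in> S \<otimes>\<^sub>s S" "z \<in> S \<otimes>\<^sub>s S"
  defines "M \<equiv> \<lambda>w. (a \<otimes>\<^sub>m a) (mid c w)"
  shows "M (M (x \<otimes> y) \<otimes> z) = M (x \<otimes> M (y \<otimes> z))"
proof -
  have mem_mid: "mid c q \<in> (S \<otimes>\<^sub>s S) \<otimes>\<^sub>s (S \<otimes>\<^sub>s S)" if "q \<in> (S \<otimes>\<^sub>s S) \<otimes>\<^sub>s (S \<otimes>\<^sub>s S)" for q
    by (rule mid_mem[OF that c]) (auto simp: c_mem)
  have M_mem: "M q \<in> S \<otimes>\<^sub>s S" if "q \<in> (S \<otimes>\<^sub>s S) \<otimes>\<^sub>s (S \<otimes>\<^sub>s S)" for q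
    unfolding M_def by (rule ten_map[OF mem_mid[OF that] a a]) (auto simp: a_mem)
  let ?M = "\<lambda>w. A 0 (A 2 (p 1 w))"
  have M: "?M (word4 q r) = word2 (M q) r" if "q \<in> (S \<otimes>\<^sub>s S) \<otimes>\<^sub>s (S \<otimes>\<^sub>s S)" for q r
    using that by (simp add: M_def mem_mid pos_cross_word4[OF c] merge_merge_word4[OF a])
  have word: "word2 u (word2 v r) = word4 (u \<otimes> v) r" for u v r
    by (simp add: word2_def word4_def ten_tensor lin_intros)
  \<comment> \<open>The factor \<open>u\<close> takes up two letters, hence the offset 2 for
    operations on what follows it.\<close>
  have shift: "pos (2 + k) F (word2 u r) = word2 u (pos k F r)" if "lin F" for k F u r
    using pos_2_assoc[of "pos k F" u r] that by (simp add: word2_def pos_pos lin_intros)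
  have "a ((a \<otimes>\<^sub>m id) w) = a ((id \<otimes>\<^sub>m a) (\<alpha> w))" if "w \<in> (S \<otimes>\<^sub>s S) \<otimes>\<^sub>s S" for w
    by (rule ten_eq3[OF that]) (simp_all add: lin_intros lin_compose[OF a] a ten_tensor assoc)
  then have "A 0 (A 0 w) = A 0 (A 1 w)" for w
    by (intro word_ext3[where F="\<lambda>w. A 0 (A 0 w)" and w=w]) (simp_all add: lin_intros Q_ac words_ac)
  then have "A k (A k w) = A k (A (k + 1) w)" for k w
    using pos_shift[where k=k and xs="[(0, merge S a), (0, merge S a)]" and w=w
        and ys="[(0, merge S a), (1, merge S a)]"] by (simp add: lin_intros)
  then have assoc_words: "?M (?M w) = ?M (A 2 (A 4 (p 3 w)))" for w
    by (rule product_assoc)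
  have right: "A 2 (A 4 (p 3 (word2 x r))) = word2 x (?M r)" for r
    using shift[of "merge S a" 0] shift[of "merge S a" 2] shift[of "cross S c" 1] by (simp add: lin_intros a c)
  note mem = ten_space_mem[OF xyz(1,2)] ten_space_mem[OF xyz(2,3)]
  let ?w = "word2 x (word2 y (word2 z (unity V)))"
  have "?M (?M ?w) = word2 (M (M (x \<otimes> y) \<otimes> z)) (unity V)"
    unfolding word[of x y "word2 z (unity V)"] M[OF mem(1)] word[of "M (x \<otimes> y)" z] M[OF ten_space_mem[OF M_mem[OF mem(1)] xyz(3)]] ..
  moreover have "?M (A 2 (A 4 (p 3 ?w))) = word2 (M (x \<otimes> M (y \<otimes> z))) (unity V)"
    unfolding right word[of y z] M[OF mem(2)] word[of x "M (y \<otimes> z)"] M[OF ten_space_mem[OF xyz(1) M_mem[OF mem(2)]]] ..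
  ultimately have "word2 (M (M (x \<otimes> y) \<otimes> z)) (unity V) = word2 (M (x \<otimes> M (y \<otimes> z))) (unity V)"
    using assoc_words[of ?w] by simp
  then show ?thesis by (simp add: word_inject)
qed

end

end

section \<open>Objects and morphisms\<close>

context tensor_universal
begin

definition swap :: "'v \<Rightarrow> 'v" where "swap = \<alpha>' \<circ> (id \<otimes>\<^sub>m flip) \<circ> \<alpha>"

lemma lin_swap [lin_intros]: "lin swap" and swap_tensor [simp]: "swap ((x \<otimes> y) \<otimes> z) = (x \<otimes> z) \<otimes> y"
  by (simp_all add: swap_def lin_intros ten_tensor)

lemmas lin_swap_apply [lin_intros] = lin_compose[OF lin_swap]

text \<open>The left-hand condition h1 x(-1) \<otimes> h2.x(0) = (h1.x)(-1) h2 \<otimes> (h1.x)(0),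
  with the action \<open>A\<close> and coaction \<open>L\<close> as linear maps so that it can be
  tested on tensors. \<open>swap\<close> keeps h2 aside while h1 acts. The structure on
  \<open>K\<close> is a parameter because right crossed modules are treated over the opposite
  structures.\<close>

definition crossed_on ::
  "'v set \<Rightarrow> ('v \<Rightarrow> 'v) \<Rightarrow> ('v \<Rightarrow> 'v) \<Rightarrow> 'v set \<Rightarrow> ('v \<Rightarrow> 'v) \<Rightarrow> ('v \<Rightarrow> 'v) \<Rightarrow> bool" where
  "crossed_on K \<mu> \<Delta> X A L \<longleftrightarrow> (\<forall>h\<in>K. \<forall>x\<in>X.
     (\<mu> \<otimes>\<^sub>m A) (mid flip (\<Delta> h \<otimes> L x)) = (\<mu> \<otimes>\<^sub>m id) (swap (((\<lambda>z. L (A z)) \<otimes>\<^sub>m id) (swap (\<Delta> h \<otimes> x)))))"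

definition diag_act :: "('v \<Rightarrow> 'v) \<Rightarrow> ('v \<Rightarrow> 'v) \<Rightarrow> ('v \<Rightarrow> 'v) \<Rightarrow> 'v \<Rightarrow> 'v" where
  "diag_act \<Delta> A B w = (A \<otimes>\<^sub>m B) (mid flip ((\<Delta> \<otimes>\<^sub>m id) w))"

definition diag_coact :: "('v \<Rightarrow> 'v) \<Rightarrow> ('v \<Rightarrow> 'v) \<Rightarrow> ('v \<Rightarrow> 'v) \<Rightarrow> 'v \<Rightarrow> 'v" where
  "diag_coact \<mu> L M z = (\<mu> \<otimes>\<^sub>m id) (mid flip ((L \<otimes>\<^sub>m M) z))"

lemma lin_diag [lin_intros]:
  "lin \<Delta> \<Longrightarrow> lin A \<Longrightarrow> lin B \<Longrightarrow> lin (diag_act \<Delta> A B)"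
  "lin \<Delta> \<Longrightarrow> lin A \<Longrightarrow> lin B \<Longrightarrow> lin (diag_coact \<Delta> A B)"
  by (simp_all add: diag_act_def[abs_def] diag_coact_def[abs_def] lin_intros)

lemmas lin_diag_apply [lin_intros] = lin_diag[THEN lin_compose]

text \<open>In Sweedler notation, both sides equal \<open>h1 x(-1) y(-1) \<otimes> h2.x(0) \<otimes> h3.y(0)\<close>.\<close>

lemma crossed_on_diag:
  assumes "is_algebra K \<mu> \<eta>" "is_coalgebra K \<Delta> \<epsilon>"
    and A: "lin A" and B: "lin B" and L: "lin L" and M: "lin M"
    and mem: "\<And>z. z \<in> K \<otimes>\<^sub>s X \<Longrightarrow> A z \<in> X" "\<And>z. z \<in> K \<otimes>\<^sub>s Y \<Longrightarrow> B z \<in> Y"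
      "\<And>x. x \<in> X \<Longrightarrow> L x \<in> K \<otimes>\<^sub>s X" "\<And>y. y \<in> Y \<Longrightarrow> M y \<in> K \<otimes>\<^sub>s Y"
    and cr: "crossed_on K \<mu> \<Delta> X A L" "crossed_on K \<mu> \<Delta> Y B M"
  shows "crossed_on K \<mu> \<Delta> (X \<otimes>\<^sub>s Y) (diag_act \<Delta> A B) (diag_coact \<mu> L M)"
  unfolding crossed_on_def
proof (intro ballI)
  have \<mu>: "lin \<mu>" "\<And>a b. a \<in> K \<Longrightarrow> b \<in> K \<Longrightarrow> \<mu> (a \<otimes> b) \<in> K"
    "\<And>a b c. a \<in> K \<Longrightarrow> b \<in> K \<Longrightarrow> c \<in> K \<Longrightarrow> \<mu> (\<mu> (a \<otimes> b) \<otimes> c) = \<mu> (a \<otimes> \<mu> (b \<otimes> c))"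
    and \<Delta>: "lin \<Delta>" "\<And>h. h \<in> K \<Longrightarrow> \<Delta> h \<in> K \<otimes>\<^sub>s K"
    "\<And>h. h \<in> K \<Longrightarrow> \<alpha> ((\<Delta> \<otimes>\<^sub>m id) (\<Delta> h)) = (id \<otimes>\<^sub>m \<Delta>) (\<Delta> h)"
    using assms(1,2) by (auto simp: is_algebra_def is_coalgebra_def coassociative_def ten_space_mem image_subset_iff)
  note lins = \<mu>(1) \<Delta>(1) A B L M lin_compose[OF \<mu>(1)] lin_compose[OF \<Delta>(1)] lin_compose[OF A] lin_compose[OF B]
    lin_compose[OF L] lin_compose[OF M]
  fix h z assume h: "h \<in> K" and z: "z \<in> X \<otimes>\<^sub>s Y"
  let ?N = "\<lambda>w. (\<mu> \<otimes>\<^sub>m id) (mid flip w)"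
  let ?R = "\<lambda>A L x m. (\<mu> \<otimes>\<^sub>m id) (swap (((\<lambda>z. L (A z)) \<otimes>\<^sub>m id) (swap (m \<otimes> x))))"
  let ?L = "\<lambda>A u m. (\<mu> \<otimes>\<^sub>m A) (mid flip (m \<otimes> u))"
  let ?T = "\<lambda>v c. (id \<otimes>\<^sub>m B) (\<alpha> ((flip \<otimes>\<^sub>m id) (\<alpha>' (c \<otimes> v))))"
  let ?D = "(\<Delta> \<otimes>\<^sub>m id) (\<Delta> h)"
  have lin_L0: "lin (\<lambda>m. ?L A u m)" "lin (\<lambda>m. ?L B u m)" "lin (\<lambda>m. ?R A L u m)" "lin (\<lambda>m. ?R B M u m)"
    "lin (\<lambda>m. ?T u m)" for u by (intro lin_intros lins)+
  have D: "?D \<in> (K \<otimes>\<^sub>s K) \<otimes>\<^sub>s K"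
    by (rule ten_map[OF \<Delta>(2)[OF h] \<Delta>(1) lin_id(1)]) (auto simp: \<Delta>)
  have eq: "(\<mu> \<otimes>\<^sub>m diag_act \<Delta> A B) (mid flip (\<Delta> h \<otimes> diag_coact \<mu> L M (x \<otimes> y))) =
      ?R (diag_act \<Delta> A B) (diag_coact \<mu> L M) (x \<otimes> y) (\<Delta> h)" if x: "x \<in> X" and y: "y \<in> Y" for x y
  proof -
    define u v where "u = L x" and "v = M y"
    have u: "u \<in> K \<otimes>\<^sub>s X" and v: "v \<in> K \<otimes>\<^sub>s Y" using x y mem by (auto simp: u_def v_def)
    let ?E1 = "\<lambda>d. (\<mu> \<otimes>\<^sub>m (\<lambda>w. (A \<otimes>\<^sub>m B) (mid flip w))) (mid flip (d \<otimes> ?N (u \<otimes> v)))"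
    have "(\<mu> \<otimes>\<^sub>m diag_act \<Delta> A B) (mid flip (w \<otimes> n)) =
        (\<mu> \<otimes>\<^sub>m (\<lambda>w. (A \<otimes>\<^sub>m B) (mid flip w))) (mid flip ((id \<otimes>\<^sub>m \<Delta>) w \<otimes> n))" for w n
    proof (rule tensor_ext[where z=w])
      show "(\<mu> \<otimes>\<^sub>m diag_act \<Delta> A B) (mid flip ((a \<otimes> b) \<otimes> n)) =
        (\<mu> \<otimes>\<^sub>m (\<lambda>w. (A \<otimes>\<^sub>m B) (mid flip w))) (mid flip ((id \<otimes>\<^sub>m \<Delta>) (a \<otimes> b) \<otimes> n))" for a b
        by (rule tensor_ext[where z=n]; simp add: lins lin_intros ten_tensor diag_act_def)
    qed (simp_all add: lins lin_intros)
    then have "(\<mu> \<otimes>\<^sub>m diag_act \<Delta> A B) (mid flip (\<Delta> h \<otimes> diag_coact \<mu> L M (x \<otimes> y))) = ?E1 (\<alpha> ?D)"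
      using \<Delta>(3)[OF h] by (simp add: u_def v_def diag_coact_def ten_tensor lins)
    also have "?E1 (\<alpha> ?D) = ?N ((?L A u \<otimes>\<^sub>m ?T v) ?D)"
    proof (rule ten_eq3[OF D])
      fix a b c assume abc: "a \<in> K" "b \<in> K" "c \<in> K"
      show "?E1 (\<alpha> ((a \<otimes> b) \<otimes> c)) = ?N ((?L A u \<otimes>\<^sub>m ?T v) ((a \<otimes> b) \<otimes> c))"
        unfolding assoc_tensor ten_tensor[OF lin_L0(1) lin_L0(5)]
      proof (rule ten_eq[OF u])
        show "(\<mu> \<otimes>\<^sub>m (\<lambda>w. (A \<otimes>\<^sub>m B) (mid flip w))) (mid flip ((a \<otimes> b \<otimes> c) \<otimes> ?N ((q \<otimes> x) \<otimes> v)))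
          = ?N (?L A (q \<otimes> x) (a \<otimes> b) \<otimes> ?T v c)" if "q \<in> K" "x \<in> X" for q x
          by (rule ten_eq[OF v]; simp add: lins lin_intros ten_tensor abc that \<mu>)
      qed (simp_all add: lins lin_intros)
    qed (simp_all add: lins lin_intros)
    \<comment> \<open>The condition for \<open>X\<close> is applied to the first two legs of the
      threefold coproduct of h; after rebracketing by coassociativity, the condition for
      \<open>Y\<close> is applied to the last two.\<close>
    also have "(?L A u \<otimes>\<^sub>m ?T v) ?D = (?R A L x \<otimes>\<^sub>m ?T v) ?D"
    proof -
      have "(?L A u \<otimes>\<^sub>m ?T v) ((\<Delta> \<otimes>\<^sub>m id) w) = (?R A L x \<otimes>\<^sub>m ?T v) ((\<Delta> \<otimes>\<^sub>m id) w)" if "w \<in> K \<otimes>\<^sub>s K" for w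
        by (rule ten_eq[OF that])
          (use cr(1) x in \<open>simp_all add: lins lin_intros ten_tensor crossed_on_def u_def id_def\<close>)
      then show ?thesis using \<Delta>(2)[OF h] .
    qed
    also have "?N ((?R A L x \<otimes>\<^sub>m ?T v) ?D) = ?N (((\<lambda>a. L (A (a \<otimes> x))) \<otimes>\<^sub>m ?L B v) (\<alpha> ?D))"
    proof (rule ten_eq3[OF D])
      fix a b c assume abc: "a \<in> K" "b \<in> K" "c \<in> K"
      have s: "L (A (a \<otimes> x)) \<in> K \<otimes>\<^sub>s X" using abc x mem by (simp add: ten_space_mem)
      have "?N ((\<mu> \<otimes>\<^sub>m id) (swap (s \<otimes> b)) \<otimes> ?T v c) = ?N (s \<otimes> ?L B v (b \<otimes> c))" if "s \<in> K \<otimes>\<^sub>s X" for s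
      proof (rule ten_eq[OF that])
        show "?N ((\<mu> \<otimes>\<^sub>m id) (swap ((t \<otimes> x) \<otimes> b)) \<otimes> ?T v c) = ?N ((t \<otimes> x) \<otimes> ?L B v (b \<otimes> c))"
          if "t \<in> K" "x \<in> X" for t x
          by (rule ten_eq[OF v]; simp add: lins lin_intros ten_tensor abc that \<mu>)
      qed (simp_all add: lins lin_intros)
      from this[OF s] show "?N ((?R A L x \<otimes>\<^sub>m ?T v) ((a \<otimes> b) \<otimes> c)) =
        ?N (((\<lambda>a. L (A (a \<otimes> x))) \<otimes>\<^sub>m ?L B v) (\<alpha> ((a \<otimes> b) \<otimes> c)))"
        by (simp add: lins lin_intros ten_tensor)
    qed (simp_all add: lins lin_intros)
    also have "\<dots> = ?N (((\<lambda>a. L (A (a \<otimes> x))) \<otimes>\<^sub>m ?R B M y) (\<alpha> ?D))"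
    proof -
      have "((\<lambda>a. L (A (a \<otimes> x))) \<otimes>\<^sub>m ?L B v) ((id \<otimes>\<^sub>m \<Delta>) w) =
          ((\<lambda>a. L (A (a \<otimes> x))) \<otimes>\<^sub>m ?R B M y) ((id \<otimes>\<^sub>m \<Delta>) w)" if "w \<in> K \<otimes>\<^sub>s K" for w
        by (rule ten_eq[OF that])
          (use cr(2) y in \<open>simp_all add: lins lin_intros ten_tensor crossed_on_def v_def id_def\<close>)
      then show ?thesis using \<Delta>(2)[OF h] by (simp add: \<Delta>(3)[OF h])
    qed
    also have "\<dots> = (\<mu> \<otimes>\<^sub>m id) (swap (((\<lambda>m. ?N (((\<lambda>z. L (A z)) \<otimes>\<^sub>m (\<lambda>z. M (B z))) (mid flip (m \<otimes> (x \<otimes> y))))) \<otimes>\<^sub>m id) ?D))"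
    proof (rule ten_eq3[OF D])
      fix a b c assume abc: "a \<in> K" "b \<in> K" "c \<in> K"
      have s: "L (A (a \<otimes> x)) \<in> K \<otimes>\<^sub>s X" "M (B (b \<otimes> y)) \<in> K \<otimes>\<^sub>s Y"
        using abc x y mem by (simp_all add: ten_space_mem)
      have "?N (s \<otimes> (\<mu> \<otimes>\<^sub>m id) (swap (t \<otimes> c))) = (\<mu> \<otimes>\<^sub>m id) (swap (?N (s \<otimes> t) \<otimes> c))"
        if s: "s \<in> K \<otimes>\<^sub>s X" and t: "t \<in> K \<otimes>\<^sub>s Y" for s t
      proof (rule ten_eq[OF s])
        show "?N ((q \<otimes> x) \<otimes> (\<mu> \<otimes>\<^sub>m id) (swap (t \<otimes> c))) = (\<mu> \<otimes>\<^sub>m id) (swap (?N ((q \<otimes> x) \<otimes> t) \<otimes> c))"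
          if "q \<in> K" "x \<in> X" for q x
          by (rule ten_eq[OF t]; simp add: lins lin_intros ten_tensor abc that \<mu>)
      qed (simp_all add: lins lin_intros)
      from this[OF s] show "?N (((\<lambda>a. L (A (a \<otimes> x))) \<otimes>\<^sub>m ?R B M y) (\<alpha> ((a \<otimes> b) \<otimes> c))) =
        (\<mu> \<otimes>\<^sub>m id) (swap (((\<lambda>m. ?N (((\<lambda>z. L (A z)) \<otimes>\<^sub>m (\<lambda>z. M (B z))) (mid flip (m \<otimes> (x \<otimes> y))))) \<otimes>\<^sub>m id) ((a \<otimes> b) \<otimes> c)))"
        by (simp add: lins lin_intros ten_tensor)
    qed (simp_all add: lins lin_intros)
    also have "\<dots> = ?R (diag_act \<Delta> A B) (diag_coact \<mu> L M) (x \<otimes> y) (\<Delta> h)"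
    proof (rule ten_eq[OF \<Delta>(2)[OF h]])
      fix k c
      have "((\<lambda>z. L (A z)) \<otimes>\<^sub>m (\<lambda>z. M (B z))) w = (L \<otimes>\<^sub>m M) ((A \<otimes>\<^sub>m B) w)" for w
        by (simp add: ten_comp lins)
      then show "(\<mu> \<otimes>\<^sub>m id) (swap (((\<lambda>m. ?N (((\<lambda>z. L (A z)) \<otimes>\<^sub>m (\<lambda>z. M (B z))) (mid flip (m \<otimes> (x \<otimes> y))))) \<otimes>\<^sub>m id) ((\<Delta> \<otimes>\<^sub>m id) (k \<otimes> c))))
        = ?R (diag_act \<Delta> A B) (diag_coact \<mu> L M) (x \<otimes> y) (k \<otimes> c)"
        by (simp add: lins lin_intros ten_tensor diag_act_def diag_coact_def)
    qed (simp_all add: lins lin_intros)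
    finally show ?thesis .
  qed
  show "(\<mu> \<otimes>\<^sub>m diag_act \<Delta> A B) (mid flip (\<Delta> h \<otimes> diag_coact \<mu> L M z)) =
      ?R (diag_act \<Delta> A B) (diag_coact \<mu> L M) z (\<Delta> h)"
    by (rule ten_eq[OF z]; (rule eq; assumption)?; simp add: lins lin_intros)
qed

end

section \<open>Modules and comodules of either side in left-handed form\<close>

context braided_category
begin

abbreviation H where "H \<equiv> hspace V"
abbreviation \<epsilon>\<^sub>H where "\<epsilon>\<^sub>H \<equiv> hcounit V"

lemma
  shows subspace_H: "subspace H" and lin_hmult: "lin (hmult V)" and lin_hcomult: "lin (hcomult V)"
    and functional_hcounit: "functional \<epsilon>\<^sub>H" and h_one: "h_one \<in> H"
    and hmult_mem: "a \<in> H \<Longrightarrow> b \<in> H \<Longrightarrow> a \<cdot> b \<in> H"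
    and hmult_assoc: "a \<in> H \<Longrightarrow> b \<in> H \<Longrightarrow> c \<in> H \<Longrightarrow> (a \<cdot> b) \<cdot> c = a \<cdot> (b \<cdot> c)"
    and hmult_one: "a \<in> H \<Longrightarrow> h_one \<cdot> a = a" "a \<in> H \<Longrightarrow> a \<cdot> h_one = a"
    and hcomult_mem: "a \<in> H \<Longrightarrow> hcomult V a \<in> H \<otimes>\<^sub>s H"
    and hcoassoc: "a \<in> H \<Longrightarrow> \<alpha> ((hcomult V \<otimes>\<^sub>m id) (hcomult V a)) = (id \<otimes>\<^sub>m hcomult V) (hcomult V a)"
    and hcounit: "a \<in> H \<Longrightarrow> contract_left \<epsilon>\<^sub>H (hcomult V a) = a"
      "a \<in> H \<Longrightarrow> contract_right \<epsilon>\<^sub>H (hcomult V a) = a"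
    and hcomult_mult: "a \<in> H \<Longrightarrow> b \<in> H \<Longrightarrow> hcomult V (a \<cdot> b) =
      (hmult V \<otimes>\<^sub>m hmult V) (mid flip (hcomult V a \<otimes> hcomult V b))"
    and hcomult_one: "hcomult V h_one = h_one \<otimes> h_one"
    and hcounit_mult: "a \<in> H \<Longrightarrow> b \<in> H \<Longrightarrow> \<epsilon>\<^sub>H (a \<cdot> b) = \<epsilon>\<^sub>H a * \<epsilon>\<^sub>H b"
    and hcounit_one: "\<epsilon>\<^sub>H h_one = 1"
  using H_bialgebra unfolding is_bialgebra_def is_algebra_def is_coalgebra_def coassociative_def
  by (auto simp: ten_space_mem image_subset_iff contract_left_def contract_right_def ten_tensor)

text \<open>\<open>mu\<close>, \<open>dl\<close> and \<open>lc\<close> are chosen such that left and right (co)modules over \<open>H\<close> are left (co)modules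
  with respect to \<open>mu\<close> and \<open>dl\<close>.\<close>

definition mu :: "'v \<Rightarrow> 'v" where
  "mu = (case side V of Left \<Rightarrow> hmult V | Right \<Rightarrow> (\<lambda>z. hmult V (flip z)))"

definition dl :: "'v \<Rightarrow> 'v" where
  "dl = (case side V of Left \<Rightarrow> hcomult V | Right \<Rightarrow> (\<lambda>h. flip (hcomult V h)))"

definition lc :: "'v obj \<Rightarrow> 'v \<Rightarrow> 'v" where
  "lc X = (case side V of Left \<Rightarrow> coact X | Right \<Rightarrow> (\<lambda>x. flip (coact X x)))"

definition ac :: "'v obj \<Rightarrow> 'v \<Rightarrow> 'v" where
  "ac X = lift (act X)"

lemma lin_mu: "lin mu" and lin_dl: "lin dl"
  by (cases "side V"; simp add: mu_def dl_def lin_hmult lin_hcomult lin_intros lin_compose[OF lin_hmult])+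

lemma mu_algebra: "is_algebra H mu (hunit V)"
proof -
  have "is_algebra H (hmult V) (hunit V)" using H_bialgebra by (simp add: is_bialgebra_def)
  then show ?thesis
    by (cases "side V") (auto simp: is_algebra_def mu_def image_subset_iff flip_mem lin_intros lin_compose[of "hmult V"])
qed

lemma dl_coalgebra: "is_coalgebra H dl \<epsilon>\<^sub>H"
proof (cases "side V")
  case Left
  then show ?thesis using H_bialgebra by (simp add: is_bialgebra_def dl_def)
next
  case Right
  have dl: "dl h = flip (hcomult V h)" for h using Right by (simp add: dl_def)
  \<comment> \<open>\<open>?R\<close> reverses the order of three tensor factors, and reversal
    exchanges the two sides of coassociativity.\<close>
  let ?R = "\<lambda>w. \<alpha> (flip ((id \<otimes>\<^sub>m flip) w))"
  have "\<alpha> ((dl \<otimes>\<^sub>m id) (flip w)) = ?R ((id \<otimes>\<^sub>m hcomult V) w)" for w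
    by (rule tensor_ext[where z=w]; simp add: lin_intros lin_dl lin_hcomult ten_tensor dl)
  moreover have "?R (\<alpha> ((hcomult V \<otimes>\<^sub>m id) w)) = (id \<otimes>\<^sub>m dl) (flip w)" for w
  proof (rule tensor_ext[where z=w])
    fix a b
    show "?R (\<alpha> ((hcomult V \<otimes>\<^sub>m id) (a \<otimes> b))) = (id \<otimes>\<^sub>m dl) (flip (a \<otimes> b))"
    proof (simp add: lin_intros lin_hcomult lin_dl ten_tensor dl)
      show "?R (\<alpha> (u \<otimes> b)) = b \<otimes> flip u" for u
        by (rule tensor_ext[where z=u]; simp add: lin_intros ten_tensor)
    qed
  qed (simp_all add: lin_intros lin_hcomult lin_dl)
  ultimately have "\<alpha> ((dl \<otimes>\<^sub>m id) (dl a)) = (id \<otimes>\<^sub>m dl) (dl a)" if "a \<in> H" for a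
    using hcoassoc[OF that] by (metis dl)
  moreover have "contract_left \<epsilon>\<^sub>H (flip w) = contract_right \<epsilon>\<^sub>H w"
    "contract_right \<epsilon>\<^sub>H (flip w) = contract_left \<epsilon>\<^sub>H w" for w
    by (rule tensor_ext[where z=w]; simp add: lin_intros functional_hcounit lin_compose[OF lin_contract_left]
        lin_compose[OF lin_contract_right] contract_left_tensor contract_right_tensor)+
  ultimately show ?thesis
    using hcounit by (auto simp: is_coalgebra_def coassociative_def subspace_H lin_dl functional_hcounit
        dl flip_mem hcomult_mem contract_left_def[symmetric] contract_right_def[symmetric])
qed

lemma mu_mem: "a \<in> H \<Longrightarrow> b \<in> H \<Longrightarrow> mu (a \<otimes> b) \<in> H"
  and mu_one: "a \<in> H \<Longrightarrow> mu (h_one \<otimes> a) = a" "a \<in> H \<Longrightarrow> mu (a \<otimes> h_one) = a"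
  using mu_algebra by (auto simp: is_algebra_def ten_space_mem image_subset_iff)

lemma dl_mem: "a \<in> H \<Longrightarrow> dl a \<in> H \<otimes>\<^sub>s H"
  and dl_counit: "a \<in> H \<Longrightarrow> contract_left \<epsilon>\<^sub>H (dl a) = a" "a \<in> H \<Longrightarrow> contract_right \<epsilon>\<^sub>H (dl a) = a"
  using dl_coalgebra
  by (auto simp: is_coalgebra_def coassociative_def image_subset_iff contract_left_def contract_right_def)

lemma dl_one: "dl h_one = h_one \<otimes> h_one"
  by (cases "side V") (simp_all add: dl_def hcomult_one)

lemma hcounit_mu: "a \<in> H \<Longrightarrow> b \<in> H \<Longrightarrow> \<epsilon>\<^sub>H (mu (a \<otimes> b)) = \<epsilon>\<^sub>H a * \<epsilon>\<^sub>H b"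
  by (cases "side V") (simp_all add: mu_def hcounit_mult)

text \<open>Modules are taken over \<open>mu\<close>, but the diagonal action uses the original
  coproduct. This mixed compatibility makes the diagonal action an action; \<open>dl_hmult\<close>
  is its counterpart for comodules over \<open>dl\<close>, whose diagonal coaction uses the original
  product.\<close>

lemma hcomult_mu:
  assumes "a \<in> H" "b \<in> H"
  shows "hcomult V (mu (a \<otimes> b)) = (mu \<otimes>\<^sub>m mu) (mid flip (hcomult V a \<otimes> hcomult V b))"
proof (cases "side V")
  case Right
  have "(hmult V \<otimes>\<^sub>m hmult V) (mid flip (v \<otimes> u)) = (mu \<otimes>\<^sub>m mu) (mid flip (u \<otimes> v))" for u v
  proof (rule tensor_ext[where z=u])
    show "(hmult V \<otimes>\<^sub>m hmult V) (mid flip (v \<otimes> (x \<otimes> y))) = (mu \<otimes>\<^sub>m mu) (mid flip ((x \<otimes> y) \<otimes> v))" for x y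
      by (rule tensor_ext[where z=v]; simp add: lin_intros lin_hmult lin_mu ten_tensor) (simp add: mu_def Right)
  qed (simp_all add: lin_intros lin_hmult lin_mu)
  then show ?thesis using assms by (simp add: mu_def Right hcomult_mult)
qed (use assms in \<open>simp add: mu_def hcomult_mult\<close>)

lemma dl_hmult:
  assumes "a \<in> H" "b \<in> H"
  shows "dl (a \<cdot> b) = (hmult V \<otimes>\<^sub>m hmult V) (mid flip (dl a \<otimes> dl b))"
proof (cases "side V")
  case Right
  have "flip ((hmult V \<otimes>\<^sub>m hmult V) (mid flip (u \<otimes> v))) = (hmult V \<otimes>\<^sub>m hmult V) (mid flip (flip u \<otimes> flip v))" for u v
  proof (rule tensor_ext[where z=u])
    show "flip ((hmult V \<otimes>\<^sub>m hmult V) (mid flip ((x \<otimes> y) \<otimes> v))) =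
        (hmult V \<otimes>\<^sub>m hmult V) (mid flip (flip (x \<otimes> y) \<otimes> flip v))" for x y
      by (rule tensor_ext[where z=v]; simp add: lin_intros lin_hmult ten_tensor)
  qed (simp_all add: lin_intros lin_hmult)
  then show ?thesis using assms by (simp add: dl_def Right hcomult_mult)
qed (use assms in \<open>simp add: dl_def hcomult_mult\<close>)

text \<open>Together with \<open>comodule_axioms'\<close> this removes the case distinction on the
  side: everything is a left structure over \<open>mu\<close> and \<open>dl\<close>.\<close>

definition module_axioms' :: "'v obj \<Rightarrow> bool" where
  "module_axioms' X \<longleftrightarrow> bilin (act X) \<and> (\<forall>z \<in> H \<otimes>\<^sub>s space X. ac X z \<in> space X) \<and>
     (\<forall>x \<in> space X. ac X (h_one \<otimes> x) = x) \<and>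
     (\<forall>g\<in>H. \<forall>h\<in>H. \<forall>x \<in> space X. ac X (g \<otimes> ac X (h \<otimes> x)) = ac X (mu (g \<otimes> h) \<otimes> x))"

definition comodule_axioms' :: "'v obj \<Rightarrow> bool" where
  "comodule_axioms' X \<longleftrightarrow> lin (lc X) \<and> (\<forall>x \<in> space X. lc X x \<in> H \<otimes>\<^sub>s space X) \<and>
     (\<forall>x \<in> space X. \<alpha> ((dl \<otimes>\<^sub>m id) (lc X x)) = (id \<otimes>\<^sub>m lc X) (lc X x)) \<and>
     (\<forall>x \<in> space X. contract_left \<epsilon>\<^sub>H (lc X x) = x)"

lemma ac_tensor: "bilin (act X) \<Longrightarrow> ac X (h \<otimes> x) = act X h x"
  and lin_ac: "bilin (act X) \<Longrightarrow> lin (ac X)"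
  by (simp_all add: ac_def lift_tensor lin_lift)

lemma is_module_iff: "subspace (space X) \<Longrightarrow> is_module X \<longleftrightarrow> module_axioms' X"
proof (cases "bilin (act X)")
  case True
  assume "subspace (space X)"
  then have "(\<forall>z \<in> H \<otimes>\<^sub>s space X. ac X z \<in> space X) \<longleftrightarrow> (\<forall>h \<in> H. \<forall>x \<in> space X. act X h x \<in> space X)"
    using True by (auto simp: ac_tensor[symmetric] lin_ac intro: ten_mem ten_space_mem)
  then show ?thesis
    using True by (cases "side V") (auto simp: is_module_def module_axioms'_def ac_tensor mu_def)
qed (simp add: is_module_def module_axioms'_def)

lemma is_comodule_iff: "is_comodule X \<longleftrightarrow> comodule_axioms' X"
proof (cases "side V")
  case Left
  then show ?thesis
    by (auto simp: is_comodule_def comodule_axioms'_def lc_def dl_def contract_left_def image_subset_iff)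
next
  case Right
  have lc: "coact X x = flip (lc X x)" "lc X x = flip (coact X x)" for x using Right by (simp_all add: lc_def)
  have lin: "lin (lc X) \<longleftrightarrow> lin (coact X)"
  proof -
    have "coact X = (\<lambda>x. flip (lc X x))" "lc X = (\<lambda>x. flip (coact X x))" using lc by auto
    then show ?thesis by (metis lin_compose[OF lin_flip])
  qed
  show ?thesis
  proof (cases "lin (coact X)")
    case True
    have linlc: "lin (lc X)" using True lin by simp
    \<comment> \<open>Again the reversal of three factors. It is injective, so the right-hand
      coassociativity condition may be compared with the left-hand one after applying it.\<close>
    let ?R = "\<lambda>w. \<alpha> (flip ((id \<otimes>\<^sub>m flip) w))"
    have inj: "?R w = ?R w' \<longleftrightarrow> w = w'" for w w'
    proof -
      have "(id \<otimes>\<^sub>m flip) ((id \<otimes>\<^sub>m flip) v) = v" for v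
        by (rule tensor_ext[where z=v]; simp add: lin_intros ten_tensor)
      then have "(id \<otimes>\<^sub>m flip) (flip (\<alpha>' (?R v))) = v" for v by simp
      then show ?thesis by metis
    qed
    have 1: "?R ((id \<otimes>\<^sub>m hcomult V) (flip w)) = \<alpha> ((dl \<otimes>\<^sub>m id) w)" for w
      by (rule tensor_ext[where z=w]; simp add: lin_intros lin_dl lin_hcomult ten_tensor) (simp add: dl_def Right)
    have 2: "?R (\<alpha> ((coact X \<otimes>\<^sub>m id) (flip w))) = (id \<otimes>\<^sub>m lc X) w" for w
    proof (rule tensor_ext[where z=w])
      fix a b
      show "?R (\<alpha> ((coact X \<otimes>\<^sub>m id) (flip (a \<otimes> b)))) = (id \<otimes>\<^sub>m lc X) (a \<otimes> b)"
      proof (simp add: lin_intros True linlc ten_tensor lc(2))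
        show "?R (\<alpha> (u \<otimes> a)) = a \<otimes> flip u" for u
          by (rule tensor_ext[where z=u]; simp add: lin_intros ten_tensor)
      qed
    qed (simp_all add: lin_intros True linlc)
    have 3: "\<alpha> ((coact X \<otimes>\<^sub>m id) (coact X x)) = (id \<otimes>\<^sub>m hcomult V) (coact X x) \<longleftrightarrow>
        \<alpha> ((dl \<otimes>\<^sub>m id) (lc X x)) = (id \<otimes>\<^sub>m lc X) (lc X x)" for x
      by (metis inj 1 2 lc(1))
    have 4: "lift (\<lambda>y h. scale V (\<epsilon>\<^sub>H h) y) w = contract_left \<epsilon>\<^sub>H (flip w)" for w
      unfolding contract_right_def[symmetric]
      by (rule tensor_ext[where z=w]; simp add: lin_intros functional_hcounit lin_compose[OF lin_contract_left]
        contract_left_tensor contract_right_tensor)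
    have 5: "coact X x \<in> space X \<otimes>\<^sub>s H \<longleftrightarrow> lc X x \<in> H \<otimes>\<^sub>s space X" for x
      using flip_mem[of "coact X x" "space X" H] flip_mem[of "lc X x" H "space X"] by (metis lc)
    show ?thesis
    proof -
      have "is_comodule X \<longleftrightarrow> (\<forall>x \<in> space X. coact X x \<in> space X \<otimes>\<^sub>s H) \<and> (\<forall>x \<in> space X.
          \<alpha> ((coact X \<otimes>\<^sub>m id) (coact X x)) = (id \<otimes>\<^sub>m hcomult V) (coact X x) \<and>
          lift (\<lambda>y h. scale V (\<epsilon>\<^sub>H h) y) (coact X x) = x)"
        using True by (simp add: is_comodule_def Right image_subset_iff)
      then show ?thesis
        using linlc by (simp only: 3 4 5 lc(2)[symmetric] comodule_axioms'_def) blast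
    qed
  qed (simp add: is_comodule_def comodule_axioms'_def lin)
qed

text \<open>The diagonal action and the crossed condition are lifts of tensor products of maps
  depending on elements of \<open>H\<close>; this supplies the bilinearity without which a lift is
  unspecified.\<close>

lemma ten_param:
  assumes "bilin \<phi>" "lin g"
  shows "bilin (\<lambda>a z. (\<phi> a \<otimes>\<^sub>m g) z)" "bilin (\<lambda>a z. (g \<otimes>\<^sub>m \<phi> a) z)"
proof -
  note l = bilinD(1)[OF assms(1)] and r = lin_simps(1,2)[OF bilinD(2)[OF assms(1)]]
  have "lin (\<lambda>a. (\<phi> a \<otimes>\<^sub>m g) z)" for z
    unfolding lin_iff
  proof (intro conjI allI)
    show "(\<phi> (x + y) \<otimes>\<^sub>m g) z = (\<phi> x \<otimes>\<^sub>m g) z + (\<phi> y \<otimes>\<^sub>m g) z" "(\<phi> (scale V c x) \<otimes>\<^sub>m g) z = scale V c ((\<phi> x \<otimes>\<^sub>m g) z)" for c x y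
      by (rule tensor_ext[where z=z]; simp add: l assms(2) ten_tensor lin_intros r)+
  qed
  moreover have "lin (\<lambda>a. (g \<otimes>\<^sub>m \<phi> a) z)" for z
    unfolding lin_iff
  proof (intro conjI allI)
    show "(g \<otimes>\<^sub>m \<phi> (x + y)) z = (g \<otimes>\<^sub>m \<phi> x) z + (g \<otimes>\<^sub>m \<phi> y) z" "(g \<otimes>\<^sub>m \<phi> (scale V c x)) z = scale V c ((g \<otimes>\<^sub>m \<phi> x) z)" for c x y
      by (rule tensor_ext[where z=z]; simp add: l assms(2) ten_tensor lin_intros r)+
  qed
  ultimately show "bilin (\<lambda>a z. (\<phi> a \<otimes>\<^sub>m g) z)" "bilin (\<lambda>a z. (g \<otimes>\<^sub>m \<phi> a) z)"
    by (auto intro!: bilinI lin_intros l assms(2))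
qed

text \<open>The condition for right crossed modules is the flip of the left condition over
  \<open>mu\<close> and \<open>dl\<close>, and \<open>flip\<close> is injective.\<close>

lemma crossed_compatible_iff:
  assumes "bilin (act X)" "lin (lc X)"
  shows "crossed_compatible X \<longleftrightarrow> crossed_on H mu dl (space X) (ac X) (lc X)"
proof -
  have m1: "bilin (\<lambda>a c. mu (a \<otimes> c))" "bilin (\<lambda>b c. mu (c \<otimes> b))"
    by (intro bilinI lin_compose[OF lin_mu] lin_left lin_right)+
  have ac': "lin (act X b)" "lin (\<lambda>b. act X b x)" for b x using bilinD[OF assms(1)] by auto
  note lins = lin_mu assms(2) ac' lin_ac[OF assms(1)] lin_compose[OF lin_mu] lin_compose[OF assms(2)] lin_compose[OF lin_ac[OF assms(1)]]
    bilinD[OF m1(1)] bilinD[OF m1(2)]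
  have b1: "bilin (\<lambda>a b. ((\<lambda>c. mu (a \<otimes> c)) \<otimes>\<^sub>m act X b) u)" for u
    by (rule bilinI; rule bilinD(2)[OF ten_param(1)[OF m1(1)]] bilinD(2)[OF ten_param(2)[OF assms(1)]]; simp add: lins)
  have b2: "bilin (\<lambda>a b. ((\<lambda>c. mu (c \<otimes> b)) \<otimes>\<^sub>m id) (lc X (act X a x)))" for x
  proof (rule bilinI)
    show "lin (\<lambda>b. ((\<lambda>c. mu (c \<otimes> b)) \<otimes>\<^sub>m id) (lc X (act X a x)))" for a
      by (rule bilinD(2)[OF ten_param(1)[OF m1(2)]]) (simp add: lin_intros)
    show "lin (\<lambda>a. ((\<lambda>c. mu (c \<otimes> b)) \<otimes>\<^sub>m id) (lc X (act X a x)))" for b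
      by (intro lin_ten_apply lins lin_intros)
  qed
  have e1: "lift (\<lambda>a b. ((\<lambda>c. mu (a \<otimes> c)) \<otimes>\<^sub>m act X b) u) w = (mu \<otimes>\<^sub>m ac X) (mid flip (w \<otimes> u))" for u w
  proof (rule tensor_ext[where z=w])
    show "lift (\<lambda>a b. ((\<lambda>c. mu (a \<otimes> c)) \<otimes>\<^sub>m act X b) u) (a \<otimes> b) = (mu \<otimes>\<^sub>m ac X) (mid flip ((a \<otimes> b) \<otimes> u))" for a b
      unfolding lift_tensor[OF b1]
      by (rule tensor_ext[where z=u]; simp add: lins lin_intros ten_tensor ac_tensor[OF assms(1)])
  qed (simp_all add: lins lin_intros lin_lift[OF b1])
  have e2: "lift (\<lambda>a b. ((\<lambda>c. mu (c \<otimes> b)) \<otimes>\<^sub>m id) (lc X (act X a x))) w =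
      (mu \<otimes>\<^sub>m id) (swap (((\<lambda>z. lc X (ac X z)) \<otimes>\<^sub>m id) (swap (w \<otimes> x))))" for x w
  proof (rule tensor_ext[where z=w])
    show "lift (\<lambda>a b. ((\<lambda>c. mu (c \<otimes> b)) \<otimes>\<^sub>m id) (lc X (act X a x))) (a \<otimes> b) =
      (mu \<otimes>\<^sub>m id) (swap (((\<lambda>z. lc X (ac X z)) \<otimes>\<^sub>m id) (swap ((a \<otimes> b) \<otimes> x))))" for a b
    proof (simp add: lift_tensor[OF b2] lins lin_intros ten_tensor ac_tensor[OF assms(1)])
      show "((\<lambda>c. mu (c \<otimes> b)) \<otimes>\<^sub>m id) u = (mu \<otimes>\<^sub>m id) (swap (u \<otimes> b))" for u
        by (rule tensor_ext[where z=u]; simp add: lins lin_intros ten_tensor)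
    qed
  qed (intro lin_lift b2 lins lin_intros)+
  show ?thesis
  proof (cases "side V")
    case Left
    then show ?thesis
      using e1 e2 by (simp add: crossed_compatible_def crossed_on_def mu_def lc_def dl_def)
  next
    case Right
    have lf: "lift \<phi> z = lift (\<lambda>b a. \<phi> a b) (flip z)" if "bilin \<phi>" for \<phi> z
    proof -
      have "bilin (\<lambda>b a. \<phi> a b)" using that by (auto simp: bilin_def)
      note b = this that lin_lift[OF this]
      show ?thesis
        by (rule tensor_ext[where f="lift \<phi>" and g="\<lambda>z. lift (\<lambda>b a. \<phi> a b) (flip z)"])
          (simp_all add: lin_lift b lin_compose[OF b(3) lin_flip] lift_tensor)
    qed
    have inj: "flip z = flip z' \<longleftrightarrow> z = z'" for z z' by (metis flip_flip)
    have lc: "coact X y = flip (lc X y)" for y by (simp add: lc_def Right)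
    have fl: "lift (\<lambda>a b. flip (\<phi> a b)) z = flip (lift \<phi> z)" if "bilin \<phi>" for \<phi> z
    proof -
      have b: "bilin (\<lambda>a b. flip (\<phi> a b))" using that by (auto simp: bilin_def lin_intros)
      show ?thesis
        by (rule tensor_ext[where f="lift (\<lambda>a b. flip (\<phi> a b))" and g="\<lambda>z. flip (lift \<phi> z)"])
          (simp_all add: lin_lift b that lin_compose[OF lin_flip] lift_tensor)
    qed
    have b1': "bilin (\<lambda>a b. ((\<lambda>c. mu (b \<otimes> c)) \<otimes>\<^sub>m act X a) u)" for u using b1[of u] by (auto simp: bilin_def)
    have b2': "bilin (\<lambda>a b. ((\<lambda>c. mu (c \<otimes> a)) \<otimes>\<^sub>m id) (lc X (act X b x)))" for x using b2[of x] by (auto simp: bilin_def)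
    have 1: "lift (\<lambda>a b. (act X a \<otimes>\<^sub>m (\<lambda>c. c \<cdot> b)) (coact X x)) z = flip ((mu \<otimes>\<^sub>m ac X) (mid flip (flip z \<otimes> lc X x)))" for x z
    proof -
      have "(act X a \<otimes>\<^sub>m (\<lambda>c. c \<cdot> b)) (coact X x) = flip (((\<lambda>c. mu (b \<otimes> c)) \<otimes>\<^sub>m act X a) (lc X x))" for a b
      proof -
        have "(\<lambda>c. mu (b \<otimes> c)) = (\<lambda>c. c \<cdot> b)" by (simp add: mu_def Right)
        then show ?thesis using bilinD(1)[OF m1(1), of b] by (simp add: flip_ten ac' lc)
      qed
      then show ?thesis
        by (simp add: fl[OF b1'] lf[OF b1'] e1)
    qed
    have 2: "lift (\<lambda>a b. (id \<otimes>\<^sub>m (\<lambda>c. a \<cdot> c)) (coact X (act X b x))) z =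
      flip ((mu \<otimes>\<^sub>m id) (swap (((\<lambda>z. lc X (ac X z)) \<otimes>\<^sub>m id) (swap (flip z \<otimes> x)))))" for x z
    proof -
      have "(id \<otimes>\<^sub>m (\<lambda>c. a \<cdot> c)) (coact X (act X b x)) = flip (((\<lambda>c. mu (c \<otimes> a)) \<otimes>\<^sub>m id) (lc X (act X b x)))" for a b
      proof -
        have "(\<lambda>c. mu (c \<otimes> a)) = (\<lambda>c. a \<cdot> c)" by (simp add: mu_def Right)
        then show ?thesis using bilinD(1)[OF m1(2), of a] by (simp add: flip_ten lin_intros lc)
      qed
      then show ?thesis
        by (simp add: fl[OF b2'] lf[OF b2'] e2)
    qed
    show ?thesis
      by (simp add: crossed_compatible_def crossed_on_def Right 1 2 inj dl_def)
  qed
qed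

lemma mid_flip_mem: "w \<in> (X \<otimes>\<^sub>s Y) \<otimes>\<^sub>s (Z \<otimes>\<^sub>s W) \<Longrightarrow> mid flip w \<in> (X \<otimes>\<^sub>s Z) \<otimes>\<^sub>s (Y \<otimes>\<^sub>s W)"
  by (rule mid_mem[OF _ lin_flip]) (auto intro: flip_mem)

text \<open>Crossed modules satisfy both \<open>mods\<close> and \<open>comods\<close>. The three
  kinds thus reduce to an action half and a coaction half.\<close>

abbreviation mods where "mods \<equiv> kind V \<noteq> Comodules"
abbreviation comods where "comods \<equiv> kind V \<noteq> Modules"

lemma is_obj_iff:
  "is_obj X \<longleftrightarrow> subspace (space X) \<and> (mods \<longrightarrow> module_axioms' X) \<and> (comods \<longrightarrow> comodule_axioms' X) \<and>
    (mods \<and> comods \<longrightarrow> crossed_on H mu dl (space X) (ac X) (lc X))"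
proof (cases "subspace (space X)")
  case True
  have "crossed_compatible X \<longleftrightarrow> crossed_on H mu dl (space X) (ac X) (lc X)"
    if "module_axioms' X" "comodule_axioms' X"
    using crossed_compatible_iff that by (auto simp: module_axioms'_def comodule_axioms'_def)
  then show ?thesis
    by (cases "kind V") (auto simp: is_obj_def is_module_iff is_comodule_iff True)
qed (simp add: is_obj_def)

lemma comodule_map_iff:
  assumes "lin f"
  shows "comodule_map X Y f \<longleftrightarrow> (\<forall>x \<in> space X. lc Y (f x) = (id \<otimes>\<^sub>m f) (lc X x))"
proof (cases "side V")
  case Right
  have inj: "flip z = flip z' \<longleftrightarrow> z = z'" for z z' by (metis flip_flip)
  show ?thesis
    using inj[of "coact Y (f x)" "(f \<otimes>\<^sub>m id) (coact X x)" for x]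
    by (simp add: comodule_map_def Right lc_def flip_ten assms lin_intros)
qed (simp add: comodule_map_def lc_def)

lemma mor_iff:
  "mor X Y f \<longleftrightarrow> lin f \<and> (\<forall>x \<in> space X. f x \<in> space Y) \<and>
    (mods \<longrightarrow> (\<forall>h\<in>H. \<forall>x \<in> space X. f (act X h x) = act Y h (f x))) \<and>
    (comods \<longrightarrow> (\<forall>x \<in> space X. lc Y (f x) = (id \<otimes>\<^sub>m f) (lc X x)))"
  by (cases "kind V"; cases "lin f")
    (auto simp: mor_def module_map_def comodule_map_iff image_subset_iff)

lemma mor_lin: "mor X Y f \<Longrightarrow> lin f"
  and mor_mem: "mor X Y f \<Longrightarrow> x \<in> space X \<Longrightarrow> f x \<in> space Y"
  and mor_act: "mor X Y f \<Longrightarrow> mods \<Longrightarrow> h \<in> H \<Longrightarrow> x \<in> space X \<Longrightarrow> f (act X h x) = act Y h (f x)"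
  and mor_lc: "mor X Y f \<Longrightarrow> comods \<Longrightarrow> x \<in> space X \<Longrightarrow> lc Y (f x) = (id \<otimes>\<^sub>m f) (lc X x)"
  by (auto simp: mor_iff)

lemma morI:
  assumes "lin f" "\<And>x. x \<in> space X \<Longrightarrow> f x \<in> space Y"
    "\<And>h x. mods \<Longrightarrow> h \<in> H \<Longrightarrow> x \<in> space X \<Longrightarrow> f (act X h x) = act Y h (f x)"
    "\<And>x. comods \<Longrightarrow> x \<in> space X \<Longrightarrow> lc Y (f x) = (id \<otimes>\<^sub>m f) (lc X x)"
  shows "mor X Y f"
  using assms by (auto simp: mor_iff)

lemma obj_subspace: "is_obj X \<Longrightarrow> subspace (space X)"
  by (simp add: is_obj_def)

lemma
  assumes "is_obj X" "mods"
  shows obj_bilin: "bilin (act X)" and obj_ac_mem: "z \<in> H \<otimes>\<^sub>s space X \<Longrightarrow> ac X z \<in> space X"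
    and obj_act_one: "x \<in> space X \<Longrightarrow> ac X (h_one \<otimes> x) = x"
    and obj_act_mult: "g \<in> H \<Longrightarrow> h \<in> H \<Longrightarrow> x \<in> space X \<Longrightarrow> ac X (g \<otimes> ac X (h \<otimes> x)) = ac X (mu (g \<otimes> h) \<otimes> x)"
  using assms by (auto simp: is_obj_iff module_axioms'_def)

lemma
  assumes "is_obj X" "comods"
  shows obj_lin_lc: "lin (lc X)" and obj_lc_mem: "x \<in> space X \<Longrightarrow> lc X x \<in> H \<otimes>\<^sub>s space X"
    and obj_lc_coassoc: "x \<in> space X \<Longrightarrow> \<alpha> ((dl \<otimes>\<^sub>m id) (lc X x)) = (id \<otimes>\<^sub>m lc X) (lc X x)"
    and obj_lc_counit: "x \<in> space X \<Longrightarrow> contract_left \<epsilon>\<^sub>H (lc X x) = x"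
  using assms by (auto simp: is_obj_iff comodule_axioms'_def)

lemma obj_act_mem: "is_obj X \<Longrightarrow> mods \<Longrightarrow> h \<in> H \<Longrightarrow> x \<in> space X \<Longrightarrow> act X h x \<in> space X"
  using obj_ac_mem[of X "h \<otimes> x"] by (simp add: ac_tensor obj_bilin ten_space_mem)

lemma obj_lin_ac: "is_obj X \<Longrightarrow> mods \<Longrightarrow> lin (ac X)"
  by (simp add: lin_ac obj_bilin)

lemma obj_lin_act: "is_obj X \<Longrightarrow> mods \<Longrightarrow> lin (act X h)"
  by (simp add: bilinD obj_bilin)

lemma ac_eq: "is_obj X \<Longrightarrow> mods \<Longrightarrow> ac X (h \<otimes> x) = act X h x"
  by (simp add: ac_tensor obj_bilin)

lemma obj_crossed: "is_obj X \<Longrightarrow> mods \<Longrightarrow> comods \<Longrightarrow> crossed_on H mu dl (space X) (ac X) (lc X)"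
  by (simp add: is_obj_iff)

section \<open>Tensor products of objects and the unit object\<close>

lemma space_ten [simp]: "space (X \<otimes>\<^sub>o Y) = space X \<otimes>\<^sub>s space Y"
  by (simp add: ten_obj_def)

lemma space_unit [simp]: "space unit_obj = span {unity V}"
  by (simp add: unit_obj_def)

text \<open>Replaces the lift in the diagonal action by a composite of linear maps, which can be
  compared on pure tensors.\<close>

lemma act_ten:
  assumes "bilin (act X)" "bilin (act Y)"
  shows "act (X \<otimes>\<^sub>o Y) h z = (ac X \<otimes>\<^sub>m ac Y) (mid flip (hcomult V h \<otimes> z))"
proof -
  note l = bilinD[OF assms(1)] bilinD[OF assms(2)]
  have b: "bilin (\<lambda>a b. (act X a \<otimes>\<^sub>m act Y b) z)" for z
    by (rule bilinI; rule bilinD(2)[OF ten_param(1)[OF assms(1)]] bilinD(2)[OF ten_param(2)[OF assms(2)]]; simp add: l)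
  have "lift (\<lambda>a b. (act X a \<otimes>\<^sub>m act Y b) z) u = (ac X \<otimes>\<^sub>m ac Y) (mid flip (u \<otimes> z))" for u
  proof (rule tensor_ext[where f="lift (\<lambda>a b. (act X a \<otimes>\<^sub>m act Y b) z)"])
    show "lift (\<lambda>a b. (act X a \<otimes>\<^sub>m act Y b) z) (a \<otimes> b) = (ac X \<otimes>\<^sub>m ac Y) (mid flip ((a \<otimes> b) \<otimes> z))" for a b
      unfolding lift_tensor[OF b]
      by (rule tensor_ext[where z=z]; simp add: l lin_intros lin_ac assms ac_tensor ten_tensor)
  qed (simp_all add: lin_lift[OF b] lin_intros lin_ac assms)
  then show ?thesis by (simp add: ten_obj_def)
qed

lemma
  assumes "bilin (act X)" "bilin (act Y)"
  shows bilin_ten: "bilin (act (X \<otimes>\<^sub>o Y))"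
    and ac_ten: "ac (X \<otimes>\<^sub>o Y) w = diag_act (hcomult V) (ac X) (ac Y) w"
proof -
  note l = lin_ac[OF assms(1)] lin_ac[OF assms(2)] lin_hcomult lin_compose[OF lin_hcomult]
  show b: "bilin (act (X \<otimes>\<^sub>o Y))"
    by (rule bilinI) (simp_all add: act_ten[OF assms, abs_def] l lin_intros)
  show "ac (X \<otimes>\<^sub>o Y) w = diag_act (hcomult V) (ac X) (ac Y) w"
    by (rule tensor_ext[where z=w])
      (simp_all add: lin_ac[OF b] ac_tensor[OF b] act_ten[OF assms] l lin_intros diag_act_def ten_tensor)
qed

lemma lc_ten:
  assumes "lin (lc X)" "lin (lc Y)"
  shows "lc (X \<otimes>\<^sub>o Y) z = diag_coact (hmult V) (lc X) (lc Y) z"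
proof (cases "side V")
  case Left
  then show ?thesis by (simp add: lc_def ten_obj_def diag_coact_def)
next
  case Right
  have c: "coact X = (\<lambda>x. flip (lc X x))" "coact Y = (\<lambda>x. flip (lc Y x))" by (auto simp: lc_def Right)
  have *: "mid flip (flip u \<otimes> flip v) = flip (mid flip (u \<otimes> v))" for u v
  proof (rule tensor_ext[where z=u])
    show "mid flip (flip (a \<otimes> b) \<otimes> flip v) = flip (mid flip ((a \<otimes> b) \<otimes> v))" for a b
      by (rule tensor_ext[where z=v]; simp add: lin_intros)
  qed (simp_all add: lin_intros)
  have "flip ((id \<otimes>\<^sub>m hmult V) (mid flip ((coact X \<otimes>\<^sub>m coact Y) z))) = diag_coact (hmult V) (lc X) (lc Y) z"
    by (rule tensor_ext[where z=z])
      (simp_all add: c assms lin_intros lin_hmult ten_tensor diag_coact_def * flip_ten lin_compose[OF assms(1)]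
        lin_compose[OF lin_flip assms(1)] lin_compose[OF lin_flip assms(2)] id_def)
  then show ?thesis by (simp add: lc_def ten_obj_def Right)
qed

text \<open>The passage from (a \<otimes> x) \<otimes> (b \<otimes> y) to ab \<otimes> (x \<otimes>
  y), which multiplies the coaction legs. It has the same form for both sides, since on the right
  the legs are multiplied in the order of the factors as well.\<close>

abbreviation N :: "'v \<Rightarrow> 'v" where "N w \<equiv> (hmult V \<otimes>\<^sub>m id) (mid flip w)"

lemma lc_ten_tensor:
  assumes "is_obj X" "is_obj Y" comods
  shows "lc (X \<otimes>\<^sub>o Y) (x \<otimes> y) = N (lc X x \<otimes> lc Y y)"
  using assms by (simp add: lc_ten obj_lin_lc diag_coact_def ten_tensor)

lemma module_ten:
  assumes X: "is_obj X" and Y: "is_obj Y" and mods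
  shows "module_axioms' (X \<otimes>\<^sub>o Y)"
proof -
  note b = obj_bilin[OF X \<open>mods\<close>] obj_bilin[OF Y \<open>mods\<close>]
  note l = lin_ac[OF b(1)] lin_ac[OF b(2)] lin_compose[OF lin_ac[OF b(1)]] lin_compose[OF lin_ac[OF b(2)]]
    lin_hcomult lin_compose[OF lin_hcomult] lin_mu lin_compose[OF lin_mu]
  let ?F = "\<lambda>u z. (ac X \<otimes>\<^sub>m ac Y) (mid flip (u \<otimes> z))"
  have ac: "ac (X \<otimes>\<^sub>o Y) (h \<otimes> z) = ?F (hcomult V h) z" for h z
    by (simp add: ac_ten[OF b] diag_act_def ten_tensor l lin_intros)
  have mem: "ac (X \<otimes>\<^sub>o Y) w \<in> space X \<otimes>\<^sub>s space Y" if "w \<in> H \<otimes>\<^sub>s (space X \<otimes>\<^sub>s space Y)" for w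
  proof -
    have "(hcomult V \<otimes>\<^sub>m id) w \<in> (H \<otimes>\<^sub>s H) \<otimes>\<^sub>s (space X \<otimes>\<^sub>s space Y)"
      by (rule ten_map[OF that lin_hcomult lin_id(1)]) (auto simp: hcomult_mem)
    then show ?thesis
      unfolding ac_ten[OF b] diag_act_def
      by (intro ten_map[OF mid_flip_mem]) (auto simp: l obj_ac_mem X Y \<open>mods\<close>)
  qed
  have one: "?F (h_one \<otimes> h_one) z = z" if "z \<in> space X \<otimes>\<^sub>s space Y" for z
    by (rule ten_eq[OF that]; simp add: l lin_intros ten_tensor obj_act_one X Y \<open>mods\<close>)
  have mult: "?F u (?F v z) = ?F ((mu \<otimes>\<^sub>m mu) (mid flip (u \<otimes> v))) z"
    if u: "u \<in> H \<otimes>\<^sub>s H" and v: "v \<in> H \<otimes>\<^sub>s H" and z: "z \<in> space X \<otimes>\<^sub>s space Y" for u v z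
  proof (rule ten_eq[OF u])
    fix a b assume ab: "a \<in> H" "b \<in> H"
    show "?F (a \<otimes> b) (?F v z) = ?F ((mu \<otimes>\<^sub>m mu) (mid flip ((a \<otimes> b) \<otimes> v))) z"
    proof (rule ten_eq[OF v])
      show "?F (a \<otimes> b) (?F (c \<otimes> d) z) = ?F ((mu \<otimes>\<^sub>m mu) (mid flip ((a \<otimes> b) \<otimes> (c \<otimes> d)))) z"
        if cd: "c \<in> H" "d \<in> H" for c d
        by (rule ten_eq[OF z]; simp add: l lin_intros ten_tensor obj_act_mult X Y ab cd \<open>mods\<close>)
    qed (simp_all add: l lin_intros)
  qed (simp_all add: l lin_intros)
  show ?thesis
    by (auto simp: module_axioms'_def bilin_ten[OF b] mem ac hcomult_one one mult hcomult_mem hcomult_mu)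
qed

lemma comodule_ten:
  assumes X: "is_obj X" and Y: "is_obj Y" and comods
  shows "comodule_axioms' (X \<otimes>\<^sub>o Y)"
proof -
  note l = obj_lin_lc[OF X \<open>comods\<close>] obj_lin_lc[OF Y \<open>comods\<close>] lin_hmult lin_compose[OF lin_hmult] lin_dl lin_compose[OF lin_dl]
    lin_compose[OF obj_lin_lc[OF X \<open>comods\<close>]] lin_compose[OF obj_lin_lc[OF Y \<open>comods\<close>]]
  note lc = lc_ten[OF l(1,2)]
  have lin: "lin (lc (X \<otimes>\<^sub>o Y))" by (simp add: lc[abs_def] l lin_intros)
  have mem: "lc (X \<otimes>\<^sub>o Y) z \<in> H \<otimes>\<^sub>s (space X \<otimes>\<^sub>s space Y)" if "z \<in> space X \<otimes>\<^sub>s space Y" for z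
  proof -
    have "(lc X \<otimes>\<^sub>m lc Y) z \<in> (H \<otimes>\<^sub>s space X) \<otimes>\<^sub>s (H \<otimes>\<^sub>s space Y)"
      by (rule ten_map[OF that l(1,2)]) (auto simp: obj_lc_mem X Y \<open>comods\<close>)
    then show ?thesis
      unfolding lc diag_coact_def
      by (intro ten_map[OF mid_flip_mem]) (auto simp: l lin_intros intro: ten_mem[OF _ lin_hmult subspace_H] hmult_mem)
  qed
  \<comment> \<open>\<open>?K\<close> multiplies two pairs of coaction legs at once. Each side of
    coassociativity for the product is \<open>?K\<close> of the corresponding sides for
    \<open>X\<close> and \<open>Y\<close>.\<close>
  let ?K = "\<lambda>w. (hmult V \<otimes>\<^sub>m (\<lambda>w. N w)) (mid flip w)"
  have coassoc: "\<alpha> ((dl \<otimes>\<^sub>m id) (lc (X \<otimes>\<^sub>o Y) z)) = (id \<otimes>\<^sub>m lc (X \<otimes>\<^sub>o Y)) (lc (X \<otimes>\<^sub>o Y) z)"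
    if z: "z \<in> space X \<otimes>\<^sub>s space Y" for z
  proof (rule ten_eq[OF z])
    fix x y assume x: "x \<in> space X" and y: "y \<in> space Y"
    have 1: "\<alpha> ((dl \<otimes>\<^sub>m id) (N (u \<otimes> v))) = ?K (\<alpha> ((dl \<otimes>\<^sub>m id) u) \<otimes> \<alpha> ((dl \<otimes>\<^sub>m id) v))"
      if u: "u \<in> H \<otimes>\<^sub>s space X" and v: "v \<in> H \<otimes>\<^sub>s space Y" for u v
    proof (rule ten_eq[OF u])
      fix a x' assume a: "a \<in> H"
      show "\<alpha> ((dl \<otimes>\<^sub>m id) (N ((a \<otimes> x') \<otimes> v))) = ?K (\<alpha> ((dl \<otimes>\<^sub>m id) (a \<otimes> x')) \<otimes> \<alpha> ((dl \<otimes>\<^sub>m id) v))"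
      proof (rule ten_eq[OF v])
        fix b y' assume b: "b \<in> H"
        have "\<alpha> ((hmult V \<otimes>\<^sub>m hmult V) (mid flip (p \<otimes> q)) \<otimes> (x' \<otimes> y')) = ?K (\<alpha> (p \<otimes> x') \<otimes> \<alpha> (q \<otimes> y'))" for p q
        proof (rule tensor_ext[where z=p])
          show "\<alpha> ((hmult V \<otimes>\<^sub>m hmult V) (mid flip ((c \<otimes> d) \<otimes> q)) \<otimes> (x' \<otimes> y')) = ?K (\<alpha> ((c \<otimes> d) \<otimes> x') \<otimes> \<alpha> (q \<otimes> y'))" for c d
            by (rule tensor_ext[where z=q]; simp add: l lin_intros ten_tensor)
        qed (simp_all add: l lin_intros)
        then show "\<alpha> ((dl \<otimes>\<^sub>m id) (N ((a \<otimes> x') \<otimes> (b \<otimes> y')))) = ?K (\<alpha> ((dl \<otimes>\<^sub>m id) (a \<otimes> x')) \<otimes> \<alpha> ((dl \<otimes>\<^sub>m id) (b \<otimes> y')))"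
          by (simp add: l lin_intros ten_tensor dl_hmult a b)
      qed (simp_all add: l lin_intros)
    qed (simp_all add: l lin_intros)
    have 2: "(id \<otimes>\<^sub>m lc (X \<otimes>\<^sub>o Y)) (N (u \<otimes> v)) = ?K ((id \<otimes>\<^sub>m lc X) u \<otimes> (id \<otimes>\<^sub>m lc Y) v)" for u v
    proof (rule tensor_ext[where z=u])
      show "(id \<otimes>\<^sub>m lc (X \<otimes>\<^sub>o Y)) (N ((a \<otimes> x) \<otimes> v)) = ?K ((id \<otimes>\<^sub>m lc X) (a \<otimes> x) \<otimes> (id \<otimes>\<^sub>m lc Y) v)" for a x
        by (rule tensor_ext[where z=v]; simp add: l lin_intros ten_tensor lin lc diag_coact_def id_def)
    qed (simp_all add: l lin_intros lin)
    have z': "lc (X \<otimes>\<^sub>o Y) (x \<otimes> y) = N (lc X x \<otimes> lc Y y)"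
      by (rule lc_ten_tensor[OF X Y \<open>comods\<close>])
    show "\<alpha> ((dl \<otimes>\<^sub>m id) (lc (X \<otimes>\<^sub>o Y) (x \<otimes> y))) = (id \<otimes>\<^sub>m lc (X \<otimes>\<^sub>o Y)) (lc (X \<otimes>\<^sub>o Y) (x \<otimes> y))"
      unfolding z' 1[OF obj_lc_mem[OF X \<open>comods\<close> x] obj_lc_mem[OF Y \<open>comods\<close> y]] 2
      by (simp only: obj_lc_coassoc[OF X \<open>comods\<close> x] obj_lc_coassoc[OF Y \<open>comods\<close> y])
  qed (simp_all add: l lin lin_intros lin_compose[OF lin])
  have counit: "contract_left \<epsilon>\<^sub>H (lc (X \<otimes>\<^sub>o Y) z) = z" if z: "z \<in> space X \<otimes>\<^sub>s space Y" for z
  proof (rule ten_eq[OF z])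
    fix x y assume x: "x \<in> space X" and y: "y \<in> space Y"
    note c = lin_contract_left[OF functional_hcounit] lin_compose[OF lin_contract_left[OF functional_hcounit]]
      contract_left_tensor[OF functional_hcounit]
    have "contract_left \<epsilon>\<^sub>H (N (u \<otimes> v)) = contract_left \<epsilon>\<^sub>H u \<otimes> contract_left \<epsilon>\<^sub>H v"
      if u: "u \<in> H \<otimes>\<^sub>s space X" and v: "v \<in> H \<otimes>\<^sub>s space Y" for u v
    proof (rule ten_eq[OF u])
      show "contract_left \<epsilon>\<^sub>H (N ((a \<otimes> x) \<otimes> v)) = contract_left \<epsilon>\<^sub>H (a \<otimes> x) \<otimes> contract_left \<epsilon>\<^sub>H v"
        if a: "a \<in> H" "x \<in> space X" for a x
        by (rule ten_eq[OF v]; simp add: l lin_intros ten_tensor c a hcounit_mult)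
    qed (simp_all add: l lin_intros c)
    from this[OF obj_lc_mem[OF X \<open>comods\<close> x] obj_lc_mem[OF Y \<open>comods\<close> y]]
    show "contract_left \<epsilon>\<^sub>H (lc (X \<otimes>\<^sub>o Y) (x \<otimes> y)) = x \<otimes> y"
      by (simp add: lc_ten_tensor[OF X Y \<open>comods\<close>] obj_lc_counit X Y x y \<open>comods\<close>)
  qed (simp_all add: lin lin_intros lin_compose[OF lin_contract_left[OF functional_hcounit]])
  show ?thesis
    by (simp add: comodule_axioms'_def lin mem coassoc counit)
qed

text \<open>For right crossed modules the left-handed translation reverses the factors:
  \<open>crossed_on_diag\<close> is applied to \<open>Y\<close> and \<open>X\<close>, and the result
  is carried back along \<open>flip\<close>.\<close>

lemma crossed_ten:
  assumes X: "is_obj X" and Y: "is_obj Y" and mods and comods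
  shows "crossed_on H mu dl (space X \<otimes>\<^sub>s space Y) (ac (X \<otimes>\<^sub>o Y)) (lc (X \<otimes>\<^sub>o Y))"
proof -
  note b = obj_bilin[OF X \<open>mods\<close>] obj_bilin[OF Y \<open>mods\<close>]
  note l = lin_ac[OF b(1)] lin_ac[OF b(2)] obj_lin_lc[OF X \<open>comods\<close>] obj_lin_lc[OF Y \<open>comods\<close>]
    lin_mu lin_compose[OF lin_mu] lin_dl lin_compose[OF lin_dl] lin_hcomult lin_hmult
  have ac_l: "ac (X \<otimes>\<^sub>o Y) = diag_act (hcomult V) (ac X) (ac Y)"
    and lc_l: "lc (X \<otimes>\<^sub>o Y) = diag_coact (hmult V) (lc X) (lc Y)"
    by (auto simp: ac_ten[OF b] lc_ten[OF l(3,4)])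
  note diag = crossed_on_diag[OF mu_algebra dl_coalgebra _ _ _ _ _ _ _ _ obj_crossed obj_crossed]
  show ?thesis
  proof (cases "side V")
    case Left
    then have "mu = hmult V" "dl = hcomult V" by (simp_all add: mu_def dl_def)
    then show ?thesis
      using diag[of X Y] by (simp add: ac_l lc_l l X Y \<open>mods\<close> \<open>comods\<close> obj_ac_mem obj_lc_mem)
  next
    case Right
    let ?A = "diag_act dl (ac Y) (ac X)" and ?L = "diag_coact mu (lc Y) (lc X)"
    have C: "crossed_on H mu dl (space Y \<otimes>\<^sub>s space X) ?A ?L"
      using diag[of Y X] by (simp add: l X Y \<open>mods\<close> \<open>comods\<close> obj_ac_mem obj_lc_mem)
    have linAL: "lin ?A" "lin ?L" by (simp_all add: l lin_intros)
    note l = l linAL lin_compose[OF linAL(1)] lin_compose[OF linAL(2)]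
    have A: "ac (X \<otimes>\<^sub>o Y) (h \<otimes> z) = flip (?A (h \<otimes> flip z))" for h z
    proof -
      have "(ac X \<otimes>\<^sub>m ac Y) (mid flip (flip u \<otimes> z)) = flip ((ac Y \<otimes>\<^sub>m ac X) (mid flip (u \<otimes> flip z)))" for u
      proof (rule tensor_ext[where z=u])
        show "(ac X \<otimes>\<^sub>m ac Y) (mid flip (flip (a \<otimes> b) \<otimes> z)) = flip ((ac Y \<otimes>\<^sub>m ac X) (mid flip ((a \<otimes> b) \<otimes> flip z)))" for a b
          by (rule tensor_ext[where z=z]; simp add: l lin_intros ten_tensor)
      qed (simp_all add: l lin_intros)
      from this[of "dl h"] show ?thesis
        by (simp add: ac_l diag_act_def ten_tensor l lin_intros) (simp add: dl_def Right)
    qed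
    have L: "lc (X \<otimes>\<^sub>o Y) z = (id \<otimes>\<^sub>m flip) (?L (flip z))" for z
    proof -
      have "N (u \<otimes> v) = (id \<otimes>\<^sub>m flip) ((mu \<otimes>\<^sub>m id) (mid flip (v \<otimes> u)))" for u v
      proof (rule tensor_ext[where z=u])
        show "N ((a \<otimes> b) \<otimes> v) = (id \<otimes>\<^sub>m flip) ((mu \<otimes>\<^sub>m id) (mid flip (v \<otimes> (a \<otimes> b))))" for a b
          by (rule tensor_ext[where z=v]; simp add: l lin_intros ten_tensor) (simp add: mu_def Right)
      qed (simp_all add: l lin_intros)
      note * = this
      show ?thesis
        by (rule tensor_ext[where z=z]; simp add: lc_l l lin_intros diag_coact_def ten_tensor *[unfolded id_def] id_def)
    qed
    show ?thesis
      unfolding crossed_on_def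
    proof (intro ballI)
      fix h z assume h: "h \<in> H" and z: "z \<in> space X \<otimes>\<^sub>s space Y"
      have 1: "(mu \<otimes>\<^sub>m ac (X \<otimes>\<^sub>o Y)) (mid flip (u \<otimes> (id \<otimes>\<^sub>m flip) v)) = (id \<otimes>\<^sub>m flip) ((mu \<otimes>\<^sub>m ?A) (mid flip (u \<otimes> v)))" for u v
      proof (rule tensor_ext[where z=u])
        show "(mu \<otimes>\<^sub>m ac (X \<otimes>\<^sub>o Y)) (mid flip ((a \<otimes> b) \<otimes> (id \<otimes>\<^sub>m flip) v)) = (id \<otimes>\<^sub>m flip) ((mu \<otimes>\<^sub>m ?A) (mid flip ((a \<otimes> b) \<otimes> v)))" for a b
          by (rule tensor_ext[where z=v]; simp add: l lin_intros ten_tensor lin_ac bilin_ten b A)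
      qed (simp_all add: l lin_intros lin_ac bilin_ten b)
      have 2: "(mu \<otimes>\<^sub>m id) (swap (((\<lambda>z. lc (X \<otimes>\<^sub>o Y) (ac (X \<otimes>\<^sub>o Y) z)) \<otimes>\<^sub>m id) (swap (u \<otimes> z)))) =
        (id \<otimes>\<^sub>m flip) ((mu \<otimes>\<^sub>m id) (swap (((\<lambda>z. ?L (?A z)) \<otimes>\<^sub>m id) (swap (u \<otimes> flip z)))))" for u
      proof -
        have LA: "lin (\<lambda>z. lc (X \<otimes>\<^sub>o Y) (ac (X \<otimes>\<^sub>o Y) z))"
          unfolding ac_l lc_l by (intro lin_diag_apply lin_diag l)
        show ?thesis
        proof (rule tensor_ext[where z=u])
          fix a c
          have "(mu \<otimes>\<^sub>m id) (swap ((id \<otimes>\<^sub>m flip) s \<otimes> c)) = (id \<otimes>\<^sub>m flip) ((mu \<otimes>\<^sub>m id) (swap (s \<otimes> c)))" for s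
            by (rule tensor_ext[where z=s]; simp add: l lin_intros ten_tensor)
          then have *: "(mu \<otimes>\<^sub>m id) (swap (lc (X \<otimes>\<^sub>o Y) (ac (X \<otimes>\<^sub>o Y) (a \<otimes> z)) \<otimes> c)) =
            (id \<otimes>\<^sub>m flip) ((mu \<otimes>\<^sub>m id) (swap (?L (?A (a \<otimes> flip z)) \<otimes> c)))" for z
            by (simp add: A L)
          show "(mu \<otimes>\<^sub>m id) (swap (((\<lambda>z. lc (X \<otimes>\<^sub>o Y) (ac (X \<otimes>\<^sub>o Y) z)) \<otimes>\<^sub>m id) (swap ((a \<otimes> c) \<otimes> z)))) =
            (id \<otimes>\<^sub>m flip) ((mu \<otimes>\<^sub>m id) (swap (((\<lambda>z. ?L (?A z)) \<otimes>\<^sub>m id) (swap ((a \<otimes> c) \<otimes> flip z)))))"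
            using * by (simp add: ten_tensor[OF LA] ten_tensor l lin_intros)
        qed (simp_all add: l lin_intros lin_ten_apply[OF LA])
      qed
      show "(mu \<otimes>\<^sub>m ac (X \<otimes>\<^sub>o Y)) (mid flip (dl h \<otimes> lc (X \<otimes>\<^sub>o Y) z)) =
        (mu \<otimes>\<^sub>m id) (swap (((\<lambda>z. lc (X \<otimes>\<^sub>o Y) (ac (X \<otimes>\<^sub>o Y) z)) \<otimes>\<^sub>m id) (swap (dl h \<otimes> z))))"
        unfolding 2 L[of z] 1 using C h flip_mem[OF z] by (simp add: crossed_on_def)
    qed
  qed
qed

lemma obj_ten: "is_obj X \<Longrightarrow> is_obj Y \<Longrightarrow> is_obj (X \<otimes>\<^sub>o Y)"
  by (subst is_obj_iff) (simp add: module_ten comodule_ten crossed_ten)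

lemmas contract_simps = lin_contract_left[OF functional_hcounit] lin_compose[OF lin_contract_left[OF functional_hcounit]]
  contract_left_tensor[OF functional_hcounit] lin_contract_right[OF functional_hcounit]
  lin_compose[OF lin_contract_right[OF functional_hcounit]] contract_right_tensor[OF functional_hcounit]

lemma bilin_unit: "bilin (act unit_obj)"
  by (auto simp: unit_obj_def bilin_def lin_iff algebra_simps functional_add[OF functional_hcounit]
      functional_scale[OF functional_hcounit])

lemma ac_unit: "ac unit_obj z = contract_left \<epsilon>\<^sub>H z"
  by (rule tensor_ext[where z=z]; simp add: lin_ac bilin_unit ac_tensor contract_simps lin_intros)
    (simp add: unit_obj_def)

lemma ac_unit_fun: "ac unit_obj = contract_left \<epsilon>\<^sub>H"
  by (rule ext) (rule ac_unit)

lemma lc_unit: "lc unit_obj x = h_one \<otimes> x"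
  by (cases "side V") (simp_all add: lc_def unit_obj_def)

lemma obj_unit: "is_obj unit_obj"
proof -
  have 1: "contract_left \<epsilon>\<^sub>H z \<in> span {unity V}" if "z \<in> H \<otimes>\<^sub>s span {unity V}" for z
    by (rule ten_mem[OF that]) (auto simp: contract_simps span_scale)
  have 2: "(mu \<otimes>\<^sub>m contract_left \<epsilon>\<^sub>H) (mid flip (u \<otimes> (h_one \<otimes> x))) = contract_right \<epsilon>\<^sub>H u \<otimes> x"
    "(mu \<otimes>\<^sub>m id) (swap (((\<lambda>z. h_one \<otimes> contract_left \<epsilon>\<^sub>H z) \<otimes>\<^sub>m id) (swap (u \<otimes> x)))) = contract_left \<epsilon>\<^sub>H u \<otimes> x"
    if "u \<in> H \<otimes>\<^sub>s H" for u x
    by (rule ten_eq[OF that]; simp add: contract_simps lin_intros lin_mu lin_compose[OF lin_mu] ten_tensor mu_one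
        lin_simps[OF lin_swap] lin_simps[OF lin_ten[OF lin_mu lin_id(2)]])+
  have "crossed_on H mu dl (span {unity V}) (ac unit_obj) (lc unit_obj)"
    using 2 by (simp add: crossed_on_def ac_unit_fun lc_unit dl_mem dl_counit)
  then show ?thesis
    by (auto simp: is_obj_iff module_axioms'_def comodule_axioms'_def bilin_unit ac_unit lc_unit 1 contract_simps
        hcounit_one hcounit_mu lin_intros ten_space_mem h_one dl_one ten_tensor lin_dl lc_unit[abs_def] lin_simps[OF lin_contract_left[OF functional_hcounit]] mult.commute)
qed

section \<open>Closure properties of morphisms\<close>

lemma mor_id [simp]: "mor X X id" "mor X X (\<lambda>x. x)"
  by (auto simp: mor_iff lin_intros id_def)

lemma mor_comp: "mor X Y f \<Longrightarrow> mor Y Z g \<Longrightarrow> mor X Z (\<lambda>x. g (f x))"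
proof (rule morI)
  assume f: "mor X Y f" and g: "mor Y Z g"
  note l = mor_lin[OF f] mor_lin[OF g]
  show "lin (\<lambda>x. g (f x))" by (rule lin_compose[OF l(2,1)])
  show "lc Z (g (f x)) = (id \<otimes>\<^sub>m (\<lambda>x. g (f x))) (lc X x)" if comods "x \<in> space X" for x
    using that by (simp add: mor_lc[OF g] mor_lc[OF f] mor_mem[OF f] ten_comp l lin_intros) (simp add: id_def)
qed (auto simp: mor_mem mor_act)

lemma mor_o: "mor X Y f \<Longrightarrow> mor Y Z g \<Longrightarrow> mor X Z (g \<circ> f)"
  using mor_comp[of X Y f Z g] by (simp add: comp_def)

text \<open>Maps are prescribed on subspaces only, so being a morphism must not depend on the values
  elsewhere. For the coaction this rests on its taking values in \<open>H\<close> tensor X.\<close>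

lemma mor_cong:
  assumes "is_obj X" "mor X Y f" "lin g" "\<And>x. x \<in> space X \<Longrightarrow> g x = f x"
  shows "mor X Y g"
proof (rule morI)
  show "lc Y (g x) = (id \<otimes>\<^sub>m g) (lc X x)" if comods and x: "x \<in> space X" for x
  proof -
    have "(id \<otimes>\<^sub>m g) (lc X x) = (id \<otimes>\<^sub>m f) (lc X x)"
      by (rule ten_cong[OF obj_lc_mem[OF assms(1) that]]) (auto simp: assms lin_intros mor_lin[OF assms(2)])
    then show ?thesis using that by (simp add: assms mor_lc[OF assms(2)])
  qed
qed (use assms in \<open>auto simp: mor_mem mor_act obj_act_mem\<close>)

lemma ten_plus:
  assumes "lin f" "lin g" "lin h"
  shows "(h \<otimes>\<^sub>m (\<lambda>x. f x + g x)) z = (h \<otimes>\<^sub>m f) z + (h \<otimes>\<^sub>m g) z"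
    "(h \<otimes>\<^sub>m (\<lambda>x. f x - g x)) z = (h \<otimes>\<^sub>m f) z - (h \<otimes>\<^sub>m g) z"
  by (rule tensor_ext[where z=z]; simp add: assms lin_intros ten_tensor)+

lemma mor_zero: "is_obj Y \<Longrightarrow> mor X Y (\<lambda>x. 0)"
proof (rule morI)
  have "(id \<otimes>\<^sub>m (\<lambda>x. 0)) z = 0" for z
    by (rule tensor_ext[where z=z]; simp add: lin_intros ten_tensor)
  then show "lc Y 0 = (id \<otimes>\<^sub>m (\<lambda>x. 0)) (lc X x)" if "is_obj Y" comods for x
    using that by (simp add: lin_0 obj_lin_lc)
qed (auto simp: lin_intros obj_subspace subspace_0 lin_0 obj_lin_act)

lemma mor_add:
  assumes "is_obj Y" and f: "mor X Y f" and g: "mor X Y g"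
  shows "mor X Y (\<lambda>x. f x + g x)" "mor X Y (\<lambda>x. f x - g x)"
proof -
  note l = mor_lin[OF f] mor_lin[OF g] lin_simps[OF obj_lin_act[OF assms(1)]] lin_simps[OF obj_lin_lc[OF assms(1)]]
  show "mor X Y (\<lambda>x. f x + g x)" "mor X Y (\<lambda>x. f x - g x)"
    by (rule morI; simp add: l lin_intros subspace_add subspace_diff obj_subspace assms mor_mem[OF f] mor_mem[OF g]
      mor_act[OF f] mor_act[OF g] mor_lc[OF f] mor_lc[OF g] ten_plus)+
qed

lemma mor_inverse:
  assumes X: "is_obj X" and Y: "is_obj Y" and f: "mor X Y f" and "lin g"
    and g: "\<And>y. y \<in> space Y \<Longrightarrow> g y \<in> space X" "\<And>y. y \<in> space Y \<Longrightarrow> f (g y) = y"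
      "\<And>x. x \<in> space X \<Longrightarrow> g (f x) = x"
  shows "mor Y X g"
proof (rule morI)
  show "g (act Y h y) = act X h (g y)" if "mods" "h \<in> H" "y \<in> space Y" for h y
    using that g(3)[of "act X h (g y)"] mor_act[OF f that(1,2) g(1)[OF that(3)]]
    by (simp add: obj_act_mem X g)
  show "lc X (g y) = (id \<otimes>\<^sub>m g) (lc Y y)" if comods and y: "y \<in> space Y" for y
  proof -
    have "(id \<otimes>\<^sub>m g) (lc Y y) = (id \<otimes>\<^sub>m g) ((id \<otimes>\<^sub>m f) (lc X (g y)))"
      using mor_lc[OF f that(1) g(1)[OF y]] by (simp add: g y)
    also have "\<dots> = lc X (g y)"
      by (rule ten_eq[OF obj_lc_mem[OF X that(1) g(1)[OF y]]])
        (simp_all add: lin_intros assms(4) mor_lin[OF f] ten_tensor g)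
    finally show ?thesis by simp
  qed
qed (use assms in auto)

lemma mor_ten:
  assumes objs: "is_obj X" "is_obj Y" "is_obj X'" "is_obj Y'" and f: "mor X X' f" and g: "mor Y Y' g"
  shows "mor (X \<otimes>\<^sub>o Y) (X' \<otimes>\<^sub>o Y') (f \<otimes>\<^sub>m g)"
proof (rule morI)
  note l = mor_lin[OF f] mor_lin[OF g] lin_compose[OF mor_lin[OF f]] lin_compose[OF mor_lin[OF g]]
  show "lin (f \<otimes>\<^sub>m g)" by (simp add: l lin_intros)
  show "(f \<otimes>\<^sub>m g) z \<in> space (X' \<otimes>\<^sub>o Y')" if "z \<in> space (X \<otimes>\<^sub>o Y)" for z
    using that by (auto intro!: ten_map l mor_mem[OF f] mor_mem[OF g])
  show "(f \<otimes>\<^sub>m g) (act (X \<otimes>\<^sub>o Y) h z) = act (X' \<otimes>\<^sub>o Y') h ((f \<otimes>\<^sub>m g) z)"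
    if mods and h: "h \<in> H" and z: "z \<in> space (X \<otimes>\<^sub>o Y)" for h z
  proof -
    note ll = l objs[THEN obj_lin_ac, OF \<open>mods\<close>] objs[THEN obj_lin_ac, OF \<open>mods\<close>, THEN lin_compose]
    have "(f \<otimes>\<^sub>m g) ((ac X \<otimes>\<^sub>m ac Y) (mid flip (u \<otimes> z))) = (ac X' \<otimes>\<^sub>m ac Y') (mid flip (u \<otimes> (f \<otimes>\<^sub>m g) z))"
      if u: "u \<in> H \<otimes>\<^sub>s H" for u
    proof (rule ten_eq[OF u])
      fix a b assume ab: "a \<in> H" "b \<in> H"
      show "(f \<otimes>\<^sub>m g) ((ac X \<otimes>\<^sub>m ac Y) (mid flip ((a \<otimes> b) \<otimes> z))) = (ac X' \<otimes>\<^sub>m ac Y') (mid flip ((a \<otimes> b) \<otimes> (f \<otimes>\<^sub>m g) z))"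
        by (rule ten_eq[OF z[unfolded space_ten]]; simp add: ll lin_intros ten_tensor ab ac_eq objs \<open>mods\<close>
          mor_act[OF f] mor_act[OF g])
    qed (simp_all add: ll lin_intros)
    then show ?thesis using h by (simp add: act_ten obj_bilin objs \<open>mods\<close> hcomult_mem)
  qed
  show "lc (X' \<otimes>\<^sub>o Y') ((f \<otimes>\<^sub>m g) z) = (id \<otimes>\<^sub>m (f \<otimes>\<^sub>m g)) (lc (X \<otimes>\<^sub>o Y) z)"
    if comods and z: "z \<in> space (X \<otimes>\<^sub>o Y)" for z
  proof (rule ten_eq[OF z[unfolded space_ten]])
    have lcs: "lin (lc (X \<otimes>\<^sub>o Y))" "lin (lc (X' \<otimes>\<^sub>o Y'))" by (simp_all add: obj_lin_lc obj_ten objs \<open>comods\<close>)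
    show "lin (\<lambda>z. lc (X' \<otimes>\<^sub>o Y') ((f \<otimes>\<^sub>m g) z))" "lin (\<lambda>z. (id \<otimes>\<^sub>m (f \<otimes>\<^sub>m g)) (lc (X \<otimes>\<^sub>o Y) z))"
      by (intro lin_compose[OF lcs(2)] lin_intros l lcs)+
    have "N ((id \<otimes>\<^sub>m f) u \<otimes> (id \<otimes>\<^sub>m g) v) = (id \<otimes>\<^sub>m (f \<otimes>\<^sub>m g)) (N (u \<otimes> v))" for u v
    proof (rule tensor_ext[where z=u])
      show "N ((id \<otimes>\<^sub>m f) (a \<otimes> b) \<otimes> (id \<otimes>\<^sub>m g) v) = (id \<otimes>\<^sub>m (f \<otimes>\<^sub>m g)) (N ((a \<otimes> b) \<otimes> v))" for a b
        by (rule tensor_ext[where z=v]; simp add: l lin_intros lin_hmult ten_tensor)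
    qed (simp_all add: l lin_intros lin_hmult)
    then show "lc (X' \<otimes>\<^sub>o Y') ((f \<otimes>\<^sub>m g) (x \<otimes> y)) = (id \<otimes>\<^sub>m (f \<otimes>\<^sub>m g)) (lc (X \<otimes>\<^sub>o Y) (x \<otimes> y))"
      if "x \<in> space X" "y \<in> space Y" for x y
      using that by (simp add: ten_tensor l lc_ten_tensor objs \<open>comods\<close> mor_lc[OF f] mor_lc[OF g])
  qed
qed

text \<open>For actions this amounts to coassociativity of the coproduct of \<open>H\<close>, for
  coactions to associativity of its product.\<close>

lemma mor_assoc:
  assumes objs: "is_obj X" "is_obj Y" "is_obj Z"
  shows "mor ((X \<otimes>\<^sub>o Y) \<otimes>\<^sub>o Z) (X \<otimes>\<^sub>o (Y \<otimes>\<^sub>o Z)) \<alpha>"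
proof (rule morI)
  show "\<alpha> (act ((X \<otimes>\<^sub>o Y) \<otimes>\<^sub>o Z) h w) = act (X \<otimes>\<^sub>o (Y \<otimes>\<^sub>o Z)) h (\<alpha> w)"
    if mods and h: "h \<in> H" for h w
  proof -
    note o2 = obj_ten[OF objs(1,2)] obj_ten[OF objs(2,3)]
    note ll = objs[THEN obj_lin_ac, OF \<open>mods\<close>] objs[THEN obj_lin_ac, OF \<open>mods\<close>, THEN lin_compose]
      o2[THEN obj_lin_ac, OF \<open>mods\<close>] o2[THEN obj_lin_ac, OF \<open>mods\<close>, THEN lin_compose] lin_hcomult
    have ac2: "ac (X \<otimes>\<^sub>o Y) (k \<otimes> z) = (ac X \<otimes>\<^sub>m ac Y) (mid flip (hcomult V k \<otimes> z))"
      "ac (Y \<otimes>\<^sub>o Z) (k \<otimes> z) = (ac Y \<otimes>\<^sub>m ac Z) (mid flip (hcomult V k \<otimes> z))" for k z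
      by (simp_all add: ac_eq o2 act_ten obj_bilin objs \<open>mods\<close>)
    have "\<alpha> ((ac (X \<otimes>\<^sub>o Y) \<otimes>\<^sub>m ac Z) (mid flip (hcomult V h \<otimes> w))) = (ac X \<otimes>\<^sub>m ac (Y \<otimes>\<^sub>o Z)) (mid flip (hcomult V h \<otimes> \<alpha> w))"
    proof (rule tensor_ext3[where w=w])
      fix x y z
      \<comment> \<open>\<open>?E\<close> and \<open>?F\<close> let a threefold tensor over
        \<open>H\<close>, bracketed to the left and to the right, act on x, y and z.\<close>
      let ?E = "\<lambda>D. (((\<lambda>m. (ac X \<otimes>\<^sub>m ac Y) (mid flip (m \<otimes> (x \<otimes> y)))) \<otimes>\<^sub>m (\<lambda>c. ac Z (c \<otimes> z))) D)"
      let ?F = "\<lambda>D. ((\<lambda>a. ac X (a \<otimes> x)) \<otimes>\<^sub>m (\<lambda>m. (ac Y \<otimes>\<^sub>m ac Z) (mid flip (m \<otimes> (y \<otimes> z))))) D"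
      have 1: "(ac (X \<otimes>\<^sub>o Y) \<otimes>\<^sub>m ac Z) (mid flip (w \<otimes> ((x \<otimes> y) \<otimes> z))) = ?E ((hcomult V \<otimes>\<^sub>m id) w)" for w
        by (rule tensor_ext[where z=w]; simp add: ll lin_intros ten_tensor ac2)
      have 2: "(ac X \<otimes>\<^sub>m ac (Y \<otimes>\<^sub>o Z)) (mid flip (w \<otimes> (x \<otimes> (y \<otimes> z)))) = ?F ((id \<otimes>\<^sub>m hcomult V) w)" for w
        by (rule tensor_ext[where z=w]; simp add: ll lin_intros ten_tensor ac2)
      have 3: "\<alpha> (?E D) = ?F (\<alpha> D)" for D
        by (rule tensor_ext3[where w=D]; simp add: ll lin_intros ten_tensor)
      show "\<alpha> ((ac (X \<otimes>\<^sub>o Y) \<otimes>\<^sub>m ac Z) (mid flip (hcomult V h \<otimes> ((x \<otimes> y) \<otimes> z)))) =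
          (ac X \<otimes>\<^sub>m ac (Y \<otimes>\<^sub>o Z)) (mid flip (hcomult V h \<otimes> \<alpha> ((x \<otimes> y) \<otimes> z)))"
        unfolding assoc_tensor 1 2 3 by (simp only: hcoassoc[OF h])
    qed (simp_all add: ll lin_intros)
    then show ?thesis by (simp add: act_ten obj_bilin objs o2 \<open>mods\<close>)
  qed
  show "lc (X \<otimes>\<^sub>o (Y \<otimes>\<^sub>o Z)) (\<alpha> w) = (id \<otimes>\<^sub>m \<alpha>) (lc ((X \<otimes>\<^sub>o Y) \<otimes>\<^sub>o Z) w)"
    if comods and w: "w \<in> space ((X \<otimes>\<^sub>o Y) \<otimes>\<^sub>o Z)" for w
  proof (rule ten_eq3[OF w[unfolded space_ten]])
    note o2 = obj_ten[OF objs(1,2)] obj_ten[OF objs(2,3)]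
    note l = lin_hmult lin_compose[OF lin_hmult]
    have lcs: "lin (lc (X \<otimes>\<^sub>o (Y \<otimes>\<^sub>o Z)))" "lin (lc ((X \<otimes>\<^sub>o Y) \<otimes>\<^sub>o Z))"
      by (simp_all add: obj_lin_lc obj_ten objs \<open>comods\<close>)
    show "lin (\<lambda>w. lc (X \<otimes>\<^sub>o (Y \<otimes>\<^sub>o Z)) (\<alpha> w))" "lin (\<lambda>w. (id \<otimes>\<^sub>m \<alpha>) (lc ((X \<otimes>\<^sub>o Y) \<otimes>\<^sub>o Z) w))"
      by (intro lin_compose[OF lcs(1)] lin_intros lcs)+
    fix x y z assume xyz: "x \<in> space X" "y \<in> space Y" "z \<in> space Z"
    have "N (u \<otimes> N (v \<otimes> t)) = (id \<otimes>\<^sub>m \<alpha>) (N (N (u \<otimes> v) \<otimes> t))"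
      if u: "u \<in> H \<otimes>\<^sub>s space X" and v: "v \<in> H \<otimes>\<^sub>s space Y" and t: "t \<in> H \<otimes>\<^sub>s space Z" for u v t
    proof (rule ten_eq[OF u])
      fix a x assume a: "a \<in> H"
      show "N ((a \<otimes> x) \<otimes> N (v \<otimes> t)) = (id \<otimes>\<^sub>m \<alpha>) (N (N ((a \<otimes> x) \<otimes> v) \<otimes> t))"
      proof (rule ten_eq[OF v])
        fix b y assume b: "b \<in> H"
        show "N ((a \<otimes> x) \<otimes> N ((b \<otimes> y) \<otimes> t)) = (id \<otimes>\<^sub>m \<alpha>) (N (N ((a \<otimes> x) \<otimes> (b \<otimes> y)) \<otimes> t))"
          by (rule ten_eq[OF t]; simp add: l lin_intros ten_tensor a b hmult_assoc)
      qed (simp_all add: l lin_intros)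
    qed (simp_all add: l lin_intros)
    from this[OF objs[THEN obj_lc_mem, OF \<open>comods\<close>]] show
      "lc (X \<otimes>\<^sub>o (Y \<otimes>\<^sub>o Z)) (\<alpha> ((x \<otimes> y) \<otimes> z)) = (id \<otimes>\<^sub>m \<alpha>) (lc ((X \<otimes>\<^sub>o Y) \<otimes>\<^sub>o Z) ((x \<otimes> y) \<otimes> z))"
      using xyz by (simp add: lc_ten_tensor objs o2 \<open>comods\<close>)
  qed
qed (auto simp: lin_intros assoc_mem)

lemma mor_assoc_inv:
  assumes objs: "is_obj X" "is_obj Y" "is_obj Z"
  shows "mor (X \<otimes>\<^sub>o (Y \<otimes>\<^sub>o Z)) ((X \<otimes>\<^sub>o Y) \<otimes>\<^sub>o Z) \<alpha>'"
  by (rule mor_inverse[OF _ _ mor_assoc[OF objs]]) (auto simp: obj_ten objs lin_intros assoc_inv_mem)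

text \<open>The unit constraints, extended from the line of \<open>unity V\<close> by
  \<open>coord\<close>.\<close>

definition runit :: "'v \<Rightarrow> 'v" where "runit = contract_right coord"
definition lunit :: "'v \<Rightarrow> 'v" where "lunit = contract_left coord"

lemma unit_simps: "lin runit" "lin f \<Longrightarrow> lin (\<lambda>x. runit (f x))" "lin lunit" "lin f \<Longrightarrow> lin (\<lambda>x. lunit (f x))"
  "runit (x \<otimes> unity V) = x" "lunit (unity V \<otimes> x) = x"
  "runit (scale V c z) = scale V c (runit z)" "lunit (scale V c z) = scale V c (lunit z)"
  by (simp_all add: lin_scale[OF lin_contract_left[OF functional_coord]] lin_scale[OF lin_contract_right[OF functional_coord]] runit_def lunit_def functional_coord contract_right_tensor contract_left_tensor lin_intros
      lin_compose[OF lin_contract_left] lin_compose[OF lin_contract_right] functional_scale[OF functional_coord])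

lemma runit_mor:
  assumes X: "is_obj X"
  shows "mor (X \<otimes>\<^sub>o unit_obj) X runit"
proof (rule morI)
  show "runit z \<in> space X" if "z \<in> space (X \<otimes>\<^sub>o unit_obj)" for z
    by (rule ten_mem[OF that[unfolded space_ten]])
      (auto simp: unit_simps obj_subspace X unit_space subspace_scale)
  show "runit (act (X \<otimes>\<^sub>o unit_obj) h z) = act X h (runit z)"
    if mods and h: "h \<in> H" and z: "z \<in> space (X \<otimes>\<^sub>o unit_obj)" for h z
  proof (rule ten_eq[OF z[unfolded space_ten]])
    note lin_a = obj_lin_act[OF X \<open>mods\<close>, of h] obj_lin_act[OF obj_ten[OF X obj_unit] \<open>mods\<close>, of h] obj_lin_ac[OF X \<open>mods\<close>]
    show "lin (\<lambda>z. runit (act (X \<otimes>\<^sub>o unit_obj) h z))" "lin (\<lambda>z. act X h (runit z))"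
      by (intro lin_compose[OF lin_a(1)] unit_simps lin_a)+
    fix x c assume x: "x \<in> space X" and "c \<in> space unit_obj"
    \<comment> \<open>The scalar of \<open>c\<close> is moved to \<open>x\<close>, so that the
      second factor becomes \<open>unity V\<close>.\<close>
    obtain x' where x': "x' \<in> space X" "x \<otimes> c = x' \<otimes> unity V"
    proof -
      obtain k where "c = scale V k (unity V)" using \<open>c \<in> space unit_obj\<close> by (auto simp: unit_space)
      then show ?thesis
        using that[of "scale V k x"] subspace_scale[OF obj_subspace[OF X] x] by simp
    qed
    have "runit ((ac X \<otimes>\<^sub>m ac unit_obj) (mid flip (u \<otimes> (x' \<otimes> unity V)))) = ac X (contract_right \<epsilon>\<^sub>H u \<otimes> x')" for u
      by (rule tensor_ext[where z=u]; simp add: lin_a lin_compose[OF lin_a(3)] ten_tensor lin_intros unit_simps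
        contract_simps lin_ac bilin_unit ac_unit_fun lin_simps[OF lin_a(3)] lin_simps[OF unit_simps(1)] lin_simps[OF unit_simps(3)])
    from this[of "hcomult V h"] show "runit (act (X \<otimes>\<^sub>o unit_obj) h (x \<otimes> c)) = act X h (runit (x \<otimes> c))"
      using h by (simp add: act_ten obj_bilin X \<open>mods\<close> bilin_unit hcounit ac_eq x' unit_simps)
  qed
  show "lc X (runit z) = (id \<otimes>\<^sub>m runit) (lc (X \<otimes>\<^sub>o unit_obj) z)"
    if comods and z: "z \<in> space (X \<otimes>\<^sub>o unit_obj)" for z
  proof (rule ten_eq[OF z[unfolded space_ten]])
    note lin_l = obj_lin_lc[OF X \<open>comods\<close>] obj_lin_lc[OF obj_ten[OF X obj_unit] \<open>comods\<close>]
    show "lin (\<lambda>z. lc X (runit z))" "lin (\<lambda>z. (id \<otimes>\<^sub>m runit) (lc (X \<otimes>\<^sub>o unit_obj) z))"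
      by (intro lin_compose[OF lin_l(1)] lin_intros unit_simps lin_l)+
    fix x c assume x: "x \<in> space X" and "c \<in> space unit_obj"
    obtain x' where x': "x' \<in> space X" "x \<otimes> c = x' \<otimes> unity V"
    proof -
      obtain k where "c = scale V k (unity V)" using \<open>c \<in> space unit_obj\<close> by (auto simp: unit_space)
      then show ?thesis
        using that[of "scale V k x"] subspace_scale[OF obj_subspace[OF X] x] by simp
    qed
    have "(id \<otimes>\<^sub>m runit) (N (u \<otimes> (h_one \<otimes> unity V))) = u" if "u \<in> H \<otimes>\<^sub>s space X" for u
      by (rule ten_eq[OF that]; simp add: lin_intros lin_hmult unit_simps ten_tensor hmult_one)
    then show "lc X (runit (x \<otimes> c)) = (id \<otimes>\<^sub>m runit) (lc (X \<otimes>\<^sub>o unit_obj) (x \<otimes> c))"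
      by (simp add: x' lc_ten_tensor X obj_unit \<open>comods\<close> lc_unit obj_lc_mem unit_simps)
  qed
qed (simp add: unit_simps)

lemma lunit_mor:
  assumes X: "is_obj X"
  shows "mor (unit_obj \<otimes>\<^sub>o X) X lunit"
proof (rule morI)
  show "lunit z \<in> space X" if "z \<in> space (unit_obj \<otimes>\<^sub>o X)" for z
    by (rule ten_mem[OF that[unfolded space_ten]])
      (auto simp: unit_simps obj_subspace X unit_space subspace_scale)
  show "lunit (act (unit_obj \<otimes>\<^sub>o X) h z) = act X h (lunit z)"
    if mods and h: "h \<in> H" and z: "z \<in> space (unit_obj \<otimes>\<^sub>o X)" for h z
  proof (rule ten_eq[OF z[unfolded space_ten]])
    note lin_a = obj_lin_act[OF X \<open>mods\<close>, of h] obj_lin_act[OF obj_ten[OF obj_unit X] \<open>mods\<close>, of h] obj_lin_ac[OF X \<open>mods\<close>]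
    show "lin (\<lambda>z. lunit (act (unit_obj \<otimes>\<^sub>o X) h z))" "lin (\<lambda>z. act X h (lunit z))"
      by (intro lin_compose[OF lin_a(1)] unit_simps lin_a)+
    fix x c assume x: "x \<in> space X" and "c \<in> space unit_obj"
    obtain x' where x': "x' \<in> space X" "c \<otimes> x = unity V \<otimes> x'"
    proof -
      obtain k where "c = scale V k (unity V)" using \<open>c \<in> space unit_obj\<close> by (auto simp: unit_space)
      then show ?thesis
        using that[of "scale V k x"] subspace_scale[OF obj_subspace[OF X] x] by simp
    qed
    have "lunit ((ac unit_obj \<otimes>\<^sub>m ac X) (mid flip (u \<otimes> (unity V \<otimes> x')))) = ac X (contract_left \<epsilon>\<^sub>H u \<otimes> x')" for u
      by (rule tensor_ext[where z=u]; simp add: lin_a lin_compose[OF lin_a(3)] ten_tensor lin_intros unit_simps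
        contract_simps lin_ac bilin_unit ac_unit_fun lin_simps[OF lin_a(3)] lin_simps[OF unit_simps(1)] lin_simps[OF unit_simps(3)])
    from this[of "hcomult V h"] show "lunit (act (unit_obj \<otimes>\<^sub>o X) h (c \<otimes> x)) = act X h (lunit (c \<otimes> x))"
      using h by (simp add: act_ten obj_bilin X \<open>mods\<close> bilin_unit hcounit ac_eq x' unit_simps)
  qed
  show "lc X (lunit z) = (id \<otimes>\<^sub>m lunit) (lc (unit_obj \<otimes>\<^sub>o X) z)"
    if comods and z: "z \<in> space (unit_obj \<otimes>\<^sub>o X)" for z
  proof (rule ten_eq[OF z[unfolded space_ten]])
    note lin_l = obj_lin_lc[OF X \<open>comods\<close>] obj_lin_lc[OF obj_ten[OF obj_unit X] \<open>comods\<close>]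
    show "lin (\<lambda>z. lc X (lunit z))" "lin (\<lambda>z. (id \<otimes>\<^sub>m lunit) (lc (unit_obj \<otimes>\<^sub>o X) z))"
      by (intro lin_compose[OF lin_l(1)] lin_intros unit_simps lin_l)+
    fix x c assume x: "x \<in> space X" and "c \<in> space unit_obj"
    obtain x' where x': "x' \<in> space X" "c \<otimes> x = unity V \<otimes> x'"
    proof -
      obtain k where "c = scale V k (unity V)" using \<open>c \<in> space unit_obj\<close> by (auto simp: unit_space)
      then show ?thesis
        using that[of "scale V k x"] subspace_scale[OF obj_subspace[OF X] x] by simp
    qed
    have "(id \<otimes>\<^sub>m lunit) (N ((h_one \<otimes> unity V) \<otimes> u)) = u" if "u \<in> H \<otimes>\<^sub>s space X" for u
      by (rule ten_eq[OF that]; simp add: lin_intros lin_hmult unit_simps ten_tensor hmult_one)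
    then show "lc X (lunit (c \<otimes> x)) = (id \<otimes>\<^sub>m lunit) (lc (unit_obj \<otimes>\<^sub>o X) (c \<otimes> x))"
      by (simp add: x' lc_ten_tensor X obj_unit \<open>comods\<close> lc_unit obj_lc_mem unit_simps)
  qed
qed (simp add: unit_simps)

lemma mor_tensor_unity:
  assumes X: "is_obj X"
  shows "mor X (X \<otimes>\<^sub>o unit_obj) (\<lambda>x. x \<otimes> unity V)" "mor X (unit_obj \<otimes>\<^sub>o X) (\<lambda>x. unity V \<otimes> x)"
proof -
  have u: "unity V \<in> span {unity V}" by (simp add: span_base)
  have "runit z \<otimes> unity V = z" if "z \<in> space X \<otimes>\<^sub>s space unit_obj" for z
    by (rule ten_eq[OF that]) (auto simp: unit_simps lin_intros unit_space)
  then show "mor X (X \<otimes>\<^sub>o unit_obj) (\<lambda>x. x \<otimes> unity V)"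
    by (intro mor_inverse[OF _ _ runit_mor[OF X]])
      (auto simp: obj_ten X obj_unit unit_simps lin_intros u intro!: ten_space_mem)
  have "unity V \<otimes> lunit z = z" if "z \<in> space unit_obj \<otimes>\<^sub>s space X" for z
    by (rule ten_eq[OF that]) (auto simp: unit_simps lin_intros unit_space)
  then show "mor X (unit_obj \<otimes>\<^sub>o X) (\<lambda>x. unity V \<otimes> x)"
    by (intro mor_inverse[OF _ _ lunit_mor[OF X]])
      (auto simp: obj_ten X obj_unit unit_simps lin_intros u intro!: ten_space_mem)
qed

text \<open>Compatibility with action and coaction is an identity of linear maps, hence can be
  tested on a family of morphisms whose images span. This handles maps out of direct sums and out of
  quotients alike.\<close>

lemma mor_epi:
  assumes X: "is_obj X" and Y: "is_obj Y" and F: "lin F"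
    and u: "\<And>i. i \<in> I \<Longrightarrow> mor (Z i) X (u i)" "\<And>i. i \<in> I \<Longrightarrow> mor (Z i) Y (\<lambda>z. F (u i z))"
    and span: "space X \<subseteq> span (\<Union>i\<in>I. u i ` space (Z i))"
  shows "mor X Y F"
proof (rule morI)
  let ?B = "\<Union>i\<in>I. u i ` space (Z i)"
  show "F x \<in> space Y" if "x \<in> space X" for x
  proof -
    have "x \<in> span ?B" using that span by auto
    then show ?thesis
    proof (induction rule: span_induct_alt)
      case base
      then show ?case by (simp add: lin_0[OF F] subspace_0 obj_subspace Y)
    next
      case (step c a b)
      then show ?case
        by (auto simp: lin_simps[OF F] intro!: subspace_add subspace_scale obj_subspace Y mor_mem[OF u(2)])
    qed
  qed
  show "F (act X h x) = act Y h (F x)" if mods "h \<in> H" "x \<in> space X" for h x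
  proof (rule span_lin_eq[where f="\<lambda>x. F (act X h x)" and g="\<lambda>x. act Y h (F x)"])
    show "x \<in> span ?B" using that span by auto
    show "lin (\<lambda>x. F (act X h x))" "lin (\<lambda>x. act Y h (F x))"
      by (intro lin_compose[OF F] lin_compose[OF obj_lin_act[OF Y \<open>mods\<close>]] F obj_lin_act[OF X \<open>mods\<close>])+
    fix b assume "b \<in> ?B"
    then obtain i z where "i \<in> I" "z \<in> space (Z i)" "b = u i z" by auto
    then show "F (act X h b) = act Y h (F b)"
      using mor_act[OF u(1) \<open>mods\<close> \<open>h \<in> H\<close>, of i z] mor_act[OF u(2) \<open>mods\<close> \<open>h \<in> H\<close>, of i z] by simp
  qed
  show "lc Y (F x) = (id \<otimes>\<^sub>m F) (lc X x)" if comods "x \<in> space X" for x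
  proof (rule span_lin_eq[where f="\<lambda>x. lc Y (F x)" and g="\<lambda>x. (id \<otimes>\<^sub>m F) (lc X x)"])
    show "x \<in> span ?B" using that span by auto
    show "lin (\<lambda>x. lc Y (F x))" "lin (\<lambda>x. (id \<otimes>\<^sub>m F) (lc X x))"
      by (intro lin_compose[OF obj_lin_lc[OF Y \<open>comods\<close>]] lin_intros F obj_lin_lc[OF X \<open>comods\<close>])+
    fix b assume "b \<in> ?B"
    then obtain i z where iz: "i \<in> I" "z \<in> space (Z i)" "b = u i z" by auto
    have "(id \<otimes>\<^sub>m F) ((id \<otimes>\<^sub>m u i) (lc (Z i) z)) = (id \<otimes>\<^sub>m (\<lambda>z. F (u i z))) (lc (Z i) z)"
      using mor_lin[OF u(1)[OF iz(1)]] by (subst ten_comp) (auto simp: lin_intros F id_def)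
    then show "lc Y (F b) = (id \<otimes>\<^sub>m F) (lc X b)"
      using iz mor_lc[OF u(1) \<open>comods\<close>, of i z] mor_lc[OF u(2) \<open>comods\<close>, of i z] by simp
  qed
qed (rule F)

lemma mor_mid:
  assumes objs: "is_obj A" "is_obj B" "is_obj C" "is_obj D" and \<psi>: "mor (B \<otimes>\<^sub>o C) (C \<otimes>\<^sub>o B) \<psi>"
  shows "mor ((A \<otimes>\<^sub>o B) \<otimes>\<^sub>o (C \<otimes>\<^sub>o D)) ((A \<otimes>\<^sub>o C) \<otimes>\<^sub>o (B \<otimes>\<^sub>o D)) (mid \<psi>)"
  unfolding mid_def
  by (rule mor_o[OF mor_assoc mor_o[OF mor_ten[OF _ _ _ _ mor_id(1) mor_o[OF mor_assoc_inv
        mor_o[OF mor_ten[OF _ _ _ _ \<psi> mor_id(1)] mor_assoc]]] mor_assoc_inv]]) (simp_all add: objs obj_ten)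

section \<open>Consequences of naturality and the hexagons\<close>

lemma mor_braid: "is_obj X \<Longrightarrow> is_obj Y \<Longrightarrow> mor (X \<otimes>\<^sub>o Y) (Y \<otimes>\<^sub>o X) (\<Psi> X Y)"
  using natural_iso_braid by (auto simp: natural_iso_braid_def)

lemma braid_bij:
  assumes "is_obj X" "is_obj Y"
  shows "bij_betw (\<Psi> X Y) (space X \<otimes>\<^sub>s space Y) (space Y \<otimes>\<^sub>s space X)"
proof -
  obtain g where "mor (Y \<otimes>\<^sub>o X) (X \<otimes>\<^sub>o Y) g" "\<And>z. z \<in> space (X \<otimes>\<^sub>o Y) \<Longrightarrow> g (\<Psi> X Y z) = z"
    "\<And>z. z \<in> space (Y \<otimes>\<^sub>o X) \<Longrightarrow> \<Psi> X Y (g z) = z"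
    using natural_iso_braid assms unfolding natural_iso_braid_def by metis
  then show ?thesis
    using mor_mem[OF mor_braid[OF assms]] mor_mem[of "Y \<otimes>\<^sub>o X" "X \<otimes>\<^sub>o Y" g]
    by (intro bij_betw_byWitness[where f'=g]) auto
qed

lemma braid_natural:
  assumes "is_obj X" "is_obj X'" "is_obj Y" "is_obj Y'" "mor X X' f" "mor Y Y' g" "z \<in> space X \<otimes>\<^sub>s space Y"
  shows "\<Psi> X' Y' ((f \<otimes>\<^sub>m g) z) = (g \<otimes>\<^sub>m f) (\<Psi> X Y z)"
  using natural_iso_braid assms unfolding natural_iso_braid_def by (metis space_ten)

lemma
  assumes "is_obj X" "is_obj Y" "is_obj Z" "w \<in> (space X \<otimes>\<^sub>s space Y) \<otimes>\<^sub>s space Z"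
  shows hexagon1: "\<Psi> X (Y \<otimes>\<^sub>o Z) (\<alpha> w) = \<alpha>' ((id \<otimes>\<^sub>m \<Psi> X Z) (\<alpha> ((\<Psi> X Y \<otimes>\<^sub>m id) w)))"
    and hexagon2: "\<Psi> (X \<otimes>\<^sub>o Y) Z w = \<alpha> ((\<Psi> X Z \<otimes>\<^sub>m id) (\<alpha>' ((id \<otimes>\<^sub>m \<Psi> Y Z) (\<alpha> w))))"
proof -
  have "\<alpha> (\<Psi> X (Y \<otimes>\<^sub>o Z) (\<alpha> w)) = (id \<otimes>\<^sub>m \<Psi> X Z) (\<alpha> ((\<Psi> X Y \<otimes>\<^sub>m id) w))"
    using hexagons assms by (simp add: hexagons_def)
  then show "\<Psi> X (Y \<otimes>\<^sub>o Z) (\<alpha> w) = \<alpha>' ((id \<otimes>\<^sub>m \<Psi> X Z) (\<alpha> ((\<Psi> X Y \<otimes>\<^sub>m id) w)))"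
    by (metis assoc_inverse(1))
  have "\<alpha>' (\<Psi> (X \<otimes>\<^sub>o Y) Z (\<alpha>' (\<alpha> w))) = (\<Psi> X Z \<otimes>\<^sub>m id) (\<alpha>' ((id \<otimes>\<^sub>m \<Psi> Y Z) (\<alpha> w)))"
    using hexagons assms assoc_mem[OF assms(4)] unfolding hexagons_def space_ten by blast
  then show "\<Psi> (X \<otimes>\<^sub>o Y) Z w = \<alpha> ((\<Psi> X Z \<otimes>\<^sub>m id) (\<alpha>' ((id \<otimes>\<^sub>m \<Psi> Y Z) (\<alpha> w))))"
    by (metis assoc_inverse)
qed

lemma product_words:
  assumes X: "is_obj X" and a: "mor (X \<otimes>\<^sub>o X) X a"
  shows "product_words V (space X) a (\<Psi> X X)"
proof
  fix w assume w: "w \<in> (space X \<otimes>\<^sub>s space X) \<otimes>\<^sub>s space X"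
  show "\<Psi> X X ((a \<otimes>\<^sub>m id) w) = (id \<otimes>\<^sub>m a) (\<alpha> ((\<Psi> X X \<otimes>\<^sub>m id) (\<alpha>' ((id \<otimes>\<^sub>m \<Psi> X X) (\<alpha> w)))))"
    using braid_natural[OF _ X X X a mor_id(1), of w] w by (simp add: obj_ten X hexagon2)
  show "\<Psi> X X ((id \<otimes>\<^sub>m a) (\<alpha> w)) = (a \<otimes>\<^sub>m id) (\<alpha>' ((id \<otimes>\<^sub>m \<Psi> X X) (\<alpha> ((\<Psi> X X \<otimes>\<^sub>m id) w))))"
    using braid_natural[OF X X _ X mor_id(1) a, of "\<alpha> w"] w by (simp add: obj_ten X hexagon1 assoc_mem)
qed (use mor_mem[OF a] mor_mem[OF mor_braid[OF X X]] in \<open>auto simp: obj_subspace X lin_simps[OF mor_lin[OF a]] lin_simps[OF mor_lin[OF mor_braid[OF X X]]]\<close>)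

lemma bialgebra_words:
  assumes X: "is_obj X" and a: "mor (X \<otimes>\<^sub>o X) X a" and e: "mor X (X \<otimes>\<^sub>o X) e"
  shows "bialgebra_words V (space X) a (\<Psi> X X) e"
proof -
  interpret product_words V "space X" a "\<Psi> X X" by (rule product_words[OF X a])
  show ?thesis
  proof
    fix z assume z: "z \<in> space X \<otimes>\<^sub>s space X"
    have e1: "\<alpha>' ((id \<otimes>\<^sub>m e) z) \<in> (space X \<otimes>\<^sub>s space X) \<otimes>\<^sub>s space X"
      "(e \<otimes>\<^sub>m id) z \<in> (space X \<otimes>\<^sub>s space X) \<otimes>\<^sub>s space X"
      using mor_mem[OF e] z by (auto intro!: assoc_inv_mem ten_map[OF _ lin_id(1) mor_lin[OF e]] ten_map[OF _ mor_lin[OF e] lin_id(1)])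
    show "(e \<otimes>\<^sub>m id) (\<Psi> X X z) = \<alpha>' ((id \<otimes>\<^sub>m \<Psi> X X) (\<alpha> ((\<Psi> X X \<otimes>\<^sub>m id) (\<alpha>' ((id \<otimes>\<^sub>m e) z)))))"
      using braid_natural[OF X X X _ mor_id(1) e z] hexagon1[OF X X X e1(1)] by (simp add: obj_ten X)
    show "(id \<otimes>\<^sub>m e) (\<Psi> X X z) = \<alpha> ((\<Psi> X X \<otimes>\<^sub>m id) (\<alpha>' ((id \<otimes>\<^sub>m \<Psi> X X) (\<alpha> ((e \<otimes>\<^sub>m id) z)))))"
      using braid_natural[OF X _ X X e mor_id(1) z] hexagon2[OF X X X e1(2)] by (simp add: obj_ten X)
  qed (use mor_mem[OF e] in \<open>auto simp: lin_simps[OF mor_lin[OF e]]\<close>)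
qed

text \<open>The braiding is itself a morphism, and naturality of the braiding with the third factor
  along it, expanded by a hexagon, is the Yang-Baxter equation.\<close>

lemma braid_yang_baxter:
  assumes X: "is_obj X" and w: "w \<in> (space X \<otimes>\<^sub>s space X) \<otimes>\<^sub>s space X"
  shows "pos12 (\<Psi> X X) (pos23 (\<Psi> X X) (pos12 (\<Psi> X X) w)) = pos23 (\<Psi> X X) (pos12 (\<Psi> X X) (pos23 (\<Psi> X X) w))"
proof -
  note p = mor_braid[OF X X]
  have w': "(\<Psi> X X \<otimes>\<^sub>m id) w \<in> (space X \<otimes>\<^sub>s space X) \<otimes>\<^sub>s space X"
    using mor_mem[OF p] by (intro ten_map[OF w mor_lin[OF p] lin_id(1)]) auto
  have "\<Psi> (X \<otimes>\<^sub>o X) X ((\<Psi> X X \<otimes>\<^sub>m id) w) = (id \<otimes>\<^sub>m \<Psi> X X) (\<Psi> (X \<otimes>\<^sub>o X) X w)"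
    using braid_natural[OF _ _ X X p mor_id(1)] w by (simp add: obj_ten X)
  then show ?thesis
    by (metis hexagon2[OF X X X w] hexagon2[OF X X X w'] pos12_def pos23_def o_apply assoc_inverse(1))
qed

text \<open>Braiding with the unit object follows from the hexagons. It induces a linear self-map of
  X that is idempotent, because \<open>unity V\<close> can be replaced by \<open>unity V\<close>
  tensor itself through a morphism, and injective, because the braiding is. Such a map is the
  identity.\<close>

lemma braid_unit:
  assumes X: "is_obj X" and x: "x \<in> space X"
  shows "\<Psi> unit_obj X (unity V \<otimes> x) = x \<otimes> unity V" "\<Psi> X unit_obj (x \<otimes> unity V) = unity V \<otimes> x"
proof -
  let ?u = "unity V"
  have u: "?u \<in> span {?u}" by (simp add: span_base)
  note uu = mor_tensor_unity(1)[OF obj_unit]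
  have idem: "f x = x" if lin: "lin f" and f: "\<And>x. x \<in> space X \<Longrightarrow> f x \<in> space X" "\<And>x. x \<in> space X \<Longrightarrow> f (f x) = f x"
    and inj: "inj_on f (space X)" for f
    using inj_onD[OF inj f(2)[OF x] f(1)[OF x] x] .
  have m1: "mor (unit_obj \<otimes>\<^sub>o X) (X \<otimes>\<^sub>o unit_obj) (\<Psi> unit_obj X)"
    and m2: "mor (X \<otimes>\<^sub>o unit_obj) (unit_obj \<otimes>\<^sub>o X) (\<Psi> X unit_obj)"
    by (simp_all add: mor_braid X obj_unit)
  have r: "runit z \<otimes> ?u = z" if "z \<in> space X \<otimes>\<^sub>s span {?u}" for z
    by (rule ten_eq[OF that]) (auto simp: unit_simps lin_intros unit_space)
  have l: "?u \<otimes> lunit z = z" if "z \<in> span {?u} \<otimes>\<^sub>s space X" for z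
    by (rule ten_eq[OF that]) (auto simp: unit_simps lin_intros unit_space)
  define f where "f = (\<lambda>x. runit (\<Psi> unit_obj X (?u \<otimes> x)))"
  define g where "g = (\<lambda>x. lunit (\<Psi> X unit_obj (x \<otimes> ?u)))"
  have f: "\<Psi> unit_obj X (?u \<otimes> x) = f x \<otimes> ?u" "f x \<in> space X" if "x \<in> space X" for x
    using r[of "\<Psi> unit_obj X (?u \<otimes> x)"] mor_mem[OF m1, of "?u \<otimes> x"] mor_mem[OF runit_mor[OF X]] that
    by (simp_all add: f_def ten_space_mem u)
  have g: "\<Psi> X unit_obj (x \<otimes> ?u) = ?u \<otimes> g x" "g x \<in> space X" if "x \<in> space X" for x
    using l[of "\<Psi> X unit_obj (x \<otimes> ?u)"] mor_mem[OF m2, of "x \<otimes> ?u"] mor_mem[OF lunit_mor[OF X]] that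
    by (simp_all add: g_def ten_space_mem u)
  have "f (f x) = f x" if "x \<in> space X" for x
  proof -
    have "f x \<otimes> (?u \<otimes> ?u) = \<Psi> (unit_obj \<otimes>\<^sub>o unit_obj) X ((?u \<otimes> ?u) \<otimes> x)"
      using braid_natural[OF obj_unit _ X X uu mor_id(1), of "?u \<otimes> x"] that
      by (simp add: obj_ten obj_unit u ten_space_mem ten_tensor lin_intros f)
    also have "\<dots> = f (f x) \<otimes> (?u \<otimes> ?u)"
      using hexagon2[OF obj_unit obj_unit X, of "(?u \<otimes> ?u) \<otimes> x"] that
      by (simp add: u ten_space_mem ten_tensor lin_intros mor_lin[OF m1] f)
    finally have "\<alpha>' (f x \<otimes> (?u \<otimes> ?u)) = \<alpha>' (f (f x) \<otimes> (?u \<otimes> ?u))" by simp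
    then show ?thesis by (simp add: tensor_unity_inject)
  qed
  moreover have "inj_on f (space X)"
  proof (rule inj_onI)
    fix x y assume "x \<in> space X" "y \<in> space X" "f x = f y"
    then have "?u \<otimes> x = ?u \<otimes> y"
      using inj_onD[OF bij_betw_imp_inj_on[OF braid_bij[OF obj_unit X]], of "?u \<otimes> x" "?u \<otimes> y"]
      by (simp add: f ten_space_mem u)
    then show "x = y" by (metis unit_simps(6))
  qed
  moreover have "lin f" unfolding f_def by (intro unit_simps lin_compose[OF mor_lin[OF m1]] lin_intros)
  ultimately have "f x = x" using f by (intro idem) auto
  then show "\<Psi> unit_obj X (?u \<otimes> x) = x \<otimes> ?u" using f x by simp
  have "g (g x) = g x" if "x \<in> space X" for x
  proof -
    have "(?u \<otimes> ?u) \<otimes> g x = \<Psi> X (unit_obj \<otimes>\<^sub>o unit_obj) (x \<otimes> (?u \<otimes> ?u))"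
      using braid_natural[OF X X obj_unit _ mor_id(1) uu, of "x \<otimes> ?u"] that
      by (simp add: obj_ten obj_unit u ten_space_mem ten_tensor lin_intros g)
    also have "\<dots> = (?u \<otimes> ?u) \<otimes> g (g x)"
      using hexagon1[OF X obj_unit obj_unit, of "(x \<otimes> ?u) \<otimes> ?u"] that
      by (simp add: u ten_space_mem ten_tensor lin_intros mor_lin[OF m2] g)
    finally have "lunit (lunit (\<alpha> ((?u \<otimes> ?u) \<otimes> g x))) = lunit (lunit (\<alpha> ((?u \<otimes> ?u) \<otimes> g (g x))))" by simp
    then show ?thesis by (simp add: unit_simps)
  qed
  moreover have "inj_on g (space X)"
  proof (rule inj_onI)
    fix x y assume "x \<in> space X" "y \<in> space X" "g x = g y"
    then have "x \<otimes> ?u = y \<otimes> ?u"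
      using inj_onD[OF bij_betw_imp_inj_on[OF braid_bij[OF X obj_unit]], of "x \<otimes> ?u" "y \<otimes> ?u"]
      by (simp add: g ten_space_mem u)
    then show "x = y" by (metis unit_simps(5))
  qed
  moreover have "lin g" unfolding g_def by (intro unit_simps lin_compose[OF mor_lin[OF m2]] lin_intros)
  ultimately have "g x = x" using g by (intro idem) auto
  then show "\<Psi> X unit_obj (x \<otimes> ?u) = ?u \<otimes> x" using g x by simp
qed

text \<open>Naturality along the morphism \<open>e\<close> to the unit object, where the braiding is
  trivial by \<open>braid_unit\<close>.\<close>

lemma contract_braid:
  assumes X: "is_obj X" and e: "functional e" and e': "mor X unit_obj (\<lambda>x. scale V (e x) (unity V))"
    and z: "z \<in> space X \<otimes>\<^sub>s space X"
  shows "contract_right e (\<Psi> X X z) = contract_left e z" "contract_left e (\<Psi> X X z) = contract_right e z"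
proof -
  let ?e = "\<lambda>x. scale V (e x) (unity V)"
  note l = lin_functional[OF e lin_id(2)] lin_intros ten_tensor contract_right_tensor[OF e] contract_left_tensor[OF e]
    lin_contract_left[OF e] lin_contract_right[OF e] lin_compose[OF lin_contract_left[OF e]] lin_compose[OF lin_contract_right[OF e]]
  have eq: "(?e \<otimes>\<^sub>m id) v = unity V \<otimes> contract_left e v" "(id \<otimes>\<^sub>m ?e) v = contract_right e v \<otimes> unity V" for v
    by (rule tensor_ext[where z=v]; simp add: l)+
  have mem: "contract_left e z \<in> space X" "contract_right e z \<in> space X"
    by (rule ten_mem[OF z]; auto simp: l obj_subspace X subspace_scale)+
  have "\<Psi> unit_obj X ((?e \<otimes>\<^sub>m id) z) = (id \<otimes>\<^sub>m ?e) (\<Psi> X X z)"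
    by (rule braid_natural[OF X obj_unit X X e' mor_id(1) z])
  then show "contract_right e (\<Psi> X X z) = contract_left e z"
    by (simp add: eq braid_unit[OF X] mem tensor_unity_inject)
  have "\<Psi> X unit_obj ((id \<otimes>\<^sub>m ?e) z) = (?e \<otimes>\<^sub>m id) (\<Psi> X X z)"
    by (rule braid_natural[OF X X X obj_unit mor_id(1) e' z])
  then show "contract_left e (\<Psi> X X z) = contract_right e z"
    by (simp add: eq braid_unit[OF X] mem) (metis unit_simps(6))
qed

end

section \<open>The extension by the unit object\<close>

text \<open>A fixed realisation of the extension, without any of the quantum Lie axioms: both
  implications of the theorem compute here.\<close>

locale extended = braided_category V
  for V :: "('k::field, 'v::ab_group_add) category_data" (structure) +
  fixes g \<sigma> C \<delta> G i j s d e
  assumes g: "is_obj g"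
    and \<sigma>: "mor (g \<otimes>\<^sub>o g) (g \<otimes>\<^sub>o g) \<sigma>" and C: "mor (g \<otimes>\<^sub>o g) g C" and \<delta>: "mor g (g \<otimes>\<^sub>o g) \<delta>"
    and coassoc: "coassociative (space g) \<delta>"
    and ext: "unit_extension g \<sigma> C \<delta> G i j s d e"
begin

abbreviation \<gamma> where "\<gamma> \<equiv> i (unity V)"
abbreviation p where "p \<equiv> \<Psi> G G"
abbreviation S where "S \<equiv> space g"
abbreviation T where "T \<equiv> space G"

lemma
  shows G: "is_obj G" and i: "mor unit_obj G i" and j: "mor g G j" and s: "lin s" and d: "lin d"
    and e: "functional e" and e_\<gamma> [simp]: "e \<gamma> = 1" and e_j [simp]: "x \<in> S \<Longrightarrow> e (j x) = 0"
    and s_\<gamma>: "z \<in> T \<Longrightarrow> s (\<gamma> \<otimes> z) = z \<otimes> \<gamma>" "z \<in> T \<Longrightarrow> s (z \<otimes> \<gamma>) = \<gamma> \<otimes> z"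
    and s_j: "x \<in> S \<Longrightarrow> y \<in> S \<Longrightarrow> s (j x \<otimes> j y) = (j \<otimes>\<^sub>m j) (\<sigma> (x \<otimes> y)) + j (C (x \<otimes> y)) \<otimes> \<gamma>"
    and d_\<gamma>: "d \<gamma> = \<gamma> \<otimes> \<gamma>"
    and d_j: "x \<in> S \<Longrightarrow> d (j x) = j x \<otimes> \<gamma> + \<gamma> \<otimes> j x + (j \<otimes>\<^sub>m j) (\<delta> x)"
    and inj_j: "inj_on j S"
    and T_eq: "T = {a + b | a b. a \<in> i ` span {unity V} \<and> b \<in> j ` S}"
  using ext by (auto simp: unit_extension_def unit_direct_sum_def Let_def)

lemma lin_i: "lin i" and lin_j: "lin j" and lin_\<sigma>: "lin \<sigma>" and lin_C: "lin C" and lin_\<delta>: "lin \<delta>" and lin_p: "lin p"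
  and lin_pg: "lin (\<Psi> g g)"
  by (auto intro: mor_lin i j \<sigma> C \<delta> G g mor_braid)

lemma u_mem: "unity V \<in> span {unity V}" by (simp add: span_base)

lemma \<gamma>_mem: "\<gamma> \<in> T" and j_mem: "x \<in> S \<Longrightarrow> j x \<in> T"
  using mor_mem[OF i, of "unity V"] mor_mem[OF j] u_mem by auto

lemma T_cases:
  assumes "z \<in> T" obtains c x where "x \<in> S" "z = scale V c \<gamma> + j x"
proof -
  obtain a x where "z = i a + j x" "a \<in> span {unity V}" "x \<in> S" using assms by (auto simp: T_eq)
  moreover from this obtain c where "a = scale V c (unity V)" by (auto simp: unit_space)
  ultimately show ?thesis using that[of x c] by (simp add: lin_scale[OF lin_i])
qed

lemma T_ext:
  assumes "z \<in> T" "lin f" "lin f'" "f \<gamma> = f' \<gamma>" "\<And>x. x \<in> S \<Longrightarrow> f (j x) = f' (j x)"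
  shows "f z = f' z"
proof -
  obtain c x where "x \<in> S" "z = scale V c \<gamma> + j x" using assms(1) by (rule T_cases)
  then show ?thesis by (simp add: assms(4,5) lin_simps[OF assms(2)] lin_simps[OF assms(3)])
qed

text \<open>Splits every verification on G \<otimes> G into two cases with \<gamma>, which are unit
  and counit laws, and the case of two elements of g, which carries the content.\<close>

lemma TT_ext:
  assumes "z \<in> T \<otimes>\<^sub>s T" "lin f" "lin f'"
    "\<And>y. y \<in> T \<Longrightarrow> f (\<gamma> \<otimes> y) = f' (\<gamma> \<otimes> y)" "\<And>y. y \<in> T \<Longrightarrow> f (y \<otimes> \<gamma>) = f' (y \<otimes> \<gamma>)"
    "\<And>x y. x \<in> S \<Longrightarrow> y \<in> S \<Longrightarrow> f (j x \<otimes> j y) = f' (j x \<otimes> j y)"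
  shows "f z = f' z"
proof (rule ten_eq[OF assms(1-3)])
  fix x y assume x: "x \<in> T" and y: "y \<in> T"
  show "f (x \<otimes> y) = f' (x \<otimes> y)"
  proof (rule T_ext[OF x])
    fix x assume x: "x \<in> S"
    show "f (j x \<otimes> y) = f' (j x \<otimes> y)"
      by (rule T_ext[OF y]) (auto intro!: lin_compose[OF assms(2)] lin_compose[OF assms(3)] lin_right assms x j_mem)
  qed (auto intro!: lin_compose[OF assms(2)] lin_compose[OF assms(3)] lin_left assms y)
qed

lemma mor_from_extension: "mor unit_obj Y (\<lambda>x. f (i x)) \<Longrightarrow> lin f \<Longrightarrow> mor g Y (\<lambda>x. f (j x)) \<Longrightarrow> is_obj Y \<Longrightarrow> mor G Y f"
proof (rule mor_epi[OF G, where I="UNIV :: bool set" and Z="\<lambda>b. if b then unit_obj else g" and u="\<lambda>b. if b then i else j"])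
  show "T \<subseteq> span (\<Union>b. (if b then i else j) ` space (if b then unit_obj else g))"
  proof
    fix z assume "z \<in> T"
    then obtain a b where z: "z = i a + j b" "a \<in> span {unity V}" "b \<in> S" by (auto simp: T_eq)
    show "z \<in> span (\<Union>b. (if b then i else j) ` space (if b then unit_obj else g))"
      unfolding z(1) using z(2,3) by (intro span_add span_base UN_I[of True] UN_I[of False]) auto
  qed
qed (auto simp: i j)

text \<open>\<open>mor_epi\<close> for the four blocks of the square; \<open>bool\<close> indexes
  the two summands of \<open>G\<close>.\<close>

lemma mor_from_square:
  assumes "lin f" "is_obj Y"
    "mor (unit_obj \<otimes>\<^sub>o unit_obj) Y (\<lambda>x. f ((i \<otimes>\<^sub>m i) x))" "mor (unit_obj \<otimes>\<^sub>o g) Y (\<lambda>x. f ((i \<otimes>\<^sub>m j) x))"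
    "mor (g \<otimes>\<^sub>o unit_obj) Y (\<lambda>x. f ((j \<otimes>\<^sub>m i) x))" "mor (g \<otimes>\<^sub>o g) Y (\<lambda>x. f ((j \<otimes>\<^sub>m j) x))"
  shows "mor (G \<otimes>\<^sub>o G) Y f"
proof -
  let ?Z = "\<lambda>b. if b then unit_obj else g" and ?u = "\<lambda>b. if b then i else j"
  let ?B = "\<Union>(b, c) \<in> UNIV. (?u b \<otimes>\<^sub>m ?u c) ` (space (?Z b) \<otimes>\<^sub>s space (?Z c))"
  have lin_u: "lin (?u b)" for b by (simp add: lin_i lin_j)
  have mor_u: "mor (?Z b) G (?u b)" for b by (simp add: i j)
  have obj: "is_obj (?Z b)" for b by (simp add: obj_unit g)
  have B: "?u b x \<otimes> ?u c y \<in> ?B" if "x \<in> space (?Z b)" "y \<in> space (?Z c)" for b c x y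
  proof -
    have "?u b x \<otimes> ?u c y = (?u b \<otimes>\<^sub>m ?u c) (x \<otimes> y)" by (simp only: ten_tensor[OF lin_u lin_u])
    moreover have "x \<otimes> y \<in> space (?Z b) \<otimes>\<^sub>s space (?Z c)" using that by (rule ten_space_mem)
    ultimately show ?thesis by blast
  qed
  have span: "z \<in> span ?B" if z: "z \<in> T \<otimes>\<^sub>s T" for z
  proof -
    have "id z \<in> span ?B"
    proof (rule ten_mem[OF z])
      fix x y assume "x \<in> T" "y \<in> T"
      then obtain a b a' b' where x: "x = i a + j b" "a \<in> span {unity V}" "b \<in> S"
        and y: "y = i a' + j b'" "a' \<in> span {unity V}" "b' \<in> S" by (auto simp: T_eq)
      show "id (x \<otimes> y) \<in> span ?B"
      proof -
        have "x \<otimes> y = i a \<otimes> i a' + i a \<otimes> j b' + (j b \<otimes> i a' + j b \<otimes> j b')" by (simp add: x(1) y(1) algebra_simps)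
        moreover have "i a \<otimes> i a' \<in> ?B" using B[of a True a' True] x(2) y(2) by (simp only: if_True space_unit)
        moreover have "i a \<otimes> j b' \<in> ?B" using B[of a True b' False] x(2) y(3) by (simp only: if_True if_False space_unit)
        moreover have "j b \<otimes> i a' \<in> ?B" using B[of b False a' True] x(3) y(2) by (simp only: if_True if_False space_unit)
        moreover have "j b \<otimes> j b' \<in> ?B" using B[of b False b' False] x(3) y(3) by (simp only: if_False)
        ultimately show ?thesis unfolding id_apply by (simp only: span_add span_base)
      qed
    qed (simp_all add: lin_intros)
    then show ?thesis by simp
  qed
  show ?thesis
  proof (rule mor_epi[OF obj_ten[OF G G] assms(2,1), where I="UNIV :: (bool \<times> bool) set"
        and Z="\<lambda>(b, c). ?Z b \<otimes>\<^sub>o ?Z c" and u="\<lambda>(b, c). ?u b \<otimes>\<^sub>m ?u c"])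
    fix bc :: "bool \<times> bool" assume "bc \<in> UNIV"
    obtain b c where bc: "bc = (b, c)" by force
    show "mor ((\<lambda>(b, c). ?Z b \<otimes>\<^sub>o ?Z c) bc) (G \<otimes>\<^sub>o G) ((\<lambda>(b, c). ?u b \<otimes>\<^sub>m ?u c) bc)"
      unfolding bc prod.case by (rule mor_ten[OF obj obj G G mor_u mor_u])
    show "mor ((\<lambda>(b, c). ?Z b \<otimes>\<^sub>o ?Z c) bc) Y (\<lambda>z. f ((\<lambda>(b, c). ?u b \<otimes>\<^sub>m ?u c) bc z))"
      using assms(3-) by (cases b; cases c; simp add: bc)
  next
    have "(\<Union>bc\<in>UNIV. (\<lambda>(b, c). ?u b \<otimes>\<^sub>m ?u c) bc ` space ((\<lambda>(b, c). ?Z b \<otimes>\<^sub>o ?Z c) bc)) = ?B"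
      by (intro SUP_cong) (auto split: prod.splits)
    then show "space (G \<otimes>\<^sub>o G) \<subseteq> span (\<Union>bc\<in>UNIV. (\<lambda>(b, c). ?u b \<otimes>\<^sub>m ?u c) bc ` space ((\<lambda>(b, c). ?Z b \<otimes>\<^sub>o ?Z c) bc))"
      using span by auto
  qed
qed

lemma jj_mem: "w \<in> S \<otimes>\<^sub>s S \<Longrightarrow> (j \<otimes>\<^sub>m j) w \<in> T \<otimes>\<^sub>s T"
  by (rule ten_map) (auto simp: lin_j j_mem)

lemma mor_j_\<gamma>: "mor g (G \<otimes>\<^sub>o G) (\<lambda>x. j x \<otimes> \<gamma>)" "mor g (G \<otimes>\<^sub>o G) (\<lambda>x. \<gamma> \<otimes> j x)"
  using mor_comp[OF mor_tensor_unity(1)[OF g] mor_ten[OF g obj_unit G G j i]]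
    mor_comp[OF mor_tensor_unity(2)[OF g] mor_ten[OF obj_unit g G G i j]]
  by (simp_all add: ten_tensor lin_i lin_j)

lemma mor_jj: "mor (g \<otimes>\<^sub>o g) (G \<otimes>\<^sub>o G) (j \<otimes>\<^sub>m j)"
  by (rule mor_ten[OF g g G G j j])

lemma mor_ii: "mor (unit_obj \<otimes>\<^sub>o unit_obj) (G \<otimes>\<^sub>o G) (i \<otimes>\<^sub>m i)"
  by (rule mor_ten[OF obj_unit obj_unit G G i i])

lemma mor_d: "mor G (G \<otimes>\<^sub>o G) d"
proof (rule mor_from_extension)
  have "mor unit_obj (G \<otimes>\<^sub>o G) (\<lambda>x. (i \<otimes>\<^sub>m i) (x \<otimes> unity V))"
    by (rule mor_comp[OF mor_tensor_unity(1)[OF obj_unit] mor_ii])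
  then show "mor unit_obj (G \<otimes>\<^sub>o G) (\<lambda>x. d (i x))"
    by (rule mor_cong[OF obj_unit])
      (auto simp: lin_compose[OF d lin_i] unit_space lin_simps[OF d] lin_simps[OF lin_i] d_\<gamma> ten_tensor lin_i
        lin_scale[OF lin_ten[OF lin_i lin_i]])
  have "mor g (G \<otimes>\<^sub>o G) (\<lambda>x. (j x \<otimes> \<gamma> + \<gamma> \<otimes> j x) + (j \<otimes>\<^sub>m j) (\<delta> x))"
    by (intro mor_add mor_j_\<gamma> obj_ten G mor_comp[OF \<delta> mor_jj])
  then show "mor g (G \<otimes>\<^sub>o G) (\<lambda>x. d (j x))"
    by (rule mor_cong[OF g]) (auto simp: lin_compose[OF d lin_j] d_j)
qed (simp_all add: d obj_ten G)

abbreviation e' where "e' \<equiv> (\<lambda>x. scale V (e x) (unity V))"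

lemma lin_e': "lin e'" by (rule lin_functional[OF e lin_id(2)])

lemma mor_e: "mor G unit_obj e'"
proof (rule mor_from_extension)
  show "mor unit_obj unit_obj (\<lambda>x. e' (i x))"
    by (rule mor_cong[OF obj_unit mor_id(2)])
      (auto simp: unit_space lin_simps[OF lin_i] functional_scale[OF e] intro!: lin_functional[OF e lin_i])
  show "mor g unit_obj (\<lambda>x. e' (j x))"
    by (rule mor_cong[OF g mor_zero[OF obj_unit]]) (auto intro!: lin_functional[OF e lin_j])
qed (simp_all add: lin_e' obj_unit)

lemma s_jj: "w \<in> S \<otimes>\<^sub>s S \<Longrightarrow> s ((j \<otimes>\<^sub>m j) w) = (j \<otimes>\<^sub>m j) (\<sigma> w) + j (C w) \<otimes> \<gamma>"
  by (rule ten_eq[where f="\<lambda>w. s ((j \<otimes>\<^sub>m j) w)" and g="\<lambda>w. (j \<otimes>\<^sub>m j) (\<sigma> w) + j (C w) \<otimes> \<gamma>"])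
    (auto simp: ten_tensor lin_j s_j intro!: lin_compose[OF s] lin_intros lin_j lin_\<sigma> lin_C lin_compose[OF lin_j])

lemma mor_s: "mor (G \<otimes>\<^sub>o G) (G \<otimes>\<^sub>o G) s"
proof (rule mor_from_square)
  have lin_s: "lin (\<lambda>x. s ((a \<otimes>\<^sub>m b) x))" if "lin a" "lin b" for a b
    using that by (intro lin_compose[OF s] lin_intros)
  note l = lin_s lin_i lin_j ten_tensor lin_scale[OF lin_i] lin_scale[OF s] unit_simps
  show "mor (unit_obj \<otimes>\<^sub>o unit_obj) (G \<otimes>\<^sub>o G) (\<lambda>x. s ((i \<otimes>\<^sub>m i) x))"
  proof (rule mor_cong[OF _ mor_ii])
    show "s ((i \<otimes>\<^sub>m i) x) = (i \<otimes>\<^sub>m i) x" if "x \<in> space (unit_obj \<otimes>\<^sub>o unit_obj)" for x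
      by (rule ten_eq[OF that[unfolded space_ten]]) (auto simp: l unit_space s_\<gamma> \<gamma>_mem lin_intros)
  qed (simp_all add: obj_ten obj_unit l)
  show "mor (unit_obj \<otimes>\<^sub>o g) (G \<otimes>\<^sub>o G) (\<lambda>x. s ((i \<otimes>\<^sub>m j) x))"
  proof (rule mor_cong[OF _ mor_comp[OF lunit_mor[OF g] mor_j_\<gamma>(1)]])
    show "s ((i \<otimes>\<^sub>m j) x) = j (lunit x) \<otimes> \<gamma>" if "x \<in> space (unit_obj \<otimes>\<^sub>o g)" for x
      by (rule ten_eq[OF that[unfolded space_ten]])
        (auto simp: l unit_space s_\<gamma> j_mem lin_scale[OF lin_j] intro!: lin_intros lin_compose[OF lin_j])
  qed (simp_all add: obj_ten obj_unit l g)
  show "mor (g \<otimes>\<^sub>o unit_obj) (G \<otimes>\<^sub>o G) (\<lambda>x. s ((j \<otimes>\<^sub>m i) x))"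
  proof (rule mor_cong[OF _ mor_comp[OF runit_mor[OF g] mor_j_\<gamma>(2)]])
    show "s ((j \<otimes>\<^sub>m i) x) = \<gamma> \<otimes> j (runit x)" if "x \<in> space (g \<otimes>\<^sub>o unit_obj)" for x
      by (rule ten_eq[OF that[unfolded space_ten]])
        (auto simp: l unit_space s_\<gamma> j_mem lin_scale[OF lin_j] intro!: lin_intros lin_compose[OF lin_j])
  qed (simp_all add: obj_ten obj_unit l g)
  have "mor (g \<otimes>\<^sub>o g) (G \<otimes>\<^sub>o G) (\<lambda>w. (j \<otimes>\<^sub>m j) (\<sigma> w) + j (C w) \<otimes> \<gamma>)"
    by (rule mor_add[OF obj_ten[OF G G] mor_comp[OF \<sigma> mor_jj] mor_comp[OF C mor_j_\<gamma>(1)]])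
  then show "mor (g \<otimes>\<^sub>o g) (G \<otimes>\<^sub>o G) (\<lambda>x. s ((j \<otimes>\<^sub>m j) x))"
    by (rule mor_cong[rotated]) (auto simp: obj_ten g s_jj l)
qed (simp_all add: s obj_ten G)

abbreviation er where "er \<equiv> contract_right e"
abbreviation el where "el \<equiv> contract_left e"

lemmas e_simps = lin_contract_right[OF e] lin_contract_left[OF e] contract_right_tensor[OF e] contract_left_tensor[OF e]
  lin_compose[OF lin_contract_right[OF e]] lin_compose[OF lin_contract_left[OF e]]

text \<open>\<open>A\<close> is the bracket, extended so that \<open>\<gamma>\<close> acts as the identity and \<open>z\<close> maps \<open>\<gamma>\<close> to \<open>e z\<close> times \<open>\<gamma>\<close>.\<close>

definition A where "A z = er (s z)"

lemma lin_A: "lin A" unfolding A_def[abs_def] by (intro e_simps s)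

lemma mor_er: "mor (G \<otimes>\<^sub>o G) G er"
proof (rule mor_cong[OF obj_ten[OF G G]])
  show "mor (G \<otimes>\<^sub>o G) G (\<lambda>z. runit ((id \<otimes>\<^sub>m e') z))"
    by (rule mor_comp[OF mor_ten[OF G G G obj_unit mor_id(1) mor_e] runit_mor[OF G]])
  show "er z = runit ((id \<otimes>\<^sub>m e') z)" for z
    by (rule tensor_ext[where z=z]; simp add: e_simps ten_tensor lin_e' lin_intros unit_simps)
qed (simp add: e_simps)

lemma mor_A: "mor (G \<otimes>\<^sub>o G) G A"
  unfolding A_def[abs_def] by (rule mor_comp[OF mor_s mor_er])

lemma
  assumes "w \<in> S \<otimes>\<^sub>s S"
  shows er_jj: "er ((j \<otimes>\<^sub>m j) w) = 0" and el_jj: "el ((j \<otimes>\<^sub>m j) w) = 0"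
  by (rule ten_eq[OF assms, where g="\<lambda>w. 0"]; simp add: e_simps ten_tensor lin_j lin_intros)+

lemma \<sigma>_mem: "w \<in> S \<otimes>\<^sub>s S \<Longrightarrow> \<sigma> w \<in> S \<otimes>\<^sub>s S" and C_mem: "w \<in> S \<otimes>\<^sub>s S \<Longrightarrow> C w \<in> S"
  and \<delta>_mem: "x \<in> S \<Longrightarrow> \<delta> x \<in> S \<otimes>\<^sub>s S" and p_mem: "z \<in> T \<otimes>\<^sub>s T \<Longrightarrow> p z \<in> T \<otimes>\<^sub>s T"
  and pg_mem: "w \<in> S \<otimes>\<^sub>s S \<Longrightarrow> \<Psi> g g w \<in> S \<otimes>\<^sub>s S"
  and d_mem: "x \<in> T \<Longrightarrow> d x \<in> T \<otimes>\<^sub>s T" and A_mem: "z \<in> T \<otimes>\<^sub>s T \<Longrightarrow> A z \<in> T"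
  and s_mem: "z \<in> T \<otimes>\<^sub>s T \<Longrightarrow> s z \<in> T \<otimes>\<^sub>s T"
  using mor_mem[OF \<sigma>] mor_mem[OF C] mor_mem[OF \<delta>] mor_mem[OF mor_braid[OF G G]] mor_mem[OF mor_d]
    mor_mem[OF mor_A] mor_mem[OF mor_s] mor_mem[OF mor_braid[OF g g]] by simp_all

lemma A_\<gamma>: "z \<in> T \<Longrightarrow> A (\<gamma> \<otimes> z) = z" "z \<in> T \<Longrightarrow> A (z \<otimes> \<gamma>) = scale V (e z) \<gamma>"
  by (simp_all add: A_def s_\<gamma> e_simps)

lemma A_jj: "w \<in> S \<otimes>\<^sub>s S \<Longrightarrow> A ((j \<otimes>\<^sub>m j) w) = j (C w)"
  by (simp add: A_def s_jj lin_simps[OF lin_contract_right[OF e]] er_jj \<sigma>_mem e_simps)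

lemma A_j: "x \<in> S \<Longrightarrow> y \<in> S \<Longrightarrow> A (j x \<otimes> j y) = j (C (x \<otimes> y))"
  using A_jj[of "x \<otimes> y"] by (simp add: ten_tensor lin_j ten_space_mem)

lemma p_\<gamma>: "z \<in> T \<Longrightarrow> p (\<gamma> \<otimes> z) = z \<otimes> \<gamma>" "z \<in> T \<Longrightarrow> p (z \<otimes> \<gamma>) = \<gamma> \<otimes> z"
  using braid_natural[OF obj_unit G G G i mor_id(1), of "unity V \<otimes> z"]
    braid_natural[OF G G obj_unit G mor_id(1) i, of "z \<otimes> unity V"]
  by (simp_all add: ten_space_mem u_mem ten_tensor lin_i lin_intros braid_unit G)

lemma p_jj: "w \<in> S \<otimes>\<^sub>s S \<Longrightarrow> p ((j \<otimes>\<^sub>m j) w) = (j \<otimes>\<^sub>m j) (\<Psi> g g w)"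
  by (rule braid_natural[OF g G g G j j])

lemma p_j: "x \<in> S \<Longrightarrow> y \<in> S \<Longrightarrow> p (j x \<otimes> j y) = (j \<otimes>\<^sub>m j) (\<Psi> g g (x \<otimes> y))"
  using p_jj[of "x \<otimes> y"] by (simp add: ten_tensor lin_j ten_space_mem)

lemma lins:
  "lin i" "lin j" "lin s" "lin d" "lin A" "lin p" "lin \<sigma>" "lin C" "lin \<delta>" "lin (\<Psi> g g)" "lin er" "lin el"
  by (simp_all add: lin_i lin_j s d lin_A lin_p lin_\<sigma> lin_C lin_\<delta> lin_pg e_simps)

lemmas linc = lins lins[THEN lin_compose]

lemma counit: "z \<in> T \<Longrightarrow> el (d z) = z" "z \<in> T \<Longrightarrow> er (d z) = z"
  by (rule T_ext[where z=z]; simp add: linc lin_intros d_\<gamma> d_j e_simps er_jj el_jj \<delta>_mem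
      lin_simps[OF lin_contract_right[OF e]] lin_simps[OF lin_contract_left[OF e]])+

text \<open>Sorted by the positions of \<gamma>, the terms of the two sides match one by one, except
  for those without \<gamma>, which match by coassociativity of \<delta>.\<close>

lemma d_coassoc: "coassociative T d"
  unfolding coassociative_def
proof
  fix z assume z: "z \<in> T"
  show "\<alpha> ((d \<otimes>\<^sub>m id) (d z)) = (id \<otimes>\<^sub>m d) (d z)"
  proof (rule T_ext[OF z])
    fix x assume x: "x \<in> S"
    let ?J = "j \<otimes>\<^sub>m (j \<otimes>\<^sub>m j)"
    have 1: "\<alpha> ((d \<otimes>\<^sub>m id) ((j \<otimes>\<^sub>m j) w)) =
        (id \<otimes>\<^sub>m (\<lambda>y. \<gamma> \<otimes> y)) ((j \<otimes>\<^sub>m j) w) + \<gamma> \<otimes> (j \<otimes>\<^sub>m j) w + ?J (\<alpha> ((\<delta> \<otimes>\<^sub>m id) w))"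
      if "w \<in> S \<otimes>\<^sub>s S" for w
    proof (rule ten_eq[OF that])
      fix a b assume a: "a \<in> S"
      have "\<alpha> ((j \<otimes>\<^sub>m j) u \<otimes> j b) = ?J (\<alpha> (u \<otimes> b))" for u
        by (rule tensor_ext[where z=u]; simp add: linc lin_intros ten_tensor)
      then show "\<alpha> ((d \<otimes>\<^sub>m id) ((j \<otimes>\<^sub>m j) (a \<otimes> b))) =
        (id \<otimes>\<^sub>m (\<lambda>y. \<gamma> \<otimes> y)) ((j \<otimes>\<^sub>m j) (a \<otimes> b)) + \<gamma> \<otimes> (j \<otimes>\<^sub>m j) (a \<otimes> b) + ?J (\<alpha> ((\<delta> \<otimes>\<^sub>m id) (a \<otimes> b)))"
        using a by (simp add: linc lin_intros ten_tensor d_j)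
    qed (simp_all add: linc lin_intros)
    have 2: "(id \<otimes>\<^sub>m d) ((j \<otimes>\<^sub>m j) w) =
        \<alpha> ((j \<otimes>\<^sub>m j) w \<otimes> \<gamma>) + (id \<otimes>\<^sub>m (\<lambda>y. \<gamma> \<otimes> y)) ((j \<otimes>\<^sub>m j) w) + ?J ((id \<otimes>\<^sub>m \<delta>) w)"
      if "w \<in> S \<otimes>\<^sub>s S" for w
      by (rule ten_eq[OF that]) (auto simp: linc lin_intros ten_tensor d_j)
    have "\<alpha> ((\<delta> \<otimes>\<^sub>m id) (\<delta> x)) = (id \<otimes>\<^sub>m \<delta>) (\<delta> x)"
      using coassoc x by (simp add: coassociative_def)
    then show "\<alpha> ((d \<otimes>\<^sub>m id) (d (j x))) = (id \<otimes>\<^sub>m d) (d (j x))"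
      using x 1[OF \<delta>_mem[OF x]] 2[OF \<delta>_mem[OF x]]
      by (simp add: d_j lin_add[OF lin_ten[OF d lin_id(1)]] lin_add[OF lin_ten[OF lin_id(1) d]] lin_add[OF lin_ten[OF d lin_id(2)]] lin_add[OF lin_ten[OF lin_id(2) d]]
        ten_tensor d lin_intros d_\<gamma> word3_def)
  qed (simp_all add: linc lin_intros d_\<gamma> ten_tensor)
qed

lemma s_counit: "z \<in> T \<otimes>\<^sub>s T \<Longrightarrow> e (er (s z)) = e (er z)"
proof -
  assume z: "z \<in> T \<otimes>\<^sub>s T"
  have "e' (A z) = e' (er z)"
    by (rule TT_ext[OF z]) (auto simp: A_\<gamma> A_j e_simps functional_scale[OF e] functional_0[OF e] C_mem ten_space_mem mult.commute
      intro!: lin_functional[OF e] linc)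
  then show ?thesis using unity_nonzero by (simp add: A_def)
qed

text \<open>The right-hand sides of (L2'-a), of (L2'-b) composed with the braiding, and of (L3') are written
  in terms of \<open>A\<close> and \<open>d\<close> for \<open>G\<close>, where they have a single term each, and in terms of \<open>C\<close> and \<open>\<delta>\<close>
  for \<open>g\<close>.\<close>

definition rhs_a where "rhs_a z = (A \<otimes>\<^sub>m id) (\<alpha>' ((id \<otimes>\<^sub>m p) (\<alpha> ((d \<otimes>\<^sub>m id) z))))"
definition rhs_b where "rhs_b z = (id \<otimes>\<^sub>m A) (\<alpha> ((d \<otimes>\<^sub>m id) z))"
definition rhs_c where "rhs_c z = (A \<otimes>\<^sub>m A) (mid p ((d \<otimes>\<^sub>m d) z))"

lemma lin_rhs: "lin rhs_a" "lin rhs_b" "lin rhs_c"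
  unfolding rhs_a_def[abs_def] rhs_b_def[abs_def] rhs_c_def[abs_def] by (intro lin_intros lins)+

lemmas linr = linc lin_rhs lin_rhs[THEN lin_compose]

definition rhs_ag where "rhs_ag w = \<Psi> g g w + (C \<otimes>\<^sub>m id) (\<alpha>' ((id \<otimes>\<^sub>m \<Psi> g g) (\<alpha> ((\<delta> \<otimes>\<^sub>m id) w))))"
definition rhs_bg where "rhs_bg w = (id \<otimes>\<^sub>m C) (\<alpha> ((\<delta> \<otimes>\<^sub>m id) w))"
definition rhs_cg where "rhs_cg w = (C \<otimes>\<^sub>m id) (\<alpha>' ((id \<otimes>\<^sub>m \<delta>) w)) +
  (id \<otimes>\<^sub>m C) (\<alpha> ((\<Psi> g g \<otimes>\<^sub>m id) (\<alpha>' ((id \<otimes>\<^sub>m \<delta>) w)))) + (C \<otimes>\<^sub>m C) (mid (\<Psi> g g) ((\<delta> \<otimes>\<^sub>m \<delta>) w))"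

lemma lin_rhsg: "lin rhs_ag" "lin rhs_bg" "lin rhs_cg"
  unfolding rhs_ag_def[abs_def] rhs_bg_def[abs_def] rhs_cg_def[abs_def] by (intro lin_intros lins)+

lemma rhs_a_\<gamma>: "z \<in> T \<Longrightarrow> rhs_a (\<gamma> \<otimes> z) = z \<otimes> \<gamma>" "z \<in> T \<Longrightarrow> rhs_a (z \<otimes> \<gamma>) = \<gamma> \<otimes> z"
proof -
  show "rhs_a (\<gamma> \<otimes> z) = z \<otimes> \<gamma>" if "z \<in> T"
    using that by (simp add: rhs_a_def ten_tensor lins lin_intros d_\<gamma> p_\<gamma> A_\<gamma>)
  assume z: "z \<in> T"
  have "(A \<otimes>\<^sub>m id) (\<alpha>' ((id \<otimes>\<^sub>m p) (\<alpha> (u \<otimes> \<gamma>)))) = \<gamma> \<otimes> el u" if "u \<in> T \<otimes>\<^sub>s T" for u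
    by (rule ten_eq[OF that]; simp add: linc ten_tensor lin_intros p_\<gamma> A_\<gamma> e_simps)
  from this[OF d_mem[OF z]] show "rhs_a (z \<otimes> \<gamma>) = \<gamma> \<otimes> z"
    by (simp add: rhs_a_def ten_tensor lins lin_intros counit z)
qed

lemma rhs_b_\<gamma>: "z \<in> T \<Longrightarrow> rhs_b (\<gamma> \<otimes> z) = \<gamma> \<otimes> z" "z \<in> T \<Longrightarrow> rhs_b (z \<otimes> \<gamma>) = z \<otimes> \<gamma>"
proof -
  show "rhs_b (\<gamma> \<otimes> z) = \<gamma> \<otimes> z" if "z \<in> T"
    using that by (simp add: rhs_b_def ten_tensor lins lin_intros d_\<gamma> A_\<gamma>)
  assume z: "z \<in> T"
  have "(id \<otimes>\<^sub>m A) (\<alpha> (u \<otimes> \<gamma>)) = er u \<otimes> \<gamma>" if "u \<in> T \<otimes>\<^sub>s T" for u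
    by (rule ten_eq[OF that]; simp add: linc ten_tensor lin_intros A_\<gamma> e_simps)
  from this[OF d_mem[OF z]] show "rhs_b (z \<otimes> \<gamma>) = z \<otimes> \<gamma>"
    by (simp add: rhs_b_def ten_tensor lins lin_intros counit z)
qed

lemma rhs_c_\<gamma>: "z \<in> T \<Longrightarrow> rhs_c (\<gamma> \<otimes> z) = d z" "z \<in> T \<Longrightarrow> rhs_c (z \<otimes> \<gamma>) = scale V (e z) (\<gamma> \<otimes> \<gamma>)"
proof -
  assume z: "z \<in> T"
  have "(A \<otimes>\<^sub>m A) (mid p ((\<gamma> \<otimes> \<gamma>) \<otimes> u)) = u" if "u \<in> T \<otimes>\<^sub>s T" for u
    by (rule ten_eq[OF that]; simp add: linc ten_tensor lin_intros p_\<gamma> A_\<gamma> mid_tensor)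
  from this[OF d_mem[OF z]] show "rhs_c (\<gamma> \<otimes> z) = d z"
    by (simp add: rhs_c_def ten_tensor lins d_\<gamma>)
  have "(A \<otimes>\<^sub>m A) (mid p (u \<otimes> (\<gamma> \<otimes> \<gamma>))) = scale V (e (er u)) (\<gamma> \<otimes> \<gamma>)" if "u \<in> T \<otimes>\<^sub>s T" for u
    by (rule ten_eq[OF that]; simp add: linc ten_tensor lin_intros p_\<gamma> A_\<gamma> mid_tensor e_simps functional_scale[OF e] mult.commute
      lin_functional[OF e])
  from this[OF d_mem[OF z]] show "rhs_c (z \<otimes> \<gamma>) = scale V (e z) (\<gamma> \<otimes> \<gamma>)"
    by (simp add: rhs_c_def ten_tensor lins d_\<gamma> counit z)
qed

lemma A_left: "z \<in> T \<otimes>\<^sub>s T \<Longrightarrow> (A \<otimes>\<^sub>m id) (\<alpha>' (\<gamma> \<otimes> z)) = z"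
  by (rule ten_eq[of z T T]; (assumption | simp add: linc ten_tensor lin_intros A_\<gamma>))

text \<open>Of the three parts of \<open>d (j x)\<close>, the part x \<otimes> \<gamma> gives the
  bracket term of \<open>s\<close>, the part \<gamma> \<otimes> x gives \<Psi> and the part \<delta>
  gives the rest of (L2'-a). Hence \<open>s\<close> agrees with \<open>rhs_a\<close> exactly if
  (L2'-a) holds.\<close>

lemma rhs_a_jj:
  assumes "w \<in> S \<otimes>\<^sub>s S"
  shows "rhs_a ((j \<otimes>\<^sub>m j) w) = (j \<otimes>\<^sub>m j) (rhs_ag w) + j (C w) \<otimes> \<gamma>"
proof (rule ten_eq[OF assms])
  fix x y assume x: "x \<in> S" and y: "y \<in> S"
  have "(A \<otimes>\<^sub>m id) (\<alpha>' ((id \<otimes>\<^sub>m p) (\<alpha> ((j \<otimes>\<^sub>m j) u \<otimes> j y)))) =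
      (j \<otimes>\<^sub>m j) ((C \<otimes>\<^sub>m id) (\<alpha>' ((id \<otimes>\<^sub>m \<Psi> g g) (\<alpha> (u \<otimes> y)))))" if "u \<in> S \<otimes>\<^sub>s S" for u
  proof (rule ten_eq[OF that])
    fix a b assume ab: "a \<in> S" "b \<in> S"
    have "(A \<otimes>\<^sub>m id) (\<alpha>' (j a \<otimes> (j \<otimes>\<^sub>m j) v)) = (j \<otimes>\<^sub>m j) ((C \<otimes>\<^sub>m id) (\<alpha>' (a \<otimes> v)))" if "v \<in> S \<otimes>\<^sub>s S" for v
      by (rule ten_eq[OF that]; simp add: linc ten_tensor lin_intros A_j ab)
    from this[OF pg_mem] show "(A \<otimes>\<^sub>m id) (\<alpha>' ((id \<otimes>\<^sub>m p) (\<alpha> ((j \<otimes>\<^sub>m j) (a \<otimes> b) \<otimes> j y)))) =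
      (j \<otimes>\<^sub>m j) ((C \<otimes>\<^sub>m id) (\<alpha>' ((id \<otimes>\<^sub>m \<Psi> g g) (\<alpha> ((a \<otimes> b) \<otimes> y)))))"
      using ab y by (simp add: ten_tensor lins lin_intros p_j ten_space_mem)
  qed (simp_all add: linc lin_intros)
  note D = this[OF \<delta>_mem[OF x]]
  have "rhs_a (j x \<otimes> j y) = j (C (x \<otimes> y)) \<otimes> \<gamma> + (j \<otimes>\<^sub>m j) (\<Psi> g g (x \<otimes> y)) +
      (A \<otimes>\<^sub>m id) (\<alpha>' ((id \<otimes>\<^sub>m p) (\<alpha> ((j \<otimes>\<^sub>m j) (\<delta> x) \<otimes> j y))))"
    using x y by (simp add: rhs_a_def ten_tensor lins lin_intros d_j lin_add[OF lin_ten[OF lin_A lin_id(1)]]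
      lin_add[OF lin_ten[OF lin_id(1) lin_p]] lin_add[OF lin_ten[OF lin_A lin_id(2)]]
      lin_add[OF lin_ten[OF lin_id(2) lin_p]] p_\<gamma> p_j j_mem A_j A_left[OF jj_mem[OF pg_mem]] ten_space_mem)
  then show "rhs_a ((j \<otimes>\<^sub>m j) (x \<otimes> y)) = (j \<otimes>\<^sub>m j) (rhs_ag (x \<otimes> y)) + j (C (x \<otimes> y)) \<otimes> \<gamma>"
    unfolding D by (simp add: ten_tensor lins lin_intros rhs_ag_def lin_add[OF lin_ten[OF lin_j lin_j]] algebra_simps)
qed (simp_all add: linr lin_rhsg lin_intros)

text \<open>The same three parts give here the argument itself, the term with \<gamma> in front, and
  the \<delta> term of (L2'-b).\<close>

lemma rhs_b_jj:
  assumes "w \<in> S \<otimes>\<^sub>s S"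
  shows "rhs_b ((j \<otimes>\<^sub>m j) w) = (j \<otimes>\<^sub>m j) (w + rhs_bg w) + \<gamma> \<otimes> j (C w)"
proof (rule ten_eq[OF assms])
  fix x y assume x: "x \<in> S" and y: "y \<in> S"
  have "(id \<otimes>\<^sub>m A) (\<alpha> ((j \<otimes>\<^sub>m j) u \<otimes> j y)) = (j \<otimes>\<^sub>m j) ((id \<otimes>\<^sub>m C) (\<alpha> (u \<otimes> y)))" if "u \<in> S \<otimes>\<^sub>s S" for u
    by (rule ten_eq[OF that]; simp add: linc ten_tensor lin_intros A_j y)
  note D = this[OF \<delta>_mem[OF x]]
  have "rhs_b (j x \<otimes> j y) = j x \<otimes> j y + \<gamma> \<otimes> j (C (x \<otimes> y)) + (id \<otimes>\<^sub>m A) (\<alpha> ((j \<otimes>\<^sub>m j) (\<delta> x) \<otimes> j y))"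
    using x y by (simp add: rhs_b_def ten_tensor lins lin_intros d_j lin_add[OF lin_ten[OF lin_id(1) lin_A]]
      lin_add[OF lin_ten[OF lin_id(2) lin_A]] j_mem A_j A_\<gamma>)
  then show "rhs_b ((j \<otimes>\<^sub>m j) (x \<otimes> y)) = (j \<otimes>\<^sub>m j) (x \<otimes> y + rhs_bg (x \<otimes> y)) + \<gamma> \<otimes> j (C (x \<otimes> y))"
    unfolding D by (simp add: ten_tensor lins lin_intros rhs_bg_def lin_add[OF lin_ten[OF lin_j lin_j]] algebra_simps)
qed (simp_all add: linr lin_rhsg lin_intros)

text \<open>Of the nine products of parts of \<open>d (j x)\<close> and \<open>d (j y)\<close>, four
  vanish because an element of g sends \<gamma> to 0. Three of the others form the right-hand side
  of (L3'), and two are the terms with \<gamma> in the coproduct of the bracket.\<close>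

lemma rhs_c_jj:
  assumes "w \<in> S \<otimes>\<^sub>s S"
  shows "rhs_c ((j \<otimes>\<^sub>m j) w) = (j \<otimes>\<^sub>m j) (rhs_cg w) + j (C w) \<otimes> \<gamma> + \<gamma> \<otimes> j (C w)"
proof (rule ten_eq[OF assms])
  fix x y assume x: "x \<in> S" and y: "y \<in> S"
  define F where "F = (\<lambda>u v. (A \<otimes>\<^sub>m A) (mid p (u \<otimes> v)))"
  have lin_F: "lin (F u)" "lin (\<lambda>u. F u v)" for u v
    unfolding F_def by (intro lin_intros lins)+
  have lin_F': "lin f \<Longrightarrow> lin (\<lambda>w. F (f w) v)" "lin f \<Longrightarrow> lin (\<lambda>w. F u (f w))" for f u v
    unfolding F_def by (intro lin_intros lins; assumption)+
  have F: "F (a \<otimes> b) (c \<otimes> h) = (A \<otimes>\<^sub>m A) (\<alpha>' (a \<otimes> \<alpha> (p (b \<otimes> c) \<otimes> h)))" for a b c h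
    by (simp add: F_def mid_tensor lins)
  note xT = j_mem[OF x] and yT = j_mem[OF y]
  have AA: "(A \<otimes>\<^sub>m A) (\<alpha>' (a \<otimes> \<alpha> ((j \<otimes>\<^sub>m j) v \<otimes> \<gamma>))) = 0" if "v \<in> S \<otimes>\<^sub>s S" "a \<in> T" for v a
    by (rule ten_eq[OF that(1), where g="\<lambda>v. 0"]; simp add: linc ten_tensor lin_intros A_\<gamma> that j_mem)
  have 1: "F (j x \<otimes> \<gamma>) (j y \<otimes> \<gamma>) = j (C (x \<otimes> y)) \<otimes> \<gamma>" "F (j x \<otimes> \<gamma>) (\<gamma> \<otimes> j y) = 0"
    "F (\<gamma> \<otimes> j x) (\<gamma> \<otimes> j y) = \<gamma> \<otimes> j (C (x \<otimes> y))" "F (\<gamma> \<otimes> j x) (j y \<otimes> \<gamma>) = 0"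
    using x y by (simp_all add: F p_\<gamma> p_j xT yT \<gamma>_mem ten_tensor lins A_j A_\<gamma> AA pg_mem ten_space_mem)
  have 2: "F (j x \<otimes> \<gamma>) ((j \<otimes>\<^sub>m j) v) = (j \<otimes>\<^sub>m j) ((C \<otimes>\<^sub>m id) (\<alpha>' (x \<otimes> v)))" if "v \<in> S \<otimes>\<^sub>s S" for v
    by (rule ten_eq[OF that]; simp add: linc lin_F' F ten_tensor lin_intros A_j A_\<gamma> p_\<gamma> x j_mem)
  have 3: "F (\<gamma> \<otimes> j x) ((j \<otimes>\<^sub>m j) v) = (j \<otimes>\<^sub>m j) ((id \<otimes>\<^sub>m C) (\<alpha> ((\<Psi> g g \<otimes>\<^sub>m id) (\<alpha>' (x \<otimes> v)))))"
    if "v \<in> S \<otimes>\<^sub>s S" for v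
  proof (rule ten_eq[OF that])
    fix a b assume ab: "a \<in> S" "b \<in> S"
    have "(A \<otimes>\<^sub>m A) (\<alpha>' (\<gamma> \<otimes> \<alpha> ((j \<otimes>\<^sub>m j) q \<otimes> j b))) = (j \<otimes>\<^sub>m j) ((id \<otimes>\<^sub>m C) (\<alpha> (q \<otimes> b)))" if "q \<in> S \<otimes>\<^sub>s S" for q
      by (rule ten_eq[OF that]; simp add: linc ten_tensor lin_intros A_j A_\<gamma> ab j_mem)
    then show "F (\<gamma> \<otimes> j x) ((j \<otimes>\<^sub>m j) (a \<otimes> b)) = (j \<otimes>\<^sub>m j) ((id \<otimes>\<^sub>m C) (\<alpha> ((\<Psi> g g \<otimes>\<^sub>m id) (\<alpha>' (x \<otimes> (a \<otimes> b))))))"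
      using ab x by (simp add: ten_tensor lins lin_intros F p_j pg_mem ten_space_mem)
  qed (simp_all add: linc lin_F' lin_intros)
  have 4: "F ((j \<otimes>\<^sub>m j) u) (j y \<otimes> \<gamma>) = 0" "F ((j \<otimes>\<^sub>m j) u) (\<gamma> \<otimes> j y) = 0" if "u \<in> S \<otimes>\<^sub>s S" for u
    by (rule ten_eq[OF that, where g="\<lambda>v. 0"]; simp add: linc lin_F' F ten_tensor lin_intros A_j A_\<gamma> p_\<gamma> p_j y j_mem AA pg_mem ten_space_mem)+
  have 5: "F ((j \<otimes>\<^sub>m j) u) ((j \<otimes>\<^sub>m j) v) = (j \<otimes>\<^sub>m j) ((C \<otimes>\<^sub>m C) (mid (\<Psi> g g) (u \<otimes> v)))"
    if u: "u \<in> S \<otimes>\<^sub>s S" and v: "v \<in> S \<otimes>\<^sub>s S" for u v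
  proof (rule ten_eq[OF u])
    fix a b assume ab: "a \<in> S" "b \<in> S"
    show "F ((j \<otimes>\<^sub>m j) (a \<otimes> b)) ((j \<otimes>\<^sub>m j) v) = (j \<otimes>\<^sub>m j) ((C \<otimes>\<^sub>m C) (mid (\<Psi> g g) ((a \<otimes> b) \<otimes> v)))"
    proof (rule ten_eq[OF v])
      fix c h assume ch: "c \<in> S" "h \<in> S"
      have "(A \<otimes>\<^sub>m A) (\<alpha>' (j a \<otimes> \<alpha> ((j \<otimes>\<^sub>m j) q \<otimes> j h))) = (j \<otimes>\<^sub>m j) ((C \<otimes>\<^sub>m C) (\<alpha>' (a \<otimes> \<alpha> (q \<otimes> h))))" if "q \<in> S \<otimes>\<^sub>s S" for q
        by (rule ten_eq[OF that]; simp add: linc ten_tensor lin_intros A_j ab ch)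
      then show "F ((j \<otimes>\<^sub>m j) (a \<otimes> b)) ((j \<otimes>\<^sub>m j) (c \<otimes> h)) = (j \<otimes>\<^sub>m j) ((C \<otimes>\<^sub>m C) (mid (\<Psi> g g) ((a \<otimes> b) \<otimes> (c \<otimes> h))))"
        using ab ch by (simp add: ten_tensor lins F p_j pg_mem ten_space_mem mid_tensor)
    qed (simp_all add: linc lin_F' lin_intros)
  qed (simp_all add: linc lin_F' lin_intros)
  have "rhs_c (j x \<otimes> j y) = F (d (j x)) (d (j y))"
    by (simp add: rhs_c_def F_def ten_tensor lins)
  also have "\<dots> = (j \<otimes>\<^sub>m j) (rhs_cg (x \<otimes> y)) + j (C (x \<otimes> y)) \<otimes> \<gamma> + \<gamma> \<otimes> j (C (x \<otimes> y))"
    using x y by (simp add: d_j lin_add[OF lin_F(1)] lin_add[OF lin_F(2)] 1 2 3 4 5 \<delta>_mem rhs_cg_def ten_tensor lins lin_intros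
      lin_add[OF lin_ten[OF lin_j lin_j]] algebra_simps)
  finally show "rhs_c ((j \<otimes>\<^sub>m j) (x \<otimes> y)) = (j \<otimes>\<^sub>m j) (rhs_cg (x \<otimes> y)) + j (C (x \<otimes> y)) \<otimes> \<gamma> + \<gamma> \<otimes> j (C (x \<otimes> y))"
    by (simp add: ten_tensor lins)
qed (simp_all add: linr lin_rhsg lin_intros)

end

section \<open>Good quantum Lie algebras\<close>

context extended
begin

lemma retraction_exists: "\<exists>t. lin t \<and> t \<gamma> = 0 \<and> (\<forall>x \<in> S. t (j x) = x)"
proof -
  obtain r where r: "lin r" "\<And>x. x \<in> S \<Longrightarrow> r (j x) = x"
    using vector_space_pair.linear_exists_left_inverse_on[OF _ lin_j obj_subspace[OF g] inj_j]
    by (auto simp: vector_space_pair_def vector_space_axioms)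
  have "lin (\<lambda>z. r (z - scale V (e z) \<gamma>))"
    by (intro lin_compose[OF r(1)] lin_intros e)
  then show ?thesis
    by (intro exI[of _ "\<lambda>z. r (z - scale V (e z) \<gamma>)"]) (simp add: lin_0[OF r(1)] r(2))
qed

text \<open>The projection of \<open>G\<close> onto g along \<gamma>. With \<open>e\<close> it reads
  off the two components of a vector of \<open>G\<close>.\<close>

definition t where "t = (SOME t. lin t \<and> t \<gamma> = 0 \<and> (\<forall>x \<in> S. t (j x) = x))"

lemma lin_t: "lin t" and t_\<gamma> [simp]: "t \<gamma> = 0" and t_j [simp]: "x \<in> S \<Longrightarrow> t (j x) = x"
  using someI_ex[OF retraction_exists] by (auto simp: t_def)

lemma t_jj: "w \<in> S \<otimes>\<^sub>s S \<Longrightarrow> (t \<otimes>\<^sub>m t) ((j \<otimes>\<^sub>m j) w) = w"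
proof -
  assume "w \<in> S \<otimes>\<^sub>s S"
  then show ?thesis by (rule ten_eq) (simp_all add: linc lin_t lin_intros ten_tensor)
qed

lemma ten_functional_e: "ten_functional e e z = e (er z)"
proof -
  note f = ten_functional_spec[OF e e]
  have "scale V (ten_functional e e z) (unity V) = scale V (e (er z)) (unity V)"
    by (rule tensor_ext[where z=z])
      (use f in \<open>auto simp: e_simps functional_scale[OF e] mult.commute intro!: lin_functional[OF _ lin_id(2)] lin_functional[OF e] e_simps\<close>)
  then show ?thesis using unity_nonzero by simp
qed

text \<open>\<open>mor_s\<close> and \<open>s_counit\<close> hold for every extension, so
  compatibility with the coproduct is all that remains.\<close>

lemma coalgebra_endomorphism_iff:
  "coalgebra_endomorphism_of_square G d e s \<longleftrightarrow>
    (\<forall>z \<in> T \<otimes>\<^sub>s T. mid p ((d \<otimes>\<^sub>m d) (s z)) = (s \<otimes>\<^sub>m s) (mid p ((d \<otimes>\<^sub>m d) z)))"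
  by (auto simp: coalgebra_endomorphism_of_square_def coalgebra_morphism_def mor_s braided_square_comult_def
      braided_square_counit_def ten_functional_e s_counit)

lemma pg_inv: "w \<in> S \<otimes>\<^sub>s S \<Longrightarrow> \<Psi> g g (inv_into (S \<otimes>\<^sub>s S) (\<Psi> g g) w) = w"
  "w \<in> S \<otimes>\<^sub>s S \<Longrightarrow> inv_into (S \<otimes>\<^sub>s S) (\<Psi> g g) (\<Psi> g g w) = w"
  "w \<in> S \<otimes>\<^sub>s S \<Longrightarrow> inv_into (S \<otimes>\<^sub>s S) (\<Psi> g g) w \<in> S \<otimes>\<^sub>s S"
  using bij_betw_inv_into_right[OF braid_bij[OF g g]] bij_betw_inv_into_left[OF braid_bij[OF g g]]
    bij_betw_apply[OF bij_betw_inv_into[OF braid_bij[OF g g]]] by auto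

lemma
  assumes w: "w \<in> S \<otimes>\<^sub>s S"
  shows rhs_ag_mem: "rhs_ag w \<in> S \<otimes>\<^sub>s S" and rhs_bg_mem: "rhs_bg w \<in> S \<otimes>\<^sub>s S" and rhs_cg_mem: "rhs_cg w \<in> S \<otimes>\<^sub>s S"
proof -
  note sub = image_subsetI
  have \<delta>1: "(\<delta> \<otimes>\<^sub>m id) w \<in> (S \<otimes>\<^sub>s S) \<otimes>\<^sub>s S" and \<delta>2: "(id \<otimes>\<^sub>m \<delta>) w \<in> S \<otimes>\<^sub>s (S \<otimes>\<^sub>s S)"
    and \<delta>\<delta>: "(\<delta> \<otimes>\<^sub>m \<delta>) w \<in> (S \<otimes>\<^sub>s S) \<otimes>\<^sub>s (S \<otimes>\<^sub>s S)"
    by (rule ten_map[OF w lin_\<delta> lin_id(1)] ten_map[OF w lin_id(1) lin_\<delta>] ten_map[OF w lin_\<delta> lin_\<delta>];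
      auto simp: \<delta>_mem)+
  have p1: "(\<Psi> g g \<otimes>\<^sub>m id) q \<in> (S \<otimes>\<^sub>s S) \<otimes>\<^sub>s S" and C1: "(C \<otimes>\<^sub>m id) q \<in> S \<otimes>\<^sub>s S" if "q \<in> (S \<otimes>\<^sub>s S) \<otimes>\<^sub>s S" for q
    by (rule ten_map[OF that]; auto simp: pg_mem C_mem lins lin_intros)+
  have p2: "(id \<otimes>\<^sub>m \<Psi> g g) q \<in> S \<otimes>\<^sub>s (S \<otimes>\<^sub>s S)" and C2: "(id \<otimes>\<^sub>m C) q \<in> S \<otimes>\<^sub>s S" if "q \<in> S \<otimes>\<^sub>s (S \<otimes>\<^sub>s S)" for q
    by (rule ten_map[OF that]; auto simp: pg_mem C_mem lins lin_intros)+
  have CC: "(C \<otimes>\<^sub>m C) q \<in> S \<otimes>\<^sub>s S" if "q \<in> (S \<otimes>\<^sub>s S) \<otimes>\<^sub>s (S \<otimes>\<^sub>s S)" for q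
    by (rule ten_map[OF that]; auto simp: C_mem lins)
  have "mid (\<Psi> g g) ((\<delta> \<otimes>\<^sub>m \<delta>) w) \<in> (S \<otimes>\<^sub>s S) \<otimes>\<^sub>s (S \<otimes>\<^sub>s S)"
    by (rule mid_mem[OF \<delta>\<delta> lin_pg]) (auto simp: pg_mem)
  then show "rhs_ag w \<in> S \<otimes>\<^sub>s S" "rhs_bg w \<in> S \<otimes>\<^sub>s S" "rhs_cg w \<in> S \<otimes>\<^sub>s S"
    unfolding rhs_ag_def rhs_bg_def rhs_cg_def
    by (intro subspace_add subspace_ten_space CC C1 C2 p1 p2 pg_mem assoc_mem assoc_inv_mem \<delta>1 \<delta>2 w; assumption)+
qed

text \<open>Composing with the bijection \<Psi> removes the inverse from (L2'-b), which then has the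
  form that \<open>rhs_b\<close> produces.\<close>

lemma L2b_iff:
  assumes w: "w \<in> S \<otimes>\<^sub>s S"
  shows "\<sigma> w = inv_into (S \<otimes>\<^sub>s S) (\<Psi> g g) w + inv_into (S \<otimes>\<^sub>s S) (\<Psi> g g) (rhs_bg w) \<longleftrightarrow>
    \<Psi> g g (\<sigma> w) = w + rhs_bg w"
proof -
  let ?i = "inv_into (S \<otimes>\<^sub>s S) (\<Psi> g g)"
  have "\<Psi> g g (?i w + ?i (rhs_bg w)) = w + rhs_bg w"
    by (simp add: lin_add[OF lin_pg] pg_inv w rhs_bg_mem)
  moreover have "?i w + ?i (rhs_bg w) \<in> S \<otimes>\<^sub>s S" by (simp add: subspace_add pg_inv w rhs_bg_mem)
  ultimately show ?thesis
    using pg_inv(2)[OF \<sigma>_mem[OF w]] pg_inv(2) by metis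
qed

lemma good_iff:
  "good_quantum_Lie_algebra g \<sigma> C \<delta> \<longleftrightarrow>
    (\<forall>w \<in> (S \<otimes>\<^sub>s S) \<otimes>\<^sub>s S. C ((id \<otimes>\<^sub>m C) (\<alpha> w)) = C ((C \<otimes>\<^sub>m id) w) + C ((id \<otimes>\<^sub>m C) (\<alpha> ((\<sigma> \<otimes>\<^sub>m id) w)))) \<and>
    (\<forall>w \<in> S \<otimes>\<^sub>s S. \<sigma> w = rhs_ag w) \<and> (\<forall>w \<in> S \<otimes>\<^sub>s S. \<Psi> g g (\<sigma> w) = w + rhs_bg w) \<and>
    (\<forall>w \<in> S \<otimes>\<^sub>s S. \<delta> (C w) = rhs_cg w) \<and> (\<forall>w \<in> S \<otimes>\<^sub>s S. w - \<sigma> w = 0 \<longrightarrow> C w = 0)"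
proof -
  have "(\<forall>w \<in> S \<otimes>\<^sub>s S. \<sigma> w = inv_into (S \<otimes>\<^sub>s S) (\<Psi> g g) w + inv_into (S \<otimes>\<^sub>s S) (\<Psi> g g) (rhs_bg w)) \<longleftrightarrow>
    (\<forall>w \<in> S \<otimes>\<^sub>s S. \<Psi> g g (\<sigma> w) = w + rhs_bg w)"
    using L2b_iff by blast
  then show ?thesis
    unfolding good_quantum_Lie_algebra_def space_ten rhs_ag_def rhs_bg_def rhs_cg_def
    using g \<sigma> C \<delta> coassoc by meson
qed

text \<open>The elementwise axiom (2) and (L1') are the same identity, once the sum over \<sigma>(x
  \<otimes> y) is written as a linear map.\<close>

lemma jacobi_iff:
  "quantum_jacobi S \<sigma> C \<longleftrightarrow>
    (\<forall>w \<in> (S \<otimes>\<^sub>s S) \<otimes>\<^sub>s S. C ((id \<otimes>\<^sub>m C) (\<alpha> w)) = C ((C \<otimes>\<^sub>m id) w) + C ((id \<otimes>\<^sub>m C) (\<alpha> ((\<sigma> \<otimes>\<^sub>m id) w))))"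
proof -
  have b: "bilin (\<lambda>y' x'. C (y' \<otimes> C (x' \<otimes> z)))" for z
    by (intro bilinI linc lin_intros)
  have l: "lift (\<lambda>y' x'. C (y' \<otimes> C (x' \<otimes> z))) u = C ((id \<otimes>\<^sub>m C) (\<alpha> (u \<otimes> z)))" for u z
    by (rule tensor_ext[where f="lift (\<lambda>y' x'. C (y' \<otimes> C (x' \<otimes> z)))"])
      (simp_all add: lin_lift b lift_tensor linc lin_intros ten_tensor)
  show ?thesis
    unfolding quantum_jacobi_def l
  proof (intro iffI ballI)
    fix w assume *: "\<forall>x\<in>S. \<forall>y\<in>S. \<forall>z\<in>S. C (x \<otimes> C (y \<otimes> z)) = C (C (x \<otimes> y) \<otimes> z) + C ((id \<otimes>\<^sub>m C) (\<alpha> (\<sigma> (x \<otimes> y) \<otimes> z)))"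
      and w: "w \<in> (S \<otimes>\<^sub>s S) \<otimes>\<^sub>s S"
    show "C ((id \<otimes>\<^sub>m C) (\<alpha> w)) = C ((C \<otimes>\<^sub>m id) w) + C ((id \<otimes>\<^sub>m C) (\<alpha> ((\<sigma> \<otimes>\<^sub>m id) w)))"
      by (rule ten_eq3[OF w]) (use * in \<open>simp_all add: linc lin_intros ten_tensor id_def\<close>)
  next
    fix x y z assume *: "\<forall>w \<in> (S \<otimes>\<^sub>s S) \<otimes>\<^sub>s S. C ((id \<otimes>\<^sub>m C) (\<alpha> w)) = C ((C \<otimes>\<^sub>m id) w) + C ((id \<otimes>\<^sub>m C) (\<alpha> ((\<sigma> \<otimes>\<^sub>m id) w)))"
      and "x \<in> S" "y \<in> S" "z \<in> S"
    then have "(x \<otimes> y) \<otimes> z \<in> (S \<otimes>\<^sub>s S) \<otimes>\<^sub>s S" by (simp add: ten_space_mem)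
    from *[rule_format, OF this] show "C (x \<otimes> C (y \<otimes> z)) = C (C (x \<otimes> y) \<otimes> z) + C ((id \<otimes>\<^sub>m C) (\<alpha> (\<sigma> (x \<otimes> y) \<otimes> z)))"
      by (simp add: ten_tensor lins lin_intros)
  qed
qed

sublocale words: bialgebra_words V T A p d
  by (rule bialgebra_words[OF G mor_A mor_d])

section \<open>From a good quantum Lie algebra to the properties of \<open>s\<close>\<close>

context
  assumes good: "good_quantum_Lie_algebra g \<sigma> C \<delta>"
begin

lemma
  shows L1: "w \<in> (S \<otimes>\<^sub>s S) \<otimes>\<^sub>s S \<Longrightarrow> C ((id \<otimes>\<^sub>m C) (\<alpha> w)) = C ((C \<otimes>\<^sub>m id) w) + C ((id \<otimes>\<^sub>m C) (\<alpha> ((\<sigma> \<otimes>\<^sub>m id) w)))"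
    and L2a: "w \<in> S \<otimes>\<^sub>s S \<Longrightarrow> \<sigma> w = rhs_ag w" and L2b: "w \<in> S \<otimes>\<^sub>s S \<Longrightarrow> \<Psi> g g (\<sigma> w) = w + rhs_bg w"
    and L3: "w \<in> S \<otimes>\<^sub>s S \<Longrightarrow> \<delta> (C w) = rhs_cg w" and ker: "w \<in> S \<otimes>\<^sub>s S \<Longrightarrow> w - \<sigma> w = 0 \<Longrightarrow> C w = 0"
  using good unfolding good_iff by blast+

lemma s_rhs_a: "z \<in> T \<otimes>\<^sub>s T \<Longrightarrow> s z = rhs_a z"
proof -
  assume z: "z \<in> T \<otimes>\<^sub>s T"
  show ?thesis
  proof (rule TT_ext[OF z])
    show "s (j x \<otimes> j y) = rhs_a (j x \<otimes> j y)" if "x \<in> S" "y \<in> S" for x y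
      using that s_j[OF that] rhs_a_jj[of "x \<otimes> y"] by (simp add: ten_tensor lins ten_space_mem L2a)
  qed (simp_all add: linr rhs_a_\<gamma> s_\<gamma>)
qed

lemma s_rhs_b: "z \<in> T \<otimes>\<^sub>s T \<Longrightarrow> p (s z) = rhs_b z"
proof -
  assume z: "z \<in> T \<otimes>\<^sub>s T"
  show ?thesis
  proof (rule TT_ext[OF z])
    show "p (s (j x \<otimes> j y)) = rhs_b (j x \<otimes> j y)" if "x \<in> S" "y \<in> S" for x y
      using that s_j[OF that] rhs_b_jj[of "x \<otimes> y"]
      by (simp add: ten_tensor lins ten_space_mem lin_add[OF lin_p] p_jj \<sigma>_mem L2b p_\<gamma> j_mem C_mem)
  qed (simp_all add: linr rhs_b_\<gamma> s_\<gamma> p_\<gamma>)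
qed

lemma A_rhs_c: "z \<in> T \<otimes>\<^sub>s T \<Longrightarrow> d (A z) = rhs_c z"
proof -
  assume z: "z \<in> T \<otimes>\<^sub>s T"
  show ?thesis
  proof (rule TT_ext[OF z])
    show "d (A (j x \<otimes> j y)) = rhs_c (j x \<otimes> j y)" if "x \<in> S" "y \<in> S" for x y
      using that rhs_c_jj[of "x \<otimes> y"]
      by (simp add: ten_tensor lins ten_space_mem A_j d_j C_mem L3 algebra_simps)
  qed (simp_all add: linr rhs_c_\<gamma> A_\<gamma> d_\<gamma> lin_scale[OF d])
qed

text \<open>For three elements of g this is (L1'): the summand [x,y] \<otimes> \<gamma> of
  \<open>s\<close> contributes the term [[x,y],z], since \<gamma> acts as the identity. If the last
  factor is \<gamma>, both sides reduce to counits.\<close>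

lemma A_twist:
  assumes "w \<in> (T \<otimes>\<^sub>s T) \<otimes>\<^sub>s T"
  shows "A ((id \<otimes>\<^sub>m A) (\<alpha> w)) = A ((id \<otimes>\<^sub>m A) (\<alpha> ((s \<otimes>\<^sub>m id) w)))"
proof (rule ten_eq[OF assms])
  fix u z assume u: "u \<in> T \<otimes>\<^sub>s T" and z: "z \<in> T"
  have 1: "A ((id \<otimes>\<^sub>m A) (\<alpha> (u \<otimes> \<gamma>))) = scale V (e (er u)) \<gamma>" if "u \<in> T \<otimes>\<^sub>s T" for u
    by (rule ten_eq[OF that]; simp add: linc lin_intros ten_tensor A_\<gamma> e_simps functional_scale[OF e] lin_functional[OF e] mult.commute
      lin_simps[OF lin_A])
  have 2: "A ((id \<otimes>\<^sub>m A) (\<alpha> (u \<otimes> j z))) = A ((id \<otimes>\<^sub>m A) (\<alpha> (s u \<otimes> j z)))" if z: "z \<in> S" for z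
  proof (rule TT_ext[OF u])
    fix x y assume xy: "x \<in> S" "y \<in> S"
    have "A ((id \<otimes>\<^sub>m A) (\<alpha> ((j \<otimes>\<^sub>m j) v \<otimes> j z))) = j (C ((id \<otimes>\<^sub>m C) (\<alpha> (v \<otimes> z))))" if "v \<in> S \<otimes>\<^sub>s S" for v
      by (rule ten_eq[OF that]; simp add: linc lin_intros ten_tensor A_j z C_mem ten_space_mem)
    then show "A ((id \<otimes>\<^sub>m A) (\<alpha> ((j x \<otimes> j y) \<otimes> j z))) = A ((id \<otimes>\<^sub>m A) (\<alpha> (s (j x \<otimes> j y) \<otimes> j z)))"
      using xy z L1[of "(x \<otimes> y) \<otimes> z"]
      by (simp add: s_j ten_tensor lins lin_intros lin_add[OF lin_A] lin_add[OF lin_ten[OF lin_id(1) lin_A]]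
        lin_add[OF lin_ten[OF lin_id(2) lin_A]] A_\<gamma> j_mem A_j \<sigma>_mem C_mem ten_space_mem lin_add[OF lin_j])
  qed (simp_all add: linc lin_intros ten_tensor A_\<gamma> s_\<gamma> j_mem z ten_space_mem A_mem)
  show "A ((id \<otimes>\<^sub>m A) (\<alpha> (u \<otimes> z))) = A ((id \<otimes>\<^sub>m A) (\<alpha> ((s \<otimes>\<^sub>m id) (u \<otimes> z))))"
  proof (rule T_ext[OF z])
    show "A ((id \<otimes>\<^sub>m A) (\<alpha> (u \<otimes> \<gamma>))) = A ((id \<otimes>\<^sub>m A) (\<alpha> ((s \<otimes>\<^sub>m id) (u \<otimes> \<gamma>))))"
      using 1[OF u] 1[OF s_mem[OF u]] by (simp add: ten_tensor lins lin_intros s_counit u)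
  qed (simp_all add: linc lin_intros ten_tensor 2[unfolded id_def] id_def)
qed (simp_all add: linc lin_intros)

lemma action_strands_G: "action_strands words.A words.p words.d"
proof (rule words.action_strands)
  show "coassociative T d" by (rule d_coassoc)
  show "pos12 p (pos23 p (pos12 p w)) = pos23 p (pos12 p (pos23 p w))" if "w \<in> (T \<otimes>\<^sub>s T) \<otimes>\<^sub>s T" for w
    by (rule braid_yang_baxter[OF G that])
  show "p ((A \<otimes>\<^sub>m id) (\<alpha>' ((id \<otimes>\<^sub>m p) (\<alpha> ((d \<otimes>\<^sub>m id) z))))) = (id \<otimes>\<^sub>m A) (\<alpha> ((d \<otimes>\<^sub>m id) z))"
    if "z \<in> T \<otimes>\<^sub>s T" for z
    using s_rhs_b[OF that] s_rhs_a[OF that] by (simp add: rhs_a_def rhs_b_def)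
  show "d (A z) = (A \<otimes>\<^sub>m A) (mid p ((d \<otimes>\<^sub>m d) z))" if "z \<in> T \<otimes>\<^sub>s T" for z
    using A_rhs_c[OF that] by (simp add: rhs_c_def)
  show "A ((id \<otimes>\<^sub>m A) (\<alpha> w)) =
      A ((id \<otimes>\<^sub>m A) (\<alpha> (((\<lambda>z. (A \<otimes>\<^sub>m id) (\<alpha>' ((id \<otimes>\<^sub>m p) (\<alpha> ((d \<otimes>\<^sub>m id) z))))) \<otimes>\<^sub>m id) w)))"
    if "w \<in> (T \<otimes>\<^sub>s T) \<otimes>\<^sub>s T" for w
  proof -
    have "(s \<otimes>\<^sub>m id) w = (rhs_a \<otimes>\<^sub>m id) w"
      by (rule ten_cong[OF that s lin_id(1) lin_rhs(1) lin_id(1)]) (simp_all add: s_rhs_a)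
    with A_twist[OF that] show ?thesis by (simp add: rhs_a_def[abs_def])
  qed
qed

lemma s_braid: "w \<in> (T \<otimes>\<^sub>s T) \<otimes>\<^sub>s T \<Longrightarrow> pos12 s (pos23 s (pos12 s w)) = pos23 s (pos12 s (pos23 s w))"
  and s_comult: "z \<in> T \<otimes>\<^sub>s T \<Longrightarrow> mid p ((d \<otimes>\<^sub>m d) (s z)) = (s \<otimes>\<^sub>m s) (mid p ((d \<otimes>\<^sub>m d) z))"
  using words.action_braiding[OF action_strands_G s] s_rhs_a by (simp_all add: rhs_a_def)

lemma coalgebra_endomorphism: "coalgebra_endomorphism_of_square G d e s"
  unfolding coalgebra_endomorphism_iff using s_comult by simp

text \<open>The braid relation of \<open>s\<close> on \<open>g\<close> is compared component by component, where a component is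
  given by the positions of \<open>\<gamma>\<close>.\<close>

lemma quantum_Lie: "quantum_Lie_algebra g \<sigma> C"
proof -
  let ?S3 = "(S \<otimes>\<^sub>s S) \<otimes>\<^sub>s S"
  define J2 where "J2 = j \<otimes>\<^sub>m j"
  define J3 where "J3 = (j \<otimes>\<^sub>m j) \<otimes>\<^sub>m j"
  \<comment> \<open>\<open>K2\<close> has \<gamma> in the second place, \<open>K3\<close> in the
    third and \<open>KK\<close> in both. In the two composites to be compared \<gamma> never reaches
    the first place.\<close>
  define K2 where "K2 z = ((\<lambda>a. a \<otimes> \<gamma>) \<otimes>\<^sub>m id) (J2 z)" for z
  define K3 where "K3 z = J2 z \<otimes> \<gamma>" for z
  define KK where "KK x = (j x \<otimes> \<gamma>) \<otimes> \<gamma>" for x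
  note l = linc lin_intros ten_tensor J2_def J3_def K2_def K3_def KK_def pos12_def pos23_def
  have linK: "lin J2" "lin J3" "lin K2" "lin K3" "lin KK"
    by (simp_all add: l K2_def[abs_def] K3_def[abs_def] KK_def[abs_def])
  note linKc = linK linK[THEN lin_compose]
  let ?s1 = "pos12 s" and ?s2 = "pos23 s" and ?\<sigma>1 = "pos12 \<sigma>" and ?\<sigma>2 = "pos23 \<sigma>"
  have lins12: "lin ?s1" "lin ?s2" by (simp_all add: pos12_def pos23_def lins lin_intros)
  note add = lin_add[OF lins12(1)] lin_add[OF lins12(2)]
  let ?C1 = "\<lambda>w. (C \<otimes>\<^sub>m id) w" and ?C2 = "\<lambda>w. (id \<otimes>\<^sub>m C) (\<alpha> w)"
  have mem: "?\<sigma>1 w \<in> ?S3" "?\<sigma>2 w \<in> ?S3" "?C1 w \<in> S \<otimes>\<^sub>s S" "?C2 w \<in> S \<otimes>\<^sub>s S" if "w \<in> ?S3" for w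
    using that by (auto simp: pos12_def pos23_def \<sigma>_mem C_mem lins
        intro!: ten_map[OF _ lin_\<sigma> lin_id(1)] ten_map[OF _ lin_id(1) lin_\<sigma>] ten_map[OF _ lin_C lin_id(1)]
          ten_map[OF _ lin_id(1) lin_C] assoc_mem assoc_inv_mem)
  have r1: "?s1 (J3 w) = J3 (?\<sigma>1 w) + K2 (?C1 w)" if "w \<in> ?S3" for w
    by (rule ten_eq3[OF that]; simp add: l s_j)
  have r2: "?s2 (J3 w) = J3 (?\<sigma>2 w) + K3 (?C2 w)" if "w \<in> ?S3" for w
  proof (rule ten_eq3[OF that])
    fix x y z assume "x \<in> S" "y \<in> S" "z \<in> S"
    moreover have "\<alpha>' (j x \<otimes> (j \<otimes>\<^sub>m j) u) = J3 (\<alpha>' (x \<otimes> u))" for u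
      by (rule tensor_ext[where z=u]; simp add: l)
    ultimately show "?s2 (J3 ((x \<otimes> y) \<otimes> z)) = J3 (?\<sigma>2 ((x \<otimes> y) \<otimes> z)) + K3 (?C2 ((x \<otimes> y) \<otimes> z))"
      by (simp add: pos23_def ten_tensor lins lin_intros s_j K3_def J2_def) (simp add: J3_def s_j ten_tensor lins lin_intros)
  qed (simp_all add: l)
  have r4: "?s2 (K2 z) = K3 z" if "z \<in> S \<otimes>\<^sub>s S" for z
    by (rule ten_eq[OF that]; simp add: l s_\<gamma> j_mem)
  have r5: "?s1 (K3 z) = K3 (\<sigma> z) + KK (C z)" if "z \<in> S \<otimes>\<^sub>s S" for z
    using that by (simp add: pos12_def K3_def KK_def ten_tensor lins lin_intros J2_def s_jj)
  have r6: "?s2 (K3 z) = K2 z" if "z \<in> S \<otimes>\<^sub>s S" for z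
    by (rule ten_eq[OF that]; simp add: l s_\<gamma> j_mem)
  have r7: "?s2 (KK x) = KK x" for x
    by (simp add: pos23_def KK_def ten_tensor lins lin_intros s_\<gamma> \<gamma>_mem)
  note r = r1 r2 r4 r5 r6 r7 mem \<sigma>_mem add
  have eq: "J3 (?\<sigma>1 (?\<sigma>2 (?\<sigma>1 w))) + K2 (?C1 (?\<sigma>2 (?\<sigma>1 w))) + (K3 (\<sigma> (?C2 (?\<sigma>1 w))) + KK (C (?C2 (?\<sigma>1 w)))) +
      (K3 (\<sigma> (?C1 w)) + KK (C (?C1 w))) =
      J3 (?\<sigma>2 (?\<sigma>1 (?\<sigma>2 w))) + K3 (?C2 (?\<sigma>1 (?\<sigma>2 w))) + K3 (?C1 (?\<sigma>2 w)) +
      (K2 (\<sigma> (?C2 w)) + KK (C (?C2 w)))" if w: "w \<in> ?S3" for w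
  proof -
    have "J3 w \<in> (T \<otimes>\<^sub>s T) \<otimes>\<^sub>s T"
      unfolding J3_def by (rule ten_map[OF w]) (auto simp: lins lin_intros jj_mem j_mem)
    from s_braid[OF this] show ?thesis
      by (simp add: r w)
  qed
  \<comment> \<open>\<open>R0\<close>, \<open>R2\<close> and \<open>R3\<close> extract the
    components without \<gamma>, with \<gamma> in the second place and with \<gamma> in the
    third.\<close>
  define R0 where "R0 = (t \<otimes>\<^sub>m t) \<otimes>\<^sub>m t"
  define R2 where "R2 q = (t \<otimes>\<^sub>m t) ((er \<otimes>\<^sub>m id) q)" for q
  define R3 where "R3 q = (t \<otimes>\<^sub>m t) (er q)" for q
  note lt = l lin_t lin_compose[OF lin_t] R0_def R2_def R3_def e_simps lin_0[OF lin_ten[OF lin_t lin_t]]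
  have linR: "lin R0" "lin R2" "lin R3"
    by (simp_all add: lt R2_def[abs_def] R3_def[abs_def])
  note linRc = linR linR[THEN lin_compose]
  have R_J3: "R0 (J3 w) = w" "R2 (J3 w) = 0" "R3 (J3 w) = 0" if "w \<in> ?S3" for w
    by (rule ten_eq3[OF that, where f="\<lambda>w. R0 (J3 w)" and g="\<lambda>w. w"]; simp add: lt linKc linRc)
      (rule ten_eq3[OF that, where g="\<lambda>w. 0"]; simp add: lt linKc linRc)+
  have R_K2: "R0 (K2 z) = 0" "R2 (K2 z) = z" "R3 (K2 z) = 0" if "z \<in> S \<otimes>\<^sub>s S" for z
    by (rule ten_eq[OF that, where f="\<lambda>z. R0 (K2 z)" and g="\<lambda>w. 0"]; simp add: lt linKc linRc)
      ((rule ten_eq[OF that, where f="\<lambda>z. R2 (K2 z)" and g="\<lambda>w. w"]; simp add: lt linKc linRc),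
       (rule ten_eq[OF that, where f="\<lambda>z. R3 (K2 z)" and g="\<lambda>w. 0"]; simp add: lt linKc linRc))
  have R_K3: "R0 (K3 z) = 0" "R2 (K3 z) = 0" "R3 (K3 z) = z" if "z \<in> S \<otimes>\<^sub>s S" for z
    using that by (simp_all add: R0_def R2_def R3_def K3_def ten_tensor lin_t lin_intros lins e_simps J2_def t_jj)
  have R_KK: "R0 (KK x) = 0" "R2 (KK x) = 0" "R3 (KK x) = 0" for x
    by (simp_all add: R0_def R2_def R3_def KK_def ten_tensor lin_t lin_intros lins e_simps)
  note R = R_J3 R_K2 R_K3 R_KK mem \<sigma>_mem linR[THEN lin_add]
  \<comment> \<open>The component without \<gamma> is the braid relation for \<sigma>, and those
    with one \<gamma> are the two identities of axiom (3). The component with two \<gamma> is the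
    Jacobi identity, available as \<open>L1\<close>.\<close>
  have 1: "?\<sigma>1 (?\<sigma>2 (?\<sigma>1 w)) = ?\<sigma>2 (?\<sigma>1 (?\<sigma>2 w))" if "w \<in> ?S3" for w
    using arg_cong[OF eq[OF that], of R0] that by (simp add: R)
  have 2: "?C1 (?\<sigma>2 (?\<sigma>1 w)) = \<sigma> (?C2 w)" if "w \<in> ?S3" for w
    using arg_cong[OF eq[OF that], of R2] that by (simp add: R)
  have 3: "\<sigma> (?C2 (?\<sigma>1 w)) + \<sigma> (?C1 w) = ?C2 (?\<sigma>1 (?\<sigma>2 w)) + ?C1 (?\<sigma>2 w)" if "w \<in> ?S3" for w
    using arg_cong[OF eq[OF that], of R3] that by (simp add: R)
  have 4: "\<sigma> (?C1 w) - ?C2 (?\<sigma>1 (?\<sigma>2 w)) = ?C1 (?\<sigma>2 w) - \<sigma> (?C2 (?\<sigma>1 w))" if "w \<in> ?S3" for w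
    using 3[OF that] by (simp add: algebra_simps)
  show ?thesis
    unfolding quantum_Lie_algebra_def jacobi_iff space_ten
    using g \<sigma> C 1 2 4 L1 ker by auto
qed

end

text \<open>The equation for the coproduct of the braided square is composed with three pairs of
  counits: \<open>er\<close> with \<open>el\<close> gives (L2'-a), \<open>el\<close> with
  \<open>er\<close> gives (L2'-b), and \<open>er\<close> with \<open>er\<close> gives (L3').\<close>

lemma good_if_coalgebra_endomorphism:
  assumes "quantum_Lie_algebra g \<sigma> C" "coalgebra_endomorphism_of_square G d e s"
  shows "good_quantum_Lie_algebra g \<sigma> C \<delta>"
proof -
  define F where "F z = mid p ((d \<otimes>\<^sub>m d) z)" for z
  have F_s: "F (s z) = (s \<otimes>\<^sub>m s) (F z)" if "z \<in> T \<otimes>\<^sub>s T" for z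
    using assms(2) that by (simp add: coalgebra_endomorphism_iff F_def)
  have lin_F: "lin F" unfolding F_def[abs_def] by (intro lin_intros lins)
  have F_mem: "F z \<in> (T \<otimes>\<^sub>s T) \<otimes>\<^sub>s (T \<otimes>\<^sub>s T)" if "z \<in> T \<otimes>\<^sub>s T" for z
    unfolding F_def using that by (simp add: words.mem_mid words.mem_split_split)
  note l = linc lin_F lin_compose[OF lin_F] lin_intros ten_tensor e_simps mid_tensor
  note er_p = contract_braid[OF G e mor_e]
  have el_er: "(el \<otimes>\<^sub>m er) (\<alpha>' (a \<otimes> \<alpha> (v \<otimes> b))) = scale V (e a) (scale V (e b) v)"
    "(er \<otimes>\<^sub>m el) (\<alpha>' (a \<otimes> \<alpha> (v \<otimes> b))) = scale V (e (er v)) (a \<otimes> b)"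
    "(er \<otimes>\<^sub>m er) (\<alpha>' (a \<otimes> \<alpha> (v \<otimes> b))) = scale V (e b) (a \<otimes> el v)"
    "(A \<otimes>\<^sub>m er) (\<alpha>' (a \<otimes> \<alpha> (v \<otimes> b))) = scale V (e b) ((A \<otimes>\<^sub>m id) (\<alpha>' (a \<otimes> v)))"
    "(er \<otimes>\<^sub>m A) (\<alpha>' (a \<otimes> \<alpha> (v \<otimes> b))) = a \<otimes> A (el v \<otimes> b)" for a b v
    by (rule tensor_ext[where z=v];
      simp add: l lin_functional[OF e] functional_scale[OF e] lin_simps[OF lin_A] mult.commute)+
  have q1: "(er \<otimes>\<^sub>m el) (F z) = z" "(el \<otimes>\<^sub>m er) (F z) = p z" "(er \<otimes>\<^sub>m er) (F z) = d (er z)"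
    "(A \<otimes>\<^sub>m er) (F z) = rhs_a z" "(er \<otimes>\<^sub>m A) (F z) = rhs_b z" if z: "z \<in> T \<otimes>\<^sub>s T" for z
  proof -
    let ?TT = "T \<otimes>\<^sub>s T"
    define ee where "ee v = e (er v)" for v
    have ee: "functional ee"
      using e e_simps(1) by (simp add: ee_def functional_iff lin_iff)
    have m: "e (er (p (b \<otimes> c))) = e b * e c" if "b \<in> T" "c \<in> T" for b c
      using that by (simp add: er_p ten_space_mem e_simps functional_scale[OF e])
    have m': "el (p (b \<otimes> c)) = scale V (e c) b" if "b \<in> T" "c \<in> T" for b c
      using that by (simp add: er_p ten_space_mem e_simps)
    note l' = l lin_functional[OF e] functional_scale[OF e] lin_simps[OF lin_A] mult.commute el_er m m' lin_simps[OF lin_p]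
      lin_contract_right[OF ee] contract_right_tensor[OF ee] lin_compose[OF lin_contract_right[OF ee]] lin_simps[OF d]
      lin_simps[OF lin_ten[OF lin_A lin_id(1)]] lin_simps[OF lin_ten[OF lin_A lin_id(2)]]
      lin_simps[OF lin_ten[OF lin_id(2) lin_p]] lin_simps[OF lin_ten[OF lin_id(2) lin_A]]
    have dd: "(d \<otimes>\<^sub>m d) z \<in> ?TT \<otimes>\<^sub>s ?TT" using z by (rule words.mem_split_split)
    have ee_d: "ee (d y) = e y" if "y \<in> T" for y using that by (simp add: ee_def counit)
    have "(er \<otimes>\<^sub>m el) (mid p q) = (er \<otimes>\<^sub>m el) q" "(el \<otimes>\<^sub>m er) (mid p q) = p ((el \<otimes>\<^sub>m er) q)"
      "(er \<otimes>\<^sub>m er) (mid p q) = contract_right ee q" if "q \<in> ?TT \<otimes>\<^sub>s ?TT" for q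
      by (rule ten_eq4[OF that]; simp add: l' id_def; simp add: ee_def l')+
    note q = this[OF dd]
    have
      "(A \<otimes>\<^sub>m er) (mid p q) = (A \<otimes>\<^sub>m id) (\<alpha>' ((id \<otimes>\<^sub>m p) (\<alpha> ((id \<otimes>\<^sub>m er) q))))"
      "(er \<otimes>\<^sub>m A) (mid p q) = (id \<otimes>\<^sub>m A) (\<alpha> ((id \<otimes>\<^sub>m el) q))" if "q \<in> ?TT \<otimes>\<^sub>s ?TT" for q
      by (rule ten_eq4[OF that]; simp add: l' id_def)+
    note q = q this[OF dd]
    have "(er \<otimes>\<^sub>m el) ((d \<otimes>\<^sub>m d) z) = z" "(el \<otimes>\<^sub>m er) ((d \<otimes>\<^sub>m d) z) = z"
      "contract_right ee ((d \<otimes>\<^sub>m d) z) = d (er z)"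
      "(id \<otimes>\<^sub>m er) ((d \<otimes>\<^sub>m d) z) = (d \<otimes>\<^sub>m id) z" "(id \<otimes>\<^sub>m el) ((d \<otimes>\<^sub>m d) z) = (d \<otimes>\<^sub>m id) z"
      by (rule ten_eq[OF z]; simp add: l' ee_d counit)+
    then show "(er \<otimes>\<^sub>m el) (F z) = z" "(el \<otimes>\<^sub>m er) (F z) = p z" "(er \<otimes>\<^sub>m er) (F z) = d (er z)"
      "(A \<otimes>\<^sub>m er) (F z) = rhs_a z" "(er \<otimes>\<^sub>m A) (F z) = rhs_b z"
      by (simp_all only: F_def q rhs_a_def rhs_b_def)
  qed
  \<comment> \<open>Contracting the first output of \<open>s\<close> leaves the first input with the
    second one contracted, whereas contracting the second output gives \<open>A\<close> by
    definition.\<close>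
  have el_s: "el (s u) = er u" if "u \<in> T \<otimes>\<^sub>s T" for u
    by (rule TT_ext[OF that])
      (simp_all add: l s_\<gamma> s_j lin_simps[OF lin_contract_left[OF e]] el_jj \<sigma>_mem C_mem ten_space_mem)
  have comp: "(er \<otimes>\<^sub>m el) ((s \<otimes>\<^sub>m s) q) = (A \<otimes>\<^sub>m er) q" "(el \<otimes>\<^sub>m er) ((s \<otimes>\<^sub>m s) q) = (er \<otimes>\<^sub>m A) q"
    "(er \<otimes>\<^sub>m er) ((s \<otimes>\<^sub>m s) q) = (A \<otimes>\<^sub>m A) q" if "q \<in> (T \<otimes>\<^sub>s T) \<otimes>\<^sub>s (T \<otimes>\<^sub>s T)" for q
    by (rule ten_eq[OF that]; simp add: l el_s A_def)+
  have a: "s z = rhs_a z" "p (s z) = rhs_b z" "d (A z) = rhs_c z" if z: "z \<in> T \<otimes>\<^sub>s T" for z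
  proof -
    note F = F_s[OF z] and Fs = q1[OF s_mem[OF z]] and F' = q1[OF z] and c = comp[OF F_mem[OF z]]
    show "s z = rhs_a z" using Fs(1) F'(4) c(1) by (simp only: F)
    show "p (s z) = rhs_b z" using Fs(2) F'(5) c(2) by (simp only: F)
    have "d (A z) = (er \<otimes>\<^sub>m er) (F (s z))" unfolding Fs(3) A_def ..
    also have "\<dots> = (A \<otimes>\<^sub>m A) (F z)" unfolding F c(3) ..
    finally show "d (A z) = rhs_c z" unfolding F_def rhs_c_def .
  qed
  have "\<sigma> w = rhs_ag w" "\<Psi> g g (\<sigma> w) = w + rhs_bg w" "\<delta> (C w) = rhs_cg w" if w: "w \<in> S \<otimes>\<^sub>s S" for w
  proof -
    note a = a[OF jj_mem[OF w]]
    have inj: "u = v" if "(j \<otimes>\<^sub>m j) u = (j \<otimes>\<^sub>m j) v" "u \<in> S \<otimes>\<^sub>s S" "v \<in> S \<otimes>\<^sub>s S" for u v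
      by (metis that(1) t_jj[OF that(2)] t_jj[OF that(3)])
    show "\<sigma> w = rhs_ag w"
      by (rule inj) (use a(1) in \<open>simp_all add: s_jj rhs_a_jj w \<sigma>_mem rhs_ag_mem\<close>)
    have pw: "p ((j \<otimes>\<^sub>m j) (\<sigma> w) + j (C w) \<otimes> \<gamma>) = (j \<otimes>\<^sub>m j) (\<Psi> g g (\<sigma> w)) + \<gamma> \<otimes> j (C w)"
      by (simp add: lin_add[OF lin_p] p_jj \<sigma>_mem w p_\<gamma> j_mem C_mem)
    show "\<Psi> g g (\<sigma> w) = w + rhs_bg w"
      by (rule inj) (use a(2) pw in \<open>simp_all add: s_jj rhs_b_jj w \<sigma>_mem pg_mem rhs_bg_mem subspace_add\<close>)
    show "\<delta> (C w) = rhs_cg w"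
      by (rule inj) (use a(3) in \<open>simp_all add: A_jj rhs_c_jj w d_j C_mem \<delta>_mem rhs_cg_mem\<close>)
  qed
  then show ?thesis
    using assms(1) unfolding good_iff quantum_Lie_algebra_def jacobi_iff space_ten by blast
qed

end

lemma (in braided_category) extendedI:
  assumes "is_obj g" "mor (g \<otimes>\<^sub>o g) (g \<otimes>\<^sub>o g) \<sigma>" "mor (g \<otimes>\<^sub>o g) g C" "mor g (g \<otimes>\<^sub>o g) \<delta>"
    "coassociative (space g) \<delta>" "unit_extension g \<sigma> C \<delta> G i j s d e"
  shows "extended V g \<sigma> C \<delta> G i j s d e"
  using assms by unfold_locales

section \<open>Direct sums and quotients\<close>

context tensor_universal
begin

lemma ten_span:
  assumes "X \<subseteq> span A" "Y \<subseteq> span B"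
  shows "X \<otimes>\<^sub>s Y \<subseteq> span {a \<otimes> b | a b. a \<in> A \<and> b \<in> B}"
proof
  let ?W = "span {a \<otimes> b | a b. a \<in> A \<and> b \<in> B}"
  have 1: "a \<otimes> y \<in> ?W" if a: "a \<in> A" and y: "y \<in> span B" for a y
    using y
  proof (induction rule: span_induct_alt)
    case base
    then show ?case by (simp add: span_zero)
  next
    case (step c b y)
    have "a \<otimes> b \<in> ?W" using a step(1) by (intro span_base) auto
    with step show ?case by (simp add: span_add span_scale)
  qed
  have 2: "x \<otimes> y \<in> ?W" if x: "x \<in> span A" and y: "y \<in> span B" for x y
    using x
  proof (induction rule: span_induct_alt)
    case base
    then show ?case by (simp add: span_zero)
  next
    case (step c a x)
    then show ?case using 1[OF step(1) y] by (simp add: span_add span_scale)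
  qed
  fix z assume z: "z \<in> X \<otimes>\<^sub>s Y"
  have "id z \<in> ?W"
    by (rule ten_mem[OF z]) (use 2 assms in \<open>auto intro: lin_intros\<close>)
  then show "z \<in> ?W" by simp
qed

text \<open>Here the infinite dimension of \<open>'v\<close> enters: it makes room for countable
  direct sums.\<close>

lemma independent_sequence_exists: "\<exists>f :: nat \<Rightarrow> 'v. inj f \<and> independent (range f)"
proof -
  obtain B where B: "independent B" "UNIV \<subseteq> span B"
    using maximal_independent_subset[of UNIV] by auto
  have "infinite B"
    using universal B(2) by (auto simp: universal_tensor_def)
  then obtain f :: "nat \<Rightarrow> 'v" where "inj f" "range f \<subseteq> B"
    using infinite_countable_subset by blast
  then show ?thesis using independent_mono[OF B(1)] by blast
qed

definition E :: "nat \<Rightarrow> 'v" where "E = (SOME f. inj f \<and> independent (range f))"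

lemma inj_E: "inj E" and independent_E: "independent (range E)"
  using someI_ex[OF independent_sequence_exists] by (auto simp: E_def)

text \<open>Tensoring with the vectors \<open>E n\<close> realises countable direct sums inside 'v.\<close>

abbreviation emb :: "nat \<Rightarrow> 'v \<Rightarrow> 'v" where "emb n x \<equiv> E n \<otimes> x"

text \<open>The bilinear map with value \<open>F n x\<close> at \<open>E n\<close> and x, extended
  linearly in the first argument. Its lift \<open>join F\<close> is the map out of the direct sum
  with components \<open>F n\<close>.\<close>

definition join_form :: "(nat \<Rightarrow> 'v \<Rightarrow> 'v) \<Rightarrow> 'v \<Rightarrow> 'v \<Rightarrow> 'v" where
  "join_form F a x = vector_space_pair.construct (scale V) (scale V) (range E) (\<lambda>v. F (inv E v) x) a"

definition join :: "(nat \<Rightarrow> 'v \<Rightarrow> 'v) \<Rightarrow> 'v \<Rightarrow> 'v" where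
  "join F = lift (join_form F)"

lemma vector_space_pair: "vector_space_pair (scale V) (scale V)"
  by (simp add: vector_space_pair_def vector_space_axioms)

lemma join_form_E: "join_form F (E n) x = F n x"
  unfolding join_form_def
  by (simp add: vector_space_pair.construct_basis[OF vector_space_pair independent_E] inj_E)

lemma join_form_lin: "lin (\<lambda>a. join_form F a x)"
  unfolding join_form_def by (rule vector_space_pair.linear_construct[OF vector_space_pair independent_E])

lemma join_form_param:
  "join_form (\<lambda>n y. F n y + G n y') a y = join_form F a y + join_form (\<lambda>n y. G n y') a y"
  "join_form (\<lambda>n y. scale V c (F n y)) a y = scale V c (join_form F a y)"
  unfolding join_form_def
  by (simp_all add: vector_space_pair.construct_add[OF vector_space_pair independent_E]
      vector_space_pair.construct_scale[OF vector_space_pair independent_E])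

lemma join_form_cong: "(\<And>n. F n x = G n y) \<Longrightarrow> join_form F a x = join_form G a y"
  unfolding join_form_def by simp

lemma join_form_bilin:
  assumes "\<And>n. lin (F n)"
  shows "bilin (join_form F)"
proof (rule bilinI)
  show "lin (join_form F a)" for a
    unfolding lin_iff
  proof (intro conjI allI)
    fix x y c
    have "join_form F a (x + y) = join_form (\<lambda>n z. F n z + F n y) a x"
      by (rule join_form_cong) (simp add: lin_add[OF assms])
    also have "\<dots> = join_form F a x + join_form (\<lambda>n z. F n y) a x" by (rule join_form_param)
    also have "join_form (\<lambda>n z. F n y) a x = join_form F a y" by (rule join_form_cong) simp
    finally show "join_form F a (x + y) = join_form F a x + join_form F a y" .
    have "join_form F a (scale V c x) = join_form (\<lambda>n z. scale V c (F n z)) a x"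
      by (rule join_form_cong) (simp add: lin_scale[OF assms])
    then show "join_form F a (scale V c x) = scale V c (join_form F a x)" by (simp add: join_form_param)
  qed
qed (rule join_form_lin)

lemma
  assumes "\<And>n. lin (F n)"
  shows lin_join: "lin (join F)" and join_emb: "join F (emb n x) = F n x"
  using join_form_bilin[OF assms] by (simp_all add: join_def lin_lift lift_tensor join_form_E)

text \<open>The product of the tensor algebra is a \<open>join\<close> whose components are again
  joins, with the other factor as a parameter; its bilinearity needs linear dependence on that
  parameter.\<close>

lemma join_param:
  assumes "\<And>n t. lin (F t n)" "\<And>n x. lin (\<lambda>t. F t n x)"
  shows "lin (\<lambda>t. join (F t) z)"
  unfolding lin_iff
proof (intro conjI allI)
  fix s t c
  note l = lin_join[OF assms(1)]
  note j = join_form_bilin[OF assms(1)]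
  show "join (F (s + t)) z = join (F s) z + join (F t) z"
  proof (rule tensor_ext[where z=z])
    fix a x
    have "join_form (F (s + t)) a x = join_form (\<lambda>n y. F s n y + F t n x) a x"
      by (rule join_form_cong) (simp add: lin_add[OF assms(2)])
    also have "\<dots> = join_form (F s) a x + join_form (\<lambda>n y. F t n x) a x" by (rule join_form_param)
    also have "join_form (\<lambda>n y. F t n x) a x = join_form (F t) a x" by (rule join_form_cong) simp
    finally show "join (F (s + t)) (a \<otimes> x) = join (F s) (a \<otimes> x) + join (F t) (a \<otimes> x)"
      by (simp add: join_def lift_tensor j)
  qed (intro l lin_plus)+
  show "join (F (scale V c t)) z = scale V c (join (F t) z)"
  proof (rule tensor_ext[where z=z])
    fix a x
    have "join_form (F (scale V c t)) a x = join_form (\<lambda>n y. scale V c (F t n y)) a x"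
      by (rule join_form_cong) (simp add: lin_scale[OF assms(2)])
    then show "join (F (scale V c t)) (a \<otimes> x) = scale V c (join (F t) (a \<otimes> x))"
      by (simp add: join_def lift_tensor j join_form_param)
  qed (intro l lin_scaled)+
qed

definition proj :: "nat \<Rightarrow> 'v \<Rightarrow> 'v" where
  "proj n = join (\<lambda>m x. if m = n then x else 0)"

lemma lin_proj: "lin (proj n)" and proj_emb: "proj n (emb m x) = (if m = n then x else 0)"
proof -
  have "lin (\<lambda>x. if m = n then x else 0)" for m by (cases "m = n") (auto intro: lin_intros)
  then show "lin (proj n)" "proj n (emb m x) = (if m = n then x else 0)"
    by (simp_all add: proj_def lin_join join_emb)
qed

end

section \<open>Quotients and direct sums of objects\<close>

context braided_category
begin

text \<open>The counterpart of \<open>mor_epi\<close> for objects: each axiom is an identity or a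
  membership that can be checked on images of objects that span. Linearity on all of
  \<open>'v\<close> cannot be checked there and is a separate hypothesis.\<close>

lemma obj_epi:
  assumes X: "subspace (space X)" and bilin: "mods \<Longrightarrow> bilin (act X)" and lin: "comods \<Longrightarrow> lin (lc X)"
    and Z: "\<And>i. i \<in> I \<Longrightarrow> is_obj (Z i)" and u: "\<And>i. i \<in> I \<Longrightarrow> mor (Z i) X (u i)"
    and span: "space X \<subseteq> span (\<Union>i\<in>I. u i ` space (Z i))"
  shows "is_obj X"
proof -
  have ext: "F x = F' x" if "x \<in> space X" "lin F" "lin F'"
    "\<And>i z. i \<in> I \<Longrightarrow> z \<in> space (Z i) \<Longrightarrow> F (u i z) = F' (u i z)" for F F' x
    by (rule span_lin_eq[of x "\<Union>i\<in>I. u i ` space (Z i)"]) (use that span in auto)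
  have ind: "F x \<in> W" if "x \<in> space X" "lin F" "subspace W"
    "\<And>i z. i \<in> I \<Longrightarrow> z \<in> space (Z i) \<Longrightarrow> F (u i z) \<in> W" for F x W
  proof -
    have "x \<in> span (\<Union>i\<in>I. u i ` space (Z i))" using that span by auto
    then show ?thesis
      by (induction rule: span_induct_alt)
        (auto simp: lin_simps[OF that(2)] that(4) intro!: subspace_0[OF that(3)] subspace_add[OF that(3)] subspace_scale[OF that(3)])
  qed
  have module: "module_axioms' X" if mods
  proof -
    note b = bilin[OF that]
    note l = lin_ac[OF b] lin_compose[OF lin_ac[OF b]]
    have au: "ac X (h \<otimes> u i z) = u i (ac (Z i) (h \<otimes> z))" if "i \<in> I" "h \<in> H" "z \<in> space (Z i)" for i h z
      using mor_act[OF u[OF that(1)] \<open>mods\<close> that(2,3)] by (simp add: ac_tensor b ac_eq Z that \<open>mods\<close>)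
    have zm: "ac (Z i) (h \<otimes> z) \<in> space (Z i)" if "i \<in> I" "h \<in> H" "z \<in> space (Z i)" for i h z
      using that by (simp add: obj_ac_mem Z \<open>mods\<close> ten_space_mem)
    have m: "ac X (h \<otimes> x) \<in> space X" if "h \<in> H" "x \<in> space X" for h x
      by (rule ind[OF that(2)]) (auto simp: l lin_intros X au that zm mor_mem[OF u])
    show ?thesis
      unfolding module_axioms'_def
    proof (intro conjI ballI b)
      show "ac X w \<in> space X" if "w \<in> H \<otimes>\<^sub>s space X" for w
        by (rule ten_mem[OF that]) (auto simp: l X m)
      show "ac X (h_one \<otimes> x) = x" if "x \<in> space X" for x
        by (rule ext[OF that]) (auto simp: l lin_intros au h_one obj_act_one Z \<open>mods\<close>)
      show "ac X (h \<otimes> ac X (k \<otimes> x)) = ac X (mu (h \<otimes> k) \<otimes> x)" if "h \<in> H" "k \<in> H" "x \<in> space X" for h k x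
        by (rule ext[OF that(3)]) (use that in \<open>auto simp: l lin_intros au zm mu_mem obj_act_mult Z \<open>mods\<close>\<close>)
    qed
  qed
  have comodule: "comodule_axioms' X" if comods
  proof -
    note l = lin[OF that] lin_compose[OF lin[OF that]] lin_dl contract_simps
    have lu: "lc X (u i z) = (id \<otimes>\<^sub>m u i) (lc (Z i) z)" if "i \<in> I" "z \<in> space (Z i)" for i z
      using mor_lc[OF u[OF that(1)] \<open>comods\<close> that(2)] .
    show ?thesis
      unfolding comodule_axioms'_def
    proof (intro conjI ballI)
      show "lc X x \<in> H \<otimes>\<^sub>s space X" if "x \<in> space X" for x
      proof (rule ind[OF that])
        show "lc X (u i z) \<in> H \<otimes>\<^sub>s space X" if "i \<in> I" "z \<in> space (Z i)" for i z
          unfolding lu[OF that]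
          by (rule ten_map[OF obj_lc_mem[OF Z[OF that(1)] \<open>comods\<close> that(2)]])
            (auto simp: lin_intros mor_lin[OF u] that mor_mem[OF u])
      qed (simp_all add: l)
      show "\<alpha> ((dl \<otimes>\<^sub>m id) (lc X x)) = (id \<otimes>\<^sub>m lc X) (lc X x)" if "x \<in> space X" for x
      proof (rule ext[OF that])
        fix i z assume i: "i \<in> I" and z: "z \<in> space (Z i)"
        note lz = obj_lin_lc[OF Z[OF i] \<open>comods\<close>] mor_lin[OF u[OF i]] lin_compose[OF mor_lin[OF u[OF i]]]
        have 1: "\<alpha> ((dl \<otimes>\<^sub>m id) ((id \<otimes>\<^sub>m u i) w)) = (id \<otimes>\<^sub>m (id \<otimes>\<^sub>m u i)) (\<alpha> ((dl \<otimes>\<^sub>m id) w))" for w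
        proof (rule tensor_ext[where z=w])
          fix a b
          have "\<alpha> (v \<otimes> u i b) = (id \<otimes>\<^sub>m (id \<otimes>\<^sub>m u i)) (\<alpha> (v \<otimes> b))" for v
            by (rule tensor_ext[where z=v]; simp add: l lz lin_intros ten_tensor)
          then show "\<alpha> ((dl \<otimes>\<^sub>m id) ((id \<otimes>\<^sub>m u i) (a \<otimes> b))) = (id \<otimes>\<^sub>m (id \<otimes>\<^sub>m u i)) (\<alpha> ((dl \<otimes>\<^sub>m id) (a \<otimes> b)))"
            by (simp add: l lz lin_intros ten_tensor)
        qed (simp_all add: l lz lin_intros)
        have 2: "(id \<otimes>\<^sub>m lc X) ((id \<otimes>\<^sub>m u i) w) = (id \<otimes>\<^sub>m (id \<otimes>\<^sub>m u i)) ((id \<otimes>\<^sub>m lc (Z i)) w)"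
          if "w \<in> H \<otimes>\<^sub>s space (Z i)" for w
          by (rule ten_eq[OF that]; simp add: l lz lin_intros ten_tensor lu i id_def)
        show "\<alpha> ((dl \<otimes>\<^sub>m id) (lc X (u i z))) = (id \<otimes>\<^sub>m lc X) (lc X (u i z))"
          unfolding lu[OF i z] 1 2[OF obj_lc_mem[OF Z[OF i] \<open>comods\<close> z]]
          by (simp only: obj_lc_coassoc[OF Z[OF i] \<open>comods\<close> z])
      qed (simp_all add: l lin_intros)
      show "contract_left \<epsilon>\<^sub>H (lc X x) = x" if "x \<in> space X" for x
      proof (rule ext[OF that])
        fix i z assume i: "i \<in> I" and z: "z \<in> space (Z i)"
        have "contract_left \<epsilon>\<^sub>H ((id \<otimes>\<^sub>m u i) w) = u i (contract_left \<epsilon>\<^sub>H w)" for w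
          by (rule tensor_ext[where z=w]; simp add: l mor_lin[OF u[OF i]] lin_compose[OF mor_lin[OF u[OF i]]] lin_intros
            ten_tensor lin_simps[OF mor_lin[OF u[OF i]]])
        then show "contract_left \<epsilon>\<^sub>H (lc X (u i z)) = u i z"
          by (simp add: lu i z obj_lc_counit Z \<open>comods\<close>)
      qed (simp_all add: l lin_intros)
    qed (rule l)
  qed
  have crossed: "crossed_on H mu dl (space X) (ac X) (lc X)" if mods comods
    unfolding crossed_on_def
  proof (intro ballI)
    fix h x assume h: "h \<in> H" and x: "x \<in> space X"
    note b = bilin[OF \<open>mods\<close>]
    note l = lin_ac[OF b] lin_compose[OF lin_ac[OF b]] lin[OF \<open>comods\<close>] lin_compose[OF lin[OF \<open>comods\<close>]]
      lin_mu lin_compose[OF lin_mu]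
    show "(mu \<otimes>\<^sub>m ac X) (mid flip (dl h \<otimes> lc X x)) = (mu \<otimes>\<^sub>m id) (swap (((\<lambda>z. lc X (ac X z)) \<otimes>\<^sub>m id) (swap (dl h \<otimes> x))))"
    proof (rule ext[OF x])
      fix i z assume i: "i \<in> I" and z: "z \<in> space (Z i)"
      note lz = mor_lin[OF u[OF i]] lin_compose[OF mor_lin[OF u[OF i]]] obj_lin_ac[OF Z[OF i] \<open>mods\<close>]
        lin_compose[OF obj_lin_ac[OF Z[OF i] \<open>mods\<close>]] obj_lin_lc[OF Z[OF i] \<open>comods\<close>] lin_compose[OF obj_lin_lc[OF Z[OF i] \<open>comods\<close>]]
      have au: "ac X (h \<otimes> u i z) = u i (ac (Z i) (h \<otimes> z))" if "h \<in> H" "z \<in> space (Z i)" for h z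
        using mor_act[OF u[OF i] \<open>mods\<close> that] by (simp add: ac_tensor b ac_eq Z i \<open>mods\<close>)
      have lu: "lc X (u i z) = (id \<otimes>\<^sub>m u i) (lc (Z i) z)" if "z \<in> space (Z i)" for z
        using mor_lc[OF u[OF i] \<open>comods\<close> that] .
      have 1: "(mu \<otimes>\<^sub>m ac X) (mid flip (v \<otimes> (id \<otimes>\<^sub>m u i) w)) = (id \<otimes>\<^sub>m u i) ((mu \<otimes>\<^sub>m ac (Z i)) (mid flip (v \<otimes> w)))"
        if v: "v \<in> H \<otimes>\<^sub>s H" and w: "w \<in> H \<otimes>\<^sub>s space (Z i)" for v w
      proof (rule ten_eq[OF v])
        show "(mu \<otimes>\<^sub>m ac X) (mid flip ((a \<otimes> c) \<otimes> (id \<otimes>\<^sub>m u i) w)) = (id \<otimes>\<^sub>m u i) ((mu \<otimes>\<^sub>m ac (Z i)) (mid flip ((a \<otimes> c) \<otimes> w)))"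
          if "a \<in> H" "c \<in> H" for a c
          by (rule ten_eq[OF w]; simp add: l lz lin_intros ten_tensor au that)
      qed (simp_all add: l lz lin_intros)
      have 2: "(mu \<otimes>\<^sub>m id) (swap (((\<lambda>z. lc X (ac X z)) \<otimes>\<^sub>m id) (swap (v \<otimes> u i z)))) =
        (id \<otimes>\<^sub>m u i) ((mu \<otimes>\<^sub>m id) (swap (((\<lambda>z. lc (Z i) (ac (Z i) z)) \<otimes>\<^sub>m id) (swap (v \<otimes> z)))))"
        if v: "v \<in> H \<otimes>\<^sub>s H" for v
      proof (rule ten_eq[OF v])
        fix a c assume a: "a \<in> H" "c \<in> H"
        have "(mu \<otimes>\<^sub>m id) (swap ((id \<otimes>\<^sub>m u i) w \<otimes> c)) = (id \<otimes>\<^sub>m u i) ((mu \<otimes>\<^sub>m id) (swap (w \<otimes> c)))" for w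
          by (rule tensor_ext[where z=w]; simp add: l lz lin_intros ten_tensor)
        then show "(mu \<otimes>\<^sub>m id) (swap (((\<lambda>z. lc X (ac X z)) \<otimes>\<^sub>m id) (swap ((a \<otimes> c) \<otimes> u i z)))) =
          (id \<otimes>\<^sub>m u i) ((mu \<otimes>\<^sub>m id) (swap (((\<lambda>z. lc (Z i) (ac (Z i) z)) \<otimes>\<^sub>m id) (swap ((a \<otimes> c) \<otimes> z)))))"
          using a z by (simp add: l lz lin_intros ten_tensor au lu obj_ac_mem[OF Z[OF i] \<open>mods\<close>] ten_space_mem)
      qed (simp_all add: l lz lin_intros)
      show "(mu \<otimes>\<^sub>m ac X) (mid flip (dl h \<otimes> lc X (u i z))) =
        (mu \<otimes>\<^sub>m id) (swap (((\<lambda>z. lc X (ac X z)) \<otimes>\<^sub>m id) (swap (dl h \<otimes> u i z))))"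
        unfolding lu[OF z] 1[OF dl_mem[OF h] obj_lc_mem[OF Z[OF i] \<open>comods\<close> z]] 2[OF dl_mem[OF h]]
        using obj_crossed[OF Z[OF i] \<open>mods\<close> \<open>comods\<close>] h z by (simp add: crossed_on_def)
    qed (simp_all add: l lin_intros)
  qed
  show ?thesis using X module comodule crossed by (simp add: is_obj_iff)
qed

text \<open>The coaction is supplied in left-handed form and flipped when the side is
  \<open>Right\<close>, so that \<open>lc\<close> returns it for both sides.\<close>

definition mk_obj :: "'v set \<Rightarrow> ('v \<Rightarrow> 'v \<Rightarrow> 'v) \<Rightarrow> ('v \<Rightarrow> 'v) \<Rightarrow> 'v obj" where
  "mk_obj S a l = \<lparr> space = S, act = a, coact = (case side V of Left \<Rightarrow> l | Right \<Rightarrow> (\<lambda>x. flip (l x))) \<rparr>"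

lemma mk_obj [simp]: "space (mk_obj S a l) = S" "act (mk_obj S a l) = a" "lc (mk_obj S a l) = l"
  by (cases "side V"; simp add: mk_obj_def lc_def)+

text \<open>The subspace divided out is the image of a morphism, which makes it stable under action
  and coaction. The quotient is a complement of it inside \<open>space T\<close>, with an idempotent
  projection.\<close>

lemma quotient_exists:
  assumes T: "is_obj T" and Z: "is_obj Z" and \<psi>: "mor Z T \<psi>"
  obtains U \<pi> where "is_obj U" "mor T U \<pi>" "space U = \<pi> ` space T" "\<And>t. t \<in> space T \<Longrightarrow> \<pi> t = 0 \<longleftrightarrow> t \<in> \<psi> ` space Z"
    "\<And>t. t \<in> space T \<Longrightarrow> \<pi> t \<in> space T" "\<And>t. t \<in> space T \<Longrightarrow> t - \<pi> t \<in> \<psi> ` space Z" "\<And>t. \<pi> (\<pi> t) = \<pi> t"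
proof -
  let ?J = "\<psi> ` space Z"
  have J: "subspace ?J" "?J \<subseteq> space T"
    using mor_mem[OF \<psi>] by (auto intro: subspace_image_lin mor_lin[OF \<psi>] obj_subspace Z)
  obtain \<pi> where \<pi>: "lin \<pi>" "\<And>x. \<pi> x = 0 \<longleftrightarrow> x \<in> ?J" "\<And>x. \<pi> (\<pi> x) = \<pi> x" "\<And>x. x - \<pi> x \<in> ?J"
    using kernel_projection[OF J(1)] by metis
  have \<pi>T: "\<pi> t \<in> space T" if "t \<in> space T" for t
    using subspace_diff[OF obj_subspace[OF T] that, of "t - \<pi> t"] \<pi>(4)[of t] J(2) by auto
  \<comment> \<open>The structure of \<open>T\<close> followed by \<pi>. That \<pi> is a morphism,
    shown next, says that this structure is compatible with passing to classes.\<close>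
  define U where "U = mk_obj (\<pi> ` space T) (\<lambda>h x. \<pi> (act T h x)) (\<lambda>x. (id \<otimes>\<^sub>m \<pi>) (lc T x))"
  have U: "space U = \<pi> ` space T" "act U h x = \<pi> (act T h x)" "lc U x = (id \<otimes>\<^sub>m \<pi>) (lc T x)" for h x
    by (simp_all add: U_def)
  have mor: "mor T U \<pi>"
  proof (rule morI)
    show "\<pi> (act T h x) = act U h (\<pi> x)" if mods "h \<in> H" "x \<in> space T" for h x
    proof -
      obtain z where z: "z \<in> space Z" "x - \<pi> x = \<psi> z" using \<pi>(4)[of x] by auto
      have "act T h (x - \<pi> x) = \<psi> (act Z h z)" using z mor_act[OF \<psi> that(1,2) z(1)] by simp
      then have "\<pi> (act T h (x - \<pi> x)) = 0" using obj_act_mem[OF Z that(1,2) z(1)] \<pi>(2) by auto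
      then show ?thesis
        by (simp add: U lin_diff[OF obj_lin_act[OF T \<open>mods\<close>]] lin_diff[OF \<pi>(1)])
    qed
    show "lc U (\<pi> x) = (id \<otimes>\<^sub>m \<pi>) (lc T x)" if comods "x \<in> space T" for x
    proof -
      obtain z where z: "z \<in> space Z" "x - \<pi> x = \<psi> z" using \<pi>(4)[of x] by auto
      have pz: "\<pi> (\<psi> y) = 0" if "y \<in> space Z" for y using \<pi>(2) that by auto
      have "(id \<otimes>\<^sub>m \<pi>) ((id \<otimes>\<^sub>m \<psi>) w) = 0" if "w \<in> H \<otimes>\<^sub>s space Z" for w
        by (rule ten_eq[OF that, where g="\<lambda>w. 0"])
          (simp_all add: lin_intros \<pi>(1) mor_lin[OF \<psi>] ten_tensor pz)
      then have "(id \<otimes>\<^sub>m \<pi>) (lc T (x - \<pi> x)) = 0"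
        using z mor_lc[OF \<psi> \<open>comods\<close> z(1)] obj_lc_mem[OF Z \<open>comods\<close> z(1)] by simp
      then show ?thesis
        by (simp add: U lin_diff[OF obj_lin_lc[OF T \<open>comods\<close>]] lin_diff[OF lin_ten[OF lin_id(1) \<pi>(1)]])
    qed
  qed (auto simp: \<pi>(1) U)
  have "is_obj U"
  proof (rule obj_epi[where I="{()}" and Z="\<lambda>_. T" and u="\<lambda>_. \<pi>"])
    show "bilin (act U)" if mods
      using obj_bilin[OF T that] by (auto simp: bilin_def U_def intro: lin_compose[OF \<pi>(1)])
    show "lin (lc U)" if comods
      by (simp add: U_def lin_intros \<pi>(1) obj_lin_lc[OF T that])
    show "subspace (space U)" by (simp add: U subspace_image_lin \<pi>(1) obj_subspace T)
    show "space U \<subseteq> span (\<Union>i\<in>{()}. \<pi> ` space T)" by (auto simp: U span_base)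
  qed (simp_all add: T mor)
  then show ?thesis using that[of U \<pi>] mor U(1) \<pi> \<pi>T by blast
qed

definition dsum :: "(nat \<Rightarrow> 'v obj) \<Rightarrow> 'v obj" where
  "dsum X = mk_obj (span (\<Union>n. emb n ` space (X n))) (\<lambda>h. join (\<lambda>n x. emb n (act (X n) h x)))
     (join (\<lambda>n x. (id \<otimes>\<^sub>m emb n) (lc (X n) x)))"

lemma
  assumes X: "\<And>n. is_obj (X n)"
  shows obj_dsum: "is_obj (dsum X)" and mor_emb: "mor (X n) (dsum X) (emb n)"
    and space_dsum: "space (dsum X) = span (\<Union>n. emb n ` space (X n))"
proof -
  show sp: "space (dsum X) = span (\<Union>n. emb n ` space (X n))" by (simp add: dsum_def)
  have la: "lin (\<lambda>x. emb n (act (X n) h x))" if mods for n h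
    by (intro lin_intros obj_lin_act[OF X that])
  have ll: "lin (\<lambda>x. (id \<otimes>\<^sub>m emb n) (lc (X n) x))" if comods for n
    by (intro lin_intros obj_lin_lc[OF X that])
  have mor: "mor (X n) (dsum X) (emb n)" for n
  proof (rule morI)
    show "emb n (act (X n) h x) = act (dsum X) h (emb n x)" if mods for h x
      by (simp add: dsum_def join_emb[OF la[OF that]])
    show "lc (dsum X) (emb n x) = (id \<otimes>\<^sub>m emb n) (lc (X n) x)" if comods for x
      by (simp add: dsum_def join_emb[OF ll[OF that]])
  qed (auto simp: sp lin_intros intro!: span_base)
  then show "mor (X n) (dsum X) (emb n)" .
  show "is_obj (dsum X)"
  proof (rule obj_epi[where I=UNIV and Z=X and u="\<lambda>n. emb n"])
    show "bilin (act (dsum X))" if mods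
    proof (rule bilinI)
      show "lin (act (dsum X) h)" for h by (simp add: dsum_def lin_join la that)
      show "lin (\<lambda>h. act (dsum X) h x)" for x
        unfolding dsum_def mk_obj
        by (rule join_param) (auto intro!: la that lin_intros bilinD(2)[OF obj_bilin[OF X that]] obj_lin_act[OF X that])
    qed
    show "lin (lc (dsum X))" if comods by (simp add: dsum_def lin_join ll that)
  qed (simp_all add: sp X mor)
qed

lemma unit_extension_exists:
  assumes g: "is_obj g" and \<sigma>: "mor (g \<otimes>\<^sub>o g) (g \<otimes>\<^sub>o g) \<sigma>" and C: "mor (g \<otimes>\<^sub>o g) g C" and \<delta>: "mor g (g \<otimes>\<^sub>o g) \<delta>"
  shows "\<exists>G i j s d e. unit_extension g \<sigma> C \<delta> G i j s d e"
proof -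
  \<comment> \<open>\<open>dsum\<close> takes a whole sequence, so the places from 2 on are filled
    with a zero object; it is an object as the image of \<open>g\<close> under the zero map.\<close>
  define O' :: "'v obj" where "O' = mk_obj {0} (\<lambda>_ _. 0) (\<lambda>_. 0)"
  have z0: "(id \<otimes>\<^sub>m (\<lambda>_. 0)) w = 0" for w
    by (rule tensor_ext[where z=w and g="\<lambda>_. 0"]; simp add: lin_intros ten_tensor)
  have O': "is_obj O'"
    by (rule obj_epi[where I="{()}" and Z="\<lambda>_. g" and u="\<lambda>_ _. 0"])
      (auto simp: O'_def g bilin_def lin_intros span_zero mor_iff z0)
  define X where "X n = (if n = 0 then unit_obj else if n = 1 then g else O')" for n :: nat
  have X: "is_obj (X n)" for n by (simp add: X_def obj_unit g O')
  define G where "G = dsum X"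
  note sp = space_dsum[of X, OF X]
  have spG: "space G = {a + b | a b. a \<in> emb 0 ` span {unity V} \<and> b \<in> emb 1 ` space g}" (is "_ = ?R")
  proof
    have "(\<Union>n. emb n ` space (X n)) \<subseteq> ?R"
    proof
      fix z assume "z \<in> (\<Union>n. emb n ` space (X n))"
      then obtain n x where "x \<in> space (X n)" "z = emb n x" by auto
      then show "z \<in> ?R"
        using subspace_0[OF obj_subspace[OF g]] span_zero[of "{unity V}"]
        by (auto simp: X_def O'_def split: if_splits) (metis add.right_neutral add.left_neutral imageI tensor_simps(8))+
    qed
    moreover have "subspace ?R"
      by (intro subspace_sums subspace_image_lin lin_right subspace_span obj_subspace g)
    ultimately show "space G \<subseteq> ?R" unfolding G_def sp by (rule span_minimal)
    show "?R \<subseteq> space G"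
    proof
      fix z assume "z \<in> ?R"
      then obtain a b where z: "z = emb 0 a + emb 1 b" and a: "a \<in> span {unity V}" and b: "b \<in> space g" by auto
      have "emb 0 a \<in> space G" "emb 1 b \<in> space G"
        using a b mor_mem[OF mor_emb[of X 0, OF X], of a] mor_mem[OF mor_emb[of X 1, OF X], of b] by (simp_all add: X_def G_def)
      then show "z \<in> space G" using subspace_add[OF obj_subspace[OF obj_dsum[of X, OF X]]] by (simp add: z G_def)
    qed
  qed
  let ?i = "emb 0" and ?j = "emb 1" and ?\<gamma> = "emb 0 (unity V)"
  have inj: "inj_on (emb n) A" for n A
    by (rule inj_onI) (metis proj_emb)
  have direct: "unit_direct_sum g G ?i ?j"
    unfolding unit_direct_sum_def
  proof (intro conjI inj)
    show "is_obj G" by (simp add: G_def obj_dsum X)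
    show "mor unit_obj G ?i" "mor g G ?j"
      using mor_emb[of X 0, OF X] mor_emb[of X 1, OF X] by (simp_all add: X_def G_def)
    show "?i ` space unit_obj \<inter> ?j ` space g = {0}"
    proof
      show "?i ` space unit_obj \<inter> ?j ` space g \<subseteq> {0}"
      proof
        fix z assume "z \<in> ?i ` space unit_obj \<inter> ?j ` space g"
        then obtain a b where "z = emb 0 a" "z = emb 1 b" by blast
        then have "a = 0" using proj_emb[of 0 0 a] proj_emb[of 0 1 b] by simp
        then show "z \<in> {0}" using \<open>z = emb 0 a\<close> by simp
      qed
      show "{0} \<subseteq> ?i ` space unit_obj \<inter> ?j ` space g"
        using subspace_0[OF obj_subspace[OF g]] by (auto intro!: image_eqI[where x=0] simp: span_zero)
    qed
  qed (simp add: spG)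
  define e where "e z = coord (proj 0 z)" for z
  define P where "P = proj 1"
  have e: "functional e"
    using functional_coord lin_proj[of 0] by (simp add: e_def functional_iff lin_iff)
  have lin_P: "lin P" by (simp add: P_def lin_proj)
  have eP: "e ?\<gamma> = 1" "e (?j x) = 0" "P ?\<gamma> = 0" "P (?j x) = x" "e (scale V c ?\<gamma>) = c" for x c
    by (simp_all add: e_def P_def proj_emb functional_0[OF functional_coord] lin_scale[OF lin_proj]
        functional_scale[OF functional_coord])
  \<comment> \<open>\<open>P\<close> projects to g, so the first summand is the prescribed formula
    on the block g \<otimes> g. Everywhere else \<open>s\<close> is the flip, which the last term
    removes from that block.\<close>
  define s where "s z = (let w = (P \<otimes>\<^sub>m P) z in (?j \<otimes>\<^sub>m ?j) (\<sigma> w) + ?j (C w) \<otimes> ?\<gamma>)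
      + (flip z - (?j \<otimes>\<^sub>m ?j) (flip ((P \<otimes>\<^sub>m P) z)))" for z
  define d where "d z = scale V (e z) (?\<gamma> \<otimes> ?\<gamma>) + (?j (P z) \<otimes> ?\<gamma> + ?\<gamma> \<otimes> ?j (P z) + (?j \<otimes>\<^sub>m ?j) (\<delta> (P z)))" for z
  note l = lin_intros lin_P lin_compose[OF lin_P] mor_lin[OF \<sigma>] mor_lin[OF C] mor_lin[OF \<delta>]
    lin_compose[OF mor_lin[OF \<sigma>]] lin_compose[OF mor_lin[OF C]] lin_compose[OF mor_lin[OF \<delta>]] lin_functional[OF e]
  have "unit_extension g \<sigma> C \<delta> G ?i ?j s d e"
    unfolding unit_extension_def Let_def
  proof (intro conjI ballI direct e eP)
    show "lin s" unfolding s_def[abs_def] Let_def by (simp add: l)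
    show "lin d" unfolding d_def[abs_def] by (simp add: l)
    note lin0 = lin_0[OF mor_lin[OF \<sigma>]] lin_0[OF mor_lin[OF C]] lin_0[OF mor_lin[OF \<delta>]] lin_0[OF lin_ten[OF lin_right lin_right]]
      lin_0[OF lin_flip]
    show "s (?\<gamma> \<otimes> z) = z \<otimes> ?\<gamma>" "s (z \<otimes> ?\<gamma>) = ?\<gamma> \<otimes> z" for z
      by (simp_all add: s_def Let_def ten_tensor lin_P eP lin0)
    show "s (?j x \<otimes> ?j y) = (?j \<otimes>\<^sub>m ?j) (\<sigma> (x \<otimes> y)) + ?j (C (x \<otimes> y)) \<otimes> ?\<gamma>" for x y
      by (simp add: s_def Let_def ten_tensor lin_P eP lin_right del: One_nat_def)
    show "d ?\<gamma> = ?\<gamma> \<otimes> ?\<gamma>" by (simp add: d_def eP lin0)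
    show "d (?j x) = ?j x \<otimes> ?\<gamma> + ?\<gamma> \<otimes> ?j x + (?j \<otimes>\<^sub>m ?j) (\<delta> x)" for x by (simp add: d_def eP del: One_nat_def)
  qed
  then show ?thesis by blast
qed

section \<open>The tensor algebra\<close>

lemma obj_tensor_power: "is_obj g \<Longrightarrow> is_obj (tensor_power g n)"
  by (induction n) (simp_all add: obj_unit obj_ten)

text \<open>Concatenation of tensor powers. Powers are bracketed to the left, so the recursion
  strips the last letter of the second factor, whose degree has to be passed along.\<close>

primrec cat :: "nat \<Rightarrow> 'v \<Rightarrow> 'v" where
  "cat 0 = runit"
| "cat (Suc k) = (\<lambda>z. (cat k \<otimes>\<^sub>m id) (\<alpha>' z))"

lemma lin_cat: "lin (cat k)"
  by (induction k) (simp_all add: unit_simps lin_intros)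

lemma mor_cat:
  assumes g: "is_obj g"
  shows "mor (tensor_power g n \<otimes>\<^sub>o tensor_power g k) (tensor_power g (n + k)) (cat k)"
proof (induction k)
  case (Suc k)
  show ?case
    unfolding add_Suc_right cat.simps tensor_power.simps
    by (rule mor_comp[OF mor_assoc_inv mor_ten[OF _ _ _ _ Suc mor_id(1)]])
      (simp_all add: obj_tensor_power obj_ten g)
qed (simp add: runit_mor obj_tensor_power g)

lemma cat_Suc: "cat (Suc k) (x \<otimes> (y \<otimes> z)) = cat k (x \<otimes> y) \<otimes> z"
  by (simp add: ten_tensor lin_cat lin_intros)

lemma cat_assoc:
  assumes g: "is_obj g" and z: "z \<in> space (tensor_power g l)"
  shows "cat l (cat k (x \<otimes> y) \<otimes> z) = cat (k + l) (x \<otimes> cat l (y \<otimes> z))"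
  using z
proof (induction l arbitrary: z)
  case 0
  then show ?case by (auto simp: unit_space unit_simps lin_simps[OF lin_cat])
next
  case (Suc l)
  show ?case
    by (rule ten_eq[OF Suc.prems[unfolded tensor_power.simps space_ten]])
      (simp_all add: lin_compose[OF lin_cat] lin_intros cat_Suc Suc.IH del: cat.simps)
qed

lemma cat_unit:
  assumes g: "is_obj g" and z: "z \<in> space (tensor_power g k)"
  shows "cat k (unity V \<otimes> z) = z"
  using z
proof (induction k arbitrary: z)
  case 0
  then show ?case by (auto simp: unit_space unit_simps)
next
  case (Suc k)
  show ?case
    by (rule ten_eq[OF Suc.prems[unfolded tensor_power.simps space_ten]])
      (simp_all add: lin_compose[OF lin_cat] lin_intros cat_Suc Suc.IH del: cat.simps)
qed

lemma lin_product_map: "lin m \<Longrightarrow> lin \<eta> \<Longrightarrow> lin \<iota> \<Longrightarrow> lin (product_map m \<eta> \<iota> n)"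
  by (induction n) (simp_all add: lin_intros)

lemma mor_product_map:
  assumes "is_obj g" "algebra_in A m \<eta>" "mor g A \<iota>"
  shows "mor (tensor_power g n) A (product_map m \<eta> \<iota> n)"
proof (induction n)
  case 0
  then show ?case using assms(2) by (simp add: algebra_in_def)
next
  case (Suc n)
  have A: "is_obj A" "mor (A \<otimes>\<^sub>o A) A m" using assms(2) by (auto simp: algebra_in_def)
  show ?case
    unfolding tensor_power.simps product_map.simps
    by (rule mor_o[OF mor_ten[OF _ _ A(1) A(1) Suc assms(3)] A(2)]) (simp_all add: obj_tensor_power assms)
qed

lemma mor_epi_square:
  assumes X: "is_obj X" and Y: "is_obj Y" and F: "lin F"
    and Z: "\<And>i. i \<in> I \<Longrightarrow> is_obj (Z i)"
    and u: "\<And>i. i \<in> I \<Longrightarrow> mor (Z i) X (u i)" and span: "space X \<subseteq> span (\<Union>i\<in>I. u i ` space (Z i))"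
    and Fu: "\<And>i k. i \<in> I \<Longrightarrow> k \<in> I \<Longrightarrow> mor (Z i \<otimes>\<^sub>o Z k) Y (\<lambda>z. F ((u i \<otimes>\<^sub>m u k) z))"
  shows "mor (X \<otimes>\<^sub>o X) Y F"
proof (rule mor_epi[OF obj_ten[OF X X] Y F, where I="I \<times> I" and Z="\<lambda>(i, k). Z i \<otimes>\<^sub>o Z k" and u="\<lambda>(i, k). u i \<otimes>\<^sub>m u k"])
  let ?B = "\<Union>i\<in>I. u i ` space (Z i)"
  have "{a \<otimes> b | a b. a \<in> ?B \<and> b \<in> ?B} \<subseteq> (\<Union>i\<in>I \<times> I. (\<lambda>(i, k). u i \<otimes>\<^sub>m u k) i ` space ((\<lambda>(i, k). Z i \<otimes>\<^sub>o Z k) i))"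
  proof
    fix w assume "w \<in> {a \<otimes> b | a b. a \<in> ?B \<and> b \<in> ?B}"
    then obtain i k x y where ik: "i \<in> I" "k \<in> I" "x \<in> space (Z i)" "y \<in> space (Z k)" "w = u i x \<otimes> u k y" by auto
    then have w: "w = (u i \<otimes>\<^sub>m u k) (x \<otimes> y)" by (simp add: ten_tensor mor_lin[OF u])
    from ik(1-4) show "w \<in> (\<Union>i\<in>I \<times> I. (\<lambda>(i, k). u i \<otimes>\<^sub>m u k) i ` space ((\<lambda>(i, k). Z i \<otimes>\<^sub>o Z k) i))"
      unfolding w by (intro UN_I[of "(i, k)"]) (auto intro!: imageI ten_space_mem)
  qed
  from ten_span[OF span span] span_mono[OF this]
  show "space (X \<otimes>\<^sub>o X) \<subseteq> span (\<Union>i\<in>I \<times> I. (\<lambda>(i, k). u i \<otimes>\<^sub>m u k) i ` space ((\<lambda>(i, k). Z i \<otimes>\<^sub>o Z k) i))"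
    by auto
qed (auto intro!: mor_ten Z X u Fu)

text \<open>A finite set containing the support is carried instead of the support itself, which may
  shrink by cancellation in a sum.\<close>

lemma dsum_decomposition:
  assumes X: "\<And>n. is_obj (X n)" and t: "t \<in> space (dsum X)"
  shows "\<exists>A. finite A \<and> (\<forall>n. proj n t \<in> space (X n)) \<and> (\<forall>n. n \<notin> A \<longrightarrow> proj n t = 0) \<and> t = (\<Sum>n\<in>A. emb n (proj n t))"
  using t unfolding space_dsum[of X, OF X]
  proof (induction rule: span_induct_alt)
    case base
    then show ?case by (intro exI[of _ "{}"]) (simp add: lin_0[OF lin_proj] subspace_0 obj_subspace X)
  next
    case (step c a t)
    then obtain A n x where A: "finite A" "\<And>n. proj n t \<in> space (X n)" "\<And>n. n \<notin> A \<Longrightarrow> proj n t = 0"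
        "t = (\<Sum>n\<in>A. emb n (proj n t))" and x: "x \<in> space (X n)" "a = emb n x" by blast
    have p: "proj k (scale V c a + t) = (if k = n then scale V c x else 0) + proj k t" for k
      by (auto simp: lin_simps[OF lin_proj] x(2) lin_scale[OF lin_proj] proj_emb simp del: tensor_simps)
    have "t = (\<Sum>k\<in>insert n A. emb k (proj k t))"
      using A by (subst A(4), cases "n \<in> A") (auto simp: insert_absorb)
    moreover have "(\<Sum>k\<in>insert n A. emb k (if k = n then scale V c x else 0)) = scale V c a"
      using A(1) by (subst sum.mono_neutral_right[where S="{n}"]) (auto simp: x(2))
    ultimately have "scale V c a + t = (\<Sum>k\<in>insert n A. emb k (proj k (scale V c a + t)))"
      unfolding p by (simp only: tensor_simps sum.distrib)
    moreover have "proj k (scale V c a + t) \<in> space (X k)" for k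
      unfolding p using A(2) x(1) by (auto intro!: subspace_add subspace_scale obj_subspace X)
    moreover have "proj k (scale V c a + t) = 0" if "k \<notin> insert n A" for k
      unfolding p using A(3) that by auto
    ultimately show ?case using A(1) by (intro exI[of _ "insert n A"]) auto
  qed

lemma tensor_algebra_exists:
  assumes g: "is_obj g"
  shows "\<exists>T m \<eta> \<iota>. tensor_algebra g T m \<eta> \<iota>"
proof -
  let ?X = "tensor_power g"
  note X = obj_tensor_power[OF g]
  define T where "T = dsum ?X"
  have T: "is_obj T" and spT: "space T = span (\<Union>n. emb n ` space (?X n))"
    and emb: "mor (?X n) T (emb n)" for n
    using obj_dsum[of ?X, OF X] mor_emb[of ?X, OF X] space_dsum[of ?X, OF X] by (simp_all add: T_def)
  \<comment> \<open>The joins are nested because the product depends on the degrees of both factors;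
    linearity in \<open>t\<close> comes from \<open>join_param\<close>.\<close>
  define b where "b s t = join (\<lambda>n x. join (\<lambda>k y. emb (n + k) (cat k (x \<otimes> y))) t) s" for s t
  define m where "m = lift b"
  have l1: "lin (\<lambda>y. emb (n + k) (cat k (x \<otimes> y)))" "lin (\<lambda>x. emb (n + k) (cat k (x \<otimes> y)))" for n k x y
    by (intro lin_intros lin_compose[OF lin_cat])+
  have l2: "lin (\<lambda>x. join (\<lambda>k y. emb (n + k) (cat k (x \<otimes> y))) t)" for n t
    by (rule join_param[where F="\<lambda>x k y. emb (n + k) (cat k (x \<otimes> y))"]) (rule l1)+
  have bb: "bilin b"
  proof (rule bilinI)
    show "lin (\<lambda>s. b s t)" for t unfolding b_def by (rule lin_join[OF l2])
    show "lin (b s)" for s unfolding b_def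
      by (rule join_param[where F="\<lambda>t n x. join (\<lambda>k y. emb (n + k) (cat k (x \<otimes> y))) t"]) (rule l2 lin_join[OF l1(1)])+
  qed
  have lin_m: "lin m" by (simp add: m_def lin_lift bb)
  have m: "m (emb n x \<otimes> emb k y) = emb (n + k) (cat k (x \<otimes> y))" for n x k y
    by (simp add: m_def lift_tensor bb) (simp add: b_def join_emb[OF l2] join_emb[OF l1(1)] join_emb[OF l1(2)])
  have mor_m: "mor (T \<otimes>\<^sub>o T) T m"
  proof (rule mor_epi_square[where I=UNIV and Z="?X" and u="\<lambda>n. emb n"])
    fix n k :: nat
    show "mor (?X n \<otimes>\<^sub>o ?X k) T (\<lambda>z. m ((emb n \<otimes>\<^sub>m emb k) z))"
    proof (rule mor_cong[OF obj_ten[OF X X] mor_comp[OF mor_cat[OF g] emb]])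
      show "m ((emb n \<otimes>\<^sub>m emb k) z) = emb (n + k) (cat k z)" for z
        by (rule tensor_ext[where z=z]) (simp_all add: ten_tensor lin_intros m lin_compose[OF lin_m] lin_cat)
    qed (intro lin_compose[OF lin_m] lin_intros)
  qed (auto simp: T X emb lin_m spT)
  have ext: "f z = f' z" if "z \<in> space T" "lin f" "lin f'" "\<And>n x. x \<in> space (?X n) \<Longrightarrow> f (emb n x) = f' (emb n x)" for f f' z
    by (rule span_lin_eq[of z "\<Union>n. emb n ` space (?X n)"]) (use that spT in auto)
  note lm = lin_compose[OF lin_m] lin_intros
  have alg: "algebra_in T m (emb 0)"
    unfolding algebra_in_def is_algebra_def
  proof (intro conjI ballI T lin_m)
    show "subspace (space T)" by (rule obj_subspace[OF T])
    show "m ` (space T \<otimes>\<^sub>s space T) \<subseteq> space T" using mor_mem[OF mor_m] by auto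
    show "lin (emb 0)" by (rule lin_right)
    show "emb 0 (unity V) \<in> space T" using mor_mem[OF emb[of 0], of "unity V"] by (simp add: span_base)
    show "mor (T \<otimes>\<^sub>o T) T m" by (rule mor_m)
    show "mor unit_obj T (emb 0)" using emb[of 0] by simp
    show "m (emb 0 (unity V) \<otimes> x) = x" "m (x \<otimes> emb 0 (unity V)) = x" if "x \<in> space T" for x
      by (rule ext[OF that]; simp add: lm m cat_unit[OF g] unit_simps)+
    show "m (m (x \<otimes> y) \<otimes> z) = m (x \<otimes> m (y \<otimes> z))" if x: "x \<in> space T" and y: "y \<in> space T" and z: "z \<in> space T" for x y z
    proof (rule ext[OF x])
      fix n x show "m (m (emb n x \<otimes> y) \<otimes> z) = m (emb n x \<otimes> m (y \<otimes> z))"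
      proof (rule ext[OF y])
        fix k y show "m (m (emb n x \<otimes> emb k y) \<otimes> z) = m (emb n x \<otimes> m (emb k y \<otimes> z))"
          by (rule ext[OF z]) (simp_all add: lm m cat_assoc[OF g] add.assoc)
      qed (simp_all add: lm)
    qed (simp_all add: lm)
  qed
  \<comment> \<open>The first tensor power is the unit object tensor g rather than g, hence the
    factor \<open>unity V\<close>.\<close>
  define \<iota> where "\<iota> x = emb 1 (unity V \<otimes> x)" for x
  have lin_\<iota>: "lin \<iota>" unfolding \<iota>_def[abs_def] by (intro lin_intros)
  have mor_\<iota>: "mor g T \<iota>"
    using mor_comp[OF mor_tensor_unity(2)[OF g], of T "emb 1"] emb[of 1] by (simp add: \<iota>_def[abs_def])
  \<comment> \<open>Products of generators are the embeddings of the homogeneous parts, so unique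
    decomposition reduces to that in the direct sum.\<close>
  have pm: "product_map m (emb 0) \<iota> n x = emb n x" if "x \<in> space (?X n)" for n x
    using that
  proof (induction n arbitrary: x)
    case (Suc n)
    show ?case
    proof (rule ten_eq[OF Suc.prems[unfolded tensor_power.simps space_ten]])
      fix y z assume "y \<in> space (?X n)" "z \<in> space g"
      then show "product_map m (emb 0) \<iota> (Suc n) (y \<otimes> z) = emb (Suc n) (y \<otimes> z)"
        using m[of n y 1 "unity V \<otimes> z"]
        by (simp add: ten_tensor lin_product_map lin_m lin_\<iota> lin_right Suc.IH \<iota>_def lin_cat unit_simps lin_intros)
    qed (intro lin_product_map lin_m lin_right lin_\<iota>)+
  qed simp
  have dec: "\<exists>!x. (\<forall>n. x n \<in> space (?X n)) \<and> finite {n. x n \<noteq> 0} \<and> t = (\<Sum>n | x n \<noteq> 0. product_map m (emb 0) \<iota> n (x n))"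
    if t: "t \<in> space T" for t
  proof (rule ex1I[of _ "\<lambda>n. proj n t"])
    obtain A where A: "finite A" "\<And>n. proj n t \<in> space (?X n)" "\<And>n. n \<notin> A \<Longrightarrow> proj n t = 0"
        "t = (\<Sum>n\<in>A. emb n (proj n t))" using dsum_decomposition[of ?X, OF X t[unfolded T_def]] by blast
    have "{n. proj n t \<noteq> 0} \<subseteq> A" using A(3) by auto
    moreover from this have "finite {n. proj n t \<noteq> 0}" using A(1) finite_subset by blast
    moreover have "t = (\<Sum>n | proj n t \<noteq> 0. emb n (proj n t))"
      using calculation A(1) by (subst A(4)) (auto intro!: sum.mono_neutral_right)
    ultimately show "(\<forall>n. proj n t \<in> space (?X n)) \<and> finite {n. proj n t \<noteq> 0} \<and>
        t = (\<Sum>n | proj n t \<noteq> 0. product_map m (emb 0) \<iota> n (proj n t))"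
      using A(2) by (simp add: pm)
  next
    fix x assume x: "(\<forall>n. x n \<in> space (?X n)) \<and> finite {n. x n \<noteq> 0} \<and> t = (\<Sum>n | x n \<noteq> 0. product_map m (emb 0) \<iota> n (x n))"
    then have "t = (\<Sum>n | x n \<noteq> 0. emb n (x n))" by (simp add: pm)
    then have "proj k t = (\<Sum>n | x n \<noteq> 0. if n = k then x n else 0)" for k
      by (simp add: lin_sum[OF lin_proj] proj_emb)
    then show "x = (\<lambda>n. proj n t)" using x by (auto simp: fun_eq_iff)
  qed
  show ?thesis
    using alg mor_\<iota> dec unfolding tensor_algebra_def by blast
qed

end

section \<open>Tensor algebras and enveloping algebras\<close>

context braided_category
begin

lemma algebra_inD:
  assumes "algebra_in A m \<eta>"
  shows "is_obj A" "mor (A \<otimes>\<^sub>o A) A m" "mor unit_obj A \<eta>" "lin m" "lin \<eta>" "subspace (space A)" "\<eta> (unity V) \<in> space A"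
    "\<And>x y. x \<in> space A \<Longrightarrow> y \<in> space A \<Longrightarrow> m (x \<otimes> y) \<in> space A"
    "\<And>x y z. x \<in> space A \<Longrightarrow> y \<in> space A \<Longrightarrow> z \<in> space A \<Longrightarrow> m (m (x \<otimes> y) \<otimes> z) = m (x \<otimes> m (y \<otimes> z))"
    "\<And>x. x \<in> space A \<Longrightarrow> m (\<eta> (unity V) \<otimes> x) = x" "\<And>x. x \<in> space A \<Longrightarrow> m (x \<otimes> \<eta> (unity V)) = x"
  using assms by (auto simp: algebra_in_def is_algebra_def intro: ten_space_mem)

context
  fixes g T m \<eta> \<iota>
  assumes g: "is_obj g" and tensor_algebra: "tensor_algebra g T m \<eta> \<iota>"
begin

lemma tensor_algebraD:
  shows "algebra_in T m \<eta>" "mor g T \<iota>"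
    "t \<in> space T \<Longrightarrow> \<exists>!x :: nat \<Rightarrow> 'v. (\<forall>n. x n \<in> space (tensor_power g n)) \<and> finite {n. x n \<noteq> 0} \<and>
        t = (\<Sum>n | x n \<noteq> 0. product_map m \<eta> \<iota> n (x n))"
  using tensor_algebra by (auto simp: tensor_algebra_def)

lemma tensor_algebra_span: "space T \<subseteq> span (\<Union>n. product_map m \<eta> \<iota> n ` space (tensor_power g n))"
proof
  fix t assume "t \<in> space T"
  then obtain x :: "nat \<Rightarrow> 'v" where "\<And>n. x n \<in> space (tensor_power g n)"
    "t = (\<Sum>n | x n \<noteq> 0. product_map m \<eta> \<iota> n (x n))"
    using tensor_algebraD(3) by blast
  then show "t \<in> span (\<Union>n. product_map m \<eta> \<iota> n ` space (tensor_power g n))"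
    by (simp only:) (intro span_sum span_base, blast)
qed

text \<open>Left-bracketed products arise from 1 by multiplying generators on the right, so this is
  the only step required.\<close>

lemma tensor_algebra_induct:
  assumes W: "subspace W" and 1: "\<eta> (unity V) \<in> W"
    and step: "\<And>c z. c \<in> space T \<Longrightarrow> c \<in> W \<Longrightarrow> z \<in> space g \<Longrightarrow> m (c \<otimes> \<iota> z) \<in> W"
    and t: "t \<in> space T"
  shows "t \<in> W"
proof -
  note A = algebra_inD[OF tensor_algebraD(1)] and \<iota> = tensor_algebraD(2)
  note p = mor_product_map[OF g tensor_algebraD(1) \<iota>]
  have "product_map m \<eta> \<iota> n x \<in> W" if "x \<in> space (tensor_power g n)" for n x
    using that
  proof (induction n arbitrary: x)
    case 0
    then show ?case by (auto simp: unit_space lin_scale[OF A(5)] subspace_scale[OF W] 1)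
  next
    case (Suc n)
    show ?case
    proof (rule ten_mem[OF Suc.prems[unfolded tensor_power.simps space_ten] mor_lin[OF p] W])
      fix y z assume y: "y \<in> space (tensor_power g n)" and z: "z \<in> space g"
      then show "product_map m \<eta> \<iota> (Suc n) (y \<otimes> z) \<in> W"
        using step[OF mor_mem[OF p y] Suc.IH[OF y] z] by (simp add: ten_tensor mor_lin[OF p] mor_lin[OF \<iota>])
    qed
  qed
  then have "span (\<Union>n. product_map m \<eta> \<iota> n ` space (tensor_power g n)) \<subseteq> W"
    by (intro span_minimal[OF _ W]) auto
  then show ?thesis using t tensor_algebra_span by auto
qed

text \<open>Products of images of generators define a map on the direct sum of the tensor powers,
  which is transported to \<open>T\<close> along the isomorphism contained in the definition of a
  tensor algebra.\<close>

lemma tensor_algebra_universal: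
  assumes B: "algebra_in B M \<eta>B" and f: "mor g B f"
  obtains F where "mor T B F" "\<And>a b. a \<in> space T \<Longrightarrow> b \<in> space T \<Longrightarrow> F (m (a \<otimes> b)) = M (F a \<otimes> F b)"
    "F (\<eta> (unity V)) = \<eta>B (unity V)" "\<And>x. x \<in> space g \<Longrightarrow> F (\<iota> x) = f x"
proof -
  let ?X = "tensor_power g" and ?p = "product_map m \<eta> \<iota>" and ?q = "product_map M \<eta>B f"
  note A = algebra_inD[OF tensor_algebraD(1)] and \<iota> = tensor_algebraD(2) and B' = algebra_inD[OF B]
  note X = obj_tensor_power[OF g]
  note p = mor_product_map[OF g tensor_algebraD(1) \<iota>] and q = mor_product_map[OF g B f]
  let ?D = "dsum ?X"
  note lp = lin_join[of ?p, OF mor_lin[OF p]] and lq = lin_join[of ?q, OF mor_lin[OF q]]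
  have T0: "subspace (space T)" by (rule A(6))
  have ker: "join ?q t = 0" if t: "t \<in> space ?D" and z: "join ?p t = 0" for t
  proof -
    obtain A where A: "finite A" "\<And>n. proj n t \<in> space (?X n)" "\<And>n. n \<notin> A \<Longrightarrow> proj n t = 0"
        "t = (\<Sum>n\<in>A. emb n (proj n t))" using dsum_decomposition[of ?X, OF X t] by blast
    have sub: "{n. proj n t \<noteq> 0} \<subseteq> A" using A(3) by auto
    have "join ?p t = (\<Sum>n\<in>A. ?p n (proj n t))"
      by (subst A(4)) (simp add: lin_sum[OF lp] join_emb mor_lin[OF p])
    also have "\<dots> = (\<Sum>n | proj n t \<noteq> 0. ?p n (proj n t))"
      using sub A(1) by (auto intro!: sum.mono_neutral_right simp: lin_0[OF mor_lin[OF p]])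
    finally have "(\<Sum>n | proj n t \<noteq> 0. ?p n (proj n t)) = 0" using z by simp
    \<comment> \<open>The components of \<open>t\<close> and the zero sequence both decompose 0 in
      \<open>T\<close>, so uniqueness shows that \<open>join ?p\<close> is injective on the direct
      sum.\<close>
    then have "(\<lambda>n. proj n t) = (\<lambda>n. 0)"
      using A(2) finite_subset[OF sub A(1)] subspace_0[OF obj_subspace[OF X]]
      by (intro Uniq_D[OF ex1_iff_ex_Uniq[THEN iffD1, THEN conjunct2, OF tensor_algebraD(3)[OF subspace_0[OF T0]]]]) auto
    then have "proj n t = 0" for n by (rule fun_cong)
    then have "t = 0" using A(4) by simp
    then show ?thesis by (simp add: lin_0[OF lq])
  qed
  obtain F where F: "lin F" "\<And>t. t \<in> space ?D \<Longrightarrow> F (join ?p t) = join ?q t"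
    using lin_factor[OF lp lq obj_subspace[OF obj_dsum[of ?X, OF X]] ker] by blast
  have Fp: "F (?p n x) = ?q n x" if "x \<in> space (?X n)" for n x
    using F(2)[OF mor_mem[OF mor_emb[of ?X, OF X] that]] by (simp add: join_emb mor_lin[OF p] mor_lin[OF q])
  have morF: "mor T B F"
  proof (rule mor_epi[OF A(1) B'(1) F(1), where I=UNIV and Z="?X" and u="?p"])
    show "mor (?X n) B (\<lambda>z. F (?p n z))" for n
      by (rule mor_cong[OF X q]) (simp_all add: Fp lin_compose[OF F(1)] mor_lin[OF p])
  qed (use p tensor_algebra_span in auto)
  note l = lin_compose[OF F(1)] lin_compose[OF A(4)] lin_compose[OF B'(4)] lin_intros F(1) mor_lin[OF \<iota>] mor_lin[OF f]
  have F1: "F (\<eta> (unity V)) = \<eta>B (unity V)" using Fp[of "unity V" 0] by (simp add: span_base)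
  have Fc: "F (m (c \<otimes> \<iota> z)) = M (F c \<otimes> f z)" if "c \<in> space T" and z: "z \<in> space g" for c z
  proof (rule span_lin_eq[OF subsetD[OF tensor_algebra_span that(1)]])
    fix b assume "b \<in> (\<Union>n. ?p n ` space (?X n))"
    then obtain n x where x: "x \<in> space (?X n)" "b = ?p n x" by auto
    have "x \<otimes> z \<in> space (?X (Suc n))" by (simp add: x z ten_space_mem)
    from Fp[OF this] show "F (m (b \<otimes> \<iota> z)) = M (F b \<otimes> f z)"
      by (simp add: x Fp ten_tensor mor_lin[OF p] mor_lin[OF q] l)
  qed (simp_all add: l)
  have F\<iota>: "F (\<iota> x) = f x" if x: "x \<in> space g" for x
    using Fc[OF A(7) x] by (simp add: F1 A(10) B'(10) mor_mem[OF \<iota>] mor_mem[OF f] x)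
  have Fm: "F (m (a \<otimes> b)) = M (F a \<otimes> F b)" if a: "a \<in> space T" and b: "b \<in> space T" for a b
  proof -
    \<comment> \<open>Induction on the second factor alone: associativity brings a new generator to
      the right end, where \<open>Fc\<close> applies.\<close>
    let ?W = "{b. F (m (a \<otimes> b)) = M (F a \<otimes> F b)}"
    have "subspace ?W"
      by (auto simp: subspace_def lin_simps[OF F(1)] lin_simps[OF A(4)] lin_simps[OF B'(4)])
    moreover have "m (c \<otimes> \<iota> z) \<in> ?W" if "c \<in> space T" "c \<in> ?W" "z \<in> space g" for c z
      using that by (simp add: A(9)[symmetric] a mor_mem[OF \<iota>] Fc A(8) B'(9) mor_mem[OF morF] mor_mem[OF f])
    ultimately have "b \<in> ?W"
      using A(11) B'(11) F1 by (intro tensor_algebra_induct[OF _ _ _ b]) (auto simp: a mor_mem[OF morF])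
    then show ?thesis by simp
  qed
  show ?thesis using that morF Fm F1 F\<iota> by blast
qed

end

lemma generated_ideal_minimal: "two_sided_ideal A m I \<Longrightarrow> R \<subseteq> I \<Longrightarrow> generated_ideal A m R \<subseteq> I"
  by (auto simp: generated_ideal_def)

lemma enveloping_algebra_exists:
  assumes g: "is_obj g" and \<sigma>: "mor (g \<otimes>\<^sub>o g) (g \<otimes>\<^sub>o g) \<sigma>" and C: "mor (g \<otimes>\<^sub>o g) g C"
  shows "\<exists>U m \<eta> \<iota>. enveloping_algebra g \<sigma> C U m \<eta> \<iota>"
proof -
  obtain T m \<eta> \<iota> where T: "tensor_algebra g T m \<eta> \<iota>" using tensor_algebra_exists[OF g] by blast
  note A = algebra_inD[OF tensor_algebraD(1)[OF g T]] and \<iota> = tensor_algebraD(2)[OF g T]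
  let ?S = "space T"
  define r where "r w = m ((\<iota> \<otimes>\<^sub>m \<iota>) w) - m ((\<iota> \<otimes>\<^sub>m \<iota>) (\<sigma> w)) - \<iota> (C w)" for w
  have gg: "is_obj (g \<otimes>\<^sub>o g)" by (intro obj_ten g)
  note \<iota>\<iota> = mor_comp[OF mor_ten[OF g g A(1) A(1) \<iota> \<iota>] A(2)]
  have r: "mor (g \<otimes>\<^sub>o g) T r"
    unfolding r_def[abs_def] by (intro mor_add(2) A(1) mor_comp[OF \<sigma> \<iota>\<iota>] \<iota>\<iota> mor_comp[OF C \<iota>])
  define R where "R = {m (\<iota> x \<otimes> \<iota> y) - m ((\<iota> \<otimes>\<^sub>m \<iota>) (\<sigma> (x \<otimes> y))) - \<iota> (C (x \<otimes> y)) | x y. x \<in> space g \<and> y \<in> space g}"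
  have R: "R = {r (x \<otimes> y) | x y. x \<in> space g \<and> y \<in> space g}"
    by (simp add: R_def r_def ten_tensor mor_lin[OF \<iota>])
  \<comment> \<open>The ideal generated by the relations is the image of T \<otimes> (g \<otimes> g)
    \<otimes> T under multiplication. As the image of a morphism it can be divided out by
    \<open>quotient_exists\<close>.\<close>
  define \<psi> where "\<psi> z = m ((m \<otimes>\<^sub>m id) (((id \<otimes>\<^sub>m r) \<otimes>\<^sub>m id) z))" for z
  let ?Z = "(T \<otimes>\<^sub>o (g \<otimes>\<^sub>o g)) \<otimes>\<^sub>o T"
  have Z: "is_obj ?Z" by (intro obj_ten A(1) g)
  have \<psi>: "mor ?Z T \<psi>"
    unfolding \<psi>_def[abs_def]
    by (rule mor_comp[OF mor_ten[OF _ _ _ _ mor_ten[OF _ _ _ _ mor_id(1) r] mor_id(1)]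
        mor_comp[OF mor_ten[OF _ _ _ _ A(2) mor_id(1)] A(2)]]) (intro obj_ten A(1) g)+
  note l = lin_compose[OF A(4)] A(4) lin_intros mor_lin[OF r] lin_compose[OF mor_lin[OF r]] mor_lin[OF \<psi>] lin_compose[OF mor_lin[OF \<psi>]]
  have \<psi>_tensor: "\<psi> ((a \<otimes> w) \<otimes> b) = m (m (a \<otimes> r w) \<otimes> b)" for a b w
    by (simp add: \<psi>_def ten_tensor l)
  let ?J = "\<psi> ` space ?Z"
  obtain U \<pi> where U: "is_obj U" "mor T U \<pi>" "space U = \<pi> ` ?S" "\<And>t. t \<in> ?S \<Longrightarrow> \<pi> t = 0 \<longleftrightarrow> t \<in> ?J"
    "\<And>t. t \<in> ?S \<Longrightarrow> \<pi> t \<in> ?S" "\<And>t. t \<in> ?S \<Longrightarrow> t - \<pi> t \<in> ?J" "\<And>t. \<pi> (\<pi> t) = \<pi> t"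
    by (rule quotient_exists[OF A(1) Z \<psi>]) (rule that)
  have JT: "?J \<subseteq> ?S" using mor_mem[OF \<psi>] by auto
  have left: "m (a \<otimes> \<psi> z) \<in> ?J" if a: "a \<in> ?S" and z: "z \<in> space ?Z" for a z
  proof
    let ?h = "((\<lambda>t. m (a \<otimes> t)) \<otimes>\<^sub>m id) \<otimes>\<^sub>m id"
    have z': "z \<in> (?S \<otimes>\<^sub>s space (g \<otimes>\<^sub>o g)) \<otimes>\<^sub>s ?S" using z by simp
    show "m (a \<otimes> \<psi> z) = \<psi> (?h z)"
      by (rule ten_eq3[OF z']) (simp_all add: l ten_tensor \<psi>_tensor A(8,9) a mor_mem[OF r])
    have "?h z \<in> (?S \<otimes>\<^sub>s space (g \<otimes>\<^sub>o g)) \<otimes>\<^sub>s ?S"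
    proof (rule ten_map[OF z'])
      show "((\<lambda>t. m (a \<otimes> t)) \<otimes>\<^sub>m id) ` (?S \<otimes>\<^sub>s space (g \<otimes>\<^sub>o g)) \<subseteq> ?S \<otimes>\<^sub>s space (g \<otimes>\<^sub>o g)"
        by (rule image_subsetI, erule ten_map) (auto simp: l A(8) a)
    qed (simp_all add: l)
    then show "?h z \<in> space ?Z" by simp
  qed
  have right: "m (\<psi> z \<otimes> b) \<in> ?J" if b: "b \<in> ?S" and z: "z \<in> space ?Z" for b z
  proof
    let ?h = "id \<otimes>\<^sub>m (\<lambda>t. m (t \<otimes> b))"
    have z': "z \<in> (?S \<otimes>\<^sub>s space (g \<otimes>\<^sub>o g)) \<otimes>\<^sub>s ?S" using z by simp
    show "m (\<psi> z \<otimes> b) = \<psi> (?h z)"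
      by (rule ten_eq3[OF z']) (simp_all add: l ten_tensor \<psi>_tensor A(8,9) b mor_mem[OF r])
    have "?h z \<in> (?S \<otimes>\<^sub>s space (g \<otimes>\<^sub>o g)) \<otimes>\<^sub>s ?S"
      by (rule ten_map[OF z']) (auto simp: l A(8) b)
    then show "?h z \<in> space ?Z" by simp
  qed
  have J: "generated_ideal ?S m R = ?J"
  proof
    have "two_sided_ideal ?S m ?J"
      unfolding two_sided_ideal_def
      using JT left right by (auto intro!: subspace_image_lin mor_lin[OF \<psi>])
    moreover have "R \<subseteq> ?J"
    proof
      fix w assume "w \<in> R"
      then obtain x y where xy: "w = r (x \<otimes> y)" "x \<in> space g" "y \<in> space g" by (auto simp: R)
      then have "w = \<psi> ((\<eta> (unity V) \<otimes> (x \<otimes> y)) \<otimes> \<eta> (unity V))"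
        by (simp add: \<psi>_tensor A(7,10,11) mor_mem[OF r] ten_space_mem)
      then show "w \<in> ?J" using xy by (auto intro!: ten_space_mem A(7))
    qed
    ultimately show "generated_ideal ?S m R \<subseteq> ?J" by (rule generated_ideal_minimal)
    show "?J \<subseteq> generated_ideal ?S m R"
    proof (unfold generated_ideal_def, rule Inter_greatest)
      fix I assume "I \<in> {I. two_sided_ideal ?S m I \<and> R \<subseteq> I}"
      then have I: "subspace I" "I \<subseteq> ?S" "\<And>a b. a \<in> ?S \<Longrightarrow> b \<in> I \<Longrightarrow> m (a \<otimes> b) \<in> I"
        "\<And>a b. a \<in> ?S \<Longrightarrow> b \<in> I \<Longrightarrow> m (b \<otimes> a) \<in> I" and RI: "R \<subseteq> I"
        by (auto simp: two_sided_ideal_def)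
      have rI: "r w \<in> I" if "w \<in> space g \<otimes>\<^sub>s space g" for w
        by (rule ten_mem[OF that]) (use RI in \<open>auto simp: R mor_lin[OF r] I(1)\<close>)
      show "?J \<subseteq> I"
      proof (rule image_subsetI)
        fix z assume "z \<in> space ?Z"
        then have z: "z \<in> (?S \<otimes>\<^sub>s space (g \<otimes>\<^sub>o g)) \<otimes>\<^sub>s ?S" by simp
        show "\<psi> z \<in> I"
        proof (rule ten_mem[OF z mor_lin[OF \<psi>] I(1)])
          fix u b assume u: "u \<in> ?S \<otimes>\<^sub>s space (g \<otimes>\<^sub>o g)" and b: "b \<in> ?S"
          show "\<psi> (u \<otimes> b) \<in> I"
            by (rule ten_mem[OF u]) (simp_all add: l I(1) \<psi>_tensor I(3,4) rI b)
        qed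
      qed
    qed
  qed
  note \<pi>l = mor_lin[OF U(2)] lin_compose[OF mor_lin[OF U(2)]] lin_simps[OF mor_lin[OF U(2)]]
  \<comment> \<open>\<open>U\<close> consists of chosen representatives inside \<open>T\<close>; the
    ideal property allows any representative in a product, so \<pi> after the product of
    \<open>T\<close> is a product on \<open>U\<close>.\<close>
  have \<pi>1: "\<pi> (m (\<pi> a \<otimes> b)) = \<pi> (m (a \<otimes> b))" if a: "a \<in> ?S" and b: "b \<in> ?S" for a b
  proof -
    obtain z where "z \<in> space ?Z" "a - \<pi> a = \<psi> z" using U(6)[OF a] by auto
    then have "m ((a - \<pi> a) \<otimes> b) \<in> ?J" using right[OF b] by metis
    then have "\<pi> (m ((a - \<pi> a) \<otimes> b)) = 0" using U(4) JT by blast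
    then show ?thesis by (simp add: \<pi>l lin_diff[OF A(4)])
  qed
  have \<pi>2: "\<pi> (m (a \<otimes> \<pi> b)) = \<pi> (m (a \<otimes> b))" if a: "a \<in> ?S" and b: "b \<in> ?S" for a b
  proof -
    obtain z where "z \<in> space ?Z" "b - \<pi> b = \<psi> z" using U(6)[OF b] by auto
    then have "m (a \<otimes> (b - \<pi> b)) \<in> ?J" using left[OF a] by metis
    then have "\<pi> (m (a \<otimes> (b - \<pi> b))) = 0" using U(4) JT by blast
    then show ?thesis by (simp add: \<pi>l lin_diff[OF A(4)])
  qed
  define mU where "mU w = \<pi> (m w)" for w
  define \<eta>U where "\<eta>U w = \<pi> (\<eta> w)" for w
  define \<iota>U where "\<iota>U x = \<pi> (\<iota> x)" for x
  have lin_mU: "lin mU" by (simp add: mU_def[abs_def] lin_compose[OF mor_lin[OF U(2)]] A(4))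
  have mU: "mor (U \<otimes>\<^sub>o U) U mU"
  proof (rule mor_epi_square[where I="{()}" and Z="\<lambda>_. T" and u="\<lambda>_. \<pi>"])
    show "mor (T \<otimes>\<^sub>o T) U (\<lambda>z. mU ((\<pi> \<otimes>\<^sub>m \<pi>) z))"
    proof (rule mor_cong[OF obj_ten[OF A(1) A(1)] mor_comp[OF A(2) U(2)]])
      fix z assume "z \<in> space (T \<otimes>\<^sub>o T)"
      then have z: "z \<in> ?S \<otimes>\<^sub>s ?S" by simp
      show "mU ((\<pi> \<otimes>\<^sub>m \<pi>) z) = \<pi> (m z)"
        by (rule ten_eq[OF z]) (simp_all add: mU_def \<pi>l(1,2) l ten_tensor \<pi>1 \<pi>2 U(5))
    qed (simp add: lin_compose[OF lin_mU] \<pi>l(1) lin_intros)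
  qed (simp_all add: A(1) U(1-3) lin_mU span_superset)
  have \<eta>U: "mor unit_obj U \<eta>U" and \<iota>U: "mor g U \<iota>U"
    unfolding \<eta>U_def[abs_def] \<iota>U_def[abs_def] by (rule mor_comp[OF A(3) U(2)] mor_comp[OF \<iota> U(2)])+
  have UT: "u \<in> ?S" "\<pi> u = u" if "u \<in> space U" for u
    using that U(3,5,7) by auto
  have "algebra_in U mU \<eta>U"
    unfolding algebra_in_def is_algebra_def
  proof (intro conjI ballI U(1) mU \<eta>U lin_mU mor_lin[OF \<eta>U] obj_subspace[OF U(1)])
    show "mU ` (space U \<otimes>\<^sub>s space U) \<subseteq> space U" using mor_mem[OF mU] by auto
    show "\<eta>U (unity V) \<in> space U" using mor_mem[OF \<eta>U] by (simp add: span_base)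
    show "mU (mU (x \<otimes> y) \<otimes> z) = mU (x \<otimes> mU (y \<otimes> z))" if "x \<in> space U" "y \<in> space U" "z \<in> space U" for x y z
      using that UT(1) by (simp add: mU_def \<pi>1 \<pi>2 A(8,9))
    show "mU (\<eta>U (unity V) \<otimes> x) = x" "mU (x \<otimes> \<eta>U (unity V)) = x" if "x \<in> space U" for x
      using UT[OF that] by (simp_all add: mU_def \<eta>U_def \<pi>1 \<pi>2 A(7,10,11))
  qed
  moreover have "{t \<in> ?S. \<pi> t = 0} = generated_ideal ?S m R"
    unfolding J using U(4) JT by auto
  moreover have "\<pi> (m (a \<otimes> b)) = mU (\<pi> a \<otimes> \<pi> b)" if "a \<in> ?S" "b \<in> ?S" for a b
    using that by (simp add: mU_def \<pi>1 \<pi>2 U(5))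
  ultimately have "enveloping_algebra g \<sigma> C U mU \<eta>U \<iota>U"
    unfolding enveloping_algebra_def R_def using T U(2,3) \<iota>U
    by (intro conjI exI[of _ T] exI[of _ m] exI[of _ \<eta>] exI[of _ \<iota>] exI[of _ \<pi>]) (auto simp: \<eta>U_def \<iota>U_def)
  then show ?thesis by blast
qed

section \<open>Induction and universal property of the enveloping algebra\<close>

context
  fixes g \<sigma> C U m \<eta> \<iota>
  assumes g: "is_obj g" and \<sigma>: "mor (g \<otimes>\<^sub>o g) (g \<otimes>\<^sub>o g) \<sigma>" and C: "mor (g \<otimes>\<^sub>o g) g C"
    and enveloping_algebra: "enveloping_algebra g \<sigma> C U m \<eta> \<iota>"
begin

lemma enveloping_algebraD: "algebra_in U m \<eta>" "mor g U \<iota>"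
  using enveloping_algebra by (auto simp: enveloping_algebra_def)

lemma enveloping_algebra_quotient:
  obtains T m\<^sub>T \<eta>\<^sub>T \<iota>\<^sub>T \<pi> where "tensor_algebra g T m\<^sub>T \<eta>\<^sub>T \<iota>\<^sub>T" "mor T U \<pi>" "\<pi> ` space T = space U"
    "\<And>a b. a \<in> space T \<Longrightarrow> b \<in> space T \<Longrightarrow> \<pi> (m\<^sub>T (a \<otimes> b)) = m (\<pi> a \<otimes> \<pi> b)" "\<pi> (\<eta>\<^sub>T (unity V)) = \<eta> (unity V)"
    "{t \<in> space T. \<pi> t = 0} = generated_ideal (space T) m\<^sub>T
      {m\<^sub>T (\<iota>\<^sub>T x \<otimes> \<iota>\<^sub>T y) - m\<^sub>T ((\<iota>\<^sub>T \<otimes>\<^sub>m \<iota>\<^sub>T) (\<sigma> (x \<otimes> y))) - \<iota>\<^sub>T (C (x \<otimes> y)) | x y. x \<in> space g \<and> y \<in> space g}"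
    "\<And>x. x \<in> space g \<Longrightarrow> \<iota> x = \<pi> (\<iota>\<^sub>T x)"
  using enveloping_algebra by (auto simp: enveloping_algebra_def)

lemma enveloping_algebra_induct:
  assumes W: "subspace W" and 1: "\<eta> (unity V) \<in> W"
    and step: "\<And>c z. c \<in> space U \<Longrightarrow> c \<in> W \<Longrightarrow> z \<in> space g \<Longrightarrow> m (c \<otimes> \<iota> z) \<in> W"
    and u: "u \<in> space U"
  shows "u \<in> W"
proof -
  obtain T m\<^sub>T \<eta>\<^sub>T \<iota>\<^sub>T \<pi> where T: "tensor_algebra g T m\<^sub>T \<eta>\<^sub>T \<iota>\<^sub>T" "mor T U \<pi>" "\<pi> ` space T = space U"
    "\<And>a b. a \<in> space T \<Longrightarrow> b \<in> space T \<Longrightarrow> \<pi> (m\<^sub>T (a \<otimes> b)) = m (\<pi> a \<otimes> \<pi> b)" "\<pi> (\<eta>\<^sub>T (unity V)) = \<eta> (unity V)"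
    and ker: "{t \<in> space T. \<pi> t = 0} = generated_ideal (space T) m\<^sub>T
      {m\<^sub>T (\<iota>\<^sub>T x \<otimes> \<iota>\<^sub>T y) - m\<^sub>T ((\<iota>\<^sub>T \<otimes>\<^sub>m \<iota>\<^sub>T) (\<sigma> (x \<otimes> y))) - \<iota>\<^sub>T (C (x \<otimes> y)) | x y. x \<in> space g \<and> y \<in> space g}"
    and \<iota>: "\<And>x. x \<in> space g \<Longrightarrow> \<iota> x = \<pi> (\<iota>\<^sub>T x)"
    by (rule enveloping_algebra_quotient) (rule that)
  obtain t where t: "t \<in> space T" "u = \<pi> t" using u T(3) by auto
  let ?W = "{t. \<pi> t \<in> W}"
  have "subspace ?W"
    using W by (simp add: subspace_def lin_simps[OF mor_lin[OF T(2)]])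
  moreover have "m\<^sub>T (c \<otimes> \<iota>\<^sub>T z) \<in> ?W" if "c \<in> space T" "c \<in> ?W" "z \<in> space g" for c z
    using that step[of "\<pi> c" z] mor_mem[OF T(2)] mor_mem[OF tensor_algebraD(2)[OF g T(1)]] by (simp add: T(4) \<iota>)
  ultimately have "t \<in> ?W"
    by (intro tensor_algebra_induct[OF g T(1) _ _ _ t(1)]) (simp_all add: T(5) 1)
  then show ?thesis by (simp add: t)
qed

text \<open>The algebra map on the tensor algebra has as kernel an ideal containing the relations,
  hence containing the kernel of the projection to \<open>U\<close>; \<open>lin_factor\<close> then
  produces the map on \<open>U\<close>.\<close>

lemma enveloping_algebra_universal:
  assumes B: "algebra_in B M \<eta>B" and f: "mor g B f"
    and rel: "\<And>x y. x \<in> space g \<Longrightarrow> y \<in> space g \<Longrightarrow> M (f x \<otimes> f y) = M ((f \<otimes>\<^sub>m f) (\<sigma> (x \<otimes> y))) + f (C (x \<otimes> y))"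
  obtains F where "mor U B F" "\<And>a b. a \<in> space U \<Longrightarrow> b \<in> space U \<Longrightarrow> F (m (a \<otimes> b)) = M (F a \<otimes> F b)"
    "F (\<eta> (unity V)) = \<eta>B (unity V)" "\<And>x. x \<in> space g \<Longrightarrow> F (\<iota> x) = f x"
proof -
  obtain T m\<^sub>T \<eta>\<^sub>T \<iota>\<^sub>T \<pi> where T: "tensor_algebra g T m\<^sub>T \<eta>\<^sub>T \<iota>\<^sub>T" "mor T U \<pi>" "\<pi> ` space T = space U"
    "\<And>a b. a \<in> space T \<Longrightarrow> b \<in> space T \<Longrightarrow> \<pi> (m\<^sub>T (a \<otimes> b)) = m (\<pi> a \<otimes> \<pi> b)" "\<pi> (\<eta>\<^sub>T (unity V)) = \<eta> (unity V)"
    and ker: "{t \<in> space T. \<pi> t = 0} = generated_ideal (space T) m\<^sub>T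
      {m\<^sub>T (\<iota>\<^sub>T x \<otimes> \<iota>\<^sub>T y) - m\<^sub>T ((\<iota>\<^sub>T \<otimes>\<^sub>m \<iota>\<^sub>T) (\<sigma> (x \<otimes> y))) - \<iota>\<^sub>T (C (x \<otimes> y)) | x y. x \<in> space g \<and> y \<in> space g}"
    and \<iota>: "\<And>x. x \<in> space g \<Longrightarrow> \<iota> x = \<pi> (\<iota>\<^sub>T x)"
    by (rule enveloping_algebra_quotient) (rule that)
  note A = algebra_inD[OF tensor_algebraD(1)[OF g T(1)]] and \<iota>T = tensor_algebraD(2)[OF g T(1)] and B' = algebra_inD[OF B]
  obtain F where F: "mor T B F" "\<And>a b. a \<in> space T \<Longrightarrow> b \<in> space T \<Longrightarrow> F (m\<^sub>T (a \<otimes> b)) = M (F a \<otimes> F b)"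
    "F (\<eta>\<^sub>T (unity V)) = \<eta>B (unity V)" "\<And>x. x \<in> space g \<Longrightarrow> F (\<iota>\<^sub>T x) = f x"
    using tensor_algebra_universal[OF g T(1) B f] by metis
  note l = mor_lin[OF F(1)] lin_compose[OF mor_lin[OF F(1)]] A(4) lin_compose[OF A(4)] B'(4) lin_compose[OF B'(4)]
    mor_lin[OF \<iota>T] mor_lin[OF f] lin_intros
  have Fmm: "F (m\<^sub>T ((\<iota>\<^sub>T \<otimes>\<^sub>m \<iota>\<^sub>T) w)) = M ((f \<otimes>\<^sub>m f) w)" if "w \<in> space g \<otimes>\<^sub>s space g" for w
    by (rule ten_eq[OF that]) (simp_all add: l ten_tensor F(2,4) mor_mem[OF \<iota>T])
  have \<sigma>C: "\<sigma> (x \<otimes> y) \<in> space g \<otimes>\<^sub>s space g" "C (x \<otimes> y) \<in> space g" if "x \<in> space g" "y \<in> space g" for x y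
    using that mor_mem[OF \<sigma>, of "x \<otimes> y"] mor_mem[OF C, of "x \<otimes> y"] by (simp_all add: ten_space_mem)
  let ?K = "{t \<in> space T. F t = 0}"
  note lF = lin_simps[OF mor_lin[OF F(1)]]
  have mM: "m\<^sub>T ((\<iota>\<^sub>T \<otimes>\<^sub>m \<iota>\<^sub>T) w) \<in> space T" if "w \<in> space g \<otimes>\<^sub>s space g" for w
    by (rule ten_mem[OF that]) (simp_all add: l A(6,8) ten_tensor mor_mem[OF \<iota>T])
  have "two_sided_ideal (space T) m\<^sub>T ?K"
    unfolding two_sided_ideal_def
    using A(6) by (auto simp: subspace_def lF A(8) F(2) lin_0[OF B'(4)])
  then have "{t \<in> space T. \<pi> t = 0} \<subseteq> ?K"
    unfolding ker
  proof (rule generated_ideal_minimal)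
    show "{m\<^sub>T (\<iota>\<^sub>T x \<otimes> \<iota>\<^sub>T y) - m\<^sub>T ((\<iota>\<^sub>T \<otimes>\<^sub>m \<iota>\<^sub>T) (\<sigma> (x \<otimes> y))) - \<iota>\<^sub>T (C (x \<otimes> y)) | x y. x \<in> space g \<and> y \<in> space g} \<subseteq> ?K"
    proof clarify
      fix x y assume xy: "x \<in> space g" "y \<in> space g"
      have "m\<^sub>T (\<iota>\<^sub>T x \<otimes> \<iota>\<^sub>T y) - m\<^sub>T ((\<iota>\<^sub>T \<otimes>\<^sub>m \<iota>\<^sub>T) (\<sigma> (x \<otimes> y))) - \<iota>\<^sub>T (C (x \<otimes> y)) \<in> space T"
        by (intro subspace_diff[OF A(6)] A(8) mM mor_mem[OF \<iota>T] \<sigma>C xy)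
      then show "m\<^sub>T (\<iota>\<^sub>T x \<otimes> \<iota>\<^sub>T y) - m\<^sub>T ((\<iota>\<^sub>T \<otimes>\<^sub>m \<iota>\<^sub>T) (\<sigma> (x \<otimes> y))) - \<iota>\<^sub>T (C (x \<otimes> y)) \<in> space T \<and>
          F (m\<^sub>T (\<iota>\<^sub>T x \<otimes> \<iota>\<^sub>T y) - m\<^sub>T ((\<iota>\<^sub>T \<otimes>\<^sub>m \<iota>\<^sub>T) (\<sigma> (x \<otimes> y))) - \<iota>\<^sub>T (C (x \<otimes> y))) = 0"
        using xy \<sigma>C[OF xy] by (simp add: lF F(2,4) mor_mem[OF \<iota>T] Fmm rel)
    qed
  qed
  then obtain h where h: "lin h" "\<And>t. t \<in> space T \<Longrightarrow> h (\<pi> t) = F t"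
    using lin_factor[OF mor_lin[OF T(2)] mor_lin[OF F(1)] A(6)] by blast
  have "mor U B h"
  proof (rule mor_epi[OF algebra_inD(1)[OF enveloping_algebraD(1)] B'(1) h(1), where I="{()}" and Z="\<lambda>_. T" and u="\<lambda>_. \<pi>"])
    show "mor T B (\<lambda>z. h (\<pi> z))"
      by (rule mor_cong[OF A(1) F(1)]) (simp_all add: h lin_compose[OF h(1)] mor_lin[OF T(2)])
  qed (simp_all add: T(2,3) span_superset)
  moreover have "h (m (a \<otimes> b)) = M (h a \<otimes> h b)" if "a \<in> space U" "b \<in> space U" for a b
  proof -
    obtain s t where "s \<in> space T" "t \<in> space T" "a = \<pi> s" "b = \<pi> t" using \<open>a \<in> space U\<close> \<open>b \<in> space U\<close> unfolding T(3)[symmetric] by blast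
    then show ?thesis by (simp add: T(4)[symmetric] h(2) A(8) F(2))
  qed
  moreover have "h (\<eta> (unity V)) = \<eta>B (unity V)" using h(2)[OF A(7)] by (simp add: T(5) F(3))
  moreover have "h (\<iota> x) = f x" if "x \<in> space g" for x using that by (simp add: \<iota> h(2) mor_mem[OF \<iota>T] F(4))
  ultimately show ?thesis using that by blast
qed

lemma enveloping_relation:
  assumes z: "z \<in> space g \<otimes>\<^sub>s space g"
  shows "m ((\<iota> \<otimes>\<^sub>m \<iota>) z) = m ((\<iota> \<otimes>\<^sub>m \<iota>) (\<sigma> z)) + \<iota> (C z)"
proof -
  obtain T m\<^sub>T \<eta>\<^sub>T \<iota>\<^sub>T \<pi> where T: "tensor_algebra g T m\<^sub>T \<eta>\<^sub>T \<iota>\<^sub>T" "mor T U \<pi>" "\<pi> ` space T = space U"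
    "\<And>a b. a \<in> space T \<Longrightarrow> b \<in> space T \<Longrightarrow> \<pi> (m\<^sub>T (a \<otimes> b)) = m (\<pi> a \<otimes> \<pi> b)" "\<pi> (\<eta>\<^sub>T (unity V)) = \<eta> (unity V)"
    and ker: "{t \<in> space T. \<pi> t = 0} = generated_ideal (space T) m\<^sub>T
      {m\<^sub>T (\<iota>\<^sub>T x \<otimes> \<iota>\<^sub>T y) - m\<^sub>T ((\<iota>\<^sub>T \<otimes>\<^sub>m \<iota>\<^sub>T) (\<sigma> (x \<otimes> y))) - \<iota>\<^sub>T (C (x \<otimes> y)) | x y. x \<in> space g \<and> y \<in> space g}"
    and \<iota>: "\<And>x. x \<in> space g \<Longrightarrow> \<iota> x = \<pi> (\<iota>\<^sub>T x)"
    by (rule enveloping_algebra_quotient) (rule that)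
  note A = algebra_inD[OF tensor_algebraD(1)[OF g T(1)]] and \<iota>T = tensor_algebraD(2)[OF g T(1)]
    and U = algebra_inD[OF enveloping_algebraD(1)]
  note l = mor_lin[OF T(2)] lin_compose[OF mor_lin[OF T(2)]] A(4) lin_compose[OF A(4)] U(4) lin_compose[OF U(4)]
    mor_lin[OF \<iota>T] lin_compose[OF mor_lin[OF \<iota>T]] mor_lin[OF enveloping_algebraD(2)] lin_compose[OF mor_lin[OF enveloping_algebraD(2)]]
    lin_compose[OF mor_lin[OF \<sigma>]] mor_lin[OF \<sigma>] mor_lin[OF C] lin_compose[OF mor_lin[OF C]] lin_intros
  have mm: "\<pi> (m\<^sub>T ((\<iota>\<^sub>T \<otimes>\<^sub>m \<iota>\<^sub>T) w)) = m ((\<iota> \<otimes>\<^sub>m \<iota>) w)" if "w \<in> space g \<otimes>\<^sub>s space g" for w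
    by (rule ten_eq[OF that]) (simp_all add: l ten_tensor T(4) \<iota> mor_mem[OF \<iota>T])
  show ?thesis
  proof (rule ten_eq[OF z])
    fix x y assume xy: "x \<in> space g" "y \<in> space g"
    then have "m\<^sub>T (\<iota>\<^sub>T x \<otimes> \<iota>\<^sub>T y) - m\<^sub>T ((\<iota>\<^sub>T \<otimes>\<^sub>m \<iota>\<^sub>T) (\<sigma> (x \<otimes> y))) - \<iota>\<^sub>T (C (x \<otimes> y)) \<in> {t \<in> space T. \<pi> t = 0}"
      unfolding ker by (auto simp: generated_ideal_def)
    then have "\<pi> (m\<^sub>T ((\<iota>\<^sub>T \<otimes>\<^sub>m \<iota>\<^sub>T) (x \<otimes> y)) - m\<^sub>T ((\<iota>\<^sub>T \<otimes>\<^sub>m \<iota>\<^sub>T) (\<sigma> (x \<otimes> y))) - \<iota>\<^sub>T (C (x \<otimes> y))) = 0"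
      by (simp add: ten_tensor mor_lin[OF \<iota>T])
    moreover have "\<sigma> (x \<otimes> y) \<in> space g \<otimes>\<^sub>s space g" "C (x \<otimes> y) \<in> space g" "x \<otimes> y \<in> space g \<otimes>\<^sub>s space g"
      using xy mor_mem[OF \<sigma>, of "x \<otimes> y"] mor_mem[OF C, of "x \<otimes> y"] by (simp_all add: ten_space_mem)
    ultimately show "m ((\<iota> \<otimes>\<^sub>m \<iota>) (x \<otimes> y)) = m ((\<iota> \<otimes>\<^sub>m \<iota>) (\<sigma> (x \<otimes> y))) + \<iota> (C (x \<otimes> y))"
      by (simp add: lin_diff[OF mor_lin[OF T(2)]] lin_add[OF mor_lin[OF T(2)]] mm \<iota> algebra_simps)
  qed (simp_all add: l)
qed

end

end

section \<open>The coproduct of the enveloping algebra\<close>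

context braided_category
begin

lemma mid_natural:
  assumes X: "is_obj X" and Y: "is_obj Y" and f: "mor X Y f"
    and w: "w \<in> (space X \<otimes>\<^sub>s space X) \<otimes>\<^sub>s (space X \<otimes>\<^sub>s space X)"
  shows "mid (\<Psi> Y Y) (((f \<otimes>\<^sub>m f) \<otimes>\<^sub>m (f \<otimes>\<^sub>m f)) w) = ((f \<otimes>\<^sub>m f) \<otimes>\<^sub>m (f \<otimes>\<^sub>m f)) (mid (\<Psi> X X) w)"
proof -
  note l = mor_lin[OF f] mor_lin[OF mor_braid[OF X X]] mor_lin[OF mor_braid[OF Y Y]]
    lin_compose[OF mor_lin[OF mor_braid[OF X X]]] lin_compose[OF mor_lin[OF mor_braid[OF Y Y]]] lin_intros
  show ?thesis
  proof (rule ten_eq4[OF w])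
    fix x y z v assume m: "x \<in> space X" "y \<in> space X" "z \<in> space X" "v \<in> space X"
    have "\<alpha>' (f x \<otimes> \<alpha> ((f \<otimes>\<^sub>m f) q \<otimes> f v)) = ((f \<otimes>\<^sub>m f) \<otimes>\<^sub>m (f \<otimes>\<^sub>m f)) (\<alpha>' (x \<otimes> \<alpha> (q \<otimes> v)))" for q
      by (rule tensor_ext[where z=q]) (simp_all add: l ten_tensor)
    with braid_natural[OF X Y X Y f f ten_space_mem[OF m(2,3)]]
    show "mid (\<Psi> Y Y) (((f \<otimes>\<^sub>m f) \<otimes>\<^sub>m (f \<otimes>\<^sub>m f)) ((x \<otimes> y) \<otimes> (z \<otimes> v))) =
      ((f \<otimes>\<^sub>m f) \<otimes>\<^sub>m (f \<otimes>\<^sub>m f)) (mid (\<Psi> X X) ((x \<otimes> y) \<otimes> (z \<otimes> v)))"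
      by (simp add: l ten_tensor mid_tensor)
  qed (simp_all add: l)
qed

lemma braid_unit_element:
  assumes A: "is_obj A" and \<eta>: "mor unit_obj A \<eta>" and x: "x \<in> space A"
  shows "\<Psi> A A (\<eta> (unity V) \<otimes> x) = x \<otimes> \<eta> (unity V)" "\<Psi> A A (x \<otimes> \<eta> (unity V)) = \<eta> (unity V) \<otimes> x"
  using braid_natural[OF obj_unit A A A \<eta> mor_id(1) ten_space_mem[of "unity V" _ x], OF _ x]
    braid_natural[OF A A obj_unit A mor_id(1) \<eta> ten_space_mem[of x _ "unity V"], OF x]
  by (simp_all add: ten_tensor mor_lin[OF \<eta>] lin_intros braid_unit A x span_base)

text \<open>The braided tensor square as target of the universal property. Associativity is
  \<open>square_assoc\<close>, and the unit laws hold because the unit element passes trivially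
  through the braiding.\<close>

lemma square_algebra:
  assumes alg: "algebra_in A m \<eta>"
  shows "algebra_in (A \<otimes>\<^sub>o A) (\<lambda>w. (m \<otimes>\<^sub>m m) (mid (\<Psi> A A) w)) (\<lambda>x. \<eta> x \<otimes> \<eta> (unity V))"
proof -
  note A = algebra_inD[OF alg]
  interpret product_words V "space A" m "\<Psi> A A" by (rule product_words[OF A(1,2)])
  have M: "mor ((A \<otimes>\<^sub>o A) \<otimes>\<^sub>o (A \<otimes>\<^sub>o A)) (A \<otimes>\<^sub>o A) (\<lambda>w. (m \<otimes>\<^sub>m m) (mid (\<Psi> A A) w))"
    by (rule mor_comp[OF mor_mid[OF A(1) A(1) A(1) A(1) mor_braid[OF A(1) A(1)]] mor_ten[OF _ _ A(1) A(1) A(2) A(2)]])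
      (intro obj_ten A(1))+
  have 1: "mor unit_obj (A \<otimes>\<^sub>o A) (\<lambda>x. \<eta> x \<otimes> \<eta> (unity V))"
    using mor_comp[OF mor_tensor_unity(1)[OF obj_unit] mor_ten[OF obj_unit obj_unit A(1) A(1) A(3) A(3)]]
    by (simp add: ten_tensor A(5))
  note l = A(4) c lin_intros
  show ?thesis
    unfolding algebra_in_def is_algebra_def
  proof (intro conjI ballI M 1 mor_lin[OF M] mor_lin[OF 1] obj_subspace obj_ten A(1))
    show "(\<lambda>w. (m \<otimes>\<^sub>m m) (mid (\<Psi> A A) w)) ` (space (A \<otimes>\<^sub>o A) \<otimes>\<^sub>s space (A \<otimes>\<^sub>o A)) \<subseteq> space (A \<otimes>\<^sub>o A)"
      using mor_mem[OF M] by auto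
    show "\<eta> (unity V) \<otimes> \<eta> (unity V) \<in> space (A \<otimes>\<^sub>o A)" by (simp add: ten_space_mem A(7))
    fix x assume "x \<in> space (A \<otimes>\<^sub>o A)"
    then have x: "x \<in> space A \<otimes>\<^sub>s space A" by simp
    note braid = braid_unit_element[OF A(1,3)]
    show "(m \<otimes>\<^sub>m m) (mid (\<Psi> A A) ((\<eta> (unity V) \<otimes> \<eta> (unity V)) \<otimes> x)) = x"
      by (rule ten_eq[OF x, where g="\<lambda>x. x"]) (simp_all add: l mid_tensor ten_tensor A(7,10,11) braid)
    show "(m \<otimes>\<^sub>m m) (mid (\<Psi> A A) (x \<otimes> (\<eta> (unity V) \<otimes> \<eta> (unity V)))) = x"
      by (rule ten_eq[OF x, where g="\<lambda>x. x"]) (simp_all add: l mid_tensor ten_tensor A(7,10,11) braid)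
    fix y z assume "y \<in> space (A \<otimes>\<^sub>o A)" "z \<in> space (A \<otimes>\<^sub>o A)"
    then show "(m \<otimes>\<^sub>m m) (mid (\<Psi> A A) ((m \<otimes>\<^sub>m m) (mid (\<Psi> A A) (x \<otimes> y)) \<otimes> z)) =
      (m \<otimes>\<^sub>m m) (mid (\<Psi> A A) (x \<otimes> (m \<otimes>\<^sub>m m) (mid (\<Psi> A A) (y \<otimes> z))))"
      using square_assoc[OF A(9) x] by simp
  qed
qed

text \<open>The ground field as an algebra in the category, the target from which the counit is
  obtained.\<close>

lemma unit_algebra: "algebra_in unit_obj runit id"
proof -
  have u: "unity V \<in> span {unity V}" by (simp add: span_base)
  have "runit ` (span {unity V} \<otimes>\<^sub>s span {unity V}) \<subseteq> span {unity V}"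
    using mor_mem[OF runit_mor[OF obj_unit]] by auto
  then show ?thesis
    unfolding algebra_in_def is_algebra_def
    using u[unfolded unit_space] by (auto simp: obj_unit obj_subspace unit_simps runit_mor lin_intros unit_space)
qed

text \<open>\<Delta> and \<epsilon> come from the universal property, hence are multiplicative. The
  coalgebra axioms hold on the image of \<open>G\<close>, by those of \<open>d\<close> and
  \<open>e\<close>, and are inherited by products.\<close>

theorem enveloping_bialgebra:
  assumes good: "good_quantum_Lie_algebra g \<sigma> C \<delta>" and env: "enveloping_algebra g \<sigma> C U m \<eta> \<iota>"
  shows "\<exists>\<Delta> \<epsilon>. bialgebra_in U m \<eta> \<Delta> \<epsilon> \<and>
    (\<forall>x \<in> space g. \<Delta> (\<iota> x) = \<iota> x \<otimes> \<eta> (unity V) + \<eta> (unity V) \<otimes> \<iota> x + (\<iota> \<otimes>\<^sub>m \<iota>) (\<delta> x) \<and> \<epsilon> (\<iota> x) = 0)"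
proof -
  have data: "is_obj g" "mor (g \<otimes>\<^sub>o g) (g \<otimes>\<^sub>o g) \<sigma>" "mor (g \<otimes>\<^sub>o g) g C" "mor g (g \<otimes>\<^sub>o g) \<delta>"
    and co: "coassociative (space g) \<delta>"
    using good by (auto simp: good_quantum_Lie_algebra_def)
  obtain G i j s d e where ext: "unit_extension g \<sigma> C \<delta> G i j s d e"
    using unit_extension_exists[OF data] by blast
  interpret extended V g \<sigma> C \<delta> G i j s d e by (rule extendedI[OF data co ext])
  note UA = enveloping_algebraD[OF data(1-3) env]
  note A = algebra_inD[OF UA(1)] and \<iota> = UA(2)
  let ?S = "space U" and ?p = "\<Psi> U U" and ?I = "\<eta> (unity V)"
  \<comment> \<open>The extension of \<iota> to \<open>G\<close> with \<gamma> sent to 1, written by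
    means of the components \<open>e\<close> and \<open>t\<close>.\<close>
  define k where "k z = scale V (e z) ?I + \<iota> (t z)" for z
  have lin_k: "lin k" unfolding k_def[abs_def] by (intro lin_intros e lin_compose[OF mor_lin[OF \<iota>]] lin_t)
  have k\<gamma> [simp]: "k \<gamma> = ?I" and kj [simp]: "x \<in> S \<Longrightarrow> k (j x) = \<iota> x" for x
    by (simp_all add: k_def lin_0[OF mor_lin[OF \<iota>]])
  have k: "mor G U k"
  proof (rule mor_from_extension)
    show "mor unit_obj U (\<lambda>x. k (i x))"
      by (rule mor_cong[OF obj_unit A(3)])
        (auto simp: unit_space lin_scale[OF lin_i] lin_scale[OF lin_k] lin_scale[OF A(5)] lin_compose[OF lin_k] lin_i)
    show "mor g U (\<lambda>x. k (j x))"
      by (rule mor_cong[OF data(1) \<iota>]) (simp_all add: lin_compose[OF lin_k] lin_j)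
  qed (simp_all add: lin_k A(1))
  note l = A(4) lin_compose[OF A(4)] lin_k lin_compose[OF lin_k] mor_lin[OF \<iota>] lin_compose[OF mor_lin[OF \<iota>]]
    mor_lin[OF mor_braid[OF A(1) A(1)]] linc lin_intros
  define \<nu> where "\<nu> z = m ((k \<otimes>\<^sub>m k) z)" for z
  have lin_\<nu>: "lin \<nu>" unfolding \<nu>_def[abs_def] by (simp add: l)
  have \<nu>s: "\<nu> (s z) = \<nu> z" if "z \<in> T \<otimes>\<^sub>s T" for z
  proof (rule TT_ext[OF that])
    fix x y assume xy: "x \<in> S" "y \<in> S"
    have kk: "(k \<otimes>\<^sub>m k) ((j \<otimes>\<^sub>m j) w) = (\<iota> \<otimes>\<^sub>m \<iota>) w" if "w \<in> S \<otimes>\<^sub>s S" for w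
      by (rule ten_eq[OF that]) (simp_all add: l ten_tensor)
    show "\<nu> (s (j x \<otimes> j y)) = \<nu> (j x \<otimes> j y)"
      using enveloping_relation[OF data(1-3) env ten_space_mem[OF xy]] xy
      by (simp add: \<nu>_def s_j lin_add[OF A(4)] lin_add[OF lin_ten[OF lin_k lin_k]] ten_tensor l kk \<sigma>_mem C_mem ten_space_mem
          A(11) mor_mem[OF \<iota>])
  qed (simp_all add: s_\<gamma> \<nu>_def ten_tensor l A(10,11) mor_mem[OF k])
  define D where "D z = (k \<otimes>\<^sub>m k) (d z)" for z
  define M where "M w = (m \<otimes>\<^sub>m m) (mid ?p w)" for w
  have kk: "mor (G \<otimes>\<^sub>o G) (U \<otimes>\<^sub>o U) (k \<otimes>\<^sub>m k)" by (intro mor_ten G A(1) k)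
  have D: "mor G (U \<otimes>\<^sub>o U) D" unfolding D_def[abs_def] by (rule mor_comp[OF mor_d kk])
  have lin_M: "lin M" unfolding M_def[abs_def] by (simp add: l)
  note alg2 = square_algebra[OF UA(1), folded M_def]
  note A2 = algebra_inD[OF alg2]
  note l2 = lin_\<nu> mor_lin[OF D] lin_compose[OF mor_lin[OF D]] lin_M lin_compose[OF lin_M] l
  have dd_mem: "(d \<otimes>\<^sub>m d) z \<in> (T \<otimes>\<^sub>s T) \<otimes>\<^sub>s (T \<otimes>\<^sub>s T)" if "z \<in> T \<otimes>\<^sub>s T" for z
    by (rule ten_map[OF that d d]) (use mor_mem[OF mor_d] in auto)
  have mid_dd_mem: "mid p ((d \<otimes>\<^sub>m d) z) \<in> (T \<otimes>\<^sub>s T) \<otimes>\<^sub>s (T \<otimes>\<^sub>s T)" if "z \<in> T \<otimes>\<^sub>s T" for z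
    by (rule mid_mem[OF dd_mem[OF that] lin_p]) (use mor_mem[OF mor_braid[OF G G]] in auto)
  \<comment> \<open>\<open>k\<close> is a morphism and so commutes with the braidings. This
    transfers invariance under \<open>s\<close> from \<nu> to the product of coproducts in U
    \<otimes> U.\<close>
  have MDD: "M ((D \<otimes>\<^sub>m D) z) = (\<nu> \<otimes>\<^sub>m \<nu>) (mid p ((d \<otimes>\<^sub>m d) z))" if z: "z \<in> T \<otimes>\<^sub>s T" for z
  proof -
    have "(D \<otimes>\<^sub>m D) z = ((k \<otimes>\<^sub>m k) \<otimes>\<^sub>m (k \<otimes>\<^sub>m k)) ((d \<otimes>\<^sub>m d) z)"
      by (rule ten_eq[OF z]) (simp_all add: l2 ten_tensor D_def)
    then have "M ((D \<otimes>\<^sub>m D) z) = (m \<otimes>\<^sub>m m) (((k \<otimes>\<^sub>m k) \<otimes>\<^sub>m (k \<otimes>\<^sub>m k)) (mid p ((d \<otimes>\<^sub>m d) z)))"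
      by (simp add: M_def mid_natural[OF G A(1) k dd_mem[OF z]])
    also have "\<dots> = (\<nu> \<otimes>\<^sub>m \<nu>) (mid p ((d \<otimes>\<^sub>m d) z))"
      by (rule ten_eq[OF mid_dd_mem[OF z]]) (simp_all add: l2 ten_tensor \<nu>_def)
    finally show ?thesis .
  qed
  have sT: "s z \<in> T \<otimes>\<^sub>s T" if "z \<in> T \<otimes>\<^sub>s T" for z using mor_mem[OF mor_s] that by simp
  have Ms: "M ((D \<otimes>\<^sub>m D) (s z)) = M ((D \<otimes>\<^sub>m D) z)" if z: "z \<in> T \<otimes>\<^sub>s T" for z
  proof -
    have "mid p ((d \<otimes>\<^sub>m d) (s z)) = (s \<otimes>\<^sub>m s) (mid p ((d \<otimes>\<^sub>m d) z))"
      using coalgebra_endomorphism[OF good] z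
      by (simp add: coalgebra_endomorphism_of_square_def coalgebra_morphism_def braided_square_comult_def)
    moreover have "(\<nu> \<otimes>\<^sub>m \<nu>) ((s \<otimes>\<^sub>m s) w) = (\<nu> \<otimes>\<^sub>m \<nu>) w" if "w \<in> (T \<otimes>\<^sub>s T) \<otimes>\<^sub>s (T \<otimes>\<^sub>s T)" for w
      by (rule ten_eq[OF that]) (simp_all add: l2 ten_tensor \<nu>s)
    ultimately show ?thesis using mid_dd_mem[OF z] by (simp add: MDD z sT)
  qed
  let ?f = "\<lambda>x. D (j x)"
  have f: "mor g (U \<otimes>\<^sub>o U) ?f" by (rule mor_comp[OF j D])
  have D\<gamma> [simp]: "D \<gamma> = ?I \<otimes> ?I" by (simp add: D_def d_\<gamma> ten_tensor lin_k)
  \<comment> \<open>Written out with \<open>s (j x \<otimes> j y)\<close> and D(\<gamma>) = 1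
    \<otimes> 1, invariance under \<open>s\<close> is the relation that the universal property
    demands.\<close>
  have rel: "M (?f x \<otimes> ?f y) = M ((?f \<otimes>\<^sub>m ?f) (\<sigma> (x \<otimes> y))) + ?f (C (x \<otimes> y))" if xy: "x \<in> S" "y \<in> S" for x y
  proof -
    have ff: "(D \<otimes>\<^sub>m D) ((j \<otimes>\<^sub>m j) w) = (?f \<otimes>\<^sub>m ?f) w" for w
      by (rule tensor_ext[where z=w]) (simp_all add: l2 ten_tensor)
    have "M (?f x \<otimes> ?f y) = M ((D \<otimes>\<^sub>m D) (s (j x \<otimes> j y)))"
      using Ms[of "j x \<otimes> j y"] xy by (simp add: ten_space_mem j_mem ten_tensor mor_lin[OF D])
    also have "\<dots> = M ((?f \<otimes>\<^sub>m ?f) (\<sigma> (x \<otimes> y))) + ?f (C (x \<otimes> y))"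
      using xy C_mem[OF ten_space_mem[OF xy]]
      by (simp add: s_j lin_add[OF lin_M] lin_add[OF lin_ten[OF mor_lin[OF D] mor_lin[OF D]]] ff ten_tensor mor_lin[OF D]
          A2(11) mor_mem[OF f, simplified])
    finally show ?thesis .
  qed
  obtain \<Delta> where \<Delta>: "mor U (U \<otimes>\<^sub>o U) \<Delta>" "\<And>a b. a \<in> ?S \<Longrightarrow> b \<in> ?S \<Longrightarrow> \<Delta> (m (a \<otimes> b)) = M (\<Delta> a \<otimes> \<Delta> b)"
    "\<Delta> ?I = ?I \<otimes> ?I" "\<And>x. x \<in> S \<Longrightarrow> \<Delta> (\<iota> x) = ?f x"
    by (rule enveloping_algebra_universal[OF data(1-3) env alg2 f]) (erule (1) rel, rule that)
  \<comment> \<open>The counit is the algebra morphism to the unit object induced by the zero map on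
    g.\<close>
  obtain F where F: "mor U unit_obj F" "\<And>a b. a \<in> ?S \<Longrightarrow> b \<in> ?S \<Longrightarrow> F (m (a \<otimes> b)) = runit (F a \<otimes> F b)"
    "F ?I = id (unity V)" "\<And>x. x \<in> S \<Longrightarrow> F (\<iota> x) = 0"
  proof (rule enveloping_algebra_universal[OF data(1-3) env unit_algebra mor_zero[OF obj_unit, of g]])
    show "runit (0 \<otimes> 0) = runit (((\<lambda>x. 0) \<otimes>\<^sub>m (\<lambda>x. 0)) (\<sigma> (x \<otimes> y))) + 0" for x y
    proof -
      have "((\<lambda>x. 0) \<otimes>\<^sub>m (\<lambda>x. 0)) w = 0" for w
        by (rule tensor_ext[where z=w and g="\<lambda>_. 0"]) (simp_all add: lin_intros ten_tensor)
      then show ?thesis by simp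
    qed
  qed (rule that)
  define \<epsilon> where "\<epsilon> u = coord (F u)" for u
  have \<epsilon>: "functional \<epsilon>"
    using functional_coord mor_lin[OF F(1)] by (simp add: \<epsilon>_def[abs_def] functional_iff lin_iff)
  have F\<epsilon>: "F u = scale V (\<epsilon> u) (unity V)" if "u \<in> ?S" for u
    using mor_mem[OF F(1) that] by (auto simp: \<epsilon>_def unit_space functional_scale[OF functional_coord])
  have mor_\<epsilon>: "mor U unit_obj (\<lambda>x. scale V (\<epsilon> x) (unity V))"
    by (rule mor_cong[OF A(1) F(1)]) (simp_all add: F\<epsilon> lin_functional[OF \<epsilon> lin_id(2)])
  have \<epsilon>m: "\<epsilon> (m (x \<otimes> y)) = \<epsilon> x * \<epsilon> y" if "x \<in> ?S" "y \<in> ?S" for x y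
    unfolding \<epsilon>_def[of "m (x \<otimes> y)"] F(2)[OF that] F\<epsilon>[OF that(1)] F\<epsilon>[OF that(2)]
    by (simp add: unit_simps functional_scale[OF functional_coord])
  have \<epsilon>1: "\<epsilon> ?I = 1" and \<epsilon>\<iota>: "x \<in> S \<Longrightarrow> \<epsilon> (\<iota> x) = 0" for x
    by (simp_all add: \<epsilon>_def F(3,4) functional_0[OF functional_coord])
  have \<epsilon>k: "\<epsilon> (k z) = e z" if "z \<in> T" for z
  proof -
    obtain c x where "x \<in> S" "z = scale V c \<gamma> + j x" using \<open>z \<in> T\<close> by (rule T_cases)
    then show ?thesis
      by (simp add: lin_simps[OF lin_k] functional_add[OF \<epsilon>] functional_scale[OF \<epsilon>] functional_add[OF e] functional_scale[OF e] \<epsilon>1 \<epsilon>\<iota>)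
  qed
  have \<Delta>k: "\<Delta> (k z) = D z" if "z \<in> T" for z
    by (rule T_ext[OF that]) (simp_all add: l2 lin_compose[OF mor_lin[OF \<Delta>(1)]] \<Delta>(3,4))
  note l3 = mor_lin[OF \<Delta>(1)] lin_compose[OF mor_lin[OF \<Delta>(1)]] l2
  have d_mem: "d z \<in> T \<otimes>\<^sub>s T" if "z \<in> T" for z using mor_mem[OF mor_d] that by simp
  have mult: "\<Delta> (m z) = (m \<otimes>\<^sub>m m) (mid ?p ((\<Delta> \<otimes>\<^sub>m \<Delta>) z))" if "z \<in> ?S \<otimes>\<^sub>s ?S" for z
    unfolding M_def[symmetric] by (rule ten_eq[OF that]) (simp_all add: l3 ten_tensor \<Delta>(2))
  have k_coassoc: "\<alpha> ((\<Delta> \<otimes>\<^sub>m id) (\<Delta> (k z))) = (id \<otimes>\<^sub>m \<Delta>) (\<Delta> (k z))" if z: "z \<in> T" for z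
  proof -
    have "\<alpha> ((\<Delta> \<otimes>\<^sub>m id) ((k \<otimes>\<^sub>m k) w)) = (k \<otimes>\<^sub>m (k \<otimes>\<^sub>m k)) (\<alpha> ((d \<otimes>\<^sub>m id) w))" if "w \<in> T \<otimes>\<^sub>s T" for w
    proof (rule ten_eq[OF that])
      fix x y assume x: "x \<in> T"
      have "\<alpha> ((k \<otimes>\<^sub>m k) v \<otimes> k y) = (k \<otimes>\<^sub>m (k \<otimes>\<^sub>m k)) (\<alpha> (v \<otimes> y))" for v
        by (rule tensor_ext[where z=v]) (simp_all add: l ten_tensor)
      then show "\<alpha> ((\<Delta> \<otimes>\<^sub>m id) ((k \<otimes>\<^sub>m k) (x \<otimes> y))) = (k \<otimes>\<^sub>m (k \<otimes>\<^sub>m k)) (\<alpha> ((d \<otimes>\<^sub>m id) (x \<otimes> y)))"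
        using x by (simp add: l3 ten_tensor \<Delta>k D_def)
    qed (simp_all add: l3)
    moreover have "(id \<otimes>\<^sub>m \<Delta>) ((k \<otimes>\<^sub>m k) w) = (k \<otimes>\<^sub>m (k \<otimes>\<^sub>m k)) ((id \<otimes>\<^sub>m d) w)" if "w \<in> T \<otimes>\<^sub>s T" for w
      by (rule ten_eq[OF that]) (simp_all add: l3 ten_tensor \<Delta>k D_def)
    ultimately show ?thesis
      using d_coassoc z by (simp add: \<Delta>k D_def d_mem coassociative_def)
  qed
  have \<iota>_k: "\<iota> x = k (j x)" if "x \<in> S" for x using that by simp
  have one_k: "?I = k \<gamma>" by simp
  \<comment> \<open>Coassociativity passes from two factors to their product, so generators suffice;
    this takes the place of comparing two algebra morphisms into a threefold tensor power.\<close>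
  have coassoc: "coassociative ?S \<Delta>"
    unfolding coassociative_def
  proof
    let ?W = "{u. \<alpha> ((\<Delta> \<otimes>\<^sub>m id) (\<Delta> u)) = (id \<otimes>\<^sub>m \<Delta>) (\<Delta> u)}"
    have lin: "lin (\<lambda>u. \<alpha> ((\<Delta> \<otimes>\<^sub>m id) (\<Delta> u)))" "lin (\<lambda>u. (id \<otimes>\<^sub>m \<Delta>) (\<Delta> u))" by (simp_all add: l3)
    have "subspace ?W" by (simp add: subspace_def lin_simps[OF lin(1)] lin_simps[OF lin(2)])
    moreover have "m (c \<otimes> \<iota> z) \<in> ?W" if "c \<in> ?S" "c \<in> ?W" "z \<in> S" for c z
      using bialgebra_words.coassoc_product_words[OF bialgebra_words[OF A(1,2) \<Delta>(1)] mult that(1) _ mor_mem[OF \<iota> that(3)]] that(2) k_coassoc[OF j_mem[OF that(3)]] that(3)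
      by simp
    moreover have "?I \<in> ?W" unfolding one_k using k_coassoc[OF \<gamma>_mem] by simp
    ultimately have "u \<in> ?W" if "u \<in> ?S" for u
      by (intro enveloping_algebra_induct[OF data(1-3) env _ _ _ that]) auto
    then show "\<alpha> ((\<Delta> \<otimes>\<^sub>m id) (\<Delta> u)) = (id \<otimes>\<^sub>m \<Delta>) (\<Delta> u)" if "u \<in> ?S" for u using that by simp
  qed
  note c_simps = lin_contract_right[OF \<epsilon>] lin_contract_left[OF \<epsilon>] contract_right_tensor[OF \<epsilon>] contract_left_tensor[OF \<epsilon>]
    lin_compose[OF lin_contract_right[OF \<epsilon>]] lin_compose[OF lin_contract_left[OF \<epsilon>]]
  have p_mem: "?p q \<in> ?S \<otimes>\<^sub>s ?S" if "q \<in> ?S \<otimes>\<^sub>s ?S" for q using mor_mem[OF mor_braid[OF A(1) A(1)]] that by simp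
  \<comment> \<open>Contraction with \<epsilon> is an algebra morphism from the braided square to
    \<open>U\<close>, because \<epsilon> is multiplicative and passes through the braiding. Hence
    the counit laws are inherited by products.\<close>
  have contract_M: "contract_left \<epsilon> (M (z \<otimes> w)) = m (contract_left \<epsilon> z \<otimes> contract_left \<epsilon> w)"
    "contract_right \<epsilon> (M (z \<otimes> w)) = m (contract_right \<epsilon> z \<otimes> contract_right \<epsilon> w)"
    if z: "z \<in> ?S \<otimes>\<^sub>s ?S" and w: "w \<in> ?S \<otimes>\<^sub>s ?S" for z w
  proof -
    have zw: "z \<otimes> w \<in> (?S \<otimes>\<^sub>s ?S) \<otimes>\<^sub>s (?S \<otimes>\<^sub>s ?S)" using z w by (rule ten_space_mem)
    have cl: "contract_left \<epsilon> ((m \<otimes>\<^sub>m m) (\<alpha>' (a \<otimes> \<alpha> (q \<otimes> b)))) = scale V (\<epsilon> a) (m (contract_left \<epsilon> q \<otimes> b))"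
      and cr: "contract_right \<epsilon> ((m \<otimes>\<^sub>m m) (\<alpha>' (a \<otimes> \<alpha> (q \<otimes> b)))) = scale V (\<epsilon> b) (m (a \<otimes> contract_right \<epsilon> q))"
      if "a \<in> ?S" "b \<in> ?S" "q \<in> ?S \<otimes>\<^sub>s ?S" for a b q
      by (rule ten_eq[OF that(3)]; simp add: l c_simps ten_tensor \<epsilon>m that(1,2) lin_scale[OF A(4)] mult.commute)+
    note pc = contract_braid[OF A(1) \<epsilon> mor_\<epsilon>]
    let ?l = "(\<lambda>v. m ((contract_left \<epsilon> \<otimes>\<^sub>m contract_left \<epsilon>) v))" and ?r = "(\<lambda>v. m ((contract_right \<epsilon> \<otimes>\<^sub>m contract_right \<epsilon>) v))"
    have "contract_left \<epsilon> (M (z \<otimes> w)) = ?l (z \<otimes> w)"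
      by (rule ten_eq4[OF zw])
        (simp_all add: l2 c_simps M_def mid_tensor cl p_mem ten_space_mem pc ten_tensor lin_scale[OF A(4)])
    moreover have "contract_right \<epsilon> (M (z \<otimes> w)) = ?r (z \<otimes> w)"
      by (rule ten_eq4[OF zw])
        (simp_all add: l2 c_simps M_def mid_tensor cr p_mem ten_space_mem pc ten_tensor lin_scale[OF A(4)] mult.commute)
    ultimately show "contract_left \<epsilon> (M (z \<otimes> w)) = m (contract_left \<epsilon> z \<otimes> contract_left \<epsilon> w)"
      "contract_right \<epsilon> (M (z \<otimes> w)) = m (contract_right \<epsilon> z \<otimes> contract_right \<epsilon> w)"
      by (simp_all add: ten_tensor c_simps)
  qed
  have k_counit: "contract_left \<epsilon> (\<Delta> (k z)) = k z" "contract_right \<epsilon> (\<Delta> (k z)) = k z" if z: "z \<in> T" for z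
  proof -
    have "contract_left \<epsilon> ((k \<otimes>\<^sub>m k) w) = k (el w)" if "w \<in> T \<otimes>\<^sub>s T" for w
      by (rule ten_eq[OF that]) (simp_all add: l c_simps e_simps ten_tensor \<epsilon>k lin_scale[OF lin_k])
    moreover have "contract_right \<epsilon> ((k \<otimes>\<^sub>m k) w) = k (er w)" if "w \<in> T \<otimes>\<^sub>s T" for w
      by (rule ten_eq[OF that]) (simp_all add: l c_simps e_simps ten_tensor \<epsilon>k lin_scale[OF lin_k])
    ultimately show "contract_left \<epsilon> (\<Delta> (k z)) = k z" "contract_right \<epsilon> (\<Delta> (k z)) = k z"
      using z by (simp_all add: \<Delta>k D_def d_mem counit)
  qed
  have counit_U: "u \<in> {u. contract_left \<epsilon> (\<Delta> u) = u \<and> contract_right \<epsilon> (\<Delta> u) = u}" (is "u \<in> ?W") if u: "u \<in> ?S" for u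
  proof (rule enveloping_algebra_induct[OF data(1-3) env _ _ _ u])
    have lin: "lin (\<lambda>u. contract_left \<epsilon> (\<Delta> u))" "lin (\<lambda>u. contract_right \<epsilon> (\<Delta> u))" by (simp_all add: l3 c_simps)
    show "subspace ?W" by (simp add: subspace_def lin_simps[OF lin(1)] lin_simps[OF lin(2)])
    show "?I \<in> ?W" unfolding one_k using k_counit[OF \<gamma>_mem] by simp
    show "m (c \<otimes> \<iota> z) \<in> ?W" if "c \<in> ?S" "c \<in> ?W" "z \<in> S" for c z
      using that mor_mem[OF \<Delta>(1)] mor_mem[OF \<iota>] k_counit[OF j_mem[OF that(3)]]
      by (simp add: \<Delta>(2) contract_M)
  qed
  have "bialgebra_in U m \<eta> \<Delta> \<epsilon>"
    unfolding bialgebra_in_def is_bialgebra_def is_coalgebra_def contract_left_def[symmetric] contract_right_def[symmetric]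
    using counit_U mor_mem[OF \<Delta>(1)] UA(1)
    by (auto simp: algebra_in_def \<Delta>(1,3) mor_\<epsilon> mult \<epsilon>m \<epsilon>1 \<epsilon> coassoc A(6) mor_lin[OF \<Delta>(1)])
  moreover have "\<Delta> (\<iota> x) = \<iota> x \<otimes> ?I + ?I \<otimes> \<iota> x + (\<iota> \<otimes>\<^sub>m \<iota>) (\<delta> x)" if x: "x \<in> S" for x
  proof -
    have "(k \<otimes>\<^sub>m k) ((j \<otimes>\<^sub>m j) w) = (\<iota> \<otimes>\<^sub>m \<iota>) w" if "w \<in> S \<otimes>\<^sub>s S" for w
      by (rule ten_eq[OF that]) (simp_all add: l ten_tensor)
    moreover have "\<delta> x \<in> S \<otimes>\<^sub>s S" using mor_mem[OF data(4) x] by simp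
    ultimately show ?thesis
      using x by (simp add: \<Delta>(4) D_def d_j lin_add[OF lin_ten[OF lin_k lin_k]] ten_tensor lin_k)
  qed
  ultimately show ?thesis using \<epsilon>\<iota> by blast
qed

end

text \<open>The extension and the enveloping algebra are described up to realisation. The
  universally quantified clauses cover every realisation, and the existence clauses keep them from
  being vacuous.\<close>

theorem theorem2p9:
  fixes V :: "('k::field, 'v::ab_group_add) category_data" (structure)
  assumes "braided_category V"
  shows
    "(\<forall>\<gg> \<sigma> C \<delta>.
        braided_category.good_quantum_Lie_algebra V \<gg> \<sigma> C \<delta> \<longrightarrow>
          braided_category.quantum_Lie_algebra V \<gg> \<sigma> C \<and>
          (\<exists>G i j s d e. braided_category.unit_extension V \<gg> \<sigma> C \<delta> G i j s d e) \<and>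
          (\<forall>G i j s d e. braided_category.unit_extension V \<gg> \<sigma> C \<delta> G i j s d e \<longrightarrow>
             braided_category.coalgebra_endomorphism_of_square V G d e s) \<and>
          (\<exists>U m \<eta> \<iota>. braided_category.enveloping_algebra V \<gg> \<sigma> C U m \<eta> \<iota>) \<and>
          (\<forall>U m \<eta> \<iota>. braided_category.enveloping_algebra V \<gg> \<sigma> C U m \<eta> \<iota> \<longrightarrow>
             (\<exists>\<Delta> \<epsilon>. braided_category.bialgebra_in V U m \<eta> \<Delta> \<epsilon> \<and>
                (\<forall>x \<in> space \<gg>.
                   \<Delta> (\<iota> x) = \<iota> x \<otimes> \<eta> (unity V) + \<eta> (unity V) \<otimes> \<iota> x +
                              tensor_universe.ten V \<iota> \<iota> (\<delta> x) \<and>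
                   \<epsilon> (\<iota> x) = 0)))) \<and>
     (\<forall>\<gg> \<sigma> C \<delta> G i j s d e.
        braided_category.quantum_Lie_algebra V \<gg> \<sigma> C \<and>
        tensor_universe.mor V \<gg> (tensor_universe.ten_obj V \<gg> \<gg>) \<delta> \<and>
        tensor_universe.coassociative V (space \<gg>) \<delta> \<and>
        braided_category.unit_extension V \<gg> \<sigma> C \<delta> G i j s d e \<and>
        braided_category.coalgebra_endomorphism_of_square V G d e s \<longrightarrow>
          braided_category.good_quantum_Lie_algebra V \<gg> \<sigma> C \<delta>)"
proof -
  interpret braided_category V by fact
  have good: "quantum_Lie_algebra \<gg> \<sigma> C \<and> (\<exists>G i j s d e. unit_extension \<gg> \<sigma> C \<delta> G i j s d e) \<and>
      (\<forall>G i j s d e. unit_extension \<gg> \<sigma> C \<delta> G i j s d e \<longrightarrow> coalgebra_endomorphism_of_square G d e s) \<and>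
      (\<exists>U m \<eta> \<iota>. enveloping_algebra \<gg> \<sigma> C U m \<eta> \<iota>)"
    if good: "good_quantum_Lie_algebra \<gg> \<sigma> C \<delta>" for \<gg> \<sigma> C \<delta>
  proof -
    have data: "is_obj \<gg>" "mor (\<gg> \<otimes>\<^sub>o \<gg>) (\<gg> \<otimes>\<^sub>o \<gg>) \<sigma>" "mor (\<gg> \<otimes>\<^sub>o \<gg>) \<gg> C" "mor \<gg> (\<gg> \<otimes>\<^sub>o \<gg>) \<delta>"
      and co: "coassociative (space \<gg>) \<delta>"
      using good by (auto simp: good_quantum_Lie_algebra_def)
    note E = extendedI[OF data co]
    have ex: "\<exists>G i j s d e. unit_extension \<gg> \<sigma> C \<delta> G i j s d e" by (rule unit_extension_exists[OF data])
    then have "quantum_Lie_algebra \<gg> \<sigma> C"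
      using extended.quantum_Lie[OF E good] by blast
    moreover have "coalgebra_endomorphism_of_square G d e s" if "unit_extension \<gg> \<sigma> C \<delta> G i j s d e" for G i j s d e
      by (rule extended.coalgebra_endomorphism[OF E[OF that] good])
    ultimately show ?thesis using ex enveloping_algebra_exists[OF data(1-3)] by blast
  qed
  have converse: "good_quantum_Lie_algebra \<gg> \<sigma> C \<delta>"
    if "quantum_Lie_algebra \<gg> \<sigma> C" "mor \<gg> (\<gg> \<otimes>\<^sub>o \<gg>) \<delta>" "coassociative (space \<gg>) \<delta>"
      "unit_extension \<gg> \<sigma> C \<delta> G i j s d e" "coalgebra_endomorphism_of_square G d e s" for \<gg> \<sigma> C \<delta> G i j s d e
  proof -
    have "is_obj \<gg>" "mor (\<gg> \<otimes>\<^sub>o \<gg>) (\<gg> \<otimes>\<^sub>o \<gg>) \<sigma>" "mor (\<gg> \<otimes>\<^sub>o \<gg>) \<gg> C"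
      using that(1) by (auto simp: quantum_Lie_algebra_def)
    from extended.good_if_coalgebra_endomorphism[OF extendedI[OF this that(2-4)] that(1,5)] show ?thesis .
  qed
  show ?thesis
  proof (intro conjI allI impI)
    fix \<gg> \<sigma> C \<delta> assume g: "good_quantum_Lie_algebra \<gg> \<sigma> C \<delta>"
    show "quantum_Lie_algebra \<gg> \<sigma> C" "\<exists>G i j s d e. unit_extension \<gg> \<sigma> C \<delta> G i j s d e"
      "\<exists>U m \<eta> \<iota>. enveloping_algebra \<gg> \<sigma> C U m \<eta> \<iota>"
      using good[OF g] by blast+
    show "coalgebra_endomorphism_of_square G d e s" if "unit_extension \<gg> \<sigma> C \<delta> G i j s d e" for G i j s d e
      using good[OF g] that by blast
    show "\<exists>\<Delta> \<epsilon>. bialgebra_in U m \<eta> \<Delta> \<epsilon> \<and>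
        (\<forall>x \<in> space \<gg>. \<Delta> (\<iota> x) = \<iota> x \<otimes> \<eta> (unity V) + \<eta> (unity V) \<otimes> \<iota> x + (\<iota> \<otimes>\<^sub>m \<iota>) (\<delta> x) \<and> \<epsilon> (\<iota> x) = 0)"
      if "enveloping_algebra \<gg> \<sigma> C U m \<eta> \<iota>" for U m \<eta> \<iota>
      by (rule enveloping_bialgebra[OF g that])
  qed (elim conjE, rule converse)
qed

end
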